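(* Let $f\in L^1_r(G)$ and $g\in L^2_r(G)$. Then $$A_{f*g}=f\star A_g,$$ where $f*g(x)=\int_Gf(y)g(xy^{-1})\,d\mu_r(y)$ and $f\star S=\int_Gf(x)\,\pi(x)^*S\,\pi(x)\,d\mu_r(x)$ for $S\in\mathcal{S}^2(\mathcal{H})$.
   Context: Setting. $G$ is a connected exponential Lie group with Lie algebra $\mathfrak{g}$ ($\exp:\mathfrak{g}\to G$ is a diffeomorphism, with inverse $\log$). The co-adjoint map $K$ is $\langle K(g)Y,X\rangle=\langle Y,\mathrm{Ad}_{g^{-1}}X\rangle$ for $Y\in\mathfrak g^*$. Fix $F\in\mathfrak{g}^*$ with trivial stabilizer $\{g\in G:K(g)F=F\}=\{e\}$, and let $\mathcal{O}_F=K(G)F$ (so $\dim\mathcal{O}_F=\dim G=2n$). $(\pi,\mathcal{H})$ is the irreducible unitary representation attached to $\mathcal{O}_F$ by the Kirillov orbit method: $\pi=\mathrm{ind}_H^G\chi_F$ with $H=\exp\mathfrak{h}$, $\mathfrak{h}$ a subalgebra of maximal dimension with $\langle F,[\mathfrak{h},\mathfrak{h}]\rangle=0$ satisfying the Pukanszky condition $K(H)F=F+\mathfrak{h}^{\perp}$, and $\chi_F(\exp X)=e^{-2\pi i\langle F,X\rangle}$; it is square integrable. Measures. $\mu_l,\mu_r$ are left and right Haar measures with $d\mu_l=\Delta\, d\mu_r$, $\Delta$ the modular function; $L^p_r(G)=L^p(G,\mu_r)$. Inner products are linear in the first variable. $\check f(x)=f(x^{-1})$. Duflo-Moore operator. With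 $\mathcal{W}_\phi\psi(x)=\langle\psi,\pi(x)^*\phi\rangle_{\mathcal H}$, $\mathcal{D}^{-1}$ is the unique positive densely defined operator on $\mathcal{H}$ with $\langle \mathcal{W}_{\phi_1}\psi_1,\mathcal{W}_{\phi_2}\psi_2\rangle_{L^2_r}=\langle\psi_1,\psi_2\rangle\overline{\langle\mathcal{D}^{-1}\phi_1,\mathcal{D}^{-1}\phi_2\rangle}$ for $\phi_i\in\mathrm{Dom}(\mathcal{D}^{-1})$, $\psi_i\in\mathcal H$; $\mathcal{D}$ is its inverse. Inverse Fourier-Wigner transform. $\mathcal{S}^2$ is the space of Hilbert-Schmidt operators on $\mathcal H$. $\mathcal{F}_{\mathrm{W}}^{-1}(f)=\pi(\check f)\mathcal{D}=\int_G f(x)\pi(x^{-1})\mathcal{D}\,d\mu_r(x)$ for $f\in L^1_r(G)$ (on $\mathrm{Dom}(\mathcal D)$), extended by continuity from $L^1_r\cap L^2_r$ to a bounded map $L^2_r(G)\to\mathcal{S}^2$. Inverse Fourier-Kirillov transform. Fix a basis $X_1,\dots,X_{2n}$ of $\mathfrak{g}$, the corresponding Lebesgue measure $dX$ on $\mathfrak g$ and dual Lebesgue measure $dY$ on $\mathfrak{g}^*$; $\mathrm{Pf}_F$ is the Pfaffian of the matrix $(F([X_i,X_j]))_{i,j}$. $\Theta(X)=\left|\det\frac{e^{\mathrm{ad}X}-1}{\mathrm{ad}X}\right|$ and $\mu_r$ is normalized by $d\mu_r(\exp X)=\Theta(X)\,dX$. The map $\kappa:G\to\mathcal{O}_F$,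 $\kappa(x)=K(x^{-1})F$, is a diffeomorphism, and the basis is chosen so that $\kappa$ carries $\mu_r$ to $|\mathrm{Pf}_F|\,\Delta(\kappa^{-1}(Y))\,dY$ on $\mathcal{O}_F$ (this compatibility of normalizations amounts to $|\mathrm{Pf}_F|=1$). On $L^2_r(G)$, with the integral understood in the $L^2$ (Plancherel) sense, $$\mathcal{F}_{\mathrm{KO}}^{-1}(f)(x)=\sqrt{\Theta(\log x)}\int_{G}f(y)e^{-2\pi i\langle\kappa(y),\log x\rangle}\frac{d\mu_r(y)}{\sqrt{|\mathrm{Pf}_F|\Delta(y)}}.$$ Quantization. $A_f=\mathcal{F}_{\mathrm{W}}^{-1}(\mathcal{F}_{\mathrm{KO}}^{-1}(f))\in\mathcal{S}^2(\mathcal{H})$ for $f\in L^2_r(G)$. The operator-valued integral defining $f\star S$ is a Bochner integral in $\mathcal{S}^2$.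
   Formalization: With the printed factor √Θ, F_KO^{-1}(g) can leave L²_r (e.g. affine group), so A_g is undefined; the identity is proved for all g with F_KO^{-1}(g) in L²_r, and for every g in L²_r when the factor is corrected to 1/√Θ. *)

theory Defs
  imports "HOL-Analysis.Analysis"
begin

section \<open>Complex Hilbert spaces and Hilbert-Schmidt operators\<close>

text \<open>The real structure of a complex Hilbert space is given by the real part of the complex
  inner product, so norm, topology and vector-valued integrals are those of the library.\<close>

class chilbert_space = real_inner + complete_space +
  fixes scaleC :: "complex \<Rightarrow> 'a \<Rightarrow> 'a" (infixr \<open>*\<^sub>C\<close> 75)
    and cinner :: "'a \<Rightarrow> 'a \<Rightarrow> complex"
  assumes scaleC_add_right: "c *\<^sub>C (x + y) = c *\<^sub>C x + c *\<^sub>C y"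
    and scaleC_add_left: "(c + d) *\<^sub>C x = c *\<^sub>C x + d *\<^sub>C x"
    and scaleC_scaleC: "c *\<^sub>C d *\<^sub>C x = (c * d) *\<^sub>C x"
    and scaleR_scaleC: "r *\<^sub>R x = complex_of_real r *\<^sub>C x"
    and cinner_commute: "cinner x y = cnj (cinner y x)"
    and cinner_add_left: "cinner (x + y) z = cinner x z + cinner y z"
    and cinner_scaleC_left: "cinner (c *\<^sub>C x) y = c * cinner x y"
    and inner_cinner: "inner x y = Re (cinner x y)"
begin

subclass banach ..

end

definition csubspace :: "'h::chilbert_space set \<Rightarrow> bool" where
  "csubspace V \<longleftrightarrow> 0 \<in> V \<and> (\<forall>v\<in>V. \<forall>w\<in>V. v + w \<in> V) \<and> (\<forall>c. \<forall>v\<in>V. c *\<^sub>C v \<in> V)"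

definition clinear_on :: "'h::chilbert_space set \<Rightarrow> ('h \<Rightarrow> 'h) \<Rightarrow> bool" where
  "clinear_on V T \<longleftrightarrow>
     (\<forall>v\<in>V. \<forall>w\<in>V. T (v + w) = T v + T w) \<and> (\<forall>c. \<forall>v\<in>V. T (c *\<^sub>C v) = c *\<^sub>C T v)"

definition cadjoint :: "('h::chilbert_space \<Rightarrow>\<^sub>L 'h) \<Rightarrow> ('h \<Rightarrow>\<^sub>L 'h)" where
  "cadjoint T = (THE S :: 'h \<Rightarrow>\<^sub>L 'h. \<forall>v w. cinner (T v) w = cinner v (S w))"

definition orthonormal_basis :: "'h::chilbert_space set \<Rightarrow> bool" where
  "orthonormal_basis B \<longleftrightarrow>
     (\<forall>b\<in>B. \<forall>b'\<in>B. cinner b b' = (if b = b' then 1 else 0)) \<and>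
     (\<forall>v. (\<forall>b\<in>B. cinner v b = 0) \<longrightarrow> v = 0)"

definition hilbert_schmidt :: "('h::chilbert_space \<Rightarrow>\<^sub>L 'h) \<Rightarrow> bool" where
  "hilbert_schmidt T \<longleftrightarrow> clinear_on UNIV T \<and>
     (\<exists>B. orthonormal_basis B \<and> (\<lambda>b. (norm (T b))\<^sup>2) summable_on B)"

text \<open>For Hilbert-Schmidt operators the value does not depend on the basis that is chosen.\<close>

definition hs_norm :: "('h::chilbert_space \<Rightarrow>\<^sub>L 'h) \<Rightarrow> real" where
  "hs_norm T = sqrt (\<Sum>\<^sub>\<infinity>b\<in>(SOME B. orthonormal_basis B). (norm (T b))\<^sup>2)"

text \<open>The Bochner integral in the Hilbert space of Hilbert-Schmidt operators.  This is
  \<^const>\<open>has_bochner_integral\<close> with the Hilbert-Schmidt norm in place of the type class norm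
  (which on the type of bounded operators is the operator norm, for which the type class
  assumption of separability fails).\<close>

definition has_hs_integral ::
    "'x measure \<Rightarrow> ('x \<Rightarrow> ('h::chilbert_space \<Rightarrow>\<^sub>L 'h)) \<Rightarrow> ('h \<Rightarrow>\<^sub>L 'h) \<Rightarrow> bool" where
  "has_hs_integral M h T \<longleftrightarrow>
     (\<forall>x\<in>space M. hilbert_schmidt (h x)) \<and> hilbert_schmidt T \<and>
     (\<exists>s. (\<forall>i. Bochner_Integration.simple_bochner_integrable M (s i) \<and>
               (\<forall>x\<in>space M. hilbert_schmidt (s i x)) \<and>
               (\<lambda>x. hs_norm (h x - s i x)) \<in> borel_measurable M) \<and>
          (\<lambda>i. \<integral>\<^sup>+x. ennreal (hs_norm (h x - s i x)) \<partial>M) \<longlonglongrightarrow> 0 \<and>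
          (\<lambda>i. hs_norm (Bochner_Integration.simple_bochner_integral M (s i) - T)) \<longlonglongrightarrow> 0)"

definition hs_integrable ::
    "'x measure \<Rightarrow> ('x \<Rightarrow> ('h::chilbert_space \<Rightarrow>\<^sub>L 'h)) \<Rightarrow> bool" where
  "hs_integrable M h \<longleftrightarrow> (\<exists>T. has_hs_integral M h T)"

definition hs_integral ::
    "'x measure \<Rightarrow> ('x \<Rightarrow> ('h::chilbert_space \<Rightarrow>\<^sub>L 'h)) \<Rightarrow> ('h \<Rightarrow>\<^sub>L 'h)" where
  "hs_integral M h = (THE T. has_hs_integral M h T)"


section \<open>Square integrable functions\<close>

definition L2 :: "'x measure \<Rightarrow> ('x \<Rightarrow> complex) \<Rightarrow> bool" where
  "L2 M f \<longleftrightarrow> f \<in> borel_measurable M \<and> integrable M (\<lambda>x. (norm (f x))\<^sup>2)"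

definition L2_tendsto :: "'x measure \<Rightarrow> (nat \<Rightarrow> 'x \<Rightarrow> complex) \<Rightarrow> ('x \<Rightarrow> complex) \<Rightarrow> bool" where
  "L2_tendsto M fs f \<longleftrightarrow> (\<forall>k. fs k \<in> borel_measurable M) \<and> f \<in> borel_measurable M \<and>
     (\<lambda>k. \<integral>\<^sup>+x. ennreal ((norm (fs k x - f x))\<^sup>2) \<partial>M) \<longlonglongrightarrow> 0"


section \<open>Exponential Lie groups\<close>

class group_mult = monoid_mult + inverse +
  assumes left_inverse_mult: "inverse a * a = 1"
    and divide_mult: "a / b = a * inverse b"

primrec C_k :: "nat \<Rightarrow> ('a::real_normed_vector \<Rightarrow> 'b::real_normed_vector) \<Rightarrow> bool" where
  "C_k 0 f = continuous_on UNIV f"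
| "C_k (Suc k) f =
     ((\<forall>x. f differentiable (at x)) \<and> (\<forall>v. C_k k (\<lambda>x. frechet_derivative f (at x) v)))"

definition smooth :: "('a::real_normed_vector \<Rightarrow> 'b::real_normed_vector) \<Rightarrow> bool" where
  "smooth f \<longleftrightarrow> (\<forall>k. C_k k f)"

text \<open>A connected Lie group \<open>G = 'g\<close> whose exponential map \<open>e : \<gg> \<rightarrow> G\<close> is a diffeomorphism,
  \<open>\<gg> = \<real>\<^sup>d\<close> as a vector space.  Since \<open>e\<close> is a diffeomorphism, \<open>inv e\<close> is a global chart
  defining the manifold structure, in which the group operations have to be smooth.
  The tangent space at 1 is identified with \<open>\<gg>\<close> by this chart, and the last condition says that
  \<open>t \<mapsto> e (t X)\<close> is the one-parameter group with velocity \<open>X\<close>, i.e. that \<open>e\<close> is the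
  exponential map of \<open>G\<close>.\<close>

definition exponential_lie_group ::
    "(real^'d \<Rightarrow> 'g::{group_mult, t2_space, second_countable_topology}) \<Rightarrow> bool" where
  "exponential_lie_group e \<longleftrightarrow>
     homeomorphism UNIV UNIV e (inv e) \<and>
     smooth (\<lambda>(X, Y). inv e (e X * e Y)) \<and>
     smooth (\<lambda>X. inv e (inverse (e X))) \<and>
     (\<forall>s t X. e ((s + t) *\<^sub>R X) = e (s *\<^sub>R X) * e (t *\<^sub>R X))"

text \<open>\<open>Ad g\<close> is the derivative at 1 of conjugation by \<open>g\<close>, and the Lie bracket
  \<open>[X, Y] = ad X Y\<close> is the derivative of \<open>Ad\<close> at 1 in direction \<open>X\<close>.\<close>

definition Ad :: "(real^'d \<Rightarrow> 'g::group_mult) \<Rightarrow> 'g \<Rightarrow> real^'d \<Rightarrow> real^'d" where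
  "Ad e g = frechet_derivative (\<lambda>X. inv e (g * e X * inverse g)) (at 0)"

definition lie_bracket :: "(real^'d \<Rightarrow> 'g::group_mult) \<Rightarrow> real^'d \<Rightarrow> real^'d \<Rightarrow> real^'d" where
  "lie_bracket e X Y = vector_derivative (\<lambda>t. Ad e (e (t *\<^sub>R X)) Y) (at 0)"

definition lie_subalgebra :: "(real^'d \<Rightarrow> 'g::group_mult) \<Rightarrow> (real^'d) set \<Rightarrow> bool" where
  "lie_subalgebra e h \<longleftrightarrow> subspace h \<and> (\<forall>X\<in>h. \<forall>Y\<in>h. lie_bracket e X Y \<in> h)"

text \<open>\<open>(e\<^sup>z - 1) / z = (\<Sum>k. z\<^sup>k / (k+1)!)\<close>, evaluated at \<open>z = ad X\<close>.\<close>

definition Theta :: "(real^'d \<Rightarrow> 'g::group_mult) \<Rightarrow> real^'d \<Rightarrow> real" where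
  "Theta e X = \<bar>det (\<Sum>k. (1 / fact (k + 1)) *\<^sub>R matrix (lie_bracket e X ^^ k))\<bar>"

definition coadjoint ::
    "(real^'d \<Rightarrow> 'g::group_mult) \<Rightarrow> 'g \<Rightarrow> ((real^'d) \<Rightarrow>\<^sub>L real) \<Rightarrow> ((real^'d) \<Rightarrow>\<^sub>L real)" where
  "coadjoint e g Y = Blinfun (\<lambda>X. Y (Ad e (inverse g) X))"

definition kappa :: "(real^'d \<Rightarrow> 'g::group_mult) \<Rightarrow> ((real^'d) \<Rightarrow>\<^sub>L real) \<Rightarrow> 'g \<Rightarrow> ((real^'d) \<Rightarrow>\<^sub>L real)"
  where "kappa e F x = coadjoint e (inverse x) F"

text \<open>The basis \<open>X\<^sub>1, \<dots>, X\<^sub>2\<^sub>n\<close> of \<open>\<gg>\<close> is the standard basis of \<^typ>\<open>real^'d\<close> (this is the choice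
  of coordinates on \<open>\<gg>\<close>), so that \<open>dX\<close> is \<^const>\<open>lborel\<close>; the functional
  \<open>X \<mapsto> y \<bullet> X\<close> has the coordinates \<open>y\<close> in the dual basis.\<close>

definition dual_lborel :: "((real^'d) \<Rightarrow>\<^sub>L real) measure" where
  "dual_lborel = distr lborel borel blinfun_inner_right"

definition pfaffian :: "nat \<Rightarrow> (nat \<Rightarrow> nat \<Rightarrow> real) \<Rightarrow> real" where
  "pfaffian n A =
     (\<Sum>p | p permutes {..<2*n}. of_int (sign p) * (\<Prod>i<n. A (p (2*i)) (p (2*i + 1))))
       / (2 ^ n * fact n)"

text \<open>The bijection \<open>\<iota>\<close> from \<open>{..<2n}\<close> to \<^typ>\<open>'d\<close> orders the basis.\<close>

definition Pf :: "(real^'d \<Rightarrow> 'g::group_mult) \<Rightarrow> nat \<Rightarrow> (nat \<Rightarrow> 'd) \<Rightarrow> ((real^'d) \<Rightarrow>\<^sub>L real) \<Rightarrow> real" where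
  "Pf e n \<iota> F = pfaffian n (\<lambda>i j. F (lie_bracket e (axis (\<iota> i) 1) (axis (\<iota> j) 1)))"


section \<open>Haar measures\<close>

text \<open>Haar measures on a subgroup \<open>S\<close> of \<open>G\<close>.  As the groups are locally compact and second
  countable, Borel measures that are finite on compact sets are Radon measures.\<close>

definition haar_like :: "'g::topological_space set \<Rightarrow> 'g measure \<Rightarrow> bool" where
  "haar_like S M \<longleftrightarrow> sets M = sets (restrict_space borel S) \<and> emeasure M S \<noteq> 0 \<and>
     (\<forall>K. compact K \<and> K \<subseteq> S \<longrightarrow> emeasure M K < \<infinity>)"

definition left_haar :: "'g::{group_mult, topological_space} set \<Rightarrow> 'g measure \<Rightarrow> bool" where
  "left_haar S M \<longleftrightarrow> haar_like S M \<and>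
     (\<forall>s\<in>S. \<forall>A\<in>sets M. emeasure M ((\<lambda>x. s * x) ` A) = emeasure M A)"

definition right_haar :: "'g::{group_mult, topological_space} set \<Rightarrow> 'g measure \<Rightarrow> bool" where
  "right_haar S M \<longleftrightarrow> haar_like S M \<and>
     (\<forall>s\<in>S. \<forall>A\<in>sets M. emeasure M ((\<lambda>x. x * s) ` A) = emeasure M A)"

text \<open>The convention for the modular function is the one with \<open>d\<mu>\<^sub>l = \<Delta> d\<mu>\<^sub>r\<close>.\<close>

definition modular_function :: "'g::{group_mult, topological_space} set \<Rightarrow> ('g \<Rightarrow> real) \<Rightarrow> bool" where
  "modular_function S \<Delta> \<longleftrightarrow> (\<forall>s\<in>S. 0 < \<Delta> s) \<and>
     (\<exists>M. left_haar S M \<and>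
        (\<forall>s\<in>S. \<forall>A\<in>sets M. emeasure M ((\<lambda>x. x * s) ` A) = ennreal (\<Delta> s) * emeasure M A))"


section \<open>Unitary representations and the orbit method\<close>

definition unitary_representation ::
    "('g::{group_mult, topological_space} \<Rightarrow> ('h::chilbert_space \<Rightarrow>\<^sub>L 'h)) \<Rightarrow> bool" where
  "unitary_representation \<pi> \<longleftrightarrow>
     \<pi> 1 = id_blinfun \<and> (\<forall>x y. \<pi> (x * y) = \<pi> x o\<^sub>L \<pi> y) \<and>
     (\<forall>x. clinear_on UNIV (\<pi> x)) \<and>
     (\<forall>x v w. cinner (\<pi> x v) (\<pi> x w) = cinner v w) \<and>
     (\<forall>v. continuous_on UNIV (\<lambda>x. \<pi> x v))"

definition irreducible_representation ::
    "('g \<Rightarrow> ('h::chilbert_space \<Rightarrow>\<^sub>L 'h)) \<Rightarrow> bool" where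
  "irreducible_representation \<pi> \<longleftrightarrow> (UNIV :: 'h set) \<noteq> {0} \<and>
     (\<forall>V. csubspace V \<and> closed V \<and> (\<forall>x. \<pi> x ` V \<subseteq> V) \<longrightarrow> V = {0} \<or> V = UNIV)"

definition isotropic_subalgebra ::
    "(real^'d \<Rightarrow> 'g::group_mult) \<Rightarrow> ((real^'d) \<Rightarrow>\<^sub>L real) \<Rightarrow> (real^'d) set \<Rightarrow> bool" where
  "isotropic_subalgebra e F h \<longleftrightarrow> lie_subalgebra e h \<and> (\<forall>X\<in>h. \<forall>Y\<in>h. F (lie_bracket e X Y) = 0)"

definition pukanszky_polarization ::
    "(real^'d \<Rightarrow> 'g::group_mult) \<Rightarrow> ((real^'d) \<Rightarrow>\<^sub>L real) \<Rightarrow> (real^'d) set \<Rightarrow> bool" where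
  "pukanszky_polarization e F h \<longleftrightarrow> isotropic_subalgebra e F h \<and>
     (\<forall>h'. isotropic_subalgebra e F h' \<longrightarrow> dim h' \<le> dim h) \<and>
     (\<lambda>x. coadjoint e x F) ` (e ` h) = {F + Y | Y. \<forall>X\<in>h. Y X = 0}"

definition orbit_character ::
    "(real^'d \<Rightarrow> 'g::group_mult) \<Rightarrow> ((real^'d) \<Rightarrow>\<^sub>L real) \<Rightarrow> 'g \<Rightarrow> complex" where
  "orbit_character e F x = exp (- (2 * of_real pi * \<i> * of_real (F (inv e x))))"

text \<open>The space of the induced representation \<open>ind\<^sub>H\<^sup>G \<xi>\<close>, on which \<open>G\<close> acts by right translation:
  functions on \<open>G\<close> that are \<open>(\<xi> (\<Delta>\<^sub>G/\<Delta>\<^sub>H)\<^sup>1\<^sup>/\<^sup>2)\<close>-covariant under left translation by \<open>H\<close>.  Integration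
  of \<open>\<bar>\<phi>\<bar>\<^sup>2\<close> over \<open>H\<backslash>G\<close> is integration over \<open>G\<close> against a Bruhat weight \<open>\<beta>\<close>, i.e.
  a function with integral 1 over every coset \<open>H x\<close>; the result does not depend on \<open>\<beta>\<close>.\<close>

definition bruhat_weight ::
    "'g::{group_mult, topological_space} measure \<Rightarrow> ('g \<Rightarrow> real) \<Rightarrow> bool" where
  "bruhat_weight \<nu> \<beta> \<longleftrightarrow> \<beta> \<in> borel_measurable borel \<and> (\<forall>x. 0 \<le> \<beta> x) \<and>
     (\<forall>x. (\<integral>\<^sup>+h. ennreal (\<beta> (h * x)) \<partial>\<nu>) = 1)"

definition induced_space ::
    "'g::{group_mult, topological_space} measure \<Rightarrow> ('g \<Rightarrow> real) \<Rightarrow> 'g set \<Rightarrow> ('g \<Rightarrow> real) \<Rightarrow>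
     ('g \<Rightarrow> real) \<Rightarrow> ('g \<Rightarrow> complex) \<Rightarrow> ('g \<Rightarrow> complex) set" where
  "induced_space \<mu>r \<Delta> H \<Delta>H \<beta> \<xi> =
     {\<phi>. \<phi> \<in> borel_measurable \<mu>r \<and>
         (\<forall>h\<in>H. \<forall>x. \<phi> (h * x) = \<xi> h * complex_of_real (sqrt (\<Delta> h / \<Delta>H h)) * \<phi> x) \<and>
         integrable \<mu>r (\<lambda>x. \<beta> x * (norm (\<phi> x))\<^sup>2)}"

text \<open>\<open>\<pi>\<close> is unitarily equivalent to \<open>ind\<^sub>H\<^sup>G \<xi>\<close>, by the map \<open>U\<close>.\<close>

definition is_induced_representation ::
    "'g::{group_mult, topological_space} measure \<Rightarrow> ('g \<Rightarrow> real) \<Rightarrow> 'g set \<Rightarrow> ('g \<Rightarrow> complex) \<Rightarrow>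
     ('g \<Rightarrow> ('h::chilbert_space \<Rightarrow>\<^sub>L 'h)) \<Rightarrow> bool" where
  "is_induced_representation \<mu>r \<Delta> H \<xi> \<pi> \<longleftrightarrow>
     (\<exists>\<nu> \<Delta>H \<beta> U. right_haar H \<nu> \<and> modular_function H \<Delta>H \<and> bruhat_weight \<nu> \<beta> \<and>
        (\<forall>v. U v \<in> induced_space \<mu>r \<Delta> H \<Delta>H \<beta> \<xi>) \<and>
        (\<forall>v w. AE x in \<mu>r. U (v + w) x = U v x + U w x) \<and>
        (\<forall>c v. AE x in \<mu>r. U (c *\<^sub>C v) x = c * U v x) \<and>
        (\<forall>v w. (LINT x|\<mu>r. complex_of_real (\<beta> x) * (U v x * cnj (U w x))) = cinner v w) \<and>
        (\<forall>\<phi>\<in>induced_space \<mu>r \<Delta> H \<Delta>H \<beta> \<xi>. \<exists>v. AE x in \<mu>r. U v x = \<phi> x) \<and>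
        (\<forall>y v. AE x in \<mu>r. U (\<pi> y v) x = U v (x * y)))"


section \<open>The Duflo-Moore operator\<close>

definition wavelet ::
    "('g \<Rightarrow> ('h::chilbert_space \<Rightarrow>\<^sub>L 'h)) \<Rightarrow> 'h \<Rightarrow> 'h \<Rightarrow> 'g \<Rightarrow> complex" where
  "wavelet \<pi> \<phi> \<psi> x = cinner \<psi> (cadjoint (\<pi> x) \<phi>)"

text \<open>Unbounded operators are given by their domain \<open>V\<close> and a function of which only the values
  on \<open>V\<close> matter.  Self-adjointness is equality of the graphs of \<open>C\<close> and of its adjoint.\<close>

definition positive_selfadjoint :: "'h::chilbert_space set \<Rightarrow> ('h \<Rightarrow> 'h) \<Rightarrow> bool" where
  "positive_selfadjoint V C \<longleftrightarrow> csubspace V \<and> closure V = UNIV \<and> clinear_on V C \<and>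
     (\<forall>\<psi> \<eta>. (\<forall>\<phi>\<in>V. cinner (C \<phi>) \<psi> = cinner \<phi> \<eta>) \<longleftrightarrow> \<psi> \<in> V \<and> C \<psi> = \<eta>) \<and>
     (\<forall>\<phi>\<in>V. 0 \<le> Re (cinner (C \<phi>) \<phi>))"

text \<open>\<open>C = \<D>\<^sup>-\<^sup>1\<close> with domain \<open>V\<close>.  The last condition says that the domain contains all
  admissible vectors; together with self-adjointness it makes the operator unique.\<close>

definition duflo_moore_inverse ::
    "'g measure \<Rightarrow> ('g \<Rightarrow> ('h::chilbert_space \<Rightarrow>\<^sub>L 'h)) \<Rightarrow> 'h set \<Rightarrow> ('h \<Rightarrow> 'h) \<Rightarrow> bool" where
  "duflo_moore_inverse \<mu>r \<pi> V C \<longleftrightarrow> positive_selfadjoint V C \<and>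
     (\<forall>\<phi>\<in>V. \<forall>\<psi>. L2 \<mu>r (wavelet \<pi> \<phi> \<psi>)) \<and>
     (\<forall>\<phi>1\<in>V. \<forall>\<phi>2\<in>V. \<forall>\<psi>1 \<psi>2.
        (LINT x|\<mu>r. wavelet \<pi> \<phi>1 \<psi>1 x * cnj (wavelet \<pi> \<phi>2 \<psi>2 x)) =
          cinner \<psi>1 \<psi>2 * cnj (cinner (C \<phi>1) (C \<phi>2))) \<and>
     (\<forall>\<phi>. (\<forall>\<psi>. L2 \<mu>r (wavelet \<pi> \<phi> \<psi>)) \<longrightarrow> \<phi> \<in> V)"


section \<open>Inverse Fourier-Wigner and Fourier-Kirillov transforms, quantization\<close>

text \<open>\<open>S\<close> is the Hilbert-Schmidt operator extending \<open>\<integral> f(x) \<pi>(x\<^sup>-\<^sup>1) \<D> d\<mu>\<^sub>r(x)\<close>, which is defined on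
  \<open>Dom \<D> = C ` V\<close>; there \<open>\<D> = inv_into V C\<close>.\<close>

definition fw_inverse_integrable ::
    "'g::group_mult measure \<Rightarrow> ('g \<Rightarrow> ('h::{chilbert_space, second_countable_topology} \<Rightarrow>\<^sub>L 'h)) \<Rightarrow>
     'h set \<Rightarrow> ('h \<Rightarrow> 'h) \<Rightarrow> ('g \<Rightarrow> complex) \<Rightarrow> ('h \<Rightarrow>\<^sub>L 'h) \<Rightarrow> bool" where
  "fw_inverse_integrable \<mu>r \<pi> V C f S \<longleftrightarrow> hilbert_schmidt S \<and>
     (\<forall>\<eta>\<in>C ` V. S \<eta> = (LINT x|\<mu>r. f x *\<^sub>C \<pi> (inverse x) (inv_into V C \<eta>)))"

text \<open>The extension by continuity from \<open>L\<^sup>1 \<inter> L\<^sup>2\<close> to \<open>L\<^sup>2\<close>: its graph is the closure of the graph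
  of \<^const>\<open>fw_inverse_integrable\<close>.\<close>

definition fw_inverse ::
    "'g::group_mult measure \<Rightarrow> ('g \<Rightarrow> ('h::{chilbert_space, second_countable_topology} \<Rightarrow>\<^sub>L 'h)) \<Rightarrow>
     'h set \<Rightarrow> ('h \<Rightarrow> 'h) \<Rightarrow> ('g \<Rightarrow> complex) \<Rightarrow> ('h \<Rightarrow>\<^sub>L 'h)" where
  "fw_inverse \<mu>r \<pi> V C f =
     (THE S. hilbert_schmidt S \<and>
        (\<exists>fs Ss. (\<forall>k. integrable \<mu>r (fs k) \<and> L2 \<mu>r (fs k) \<and>
                      fw_inverse_integrable \<mu>r \<pi> V C (fs k) (Ss k)) \<and>
                 L2_tendsto \<mu>r fs f \<and> (\<lambda>k. hs_norm (Ss k - S)) \<longlonglongrightarrow> 0))"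

text \<open>The integral in the inverse Fourier-Kirillov transform, as a function of \<open>X = log x\<close>:
  first the integrand, then the integral in the sense of Plancherel (\<open>c\<close> stands for
  \<open>\<bar>Pf\<^sub>F\<bar>\<close>).  The function is determined up to null sets.\<close>

definition ko_integrand ::
    "(real^'d \<Rightarrow> 'g::group_mult) \<Rightarrow> ((real^'d) \<Rightarrow>\<^sub>L real) \<Rightarrow> real \<Rightarrow> ('g \<Rightarrow> real) \<Rightarrow>
     ('g \<Rightarrow> complex) \<Rightarrow> real^'d \<Rightarrow> 'g \<Rightarrow> complex" where
  "ko_integrand e F c \<Delta> f X y =
     f y * exp (- (2 * of_real pi * \<i> * of_real (kappa e F y X))) / of_real (sqrt (c * \<Delta> y))"

definition ko_integral ::
    "(real^'d \<Rightarrow> 'g::group_mult) \<Rightarrow> ((real^'d) \<Rightarrow>\<^sub>L real) \<Rightarrow> real \<Rightarrow> 'g measure \<Rightarrow> ('g \<Rightarrow> real) \<Rightarrow>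
     ('g \<Rightarrow> complex) \<Rightarrow> real^'d \<Rightarrow> complex" where
  "ko_integral e F c \<mu>r \<Delta> f =
     (SOME u. L2 lborel u \<and>
        (\<exists>fs. (\<forall>k. L2 \<mu>r (fs k) \<and> integrable \<mu>r (\<lambda>y. fs k y / of_real (sqrt (c * \<Delta> y)))) \<and>
              L2_tendsto \<mu>r fs f \<and>
              L2_tendsto lborel (\<lambda>k X. LINT y|\<mu>r. ko_integrand e F c \<Delta> (fs k) X y) u))"

text \<open>The factor in front of the integral is a parameter \<open>w\<close>, a function of \<open>log x\<close>, because two
  normalizations are of interest.  Since \<open>d\<mu>\<^sub>r = \<Theta> dX\<close> and \<^const>\<open>ko_integral\<close> is an isometry from
  \<open>L\<^sup>2(\<mu>\<^sub>r)\<close> to \<open>L\<^sup>2(dX)\<close>, the transform with \<open>w = 1/\<surd>\<Theta>\<close> is an isometry of \<open>L\<^sup>2(\<mu>\<^sub>r)\<close>, whereas the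
  one with \<open>w = \<surd>\<Theta>\<close> maps only part of \<open>L\<^sup>2(\<mu>\<^sub>r)\<close> into \<open>L\<^sup>2(\<mu>\<^sub>r)\<close> unless \<open>\<Theta>\<close> is bounded.\<close>

definition ko_inverse ::
    "(real^'d \<Rightarrow> real) \<Rightarrow> (real^'d \<Rightarrow> 'g::group_mult) \<Rightarrow> ((real^'d) \<Rightarrow>\<^sub>L real) \<Rightarrow> real \<Rightarrow> 'g measure \<Rightarrow>
     ('g \<Rightarrow> real) \<Rightarrow> ('g \<Rightarrow> complex) \<Rightarrow> 'g \<Rightarrow> complex" where
  "ko_inverse w e F c \<mu>r \<Delta> f x = of_real (w (inv e x)) * ko_integral e F c \<mu>r \<Delta> f (inv e x)"

definition group_convolution ::
    "'g::group_mult measure \<Rightarrow> ('g \<Rightarrow> complex) \<Rightarrow> ('g \<Rightarrow> complex) \<Rightarrow> 'g \<Rightarrow> complex" where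
  "group_convolution \<mu>r f g x = (LINT y|\<mu>r. f y * g (x * inverse y))"

definition star_integrand ::
    "('g \<Rightarrow> ('h::chilbert_space \<Rightarrow>\<^sub>L 'h)) \<Rightarrow> ('g \<Rightarrow> complex) \<Rightarrow> ('h \<Rightarrow>\<^sub>L 'h) \<Rightarrow> 'g \<Rightarrow> ('h \<Rightarrow>\<^sub>L 'h)"
  where
  "star_integrand \<pi> f S x = Blinfun (\<lambda>v. f x *\<^sub>C (cadjoint (\<pi> x) o\<^sub>L S o\<^sub>L \<pi> x) v)"

definition operator_convolution ::
    "'g measure \<Rightarrow> ('g \<Rightarrow> ('h::chilbert_space \<Rightarrow>\<^sub>L 'h)) \<Rightarrow> ('g \<Rightarrow> complex) \<Rightarrow> ('h \<Rightarrow>\<^sub>L 'h) \<Rightarrow>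
     ('h \<Rightarrow>\<^sub>L 'h)" where
  "operator_convolution \<mu>r \<pi> f S = hs_integral \<mu>r (star_integrand \<pi> f S)"

end

theory Submission
  imports Defs "HOL-Probability.Probability"
begin

text \<open>Right translation of \<open>g\<close> by \<open>y\<close> turns, under the Fourier-Kirillov transform, into conjugation by \<open>y\<close>
  in the group with the factor \<open>\<Delta>(y)\<^sup>-\<^sup>1\<^sup>/\<^sup>2\<close>, because \<open>\<kappa>(x y) = Ad\<^sub>y\<^sup>* \<kappa>(x)\<close>; and this conjugation turns, under
  the Fourier-Wigner transform, into \<open>S \<mapsto> \<pi>(y)\<^sup>* S \<pi>(y)\<close>, because \<open>\<pi>(y)\<^sup>* \<D>\<^sup>-\<^sup>1 \<pi>(y) = \<Delta>(y)\<^sup>-\<^sup>1\<^sup>/\<^sup>2 \<D>\<^sup>-\<^sup>1\<close>.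
  Integrating against \<open>f(y)\<close> gives the theorem.  To interchange the integral over \<open>y\<close> with the two
  transforms, each of them is characterized by its pairings: the Fourier-Kirillov integral \<open>u\<close> of \<open>g\<close>
  by \<open>\<integral> u h\<close> for \<open>h \<in> L\<^sup>1 \<inter> L\<^sup>2\<close>, which equals the pairing of \<open>g\<close> with the Fourier transform of \<open>h\<close>
  on the orbit, and the Fourier-Wigner transform \<open>S\<close> by \<open>\<langle>S \<D>\<^sup>-\<^sup>1 \<phi>, \<psi>\<rangle>\<close>, the pairing with a wavelet
  transform.  For such pairings the interchange is Fubini's theorem, also for the unbounded weight
  \<open>\<surd>\<Theta>\<close>.  Of Plancherel's theorem only the inequality is needed, since the bound for the Fourier-Kirillov
  integral follows from it by duality.\<close>

section \<open>Hilbert spaces\<close>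

text \<open>Every interchange of integrals follows one pattern: maps \<open>T y\<close> that
  multiply a measure by \<open>a y\<close> are averaged against \<open>f\<close> with the unitary
  normalization \<open>1 / sqrt (a y)\<close>. Right translation has \<open>a = 1\<close>;
  conjugation in the group and \<open>Ad\<close> on the Lie algebra have
  \<open>a = \<Delta>\<close>. The Fourier-Kirillov transform intertwines these three averages, and
  the Fourier-Wigner transform carries the second to an average of operators. The weight
  \<open>w\<close> enters the intertwining through its invariance under \<open>Ad\<close>. Two
  obstacles shape the rest. The orthogonality relations determine only the products
  \<open>cinner (C u) (C v)\<close>, so the semi-invariance of \<open>C\<close> is a uniqueness
  question for positive, possibly unbounded operators with equal products; a direct argument takes
  the place of a functional calculus. And the Hilbert-Schmidt norm is not the norm of the operator
  type, so operators are compared through matrix coefficients on the dense range of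
  \<open>C\<close>, and their Hilbert-Schmidt norms are estimated by duality, on an orthonormal
  basis contained in that range.\<close>

lemma mult_cnj_cmod: "z * cnj z = (complex_of_real (cmod z))\<^sup>2" "cnj z * z = (complex_of_real (cmod z))\<^sup>2"
  by (simp_all flip: of_real_power add: complex_norm_square mult.commute)

lemma cinner_add_right: "cinner (x::'h::chilbert_space) (y + z) = cinner x y + cinner x z"
  by (metis cinner_add_left cinner_commute complex_cnj_add)

lemma cinner_scaleC_right: "cinner (x::'h::chilbert_space) (c *\<^sub>C y) = cnj c * cinner x y"
  by (metis cinner_scaleC_left cinner_commute complex_cnj_mult)

lemma cinner_zero_left [simp]: "cinner 0 (y::'h::chilbert_space) = 0"
  by (metis add_cancel_right_left cinner_add_left)

lemma cinner_zero_right [simp]: "cinner (y::'h::chilbert_space) 0 = 0"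
  by (metis cinner_zero_left cinner_commute complex_cnj_zero)

lemma cinner_scaleR_left: "cinner (r *\<^sub>R x) (y::'h::chilbert_space) = of_real r * cinner x y"
  by (simp add: scaleR_scaleC cinner_scaleC_left)

lemma cinner_scaleR_right: "cinner x (r *\<^sub>R (y::'h::chilbert_space)) = of_real r * cinner x y"
  by (simp add: scaleR_scaleC cinner_scaleC_right)

lemma cinner_minus_left: "cinner (- x) (y::'h::chilbert_space) = - cinner x y"
  using cinner_scaleR_left[of "-1" x y] by simp

lemma cinner_minus_right: "cinner x (- (y::'h::chilbert_space)) = - cinner x y"
  using cinner_scaleR_right[of x "-1" y] by simp

lemma cinner_diff_left: "cinner (x - y) (z::'h::chilbert_space) = cinner x z - cinner y z"
  by (metis add_uminus_conv_diff cinner_add_left cinner_minus_left)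

lemma cinner_diff_right: "cinner x (y - (z::'h::chilbert_space)) = cinner x y - cinner x z"
  by (metis add_uminus_conv_diff cinner_add_right cinner_minus_right)

lemma cinner_sum_left: "cinner (\<Sum>i\<in>I. u i) (z::'h::chilbert_space) = (\<Sum>i\<in>I. cinner (u i) z)"
  by (induction I rule: infinite_finite_induct) (auto simp: cinner_add_left)

lemma cinner_sum_right: "cinner z (\<Sum>i\<in>I. u i) = (\<Sum>i\<in>I. cinner (z::'h::chilbert_space) (u i))"
  by (induction I rule: infinite_finite_induct) (auto simp: cinner_add_right)

lemma cinner_self: "cinner x (x::'h::chilbert_space) = of_real ((norm x)\<^sup>2)"
proof -
  have "Im (cinner x x) = 0"
    using cinner_commute[of x x] by (metis complex_cnj_cancel_iff complex_cnj_cnj complex_is_Real_iff Reals_cnj_iff)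
  moreover have "Re (cinner x x) = (norm x)\<^sup>2"
    by (simp add: inner_cinner[symmetric] power2_norm_eq_inner)
  ultimately show ?thesis by (simp add: complex_eq_iff)
qed

lemma norm_scaleC: "norm (c *\<^sub>C (x::'h::chilbert_space)) = cmod c * norm x"
proof -
  have "complex_of_real ((norm (c *\<^sub>C x))\<^sup>2) = (c * cnj c) * of_real ((norm x)\<^sup>2)"
    by (simp only: cinner_self[symmetric] cinner_scaleC_left cinner_scaleC_right ac_simps)
  also have "\<dots> = of_real ((cmod c * norm x)\<^sup>2)"
    by (simp add: mult_cnj_cmod power_mult_distrib)
  finally have "(norm (c *\<^sub>C x))\<^sup>2 = (cmod c * norm x)\<^sup>2"
    using of_real_eq_iff by blast
  then show ?thesis by (simp add: power2_eq_iff_nonneg)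
qed

lemma cmod_cinner_le: "cmod (cinner x y) \<le> norm x * norm (y::'h::chilbert_space)"
proof (cases "cinner x y = 0")
  case False
  \<comment> \<open>The phase that rotates \<open>cinner x y\<close> to its modulus; the real
    Cauchy-Schwarz inequality then applies.\<close>
  define c where "c = cnj (cinner x y) / cmod (cinner x y)"
  have c1: "cmod c = 1" using False by (simp add: c_def norm_divide)
  have "cinner (c *\<^sub>C x) y = cmod (cinner x y)"
    using False by (simp add: c_def cinner_scaleC_left mult_cnj_cmod power2_eq_square)
  then have "cmod (cinner x y) = inner (c *\<^sub>C x) y" by (simp add: inner_cinner)
  also have "\<dots> \<le> norm (c *\<^sub>C x) * norm y" by (rule norm_cauchy_schwarz)
  finally show ?thesis by (simp add: norm_scaleC c1)
qed auto

lemma scaleC_one [simp]: "1 *\<^sub>C (x::'h::chilbert_space) = x"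
  using scaleR_scaleC[of 1 x] by simp

lemma scaleC_zero_left [simp]: "0 *\<^sub>C (x::'h::chilbert_space) = 0"
  using scaleR_scaleC[of 0 x] by simp

lemma scaleC_zero_right [simp]: "c *\<^sub>C (0::'h::chilbert_space) = 0"
  by (metis norm_eq_zero norm_scaleC mult_zero_right norm_zero)

lemma scaleC_minus_left: "(- c) *\<^sub>C (x::'h::chilbert_space) = - (c *\<^sub>C x)"
  by (metis add.right_inverse neg_eq_iff_add_eq_0 scaleC_add_left scaleC_zero_left)

lemma scaleC_minus_right: "c *\<^sub>C (- (x::'h::chilbert_space)) = - (c *\<^sub>C x)"
  by (metis add.right_inverse neg_eq_iff_add_eq_0 scaleC_add_right scaleC_zero_right)

lemma scaleC_diff_left: "(c - d) *\<^sub>C (x::'h::chilbert_space) = c *\<^sub>C x - d *\<^sub>C x"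
  by (metis diff_conv_add_uminus scaleC_add_left scaleC_minus_left)

lemma scaleC_diff_right: "c *\<^sub>C (x - (y::'h::chilbert_space)) = c *\<^sub>C x - c *\<^sub>C y"
  by (metis diff_conv_add_uminus scaleC_add_right scaleC_minus_right)

lemma bounded_bilinear_cinner: "bounded_bilinear (cinner :: 'h::chilbert_space \<Rightarrow> 'h \<Rightarrow> complex)"
  by standard (auto simp: cinner_add_left cinner_add_right cinner_scaleR_left cinner_scaleR_right
      scaleR_conv_of_real intro!: exI[of _ 1] cmod_cinner_le)

lemma scaleC_scaleR_commute: "c *\<^sub>C (r *\<^sub>R x) = r *\<^sub>R (c *\<^sub>C (x::'h::chilbert_space))"
  by (simp add: scaleR_scaleC scaleC_scaleC mult.commute)

lemma bounded_bilinear_scaleC: "bounded_bilinear (scaleC :: complex \<Rightarrow> 'h::chilbert_space \<Rightarrow> 'h)"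
proof
  show "(r *\<^sub>R a) *\<^sub>C b = r *\<^sub>R a *\<^sub>C b" for r a and b :: 'h
    by (simp add: scaleR_scaleC scaleC_scaleC scaleR_conv_of_real)
qed (auto simp: scaleC_add_left scaleC_add_right scaleC_scaleR_commute norm_scaleC intro!: exI[of _ 1])

lemmas tendsto_cinner [tendsto_intros] = bounded_bilinear.tendsto[OF bounded_bilinear_cinner]
lemmas continuous_on_cinner [continuous_intros] = bounded_bilinear.continuous_on[OF bounded_bilinear_cinner]
lemmas tendsto_scaleC [tendsto_intros] = bounded_bilinear.tendsto[OF bounded_bilinear_scaleC]
lemmas continuous_on_scaleC [continuous_intros] = bounded_bilinear.continuous_on[OF bounded_bilinear_scaleC]

lemma cinner_eq_zeroI: "x = (0::'h::chilbert_space)" if "\<And>y. cinner x y = 0"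
  using that[of x] by (simp add: cinner_self)

lemma cinner_eqI: "x = (y::'h::chilbert_space)" if "\<And>z. cinner x z = cinner y z"
  using cinner_eq_zeroI[of "x - y"] that by (simp add: cinner_diff_left)

lemma cinner_eqI_right: "x = (y::'h::chilbert_space)" if "\<And>z. cinner z x = cinner z y"
  by (rule cinner_eqI) (metis that cinner_commute)

lemma clinear_onD:
  "clinear_on V T \<Longrightarrow> v \<in> V \<Longrightarrow> w \<in> V \<Longrightarrow> T (v + w) = T v + T w"
  "clinear_on V T \<Longrightarrow> v \<in> V \<Longrightarrow> T (c *\<^sub>C v) = c *\<^sub>C T v"
  by (auto simp: clinear_on_def)

lemma csubspaceD:
  assumes "csubspace V"
  shows "0 \<in> V" "v \<in> V \<Longrightarrow> w \<in> V \<Longrightarrow> v + w \<in> V" "v \<in> V \<Longrightarrow> c *\<^sub>C v \<in> V"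
    "v \<in> V \<Longrightarrow> w \<in> V \<Longrightarrow> v - w \<in> V" "v \<in> V \<Longrightarrow> r *\<^sub>R v \<in> V"
proof -
  show "0 \<in> V" "v \<in> V \<Longrightarrow> w \<in> V \<Longrightarrow> v + w \<in> V" "v \<in> V \<Longrightarrow> c *\<^sub>C v \<in> V"
    using assms by (auto simp: csubspace_def)
  show "v \<in> V \<Longrightarrow> r *\<^sub>R v \<in> V" using assms by (auto simp: csubspace_def scaleR_scaleC)
  show "v \<in> V \<Longrightarrow> w \<in> V \<Longrightarrow> v - w \<in> V"
    using assms unfolding csubspace_def
    by (metis add_uminus_conv_diff scaleC_minus_left scaleC_one)
qed

lemma csubspace_sum: "csubspace V \<Longrightarrow> (\<And>i. i \<in> I \<Longrightarrow> u i \<in> V) \<Longrightarrow> (\<Sum>i\<in>I. u i) \<in> V"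
  by (induction I rule: infinite_finite_induct) (auto intro: csubspaceD)

lemma clinear_on_zero_diff:
  assumes "csubspace V" "clinear_on V T"
  shows "T 0 = 0" "v \<in> V \<Longrightarrow> w \<in> V \<Longrightarrow> T (v - w) = T v - T w"
proof -
  show "T 0 = 0" using assms by (metis csubspaceD(1) clinear_onD(2) scaleC_zero_left)
  have "T v = T (v - w) + T w" if "v \<in> V" "w \<in> V"
    using clinear_onD(1)[OF assms(2) csubspaceD(4)[OF assms(1) that] that(2)] by simp
  then show "v \<in> V \<Longrightarrow> w \<in> V \<Longrightarrow> T (v - w) = T v - T w" by (simp add: algebra_simps)
qed

subsection \<open>Orthonormal bases\<close>

definition orthonormal :: "'h::chilbert_space set \<Rightarrow> bool" where
  "orthonormal B \<longleftrightarrow> (\<forall>b\<in>B. \<forall>b'\<in>B. cinner b b' = (if b = b' then 1 else 0))"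

lemma orthonormal_basis_iff:
  "orthonormal_basis B \<longleftrightarrow> orthonormal B \<and> (\<forall>v. (\<forall>b\<in>B. cinner v b = 0) \<longrightarrow> v = 0)"
  by (simp add: orthonormal_basis_def orthonormal_def)

lemma orthonormal_subset: "orthonormal B \<Longrightarrow> F \<subseteq> B \<Longrightarrow> orthonormal F"
  unfolding orthonormal_def by blast

lemma cinner_orthonormal_sum:
  assumes "orthonormal F" "finite F" "b \<in> F"
  shows "cinner (\<Sum>x\<in>F. a x *\<^sub>C x) b = a b"
proof -
  have "cinner (\<Sum>x\<in>F. a x *\<^sub>C x) b = (\<Sum>x\<in>F. if x = b then a x else 0)"
    unfolding cinner_sum_left
    by (rule sum.cong) (use assms in \<open>auto simp: cinner_scaleC_left orthonormal_def\<close>)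
  then show ?thesis using assms by simp
qed

lemma norm_orthonormal_sum:
  assumes "orthonormal F" "finite F"
  shows "(norm (\<Sum>x\<in>F. a x *\<^sub>C x))\<^sup>2 = (\<Sum>x\<in>F. (cmod (a x))\<^sup>2)"
proof -
  have "complex_of_real ((norm (\<Sum>x\<in>F. a x *\<^sub>C x))\<^sup>2) = (\<Sum>x\<in>F. cnj (a x) * cinner (\<Sum>x\<in>F. a x *\<^sub>C x) x)"
    unfolding cinner_self[symmetric] by (subst cinner_sum_right) (simp add: cinner_scaleC_right)
  also have "\<dots> = (\<Sum>x\<in>F. cnj (a x) * a x)"
    by (rule sum.cong) (simp_all add: cinner_orthonormal_sum[OF assms])
  also have "\<dots> = of_real (\<Sum>x\<in>F. (cmod (a x))\<^sup>2)"
    by (simp add: mult_cnj_cmod)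
  finally show ?thesis using of_real_eq_iff by blast
qed

lemma bessel_identity:
  assumes "orthonormal F" "finite F"
  shows "(norm (v - (\<Sum>x\<in>F. cinner v x *\<^sub>C x)))\<^sup>2 = (norm v)\<^sup>2 - (\<Sum>x\<in>F. (cmod (cinner v x))\<^sup>2)"
proof -
  define p where "p = (\<Sum>x\<in>F. cinner v x *\<^sub>C x)"
  have "cinner (v - p) p = (\<Sum>x\<in>F. cnj (cinner v x) * cinner (v - p) x)"
    by (subst (2) p_def) (simp add: cinner_sum_right cinner_scaleC_right)
  also have "\<dots> = 0"
    by (rule sum.neutral) (use cinner_orthonormal_sum[OF assms] in \<open>auto simp: p_def cinner_diff_left\<close>)
  finally have "inner (v - p) p = 0" by (simp add: inner_cinner)
  then have "(norm (v - p))\<^sup>2 = (norm v)\<^sup>2 - (norm p)\<^sup>2"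
    by (simp add: power2_norm_eq_inner inner_diff_left inner_diff_right inner_commute)
  then show ?thesis using norm_orthonormal_sum[OF assms] by (simp add: p_def)
qed

lemma bessel_inequality:
  "orthonormal F \<Longrightarrow> finite F \<Longrightarrow> (\<Sum>x\<in>F. (cmod (cinner v x))\<^sup>2) \<le> (norm v)\<^sup>2"
  using bessel_identity[of F v] zero_le_power2[of "norm (v - (\<Sum>x\<in>F. cinner v x *\<^sub>C x))"] by linarith

text \<open>\<open>B\<close> may be uncountable, so the series is summed along increasing finite
  sets \<open>F n\<close> whose square sums come within \<open>1 / Suc n\<close> of the supremum
  \<open>s\<close> of all finite square sums. A finite set disjoint from \<open>F n\<close> then has
  square sum at most \<open>1 / Suc n\<close>, which makes the partial sums Cauchy.\<close>

lemma riesz_fischer: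
  assumes B: "orthonormal B" and K: "\<And>F. finite F \<Longrightarrow> F \<subseteq> B \<Longrightarrow> (\<Sum>b\<in>F. (cmod (a b))\<^sup>2) \<le> K"
  obtains w :: "'h::chilbert_space" and F where "\<And>b. b \<in> B \<Longrightarrow> cinner w b = a b"
    "\<And>n::nat. finite (F n)" "\<And>n. F n \<subseteq> B" "(\<lambda>n. \<Sum>b\<in>F n. a b *\<^sub>C b) \<longlonglongrightarrow> w"
proof -
  define q where "q F = (\<Sum>b\<in>F. (cmod (a b))\<^sup>2)" for F
  define s where "s = Sup (q ` {F. finite F \<and> F \<subseteq> B})"
  have bdd: "bdd_above (q ` {F. finite F \<and> F \<subseteq> B})"
    using K by (auto simp: q_def bdd_above_def)
  have le: "q F \<le> s" if "finite F" "F \<subseteq> B" for F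
    unfolding s_def by (rule cSup_upper) (use that bdd in auto)
  have ex: "\<exists>F. finite F \<and> F \<subseteq> B \<and> s - 1 / Suc n < q F" for n
  proof (rule ccontr)
    assume "\<nexists>F. finite F \<and> F \<subseteq> B \<and> s - 1 / Suc n < q F"
    then have "s \<le> s - 1 / Suc n"
      by (subst s_def, intro cSup_least) (auto simp: not_less)
    then show False by simp
  qed
  then obtain G where G: "\<And>n. finite (G n)" "\<And>n. G n \<subseteq> B" "\<And>n. s - 1 / Suc n < q (G n)"
    by metis
  define F where "F n = (\<Union>i\<le>n. G i)" for n
  have F: "finite (F n)" "F n \<subseteq> B" for n using G by (auto simp: F_def)
  have Fs: "s - 1 / Suc n < q (F n)" for n
    by (rule less_le_trans[OF G(3)], unfold q_def, rule sum_mono2) (use F in \<open>auto simp: F_def\<close>)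
  have mono: "F m \<subseteq> F n" if "m \<le> n" for m n using that by (fastforce simp: F_def)
  define p where "p n = (\<Sum>b\<in>F n. a b *\<^sub>C b)" for n
  have tail: "q D \<le> 1 / Suc n" if "finite D" "D \<subseteq> B" "D \<inter> F n = {}" for D n
  proof -
    have "q (D \<union> F n) = q D + q (F n)"
      unfolding q_def by (rule sum.union_disjoint) (use that F in auto)
    moreover have "q (D \<union> F n) \<le> s" using that F by (intro le) auto
    ultimately show ?thesis using Fs[of n] by linarith
  qed
  have diff: "(norm (p n - p m))\<^sup>2 \<le> 1 / Suc m" if "m \<le> n" for m n
  proof -
    have "p n - p m = (\<Sum>b\<in>F n - F m. a b *\<^sub>C b)"
      unfolding p_def using sum_diff[OF F(1) mono[OF that]] by metis
    moreover have "orthonormal (F n - F m)" by (rule orthonormal_subset[OF B]) (use F in auto)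
    ultimately have "(norm (p n - p m))\<^sup>2 = q (F n - F m)"
      using F by (simp add: q_def norm_orthonormal_sum)
    also have "\<dots> \<le> 1 / Suc m" using F by (intro tail) auto
    finally show ?thesis .
  qed
  have "Cauchy p"
  proof (rule CauchyI)
    fix e :: real assume e: "e > 0"
    obtain M where M: "1 / Suc M < (e/2)\<^sup>2"
      using e reals_Archimedean[of "(e/2)\<^sup>2"] by (auto simp: field_simps)
    have near: "norm (p n - p M) < e/2" if "n \<ge> M" for n
    proof -
      have "(norm (p n - p M))\<^sup>2 < (e/2)\<^sup>2" using diff[OF that] M by linarith
      then show ?thesis using e by (meson half_gt_zero less_imp_le power2_less_imp_less)
    qed
    show "\<exists>M. \<forall>m\<ge>M. \<forall>n\<ge>M. norm (p m - p n) < e"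
      using norm_triangle_half_l[OF near near] by blast
  qed
  then obtain w where w: "p \<longlonglongrightarrow> w" by (metis Cauchy_convergent convergent_def)
  have "cinner w b = a b" if "b \<in> B" for b
  proof -
    have lim: "(\<lambda>n. cinner (p n) b) \<longlonglongrightarrow> cinner w b"
      using w by (intro tendsto_intros)
    have "(\<lambda>n. cinner (p n) b) \<longlonglongrightarrow> a b"
    proof (cases "\<exists>m. b \<in> F m")
      case True
      then obtain m where "b \<in> F m" by auto
      then have "cinner (p n) b = a b" if "n \<ge> m" for n
        unfolding p_def using mono[OF that] F \<open>b \<in> F m\<close> by (intro cinner_orthonormal_sum orthonormal_subset[OF B]) auto
      then show ?thesis by (intro tendsto_eventually) (auto simp: eventually_sequentially)
    next
      case False
      \<comment> \<open>A coefficient that no \<open>F m\<close> catches is bounded by every tail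
        estimate, hence it is zero.\<close>
      have "(cmod (a b))\<^sup>2 \<le> 1 / Suc n" for n
        using tail[of "{b}" n] False that by (auto simp: q_def)
      then have "(cmod (a b))\<^sup>2 \<le> 0"
        by (intro LIMSEQ_le_const[OF LIMSEQ_inverse_real_of_nat]) (auto simp: inverse_eq_divide)
      then have 0: "a b = 0" by auto
      have "cinner x b = 0" if "x \<in> F n" for x n
      proof -
        have "x \<noteq> b" using False that by auto
        then show ?thesis using B F that \<open>b \<in> B\<close> unfolding orthonormal_def by (meson subsetD)
      qed
      then have "cinner (p n) b = 0" for n
        unfolding p_def cinner_sum_left by (intro sum.neutral) (auto simp: cinner_scaleC_left)
      then show ?thesis using 0 by simp
    qed
    then show ?thesis using lim LIMSEQ_unique by blast
  qed
  then show thesis using that[of w F] F w unfolding p_def by auto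
qed

text \<open>The vector that \<open>riesz_fischer\<close> builds from the coefficients of
  \<open>v\<close> has the same coefficients as \<open>v\<close>, so completeness of
  \<open>B\<close> identifies the two. The finite sets depend on \<open>v\<close>.\<close>

lemma orthonormal_basis_expansion:
  assumes "orthonormal_basis B"
  obtains F where "\<And>n::nat. finite (F n)" "\<And>n. F n \<subseteq> B"
    "(\<lambda>n. \<Sum>b\<in>F n. cinner v b *\<^sub>C b) \<longlonglongrightarrow> (v::'h::chilbert_space)"
proof -
  have B: "orthonormal B" using assms orthonormal_basis_iff by blast
  obtain w F where w: "\<And>b. b \<in> B \<Longrightarrow> cinner w b = cinner v b"
    "\<And>n::nat. finite (F n)" "\<And>n. F n \<subseteq> B" "(\<lambda>n. \<Sum>b\<in>F n. cinner v b *\<^sub>C b) \<longlonglongrightarrow> w"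
    by (rule riesz_fischer[OF B, of "cinner v" "(norm v)\<^sup>2"])
      (auto intro: bessel_inequality orthonormal_subset[OF B])
  have "v - w = 0" using assms w(1) unfolding orthonormal_basis_def by (metis cinner_diff_left diff_self)
  then show thesis using w that by auto
qed

lemma parseval_le:
  assumes "orthonormal_basis B"
    and "\<And>F. finite F \<Longrightarrow> F \<subseteq> B \<Longrightarrow> (\<Sum>b\<in>F. (cmod (cinner v b))\<^sup>2) \<le> K"
  shows "(norm (v::'h::chilbert_space))\<^sup>2 \<le> K"
proof -
  obtain F where F: "\<And>n::nat. finite (F n)" "\<And>n. F n \<subseteq> B"
    "(\<lambda>n. \<Sum>b\<in>F n. cinner v b *\<^sub>C b) \<longlonglongrightarrow> v"
    using orthonormal_basis_expansion[OF assms(1), where v = v and thesis = thesis] that .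
  have "orthonormal (F n)" for n
    using assms(1) F(2) unfolding orthonormal_basis_iff by (blast intro: orthonormal_subset)
  then have "(norm (\<Sum>b\<in>F n. cinner v b *\<^sub>C b))\<^sup>2 \<le> K" for n
    using F assms by (simp add: norm_orthonormal_sum)
  then show ?thesis
    by (intro LIMSEQ_le_const2[OF tendsto_power[OF tendsto_norm[OF F(3)]]]) auto
qed

text \<open>Distinct orthonormal vectors are \<open>sqrt 2\<close> apart, so the balls of radius 1/2
  around them are disjoint open sets, of which a second countable space has only countably
  many.\<close>

lemma orthonormal_countable:
  assumes "orthonormal (B :: 'h::{chilbert_space, second_countable_topology} set)"
  shows "countable B"
proof -
  have d: "dist b b' = sqrt 2" if "b \<in> B" "b' \<in> B" "b \<noteq> b'" for b b'
  proof -
    have "inner b b' = 0" "inner b b = 1" "inner b' b' = 1"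
      using that assms by (auto simp: inner_cinner orthonormal_def)
    then have "(norm (b - b'))\<^sup>2 = 2"
      by (simp add: power2_norm_eq_inner inner_diff_left inner_diff_right inner_commute)
    then show ?thesis by (simp add: dist_norm real_sqrt_unique)
  qed
  have "disjoint_family_on (\<lambda>b. ball b (1/2)) B"
  unfolding disjoint_family_on_def
  proof (intro ballI impI, rule ccontr)
    fix b b' assume *: "b \<in> B" "b' \<in> B" "b \<noteq> b'" "ball b (1/2) \<inter> ball b' (1/2) \<noteq> {}"
    then obtain z where "dist b z < 1/2" "dist b' z < 1/2" by auto
    then have "dist b b' < 1" by (metis dist_triangle_half_l dist_commute)
    then show False using d[OF *(1-3)] by simp
  qed
  then have "countable ((\<lambda>b. ball b (1/2)) ` B)"
    by (intro countable_disjoint_open_subsets) (auto simp: disjoint_family_on_disjoint_image)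
  moreover have "inj_on (\<lambda>b. ball b (1/2)) B"
  proof (rule inj_onI, rule ccontr)
    fix b b' assume *: "b \<in> B" "b' \<in> B" "ball b (1/2) = ball b' (1/2)" "b \<noteq> b'"
    have "b' \<in> ball b (1/2)" using *(3) by simp
    moreover have "1 \<le> sqrt 2" by simp
    ultimately show False using d[OF *(1,2,4)] by simp
  qed
  ultimately show ?thesis by (rule countable_image_inj_on)
qed

text \<open>That orthogonality to \<open>B'\<close> implies orthogonality to \<open>d\<close> stands
  in for membership of \<open>d\<close> in the span of \<open>B'\<close>, and is the form in which
  totality is checked later. If \<open>d\<close> equals its projection \<open>p\<close>, nothing is
  added to \<open>B\<close>; otherwise the normalized remainder is.\<close>

lemma gram_schmidt_step:
  assumes W: "csubspace W" and B: "finite B" "orthonormal B" "B \<subseteq> W" and d: "d \<in> W"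
  shows "\<exists>B'. finite B' \<and> orthonormal B' \<and> B' \<subseteq> W \<and> B \<subseteq> B' \<and>
    (\<forall>v. (\<forall>b\<in>B'. cinner v b = 0) \<longrightarrow> cinner v (d::'h::chilbert_space) = 0)"
proof -
  define p where "p = (\<Sum>x\<in>B. cinner d x *\<^sub>C x)"
  define r where "r = d - p"
  have pW: "p \<in> W" unfolding p_def by (intro csubspace_sum W csubspaceD(3)[OF W]) (use B in auto)
  have rB: "cinner r b = 0" if "b \<in> B" for b
    using cinner_orthonormal_sum[OF B(2,1) that] by (simp add: r_def p_def cinner_diff_left)
  have vp: "cinner v p = 0" if "\<forall>b\<in>B. cinner v b = 0" for v
    using that by (simp add: p_def cinner_sum_right cinner_scaleC_right)
  show ?thesis
  proof (cases "r = 0")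
    case True
    then have "d = p" by (simp add: r_def)
    then show ?thesis using vp B by blast
  next
    case False
    define u where "u = (1 / norm r) *\<^sub>R r"
    have uB: "cinner u b = 0" "cinner b u = 0" if "b \<in> B" for b
    proof -
      show "cinner u b = 0" using rB[OF that] by (simp add: u_def cinner_scaleR_left)
      then show "cinner b u = 0" by (metis cinner_commute complex_cnj_zero)
    qed
    have uu: "cinner u u = 1"
      using False by (simp add: u_def cinner_self)
    have "r = norm r *\<^sub>R u" using False by (simp add: u_def)
    then have dd: "d = p + norm r *\<^sub>R u" by (simp add: r_def)
    have "u \<in> W" unfolding u_def r_def by (intro csubspaceD W d pW)
    moreover have "orthonormal (insert u B)"
      using B(2) uB uu by (auto simp: orthonormal_def)
    moreover have "cinner v d = 0" if "\<forall>b\<in>insert u B. cinner v b = 0" for v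
      using that vp[of v] by (subst dd) (simp add: cinner_add_right cinner_scaleR_right)
    ultimately show ?thesis using B by (intro exI[of _ "insert u B"]) auto
  qed
qed

text \<open>Gram-Schmidt along a countable dense subset of \<open>W\<close>. The basis lies in
  \<open>W\<close> itself and not just in its closure: for \<open>W\<close> the range of
  \<open>C\<close> this lets every basis vector be written as \<open>C (p b)\<close> with
  \<open>p b\<close> in the domain.\<close>

lemma orthonormal_basis_in_total:
  assumes W: "csubspace W" and total: "\<And>v. (\<And>w. w \<in> W \<Longrightarrow> cinner v w = 0) \<Longrightarrow> v = 0"
  shows "\<exists>B \<subseteq> W. orthonormal_basis (B :: 'h::{chilbert_space, second_countable_topology} set)"
proof -
  obtain T where T: "countable T" "T \<subseteq> W" "W \<subseteq> closure T"
    using separable by blast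
  have "T \<noteq> {}" using T csubspaceD(1)[OF W] by auto
  define d where "d = from_nat_into T"
  have d: "range d = T" using T \<open>T \<noteq> {}\<close> by (simp add: d_def range_from_nat_into)
  then have dW: "d n \<in> W" for n using T by auto
  have "\<exists>B. \<forall>n. (finite (B n) \<and> orthonormal (B n) \<and> B n \<subseteq> W) \<and>
     (B n \<subseteq> B (Suc n) \<and> (\<forall>v. (\<forall>b\<in>B (Suc n). cinner v b = 0) \<longrightarrow> cinner v (d n) = 0))"
  proof (rule dependent_nat_choice)
    show "\<exists>B. finite B \<and> orthonormal B \<and> B \<subseteq> W" by (rule exI[of _ "{}"]) (auto simp: orthonormal_def)
  next
    fix B n assume "finite B \<and> orthonormal B \<and> B \<subseteq> W"
    then show "\<exists>B'. (finite B' \<and> orthonormal B' \<and> B' \<subseteq> W) \<and> (B \<subseteq> B' \<and>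
      (\<forall>v. (\<forall>b\<in>B'. cinner v b = 0) \<longrightarrow> cinner v (d n) = 0))"
      using gram_schmidt_step[OF W _ _ _ dW[of n], of B] by blast
  qed
  then obtain B where B: "\<And>n. orthonormal (B n)" "\<And>n. B n \<subseteq> W" "\<And>n. B n \<subseteq> B (Suc n)"
    "\<And>n v. (\<forall>b\<in>B (Suc n). cinner v b = 0) \<Longrightarrow> cinner v (d n) = 0" by blast
  have mono: "B m \<subseteq> B n" if "m \<le> n" for m n using that B(3) by (rule lift_Suc_mono_le[rotated])
  define U where "U = (\<Union>n. B n)"
  have "orthonormal U" unfolding orthonormal_def
  proof (intro ballI)
    fix b b' assume "b \<in> U" "b' \<in> U"
    then obtain m n where "b \<in> B m" "b' \<in> B n" by (auto simp: U_def)
    then have "b \<in> B (max m n)" "b' \<in> B (max m n)"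
      using mono[of m "max m n"] mono[of n "max m n"] by auto
    then show "cinner b b' = (if b = b' then 1 else 0)" using B(1) by (auto simp: orthonormal_def)
  qed
  moreover have "v = 0" if v: "\<forall>b\<in>U. cinner v b = 0" for v
  proof -
    have "T \<subseteq> {x. cinner v x = 0}" using B(4) v by (auto simp: U_def d[symmetric])
    moreover have "closed {x. cinner v x = 0}"
      by (intro closed_Collect_eq continuous_intros)
    ultimately have "W \<subseteq> {x. cinner v x = 0}"
      using T(3) closure_minimal by (metis subset_trans)
    then show "v = 0" by (intro total) auto
  qed
  ultimately show ?thesis using B(2) by (intro exI[of _ U]) (auto simp: orthonormal_basis_iff U_def)
qed

lemma orthonormal_basis_exists:
  "\<exists>B :: 'h::{chilbert_space, second_countable_topology} set. orthonormal_basis B"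
  using orthonormal_basis_in_total[of UNIV] cinner_eq_zeroI by (auto simp: csubspace_def)

lemma closure_total:
  assumes W: "csubspace W" and total: "\<And>v. (\<And>w. w \<in> W \<Longrightarrow> cinner v w = 0) \<Longrightarrow> v = 0"
  shows "closure W = (UNIV :: 'h::{chilbert_space, second_countable_topology} set)"
proof -
  obtain B where B: "B \<subseteq> W" "orthonormal_basis B" using orthonormal_basis_in_total[OF W total] by blast
  have "v \<in> closure W" for v
  proof -
    obtain F where F: "\<And>n::nat. finite (F n)" "\<And>n. F n \<subseteq> B"
      "(\<lambda>n. \<Sum>b\<in>F n. cinner v b *\<^sub>C b) \<longlonglongrightarrow> v"
      using orthonormal_basis_expansion[OF B(2), where v = v and thesis = thesis] that .
    have "(\<Sum>b\<in>F n. cinner v b *\<^sub>C b) \<in> W" for n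
      using F(2)[of n] B(1) by (intro csubspace_sum W csubspaceD(3)[OF W]) auto
    with F(3) show ?thesis
      unfolding closure_sequential by (intro exI[of _ "\<lambda>n. \<Sum>b\<in>F n. cinner v b *\<^sub>C b"]) simp
  qed
  then show ?thesis by blast
qed

lemma dense_extend:
  assumes "closure W = UNIV" "closed {x. P x}" "\<And>w. w \<in> W \<Longrightarrow> P w"
  shows "P x"
proof -
  have "W \<subseteq> {x. P x}" using assms(3) by blast
  then have "closure W \<subseteq> {x. P x}" using assms(2) by (rule closure_minimal)
  then show ?thesis using assms(1) by blast
qed

subsection \<open>Adjoints\<close>

lemma LIMSEQ_unique_eq:
  "f \<longlonglongrightarrow> a \<Longrightarrow> (\<And>n. f n = g n) \<Longrightarrow> g \<longlonglongrightarrow> b \<Longrightarrow> a = (b :: 'a :: t2_space)"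
  by (metis LIMSEQ_unique ext)

text \<open>The coefficients of the representing vector must be \<open>cnj (l b)\<close>. Their
  square sums are bounded by testing \<open>l\<close> on
  \<open>x = (\<Sum>b\<in>F. cnj (l b) *\<^sub>C b)\<close>, where \<open>l x\<close> equals
  \<open>(norm x)\<^sup>2\<close>. The absolute value absorbs a negative \<open>K\<close>, which the
  zero space permits.\<close>

lemma riesz_representation:
  fixes l :: "'h::{chilbert_space, second_countable_topology} \<Rightarrow> complex"
  assumes add: "\<And>x y. l (x + y) = l x + l y" and scale: "\<And>c x. l (c *\<^sub>C x) = c * l x"
    and K: "\<And>x. cmod (l x) \<le> K * norm x"
  obtains r where "\<And>x. l x = cinner x r" "norm r \<le> \<bar>K\<bar>"
proof -
  obtain B :: "'h set" where B: "orthonormal_basis B" using orthonormal_basis_exists by blast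
  then have oB: "orthonormal B" by (simp add: orthonormal_basis_iff)
  have zero: "l 0 = 0" using scale[of 0 0] by simp
  have sum: "l (\<Sum>b\<in>F. c b *\<^sub>C b) = (\<Sum>b\<in>F. c b * l b)" for c F
    by (induction F rule: infinite_finite_induct) (auto simp: zero add scale)
  have bl: "bounded_linear l"
    by (rule bounded_linear_intro[where K = K]) (use K in \<open>auto simp: add scale scaleR_scaleC scaleR_conv_of_real mult.commute\<close>)
  have "(\<Sum>b\<in>F. (cmod (cnj (l b)))\<^sup>2) \<le> K\<^sup>2" if F: "finite F" "F \<subseteq> B" for F
  proof -
    define s where "s = (\<Sum>b\<in>F. (cmod (l b))\<^sup>2)"
    define x where "x = (\<Sum>b\<in>F. cnj (l b) *\<^sub>C b)"
    have nx: "(norm x)\<^sup>2 = s"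
      unfolding x_def s_def by (simp add: norm_orthonormal_sum[OF orthonormal_subset[OF oB F(2)] F(1)])
    have "l x = of_real s" unfolding x_def s_def sum by (simp add: mult_cnj_cmod)
    moreover have "0 \<le> s" by (simp add: s_def sum_nonneg)
    ultimately have "s = cmod (l x)" by (simp only: norm_of_real abs_of_nonneg)
    also have "\<dots> \<le> K * norm x" by (rule K)
    also have "\<dots> \<le> \<bar>K\<bar> * norm x" by (intro mult_right_mono) auto
    finally have "(norm x)\<^sup>2 \<le> \<bar>K\<bar> * norm x" using nx by simp
    then have "norm x \<le> \<bar>K\<bar>" by (cases "x = 0") (auto simp: power2_eq_square)
    then have "(norm x)\<^sup>2 \<le> \<bar>K\<bar>\<^sup>2" by (intro power_mono) auto
    then show ?thesis using nx by (simp add: s_def)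
  qed
  then obtain r where r: "\<And>b. b \<in> B \<Longrightarrow> cinner r b = cnj (l b)"
    by (rule riesz_fischer[OF oB]) blast+
  have eq: "l v = cinner v r" for v
  proof -
    obtain F where F: "\<And>n::nat. finite (F n)" "\<And>n. F n \<subseteq> B"
      "(\<lambda>n. \<Sum>b\<in>F n. cinner v b *\<^sub>C b) \<longlonglongrightarrow> v"
      using orthonormal_basis_expansion[OF B, where v = v and thesis = thesis] that .
    have eq: "l (\<Sum>b\<in>F n. cinner v b *\<^sub>C b) = cinner (\<Sum>b\<in>F n. cinner v b *\<^sub>C b) r" for n
    proof -
      have "cinner b r = l b" if "b \<in> F n" for b
        using r[of b] that F(2)[of n] by (metis cinner_commute complex_cnj_cnj subsetD)
      then show ?thesis by (simp add: sum cinner_sum_left cinner_scaleC_left)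
    qed
    have lim: "(\<lambda>n. l (\<Sum>b\<in>F n. cinner v b *\<^sub>C b)) \<longlonglongrightarrow> l v"
      "(\<lambda>n. cinner (\<Sum>b\<in>F n. cinner v b *\<^sub>C b) r) \<longlonglongrightarrow> cinner v r"
      by (intro bounded_linear.tendsto[OF bl] tendsto_intros F(3))+
    show ?thesis by (rule LIMSEQ_unique_eq[OF lim(1) eq lim(2)])
  qed
  have "(norm r)\<^sup>2 = cmod (cinner r r)" by (simp add: cinner_self norm_power)
  also have "\<dots> = cmod (l r)" by (simp add: eq)
  also have "\<dots> \<le> K * norm r" by (rule K)
  also have "\<dots> \<le> \<bar>K\<bar> * norm r" by (intro mult_right_mono) auto
  finally have "norm r \<le> \<bar>K\<bar>" by (cases "r = 0") (auto simp: power2_eq_square)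
  with eq show thesis by (rule that)
qed

text \<open>Riesz representation of \<open>v \<mapsto> cinner (T v) w\<close> for each
  \<open>w\<close>; linearity in \<open>w\<close> comes from uniqueness of the representing
  vector.\<close>

lemma clinear_adjoint_exists:
  fixes T :: "'h::{chilbert_space, second_countable_topology} \<Rightarrow>\<^sub>L 'h"
  assumes T: "clinear_on UNIV T"
  shows "\<exists>S. clinear_on UNIV (blinfun_apply S) \<and> (\<forall>v w. cinner (T v) w = cinner v (S w))"
proof -
  have "\<exists>r. (\<forall>v. cinner (T v) w = cinner v r) \<and> norm r \<le> norm w * norm T" for w
  proof -
    have "cmod (cinner (T v) w) \<le> (norm w * norm T) * norm v" for v
    proof -
      have "cmod (cinner (T v) w) \<le> norm (T v) * norm w" by (rule cmod_cinner_le)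
      also have "\<dots> \<le> (norm T * norm v) * norm w" by (intro mult_right_mono norm_blinfun) auto
      finally show ?thesis by (simp add: mult_ac)
    qed
    then obtain r where "\<And>v. cinner (T v) w = cinner v r" "norm r \<le> \<bar>norm w * norm T\<bar>"
      by (rule riesz_representation[of "\<lambda>v. cinner (T v) w", rotated 2])
        (use T in \<open>auto simp: clinear_on_def cinner_add_left cinner_scaleC_left\<close>)
    then show ?thesis by auto
  qed
  then obtain r where r: "\<And>v w. cinner (T v) w = cinner v (r w)" and nr: "\<And>w. norm (r w) \<le> norm w * norm T"
    by metis
  have rs: "r (c *\<^sub>C x) = c *\<^sub>C r x" for c x
    by (rule cinner_eqI_right) (simp add: cinner_scaleC_right r[symmetric])
  have ra: "r (x + y) = r x + r y" for x y
    by (rule cinner_eqI_right) (simp add: cinner_add_right r[symmetric])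
  have "bounded_linear r"
    using nr by (intro bounded_linear_intro[where K = "norm T"]) (auto simp: ra rs scaleR_scaleC)
  then show ?thesis
    using r rs ra by (intro exI[of _ "Blinfun r"]) (auto simp: bounded_linear_Blinfun_apply clinear_on_def)
qed

lemma cadjoint_eqI: "(\<And>v w. cinner (blinfun_apply T v) w = cinner v (blinfun_apply S w)) \<Longrightarrow> cadjoint T = S"
  unfolding cadjoint_def
proof (rule the_equality)
  fix S' assume T: "\<And>v w. cinner (blinfun_apply T v) w = cinner v (blinfun_apply S w)"
    and S': "\<forall>v w. cinner (blinfun_apply T v) w = cinner v (blinfun_apply S' w)"
  show "S' = S"
  proof (rule blinfun_eqI, rule cinner_eqI_right)
    show "cinner z (S' w) = cinner z (S w)" for z w using T[of z w] S' by simp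
  qed
qed auto

subsection \<open>Hilbert-Schmidt operators\<close>

text \<open>A basis-free form of the Hilbert-Schmidt norm: \<open>K\<close> bounds its square.\<close>

definition hs_bound :: "('h::chilbert_space \<Rightarrow> 'h) \<Rightarrow> real \<Rightarrow> bool" where
  "hs_bound T K \<longleftrightarrow> (\<forall>F. finite F \<and> orthonormal F \<longrightarrow> (\<Sum>b\<in>F. (norm (T b))\<^sup>2) \<le> K)"

text \<open>The double sum of \<open>(cmod (cinner (T b) g))\<^sup>2\<close> is read in two ways.
  Finitely many vectors of \<open>B\<close> catch the norms of all \<open>S g\<close> up to a small
  loss, and Bessel's inequality over \<open>G\<close> then leads back to the norms of
  \<open>T b\<close>.\<close>

lemma hs_bound_adjoint:
  assumes B: "orthonormal_basis B" and T: "\<And>v w. cinner (T v) w = cinner v (S w)"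
    and K: "\<And>F. finite F \<Longrightarrow> F \<subseteq> B \<Longrightarrow> (\<Sum>b\<in>F. (norm (T b))\<^sup>2) \<le> K"
  shows "hs_bound S K"
  unfolding hs_bound_def
proof (intro allI impI, elim conjE)
  fix G :: "'a set" assume G: "finite G" "orthonormal G"
  have oB: "orthonormal B" using B by (simp add: orthonormal_basis_iff)
  have "(\<Sum>g\<in>G. (norm (S g))\<^sup>2) \<le> K + e" if e: "e > 0" for e
  proof -
    \<comment> \<open>Each \<open>g\<close> may lose \<open>e / Suc (card G)\<close>, which adds up
      to less than \<open>e\<close>; the successor keeps the denominator positive for empty
      \<open>G\<close>.\<close>
    have "\<exists>F. finite F \<and> F \<subseteq> B \<and> (norm (S g))\<^sup>2 - e / Suc (card G) < (\<Sum>b\<in>F. (cmod (cinner (S g) b))\<^sup>2)" for g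
    proof (rule ccontr)
      assume "\<not> ?thesis"
      then have "(norm (S g))\<^sup>2 \<le> (norm (S g))\<^sup>2 - e / Suc (card G)"
        by (intro parseval_le[OF B]) (auto simp: not_less)
      then show False using e by (auto simp: divide_le_0_iff)
    qed
    then obtain F where F: "\<And>g. finite (F g)" "\<And>g. F g \<subseteq> B"
      "\<And>g. (norm (S g))\<^sup>2 - e / Suc (card G) < (\<Sum>b\<in>F g. (cmod (cinner (S g) b))\<^sup>2)" by metis
    define U where "U = (\<Union>g\<in>G. F g)"
    have U: "finite U" "U \<subseteq> B" using F G by (auto simp: U_def)
    have "(\<Sum>g\<in>G. (norm (S g))\<^sup>2) \<le> (\<Sum>g\<in>G. (\<Sum>b\<in>U. (cmod (cinner (S g) b))\<^sup>2) + e / Suc (card G))"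
    proof (rule sum_mono)
      fix g assume "g \<in> G"
      then have "(\<Sum>b\<in>F g. (cmod (cinner (S g) b))\<^sup>2) \<le> (\<Sum>b\<in>U. (cmod (cinner (S g) b))\<^sup>2)"
        using U by (intro sum_mono2) (auto simp: U_def)
      then show "(norm (S g))\<^sup>2 \<le> (\<Sum>b\<in>U. (cmod (cinner (S g) b))\<^sup>2) + e / Suc (card G)"
        using F(3)[of g] by linarith
    qed
    also have "\<dots> = (\<Sum>b\<in>U. \<Sum>g\<in>G. (cmod (cinner (S g) b))\<^sup>2) + card G * (e / Suc (card G))"
      by (simp add: sum.distrib) (rule sum.swap)
    also have "card G * (e / Suc (card G)) \<le> e"
      using e by (simp add: field_simps)
    also have "(\<Sum>b\<in>U. \<Sum>g\<in>G. (cmod (cinner (S g) b))\<^sup>2) \<le> (\<Sum>b\<in>U. (norm (T b))\<^sup>2)"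
    proof (rule sum_mono)
      fix b assume "b \<in> U"
      have "cmod (cinner (S g) b) = cmod (cinner (T b) g)" for g
        using T[of b g] by (metis cinner_commute complex_mod_cnj)
      then show "(\<Sum>g\<in>G. (cmod (cinner (S g) b))\<^sup>2) \<le> (norm (T b))\<^sup>2"
        using bessel_inequality[OF G(2,1), of "T b"] by simp
    qed
    also have "(\<Sum>b\<in>U. (norm (T b))\<^sup>2) \<le> K" using U by (rule K)
    finally show ?thesis by simp
  qed
  then show "(\<Sum>g\<in>G. (norm (S g))\<^sup>2) \<le> K" by (rule field_le_epsilon)
qed

text \<open>Passing to the adjoint twice spreads the bound from one basis to all orthonormal
  systems; this is the independence of the basis.\<close>

lemma hs_bound_basis:
  fixes T :: "'h::{chilbert_space, second_countable_topology} \<Rightarrow>\<^sub>L 'h"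
  assumes T: "clinear_on UNIV T" and B: "orthonormal_basis B"
    and K: "\<And>F. finite F \<Longrightarrow> F \<subseteq> B \<Longrightarrow> (\<Sum>b\<in>F. (norm (T b))\<^sup>2) \<le> K"
  shows "hs_bound T K"
proof -
  obtain S :: "'h \<Rightarrow>\<^sub>L 'h" where S: "\<And>v w. cinner (T v) w = cinner v (S w)"
    using clinear_adjoint_exists[OF T] by blast
  have "hs_bound S K" by (rule hs_bound_adjoint[OF B S K])
  moreover have "cinner (S v) w = cinner v (T w)" for v w
    using S by (metis cinner_commute)
  ultimately show ?thesis
    using B by (intro hs_bound_adjoint[OF B, of S T K])
      (auto simp: hs_bound_def orthonormal_basis_iff intro: orthonormal_subset)
qed

lemma hilbert_schmidt_iff:
  fixes T :: "'h::{chilbert_space, second_countable_topology} \<Rightarrow>\<^sub>L 'h"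
  shows "hilbert_schmidt T \<longleftrightarrow> clinear_on UNIV T \<and> (\<exists>K. hs_bound T K)"
proof
  assume "hilbert_schmidt T"
  then obtain B where T: "clinear_on UNIV T" and B: "orthonormal_basis B"
    and s: "(\<lambda>b. (norm (T b))\<^sup>2) summable_on B" by (auto simp: hilbert_schmidt_def)
  have "hs_bound T (\<Sum>\<^sub>\<infinity>b\<in>B. (norm (T b))\<^sup>2)"
    by (rule hs_bound_basis[OF T B]) (rule finite_sum_le_infsum[OF s], auto)
  then show "clinear_on UNIV T \<and> (\<exists>K. hs_bound T K)" using T by blast
next
  assume *: "clinear_on UNIV T \<and> (\<exists>K. hs_bound T K)"
  then obtain K where K: "hs_bound T K" by blast
  obtain B :: "'h set" where B: "orthonormal_basis B" using orthonormal_basis_exists by blast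
  have "(\<lambda>b. (norm (T b))\<^sup>2) summable_on B"
  proof (rule nonneg_bdd_above_summable_on)
    show "bdd_above (sum (\<lambda>b. (norm (T b))\<^sup>2) ` {F. F \<subseteq> B \<and> finite F})"
      using K B by (auto simp: bdd_above_def hs_bound_def orthonormal_basis_iff intro!: exI[of _ K]
          intro: orthonormal_subset)
  qed auto
  then show "hilbert_schmidt T" using * B by (auto simp: hilbert_schmidt_def)
qed

text \<open>Names the basis chosen inside \<open>hs_norm\<close>, so that its properties can be
  cited.\<close>

definition hs_basis :: "'h::chilbert_space set" where
  "hs_basis = (SOME B. orthonormal_basis B)"

lemma hs_basis: "orthonormal_basis (hs_basis :: 'h::{chilbert_space, second_countable_topology} set)"
  unfolding hs_basis_def using orthonormal_basis_exists by (rule someI_ex)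

lemma hs_basis_subset:
  "orthonormal (F :: 'h::{chilbert_space, second_countable_topology} set)" if "F \<subseteq> hs_basis"
  using that hs_basis by (auto simp: orthonormal_basis_iff intro: orthonormal_subset)

lemma hs_summable:
  fixes T :: "'h::{chilbert_space, second_countable_topology} \<Rightarrow>\<^sub>L 'h"
  assumes "hilbert_schmidt T"
  shows "(\<lambda>b. (norm (T b))\<^sup>2) summable_on hs_basis"
proof -
  obtain K where K: "hs_bound T K" using assms by (auto simp: hilbert_schmidt_iff)
  show ?thesis
  proof (rule nonneg_bdd_above_summable_on)
    show "bdd_above (sum (\<lambda>b. (norm (T b))\<^sup>2) ` {F. F \<subseteq> hs_basis \<and> finite F})"
      using K by (auto simp: bdd_above_def hs_bound_def intro!: exI[of _ K] hs_basis_subset)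
  qed auto
qed

lemma hs_norm_sq: "(hs_norm T)\<^sup>2 = (\<Sum>\<^sub>\<infinity>b\<in>hs_basis. (norm (T b))\<^sup>2)"
  unfolding hs_norm_def hs_basis_def by (simp add: infsum_nonneg)

lemma hs_norm_nonneg [simp]: "0 \<le> hs_norm T"
  unfolding hs_norm_def by (simp add: infsum_nonneg)

lemma hs_bound_norm:
  fixes T :: "'h::{chilbert_space, second_countable_topology} \<Rightarrow>\<^sub>L 'h"
  assumes "hilbert_schmidt T"
  shows "hs_bound T ((hs_norm T)\<^sup>2)"
  unfolding hs_norm_sq
  using assms by (intro hs_bound_basis[OF _ hs_basis] finite_sum_le_infsum hs_summable)
    (auto simp: hilbert_schmidt_iff)

text \<open>\<open>hs_norm\<close> sums over a basis fixed by choice, but the estimate may be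
  checked on any other one; the main later uses take a basis from the range of
  \<open>C\<close>.\<close>

lemma hs_norm_le:
  fixes T :: "'h::{chilbert_space, second_countable_topology} \<Rightarrow>\<^sub>L 'h"
  assumes T: "clinear_on UNIV T" and B: "orthonormal_basis B"
    and K: "\<And>F. finite F \<Longrightarrow> F \<subseteq> B \<Longrightarrow> (\<Sum>b\<in>F. (norm (T b))\<^sup>2) \<le> K\<^sup>2" and "0 \<le> K"
  shows "hilbert_schmidt T" "hs_norm T \<le> K"
proof -
  have b: "hs_bound T (K\<^sup>2)" by (rule hs_bound_basis[OF T B K])
  then show hs: "hilbert_schmidt T" using T by (auto simp: hilbert_schmidt_iff)
  have "(hs_norm T)\<^sup>2 \<le> K\<^sup>2"
    unfolding hs_norm_sq
    using b by (intro infsum_le_finite_sums[OF hs_summable[OF hs]]) (auto simp: hs_bound_def hs_basis_subset)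
  then show "hs_norm T \<le> K" using \<open>0 \<le> K\<close> by (rule power2_le_imp_le)
qed

lemma hs_norm_le_bound:
  fixes T :: "'h::{chilbert_space, second_countable_topology} \<Rightarrow>\<^sub>L 'h"
  assumes T: "clinear_on UNIV T" and b: "hs_bound T (K\<^sup>2)" and "0 \<le> K"
  shows "hilbert_schmidt T" "hs_norm T \<le> K"
  using hs_norm_le[OF T hs_basis _ \<open>0 \<le> K\<close>] b by (auto simp: hs_bound_def hs_basis_subset)

lemma norm_le_hs_norm:
  fixes T :: "'h::{chilbert_space, second_countable_topology} \<Rightarrow>\<^sub>L 'h"
  assumes "hilbert_schmidt T"
  shows "norm (T v) \<le> hs_norm T * norm v"
proof (cases "v = 0")
  case False
  define u where "u = (1 / norm v) *\<^sub>R v"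
  have "orthonormal {u}" using False by (simp add: orthonormal_def u_def cinner_self)
  then have "(norm (T u))\<^sup>2 \<le> (hs_norm T)\<^sup>2"
    using hs_bound_norm[OF assms] by (auto simp: hs_bound_def dest: spec[of _ "{u}"])
  then have "norm (T u) \<le> hs_norm T" by (rule power2_le_imp_le) simp
  then show ?thesis using False by (simp add: u_def blinfun.scaleR_right field_simps)
qed (simp add: blinfun.zero_right)

lemma hs_norm_L2_set:
  fixes T :: "'h::{chilbert_space, second_countable_topology} \<Rightarrow>\<^sub>L 'h"
  assumes "hilbert_schmidt T" "finite F" "orthonormal F"
  shows "L2_set (\<lambda>b. norm (T b)) F \<le> hs_norm T"
  using hs_bound_norm[OF assms(1)] assms(2,3) unfolding L2_set_def hs_bound_def
  by (intro real_le_lsqrt) (auto intro: sum_nonneg)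

lemma clinear_on_blinfun_add:
  "clinear_on UNIV (blinfun_apply S) \<Longrightarrow> clinear_on UNIV (blinfun_apply T) \<Longrightarrow> clinear_on UNIV (blinfun_apply (S + T))"
  "clinear_on UNIV (blinfun_apply S) \<Longrightarrow> clinear_on UNIV (blinfun_apply T) \<Longrightarrow> clinear_on UNIV (blinfun_apply (S - T))"
  "clinear_on UNIV (blinfun_apply S) \<Longrightarrow> clinear_on UNIV (blinfun_apply T) \<Longrightarrow> clinear_on UNIV (blinfun_apply (S o\<^sub>L T))"
  by (auto simp: clinear_on_def blinfun.add_left blinfun.diff_left scaleC_add_right scaleC_diff_right)

lemma
  fixes S T :: "'h::{chilbert_space, second_countable_topology} \<Rightarrow>\<^sub>L 'h"
  assumes S: "hilbert_schmidt S" and T: "hilbert_schmidt T"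
  shows hilbert_schmidt_add: "hilbert_schmidt (S + T)"
    and hs_norm_triangle: "hs_norm (S + T) \<le> hs_norm S + hs_norm T"
proof -
  have b: "hs_bound (S + T) ((hs_norm S + hs_norm T)\<^sup>2)" unfolding hs_bound_def
  proof (intro allI impI, elim conjE)
    fix F :: "'h set" assume F: "finite F" "orthonormal F"
    have "L2_set (\<lambda>b. norm ((S + T) b)) F \<le> L2_set (\<lambda>b. norm (S b) + norm (T b)) F"
      by (intro L2_set_mono) (auto simp: blinfun.add_left norm_triangle_ineq)
    also have "\<dots> \<le> L2_set (\<lambda>b. norm (S b)) F + L2_set (\<lambda>b. norm (T b)) F"
      by (rule L2_set_triangle_ineq)
    also have "\<dots> \<le> hs_norm S + hs_norm T" using S T F by (intro add_mono hs_norm_L2_set)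
    finally show "(\<Sum>b\<in>F. (norm ((S + T) b))\<^sup>2) \<le> (hs_norm S + hs_norm T)\<^sup>2"
      unfolding L2_set_def by (rule sqrt_le_D)
  qed
  have l: "clinear_on UNIV (S + T)" using S T by (auto simp: hilbert_schmidt_iff clinear_on_blinfun_add)
  show "hilbert_schmidt (S + T)" "hs_norm (S + T) \<le> hs_norm S + hs_norm T"
    using hs_norm_le_bound[OF l b] by auto
qed

lemma
  fixes S T :: "'h::{chilbert_space, second_countable_topology} \<Rightarrow>\<^sub>L 'h"
  assumes T: "hilbert_schmidt T" and S: "clinear_on UNIV (blinfun_apply S)" "\<And>v. norm (S v) \<le> k * norm (T v)"
    and "0 \<le> k"
  shows hilbert_schmidt_dominated: "hilbert_schmidt S"
    and hs_norm_dominated: "hs_norm S \<le> k * hs_norm T"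
proof -
  have b: "hs_bound S ((k * hs_norm T)\<^sup>2)" unfolding hs_bound_def
  proof (intro allI impI, elim conjE)
    fix F :: "'h set" assume F: "finite F" "orthonormal F"
    have "(\<Sum>b\<in>F. (norm (S b))\<^sup>2) \<le> (\<Sum>b\<in>F. (k * norm (T b))\<^sup>2)"
      by (intro sum_mono power_mono S) auto
    also have "\<dots> = k\<^sup>2 * (\<Sum>b\<in>F. (norm (T b))\<^sup>2)" by (simp add: power_mult_distrib sum_distrib_left)
    also have "\<dots> \<le> k\<^sup>2 * (hs_norm T)\<^sup>2"
      using hs_bound_norm[OF T] F by (intro mult_left_mono) (auto simp: hs_bound_def)
    finally show "(\<Sum>b\<in>F. (norm (S b))\<^sup>2) \<le> (k * hs_norm T)\<^sup>2" by (simp add: power_mult_distrib)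
  qed
  show "hilbert_schmidt S" "hs_norm S \<le> k * hs_norm T"
    using hs_norm_le_bound[OF S(1) b] \<open>0 \<le> k\<close> by auto
qed

lemma hilbert_schmidt_diff:
  fixes S T :: "'h::{chilbert_space, second_countable_topology} \<Rightarrow>\<^sub>L 'h"
  assumes S: "hilbert_schmidt S" and T: "hilbert_schmidt T"
  shows "hilbert_schmidt (S - T)"
proof -
  have l: "clinear_on UNIV (- T)"
    using T by (auto simp: hilbert_schmidt_iff clinear_on_def blinfun.minus_left scaleC_minus_right)
  have "norm ((- T) v) \<le> 1 * norm (T v)" for v by (simp add: blinfun.minus_left)
  from hilbert_schmidt_dominated[OF T l this] have "hilbert_schmidt (- T)" by simp
  then show ?thesis using hilbert_schmidt_add[OF S] by fastforce
qed

lemma hs_norm_minus_commute: "hs_norm (S - T) = hs_norm (T - S)"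
  unfolding hs_norm_def by (simp add: blinfun.diff_left norm_minus_commute)

lemma hilbert_schmidt_zero [simp]:
  "hilbert_schmidt (0 :: 'h::{chilbert_space, second_countable_topology} \<Rightarrow>\<^sub>L 'h)"
  by (auto simp: hilbert_schmidt_iff hs_bound_def clinear_on_def intro!: exI[of _ 0])

lemma hilbert_schmidt_sum:
  fixes S :: "'i \<Rightarrow> 'h::{chilbert_space, second_countable_topology} \<Rightarrow>\<^sub>L 'h"
  shows "(\<And>i. i \<in> I \<Longrightarrow> hilbert_schmidt (S i)) \<Longrightarrow> hilbert_schmidt (\<Sum>i\<in>I. S i)"
  by (induction I rule: infinite_finite_induct) (auto intro: hilbert_schmidt_add)

lemma
  fixes S T :: "'h::{chilbert_space, second_countable_topology} \<Rightarrow>\<^sub>L 'h"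
  assumes T: "hilbert_schmidt T" and S: "\<And>v w. cinner (T v) w = cinner v (S w)"
  shows hilbert_schmidt_adjoint: "hilbert_schmidt S"
    and hs_norm_adjoint: "hs_norm S \<le> hs_norm T"
proof -
  have l: "clinear_on UNIV S"
    unfolding clinear_on_def
  proof (intro conjI ballI allI)
    show "S (v + w) = S v + S w" for v w
      by (rule cinner_eqI_right) (simp add: cinner_add_right S[symmetric])
    show "S (c *\<^sub>C v) = c *\<^sub>C S v" for c v
      by (rule cinner_eqI_right) (simp add: cinner_scaleC_right S[symmetric])
  qed
  have "hs_bound S ((hs_norm T)\<^sup>2)"
    using hs_bound_norm[OF T] by (intro hs_bound_adjoint[OF hs_basis S]) (auto simp: hs_bound_def hs_basis_subset)
  then show "hilbert_schmidt S" "hs_norm S \<le> hs_norm T"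
    using hs_norm_le_bound[OF l] by auto
qed

subsection \<open>Extension from a dense subspace\<close>

text \<open>A bounded linear map on a subspace is Lipschitz, hence extends continuously to the
  closure; linearity and the bound pass to limits.\<close>

lemma bounded_clinear_extension:
  fixes L :: "'h::chilbert_space \<Rightarrow> 'h"
  assumes W: "csubspace W" "closure W = UNIV" and L: "clinear_on W L"
    and K: "\<And>v. v \<in> W \<Longrightarrow> norm (L v) \<le> K * norm v"
  obtains T :: "'h \<Rightarrow>\<^sub>L 'h" where "clinear_on UNIV T" "\<And>v. v \<in> W \<Longrightarrow> T v = L v"
proof -
  have lip: "norm (L v - L w) \<le> \<bar>K\<bar> * norm (v - w)" if "v \<in> W" "w \<in> W" for v w
  proof -
    have "norm (L v - L w) \<le> K * norm (v - w)"
      using K[OF csubspaceD(4)[OF W(1) that]] clinear_on_zero_diff(2)[OF W(1) L that] by simp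
    also have "\<dots> \<le> \<bar>K\<bar> * norm (v - w)" by (intro mult_right_mono) auto
    finally show ?thesis .
  qed
  have "\<bar>K\<bar>-lipschitz_on W L"
    using lip by (intro lipschitz_onI) (auto simp: dist_norm)
  then have "uniformly_continuous_on W L" by (rule lipschitz_on_uniformly_continuous)
  then obtain g where g: "uniformly_continuous_on (closure W) g" "\<And>x. x \<in> W \<Longrightarrow> L x = g x"
    by (rule uniformly_continuous_on_extension_on_closure) blast+
  have cg: "continuous_on UNIV g" using g(1) W(2) uniformly_continuous_imp_continuous by metis
  have lim: "\<exists>x. (\<forall>n. x n \<in> W) \<and> x \<longlonglongrightarrow> v" for v
    using W(2) closure_sequential[of v W] by auto
  have tg: "(\<lambda>n. g (x n)) \<longlonglongrightarrow> g v" if "x \<longlonglongrightarrow> v" for x v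
    using cg that by (auto simp: continuous_on_eq_continuous_at isCont_tendsto_compose)
  have add: "g (v + w) = g v + g w" for v w
  proof -
    obtain x y where x: "\<And>n. x n \<in> W" "x \<longlonglongrightarrow> v" and y: "\<And>n. y n \<in> W" "y \<longlonglongrightarrow> w" using lim by metis
    have "(\<lambda>n. g (x n + y n)) \<longlonglongrightarrow> g (v + w)" by (intro tg tendsto_intros x y)
    moreover have "g (x n + y n) = g (x n) + g (y n)" for n
      using x y clinear_onD(1)[OF L] csubspaceD(2)[OF W(1)] by (simp flip: g(2))
    moreover have "(\<lambda>n. g (x n) + g (y n)) \<longlonglongrightarrow> g v + g w" by (intro tendsto_intros tg x y)
    ultimately show ?thesis by (rule LIMSEQ_unique_eq)
  qed
  have scale: "g (c *\<^sub>C v) = c *\<^sub>C g v" for c v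
  proof -
    obtain x where x: "\<And>n. x n \<in> W" "x \<longlonglongrightarrow> v" using lim by metis
    have "(\<lambda>n. g (c *\<^sub>C x n)) \<longlonglongrightarrow> g (c *\<^sub>C v)" by (intro tg tendsto_intros x)
    moreover have "g (c *\<^sub>C x n) = c *\<^sub>C g (x n)" for n
      using x clinear_onD(2)[OF L] csubspaceD(3)[OF W(1)] by (simp flip: g(2))
    moreover have "(\<lambda>n. c *\<^sub>C g (x n)) \<longlonglongrightarrow> c *\<^sub>C g v" by (intro tendsto_intros tg x)
    ultimately show ?thesis by (rule LIMSEQ_unique_eq)
  qed
  have bound: "norm (g v) \<le> norm v * K" for v
  proof -
    obtain x where x: "\<And>n. x n \<in> W" "x \<longlonglongrightarrow> v" using lim by metis
    have "norm (g (x n)) \<le> norm (x n) * K" for n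
      using K[OF x(1)[of n]] g(2)[OF x(1)[of n]] by (simp add: mult.commute)
    then show ?thesis
      by (intro LIMSEQ_le[OF tendsto_norm[OF tg[OF x(2)]] tendsto_mult_right[OF tendsto_norm[OF x(2)]]]) auto
  qed
  have "bounded_linear g"
    using bound by (intro bounded_linear_intro[where K = K]) (auto simp: add scale scaleR_scaleC)
  then show thesis
    using add scale g(2) by (intro that[of "Blinfun g"]) (auto simp: bounded_linear_Blinfun_apply clinear_on_def)
qed

section \<open>Square integrable functions\<close>

text \<open>The free parameter \<open>t\<close> is optimized in the Cauchy-Schwarz inequality that
  follows. Extended nonnegative reals allow that inequality to be used before integrability is
  known.\<close>

lemma ennreal_arith_geo: "2 * (a * b) \<le> ennreal t * a\<^sup>2 + ennreal (1 / t) * b\<^sup>2" if t: "t > 0"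
proof (cases a; cases b)
  fix x y assume a: "0 \<le> x" "a = ennreal x" and b: "0 \<le> y" "b = ennreal y"
  have "0 \<le> (t * x - y)\<^sup>2 / t" using t by simp
  also have "\<dots> = t * x\<^sup>2 + 1 / t * y\<^sup>2 - 2 * (x * y)"
    using t by (simp add: power2_eq_square field_simps)
  finally have "2 * (x * y) \<le> t * x\<^sup>2 + 1 / t * y\<^sup>2" by simp
  then have "ennreal (2 * (x * y)) \<le> ennreal (t * x\<^sup>2 + 1 / t * y\<^sup>2)" by (rule ennreal_leI)
  moreover have "2 * (a * b) = ennreal (2 * (x * y))" using a b by (simp add: ennreal_mult)
  moreover have "ennreal t * a\<^sup>2 + ennreal (1 / t) * b\<^sup>2 = ennreal (t * x\<^sup>2 + 1 / t * y\<^sup>2)"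
    using a b t by (simp add: ennreal_power ennreal_mult[symmetric] ennreal_plus[symmetric] less_imp_le del: ennreal_plus)
  ultimately show ?thesis by simp
qed (use t in \<open>auto simp: power2_eq_square ennreal_mult_top ennreal_top_mult top_unique\<close>)

lemma Cauchy_Schwarz_nn_integral:
  assumes [measurable]: "f \<in> borel_measurable M" "g \<in> borel_measurable M"
  shows "(\<integral>\<^sup>+x. f x * g x \<partial>M)\<^sup>2 \<le> (\<integral>\<^sup>+x. (f x)\<^sup>2 \<partial>M) * (\<integral>\<^sup>+x. (g x)\<^sup>2 \<partial>M)"
proof -
  define A where "A = (\<integral>\<^sup>+x. (f x)\<^sup>2 \<partial>M)"
  define B where "B = (\<integral>\<^sup>+x. (g x)\<^sup>2 \<partial>M)"
  define I where "I = (\<integral>\<^sup>+x. f x * g x \<partial>M)"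
  \<comment> \<open>Separate because of \<open>0 * \<top> = 0\<close>: when one factor on the right
    vanishes and the other is infinite, the claim is that the left side is zero.\<close>
  have zero: "I = 0" if "A = 0 \<or> B = 0"
  proof -
    have "AE x in M. f x * g x = 0"
      using that by (auto simp: A_def B_def nn_integral_0_iff_AE)
    then show ?thesis unfolding I_def by (subst nn_integral_0_iff_AE) auto
  qed
  have bound: "2 * I \<le> ennreal t * A + ennreal (1 / t) * B" if t: "t > 0" for t
  proof -
    have "2 * I = (\<integral>\<^sup>+x. 2 * (f x * g x) \<partial>M)" by (simp add: I_def nn_integral_cmult)
    also have "\<dots> \<le> (\<integral>\<^sup>+x. ennreal t * (f x)\<^sup>2 + ennreal (1 / t) * (g x)\<^sup>2 \<partial>M)"
      by (intro nn_integral_mono ennreal_arith_geo t)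
    finally show ?thesis by (simp add: A_def B_def nn_integral_add nn_integral_cmult)
  qed
  show ?thesis
  proof (cases "A = 0 \<or> B = 0 \<or> A = \<top> \<or> B = \<top>")
    case True
    then show ?thesis using zero by (auto simp: A_def[symmetric] B_def[symmetric] I_def[symmetric]
          ennreal_top_mult ennreal_mult_top)
  next
    case False
    then obtain a b where a: "a > 0" "A = ennreal a" and b: "b > 0" "B = ennreal b"
      by (metis ennreal_cases ennreal_eq_0_iff not_le)
    \<comment> \<open>The minimizer of \<open>t * a + b / t\<close>, for which both summands equal
      \<open>sqrt (a * b)\<close>.\<close>
    define t where "t = sqrt (b / a)"
    have t: "t > 0" "t\<^sup>2 = b / a" using a b by (auto simp: t_def)
    have "t * a = sqrt (a * b)" "1 / t * b = sqrt (a * b)"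
      using a b unfolding t_def
      by (auto simp: real_sqrt_mult real_sqrt_divide field_simps)
    then have "2 * I \<le> ennreal (2 * sqrt (a * b))"
      using bound[OF t(1)] a b t by (simp add: ennreal_mult[symmetric] flip: ennreal_plus)
    then have I: "I \<le> ennreal (sqrt (a * b))"
      using a b by (cases I) (auto simp: ennreal_mult[symmetric] top_unique ennreal_mult_top ennreal_le_iff simp flip: ennreal_numeral)
    then have "I\<^sup>2 \<le> (ennreal (sqrt (a * b)))\<^sup>2" by (rule power_mono) simp
    also have "\<dots> = A * B" using a b by (simp add: ennreal_power ennreal_mult[symmetric])
    finally show ?thesis by (simp add: A_def B_def I_def)
  qed
qed

lemma ennreal_power2_le_imp_le:
  assumes "x\<^sup>2 \<le> (ennreal y)\<^sup>2" "0 \<le> y"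
  shows "x \<le> ennreal y"
proof (rule ccontr)
  assume "\<not> x \<le> ennreal y"
  then have lt: "ennreal y < x" by simp
  then obtain z where z: "ennreal y < z" "z < x" by (rule dense[THEN exE]) auto
  then obtain r where r: "z = ennreal r" "0 \<le> r"
    by (metis ennreal_cases top.not_eq_extremum not_less_iff_gr_or_eq order.strict_trans2 top_greatest)
  then have "y < r" using z(1) assms(2) by (simp add: ennreal_less_iff)
  then have "y\<^sup>2 < r\<^sup>2" using assms(2) by (intro power_strict_mono) auto
  then have "(ennreal y)\<^sup>2 < (ennreal r)\<^sup>2" using assms(2) r by (simp add: ennreal_power ennreal_less_iff)
  also have "\<dots> \<le> x\<^sup>2" using z(2) r by (intro power_mono) auto
  finally show False using assms(1) by simp
qed

text \<open>When the squared modulus is not integrable the integral defaults to 0, so estimates by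
  \<open>l2norm\<close> come with \<open>L2\<close> hypotheses.\<close>

definition l2norm :: "'x measure \<Rightarrow> ('x \<Rightarrow> complex) \<Rightarrow> real" where
  "l2norm M f = sqrt (LINT x|M. (norm (f x))\<^sup>2)"

lemma l2norm_nonneg [simp]: "0 \<le> l2norm M f"
  by (simp add: l2norm_def)

lemma L2_measurable: "L2 M f \<Longrightarrow> f \<in> borel_measurable M"
  by (simp add: L2_def)

lemma L2_iff: "L2 M f \<longleftrightarrow> f \<in> borel_measurable M \<and> (\<integral>\<^sup>+x. ennreal ((norm (f x))\<^sup>2) \<partial>M) < \<infinity>"
  by (auto simp: L2_def integrable_iff_bounded)

lemma L2_nn: "L2 M f \<Longrightarrow> (\<integral>\<^sup>+x. ennreal ((norm (f x))\<^sup>2) \<partial>M) = ennreal ((l2norm M f)\<^sup>2)"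
  by (simp add: L2_def l2norm_def nn_integral_eq_integral)

lemma L2I:
  assumes "f \<in> borel_measurable M" "(\<integral>\<^sup>+x. ennreal ((norm (f x))\<^sup>2) \<partial>M) \<le> ennreal (K\<^sup>2)" "0 \<le> K"
  shows "L2 M f" "l2norm M f \<le> K"
proof -
  show L: "L2 M f" using assms by (auto simp: L2_iff intro: order_le_less_trans)
  have "(l2norm M f)\<^sup>2 \<le> K\<^sup>2" using assms(2) unfolding L2_nn[OF L] by (simp add: ennreal_le_iff)
  then show "l2norm M f \<le> K" using \<open>0 \<le> K\<close> by (rule power2_le_imp_le)
qed

lemma L2_cong_AE:
  assumes "L2 M f" "AE x in M. f x = g x" "g \<in> borel_measurable M"
  shows "L2 M g"
proof -
  have "(\<integral>\<^sup>+x. ennreal ((norm (g x))\<^sup>2) \<partial>M) = (\<integral>\<^sup>+x. ennreal ((norm (f x))\<^sup>2) \<partial>M)"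
    by (rule nn_integral_cong_AE) (use assms(2) in auto)
  then show ?thesis using assms by (simp add: L2_iff)
qed

lemma
  assumes "L2 M f" "L2 M g"
  shows L2_nn_mult: "(\<integral>\<^sup>+x. ennreal (norm (f x)) * ennreal (norm (g x)) \<partial>M) \<le> ennreal (l2norm M f * l2norm M g)"
    and L2_integrable_mult: "integrable M (\<lambda>x. f x * g x)"
    and L2_integral_mult_le: "norm (LINT x|M. f x * g x) \<le> l2norm M f * l2norm M g"
proof -
  note [measurable] = assms[THEN L2_measurable]
  have "(\<integral>\<^sup>+x. ennreal (norm (f x)) * ennreal (norm (g x)) \<partial>M)\<^sup>2
      \<le> (\<integral>\<^sup>+x. (ennreal (norm (f x)))\<^sup>2 \<partial>M) * (\<integral>\<^sup>+x. (ennreal (norm (g x)))\<^sup>2 \<partial>M)"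
    by (rule Cauchy_Schwarz_nn_integral) auto
  also have "\<dots> = ennreal ((l2norm M f)\<^sup>2) * ennreal ((l2norm M g)\<^sup>2)"
    using assms by (simp add: L2_nn ennreal_power)
  also have "\<dots> = (ennreal (l2norm M f * l2norm M g))\<^sup>2"
    by (simp add: ennreal_mult[symmetric] ennreal_power power_mult_distrib)
  finally show 1: "(\<integral>\<^sup>+x. ennreal (norm (f x)) * ennreal (norm (g x)) \<partial>M) \<le> ennreal (l2norm M f * l2norm M g)"
    by (rule ennreal_power2_le_imp_le) simp
  then have 2: "(\<integral>\<^sup>+x. ennreal (norm (f x * g x)) \<partial>M) \<le> ennreal (l2norm M f * l2norm M g)"
    by (simp add: norm_mult ennreal_mult)
  show 3: "integrable M (\<lambda>x. f x * g x)"
    using 2 by (intro integrableI_bounded) (auto intro: order_le_less_trans)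
  show "norm (LINT x|M. f x * g x) \<le> l2norm M f * l2norm M g"
    using order_trans[OF integral_norm_bound_ennreal[OF 3] 2] by (simp add: ennreal_le_iff)
qed

lemma L2_cnj: "L2 M f \<Longrightarrow> L2 M (\<lambda>x. cnj (f x))"
  by (auto simp: L2_def intro: measurable_compose[OF _ borel_measurable_continuous_onI] continuous_on_cnj)

lemma l2norm_cnj: "l2norm M (\<lambda>x. cnj (f x)) = l2norm M f"
  by (simp add: l2norm_def)

lemma norm_sum_sq_le: "(norm (a + b))\<^sup>2 \<le> 2 * (norm a)\<^sup>2 + 2 * (norm (b::'a::real_normed_vector))\<^sup>2"
proof -
  have "(norm (a + b))\<^sup>2 \<le> (norm a + norm b)\<^sup>2" by (intro power_mono norm_triangle_ineq) auto
  also have "\<dots> \<le> 2 * (norm a)\<^sup>2 + 2 * (norm b)\<^sup>2"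
    using sum_squares_bound[of "norm a" "norm b"] by (simp add: power2_sum)
  finally show ?thesis .
qed

lemma L2_add:
  assumes "L2 M f" "L2 M g"
  shows "L2 M (\<lambda>x. f x + g x)"
proof -
  note [measurable] = assms[THEN L2_measurable]
  have "integrable M (\<lambda>x. (norm (f x + g x))\<^sup>2)"
    by (rule Bochner_Integration.integrable_bound[where f = "\<lambda>x. 2 * (norm (f x))\<^sup>2 + 2 * (norm (g x))\<^sup>2"])
      (use assms in \<open>auto simp: norm_sum_sq_le L2_def\<close>)
  then show ?thesis by (simp add: L2_def)
qed

lemma L2_mult_left: "L2 M f \<Longrightarrow> L2 M (\<lambda>x. c * f x)"
  unfolding L2_def by (auto simp: norm_mult power_mult_distrib)

lemma L2_uminus: "L2 M f \<Longrightarrow> L2 M (\<lambda>x. - f x)"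
  unfolding L2_def by auto

lemma L2_diff: "L2 M f \<Longrightarrow> L2 M g \<Longrightarrow> L2 M (\<lambda>x. f x - g x)"
  using L2_add[of M f "\<lambda>x. - g x"] L2_uminus[of M g] by simp

lemma L2_tendsto_iff:
  assumes "\<And>k. L2 M (fs k)" "L2 M f"
  shows "L2_tendsto M fs f \<longleftrightarrow> (\<lambda>k. l2norm M (\<lambda>x. fs k x - f x)) \<longlonglongrightarrow> 0"
proof -
  have L: "L2 M (\<lambda>x. fs k x - f x)" for k by (intro L2_diff assms)
  have "L2_tendsto M fs f \<longleftrightarrow> (\<lambda>k. ennreal ((l2norm M (\<lambda>x. fs k x - f x))\<^sup>2)) \<longlonglongrightarrow> ennreal 0"
    unfolding L2_tendsto_def using assms by (simp add: L2_measurable L2_nn[OF L])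
  also have "\<dots> \<longleftrightarrow> (\<lambda>k. (l2norm M (\<lambda>x. fs k x - f x))\<^sup>2) \<longlonglongrightarrow> 0"
    by (intro tendsto_ennreal_iff) auto
  also have "\<dots> \<longleftrightarrow> (\<lambda>k. l2norm M (\<lambda>x. fs k x - f x)) \<longlonglongrightarrow> 0"
    using tendsto_real_sqrt[of "\<lambda>k. (l2norm M (\<lambda>x. fs k x - f x))\<^sup>2" 0]
      tendsto_power[of "\<lambda>k. l2norm M (\<lambda>x. fs k x - f x)" 0 _ 2] by auto
  finally show ?thesis .
qed

lemma L2_tendsto_integral:
  assumes "\<And>k. L2 M (fs k)" "L2 M f" "L2_tendsto M fs f" "L2 M g"
  shows "(\<lambda>k. LINT x|M. fs k x * g x) \<longlonglongrightarrow> (LINT x|M. f x * g x)"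
proof (rule LIM_zero_cancel, rule Lim_null_comparison)
  have "(\<lambda>k. l2norm M (\<lambda>x. fs k x - f x)) \<longlonglongrightarrow> 0" using assms L2_tendsto_iff by blast
  then show "(\<lambda>k. l2norm M (\<lambda>x. fs k x - f x) * l2norm M g) \<longlonglongrightarrow> 0" by (rule tendsto_mult_left_zero)
  have "(LINT x|M. fs k x * g x) - (LINT x|M. f x * g x) = (LINT x|M. (fs k x - f x) * g x)" for k
    using assms by (subst Bochner_Integration.integral_diff[symmetric])
      (auto intro: L2_integrable_mult simp: algebra_simps)
  then show "\<forall>\<^sub>F k in sequentially. norm ((LINT x|M. fs k x * g x) - (LINT x|M. f x * g x))
      \<le> l2norm M (\<lambda>x. fs k x - f x) * l2norm M g"
    using assms by (auto intro!: always_eventually L2_integral_mult_le L2_diff)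
qed

text \<open>A fast subsequence converges almost everywhere, and Fatou's lemma along it turns the
  Cauchy condition into convergence of the whole sequence in mean square.\<close>

lemma L2_complete:
  assumes L: "\<And>n. L2 M (fs n)"
    and C: "\<And>e. e > 0 \<Longrightarrow> \<exists>N. \<forall>m\<ge>N. \<forall>n\<ge>N. (\<integral>\<^sup>+x. ennreal ((norm (fs m x - fs n x))\<^sup>2) \<partial>M) \<le> ennreal e"
  obtains u where "L2 M u" "L2_tendsto M fs u"
proof -
  note [measurable] = L[THEN L2_measurable]
  \<comment> \<open>The rate \<open>(1/8)^k\<close> leaves room for the weight \<open>4^k\<close>:
    the weighted sum of squared increments is still integrable, and where it is finite the
    increments are of order \<open>(1/2)^k\<close>, hence summable.\<close>
  have "\<exists>N. \<forall>m\<ge>N. \<forall>n\<ge>N. (\<integral>\<^sup>+x. ennreal ((norm (fs m x - fs n x))\<^sup>2) \<partial>M) \<le> ennreal ((1/8)^k)" for k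
    by (rule C) simp
  then obtain N where N: "\<And>k m n. m \<ge> N k \<Longrightarrow> n \<ge> N k \<Longrightarrow>
      (\<integral>\<^sup>+x. ennreal ((norm (fs m x - fs n x))\<^sup>2) \<partial>M) \<le> ennreal ((1/8)^k)" by metis
  \<comment> \<open>\<open>r k\<close> dominates \<open>k\<close> and every \<open>N i\<close> with
    \<open>i \<le> k\<close>, so \<open>r k\<close> and \<open>r (Suc k)\<close> both lie beyond
    \<open>N k\<close>.\<close>
  define r where "r k = k + (\<Sum>i\<le>k. N i)" for k
  have rN: "r k \<ge> N k" for k unfolding r_def by (rule trans_le_add2) (rule member_le_sum, auto)
  have rS: "r (Suc k) \<ge> N k" for k unfolding r_def by (rule trans_le_add2) (rule member_le_sum, auto)
  define d where "d k x = fs (r (Suc k)) x - fs (r k) x" for k x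
  have [measurable]: "d k \<in> borel_measurable M" for k unfolding d_def by measurable
  have "(\<integral>\<^sup>+x. (\<Sum>k. ennreal (4^k * (norm (d k x))\<^sup>2)) \<partial>M) = (\<Sum>k. \<integral>\<^sup>+x. ennreal (4^k * (norm (d k x))\<^sup>2) \<partial>M)"
    by (rule nn_integral_suminf) measurable
  also have "\<dots> \<le> (\<Sum>k. ennreal ((1/2)^k))"
  proof (rule suminf_le)
    fix k
    have "(\<integral>\<^sup>+x. ennreal (4^k * (norm (d k x))\<^sup>2) \<partial>M) = ennreal (4^k) * (\<integral>\<^sup>+x. ennreal ((norm (d k x))\<^sup>2) \<partial>M)"
      by (simp add: ennreal_mult nn_integral_cmult)
    also have "\<dots> \<le> ennreal (4^k) * ennreal ((1/8)^k)"
      unfolding d_def by (intro mult_left_mono N rN rS) auto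
    also have "\<dots> = ennreal ((1/2)^k)"
      by (simp add: ennreal_mult[symmetric] power_mult_distrib[symmetric])
    finally show "(\<integral>\<^sup>+x. ennreal (4^k * (norm (d k x))\<^sup>2) \<partial>M) \<le> ennreal ((1/2)^k)" .
  qed auto
  also have "\<dots> < \<infinity>" by (subst suminf_ennreal2) (auto intro: summable_geometric)
  finally have "AE x in M. (\<Sum>k. ennreal (4^k * (norm (d k x))\<^sup>2)) \<noteq> \<infinity>"
    by (intro nn_integral_PInf_AE) auto
  then have conv: "AE x in M. convergent (\<lambda>k. fs (r k) x)"
  proof eventually_elim
    fix x assume "(\<Sum>k. ennreal (4^k * (norm (d k x))\<^sup>2)) \<noteq> \<infinity>"
    then have "summable (\<lambda>k. 4^k * (norm (d k x))\<^sup>2)" by (intro summable_suminf_not_top) auto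
    then have "bounded (range (\<lambda>k. 4^k * (norm (d k x))\<^sup>2))"
      by (metis summable_LIMSEQ_zero convergent_imp_bounded)
    then obtain b where b: "\<And>k. norm (4^k * (norm (d k x))\<^sup>2) \<le> b" by (auto simp: bounded_iff)
    have nd: "norm (d k x) \<le> sqrt b * (1/2)^k" for k
    proof -
      have "(2::real)^k * 2^k = 4^k" by (simp flip: power_mult_distrib)
      then have "(2^k * norm (d k x))\<^sup>2 = 4^k * (norm (d k x))\<^sup>2"
        by (simp only: power_mult_distrib power2_eq_square[of "2^k"])
      then have "(2^k * norm (d k x))\<^sup>2 \<le> b" using b[of k] by simp
      then have "2^k * norm (d k x) \<le> sqrt b" by (rule real_le_rsqrt)
      then show ?thesis by (simp add: field_simps power_one_over)
    qed
    have "summable (\<lambda>k. sqrt b * (1/2)^k)" by (intro summable_mult summable_geometric) simp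
    then have "summable (\<lambda>k. d k x)" by (rule summable_comparison_test'[where N = 0]) (rule nd)
    then have "convergent (\<lambda>n. \<Sum>k<n. d k x)" by (simp add: summable_iff_convergent)
    moreover have "(\<Sum>k<n. d k x) = fs (r n) x - fs (r 0) x" for n
      unfolding d_def by (rule sum_lessThan_telescope)
    ultimately have "convergent (\<lambda>n. fs (r n) x - fs (r 0) x)" by simp
    then show "convergent (\<lambda>k. fs (r k) x)" by (simp add: convergent_diff_const_right_iff)
  qed
  define u where "u x = lim (\<lambda>k. fs (r k) x)" for x
  have [measurable]: "u \<in> borel_measurable M" unfolding u_def by measurable
  have fatou: "(\<integral>\<^sup>+x. ennreal ((norm (fs n x - u x))\<^sup>2) \<partial>M) \<le> ennreal e"
    if e: "e > 0" and n: "n \<ge> K" and K: "\<forall>m\<ge>K. \<forall>n\<ge>K. (\<integral>\<^sup>+x. ennreal ((norm (fs m x - fs n x))\<^sup>2) \<partial>M) \<le> ennreal e" for e n K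
  proof -
    have "(\<integral>\<^sup>+x. ennreal ((norm (fs n x - u x))\<^sup>2) \<partial>M) = (\<integral>\<^sup>+x. liminf (\<lambda>k. ennreal ((norm (fs n x - fs (r k) x))\<^sup>2)) \<partial>M)"
    proof (rule nn_integral_cong_AE, use conv in eventually_elim)
      fix x assume "convergent (\<lambda>k. fs (r k) x)"
      then have "(\<lambda>k. fs (r k) x) \<longlonglongrightarrow> u x" unfolding u_def by (simp add: convergent_LIMSEQ_iff)
      then have "(\<lambda>k. ennreal ((norm (fs n x - fs (r k) x))\<^sup>2)) \<longlonglongrightarrow> ennreal ((norm (fs n x - u x))\<^sup>2)"
        by (intro tendsto_intros)
      then show "ennreal ((norm (fs n x - u x))\<^sup>2) = liminf (\<lambda>k. ennreal ((norm (fs n x - fs (r k) x))\<^sup>2))"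
        by (intro lim_imp_Liminf[symmetric]) auto
    qed
    also have "\<dots> \<le> liminf (\<lambda>k. \<integral>\<^sup>+x. ennreal ((norm (fs n x - fs (r k) x))\<^sup>2) \<partial>M)"
      by (rule nn_integral_liminf) measurable
    also have "\<dots> \<le> limsup (\<lambda>k. \<integral>\<^sup>+x. ennreal ((norm (fs n x - fs (r k) x))\<^sup>2) \<partial>M)"
      by (rule Liminf_le_Limsup) auto
    also have "\<dots> \<le> ennreal e"
    proof (rule Limsup_bounded)
      show "\<forall>\<^sub>F k in sequentially. (\<integral>\<^sup>+x. ennreal ((norm (fs n x - fs (r k) x))\<^sup>2) \<partial>M) \<le> ennreal e"
        unfolding eventually_sequentially
      proof (intro exI allI impI)
        fix k assume "k \<ge> K"
        then have "r k \<ge> K" by (simp add: r_def)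
        then show "(\<integral>\<^sup>+x. ennreal ((norm (fs n x - fs (r k) x))\<^sup>2) \<partial>M) \<le> ennreal e" using K n by blast
      qed
    qed
    finally show ?thesis .
  qed
  have tend: "L2_tendsto M fs u"
    unfolding L2_tendsto_def
  proof (intro conjI allI)
    show "(\<lambda>k. \<integral>\<^sup>+x. ennreal ((norm (fs k x - u x))\<^sup>2) \<partial>M) \<longlonglongrightarrow> 0"
    proof (rule tendsto_0_if_Limsup_eq_0_ennreal)
      have "limsup (\<lambda>k. \<integral>\<^sup>+x. ennreal ((norm (fs k x - u x))\<^sup>2) \<partial>M) \<le> 0 + ennreal e" if e: "e > 0" for e :: real
      proof (rule Limsup_bounded)
        obtain K where K: "\<forall>m\<ge>K. \<forall>n\<ge>K. (\<integral>\<^sup>+x. ennreal ((norm (fs m x - fs n x))\<^sup>2) \<partial>M) \<le> ennreal e" using C[OF e] by blast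
        show "\<forall>\<^sub>F k in sequentially. (\<integral>\<^sup>+x. ennreal ((norm (fs k x - u x))\<^sup>2) \<partial>M) \<le> 0 + ennreal e"
          using fatou[OF e _ K] by (auto simp: eventually_sequentially)
      qed
      then show "limsup (\<lambda>k. \<integral>\<^sup>+x. ennreal ((norm (fs k x - u x))\<^sup>2) \<partial>M) = 0"
        unfolding le_zero_eq[symmetric] by (rule ennreal_le_epsilon)
    qed
  qed measurable
  obtain K where K: "\<forall>m\<ge>K. \<forall>n\<ge>K. (\<integral>\<^sup>+x. ennreal ((norm (fs m x - fs n x))\<^sup>2) \<partial>M) \<le> ennreal 1" using C[of 1] by auto
  have "L2 M (\<lambda>x. fs K x - u x)"
    using fatou[OF _ order_refl K] by (intro L2I[where K = 1]) auto
  from L2_diff[OF L[of K] this] have "L2 M (\<lambda>x. fs K x - (fs K x - u x))" .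
  then have "L2 M u" by simp
  then show thesis using tend that by blast
qed

text \<open>Dominated convergence with majorant \<open>(norm (f x))\<^sup>2\<close>. For sets
  \<open>A k\<close> of finite measure this supplies the integrable approximations through which
  both transforms are defined.\<close>

lemma L2_truncate:
  assumes f: "L2 M f" and A[measurable]: "\<And>k. A k \<in> sets M" and ev: "\<And>x. x \<in> space M \<Longrightarrow> \<forall>\<^sub>F k in sequentially. x \<in> A k"
  shows "L2 M (\<lambda>x. f x * indicator (A k) x)" "L2_tendsto M (\<lambda>k x. f x * indicator (A k) x) f"
proof -
  note [measurable] = L2_measurable[OF f]
  show "L2 M (\<lambda>x. f x * indicator (A k) x)" for k
  proof -
    have "(\<integral>\<^sup>+x. ennreal ((norm (f x * indicator (A k) x))\<^sup>2) \<partial>M) \<le> (\<integral>\<^sup>+x. ennreal ((norm (f x))\<^sup>2) \<partial>M)"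
      by (intro nn_integral_mono) (auto simp: indicator_def)
    then show ?thesis using f by (auto simp: L2_iff)
  qed
  have "(\<lambda>k. \<integral>\<^sup>+x. ennreal ((norm (f x * indicator (A k) x - f x))\<^sup>2) \<partial>M) \<longlonglongrightarrow> (\<integral>\<^sup>+x. 0 \<partial>M)"
  proof (rule nn_integral_dominated_convergence[where w = "\<lambda>x. ennreal ((norm (f x))\<^sup>2)"])
    show "AE x in M. (\<lambda>k. ennreal ((norm (f x * indicator (A k) x - f x))\<^sup>2)) \<longlonglongrightarrow> 0"
    proof (rule AE_I2)
      fix x assume "x \<in> space M"
      from ev[OF this] show "(\<lambda>k. ennreal ((norm (f x * indicator (A k) x - f x))\<^sup>2)) \<longlonglongrightarrow> 0"
        by (intro tendsto_eventually, elim eventually_mono) simp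
    qed
  qed (use f in \<open>auto simp: L2_iff indicator_def\<close>)
  then show "L2_tendsto M (\<lambda>k x. f x * indicator (A k) x) f"
    by (simp add: L2_tendsto_def)
qed

subsection \<open>Twisted convolution\<close>

lemma norm_integral_le_nn:
  fixes f :: "'x \<Rightarrow> 'b::{banach, second_countable_topology}"
  shows "ennreal (norm (LINT x|M. f x)) \<le> (\<integral>\<^sup>+x. ennreal (norm (f x)) \<partial>M)"
  by (cases "integrable M f") (auto intro: integral_norm_bound_ennreal simp: not_integrable_integral_eq)

text \<open>Four actions are instances: right translation with factor 1, and left translation,
  conjugation and \<open>Ad\<close> with factor \<open>\<Delta>\<close>.\<close>

locale measure_action =
  N: sigma_finite_measure N + M: sigma_finite_measure M
  for N :: "'y measure" and M :: "'x measure" +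
  fixes T :: "'y \<Rightarrow> 'x \<Rightarrow> 'x" and a :: "'y \<Rightarrow> real"
  assumes T_measurable [measurable]: "case_prod T \<in> N \<Otimes>\<^sub>M M \<rightarrow>\<^sub>M M"
    and a_measurable [measurable]: "a \<in> borel_measurable N"
    and a_pos: "\<And>y. 0 < a y"
    and scale: "\<And>y \<phi>. y \<in> space N \<Longrightarrow> \<phi> \<in> borel_measurable M \<Longrightarrow> (\<integral>\<^sup>+x. \<phi> (T y x) \<partial>M) = ennreal (a y) * (\<integral>\<^sup>+x. \<phi> x \<partial>M)"
begin

sublocale pair_sigma_finite N M ..

text \<open>Division by \<open>sqrt (a y)\<close> compensates the scaling of the measure in the L2
  norm, so that \<open>act\<close> behaves like convolution with an integrable function; for right
  translation it is \<open>group_convolution\<close>.\<close>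

definition act :: "('y \<Rightarrow> complex) \<Rightarrow> ('x \<Rightarrow> complex) \<Rightarrow> 'x \<Rightarrow> complex" where
  "act f u x = (LINT y|N. f y * (u (T y x) / of_real (sqrt (a y))))"

lemma T_measurable2 [measurable]: "y \<in> space N \<Longrightarrow> T y \<in> M \<rightarrow>\<^sub>M M"
  using measurable_compose[OF measurable_Pair1' T_measurable] by simp

text \<open>An identity of measures: \<open>distr M M (T y)\<close> is \<open>M\<close> with the
  constant density \<open>a y\<close>. So it holds for every measurable \<open>\<phi>\<close>, with
  the default value 0 on both sides when \<open>\<phi>\<close> is not integrable.\<close>

lemma integral_scale:
  fixes \<phi> :: "'x \<Rightarrow> complex"
  assumes y: "y \<in> space N" and [measurable]: "\<phi> \<in> borel_measurable M"
  shows "(LINT x|M. \<phi> (T y x)) = of_real (a y) * (LINT x|M. \<phi> x)"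
proof -
  have [measurable]: "T y \<in> M \<rightarrow>\<^sub>M M" by (rule T_measurable2[OF y])
  have "distr M M (T y) = density M (\<lambda>_. ennreal (a y))"
  proof (rule measure_eqI)
    fix A assume "A \<in> sets (distr M M (T y))"
    then have A [measurable]: "A \<in> sets M" by simp
    have "emeasure (distr M M (T y)) A = (\<integral>\<^sup>+x. indicator A (T y x) \<partial>M)"
      by (subst emeasure_distr) (auto simp: nn_integral_indicator[symmetric] indicator_def
          intro!: nn_integral_cong simp del: nn_integral_indicator)
    then show "emeasure (distr M M (T y)) A = emeasure (density M (\<lambda>_. ennreal (a y))) A"
      using scale[OF y, of "indicator A"] by (simp add: emeasure_density nn_integral_cmult_indicator)
  qed simp
  then have "(LINT x|M. \<phi> (T y x)) = (LINT x|density M (\<lambda>_. ennreal (a y)). \<phi> x)"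
    by (simp add: integral_distr[symmetric, of "T y" M M \<phi>])
  also have "\<dots> = (LINT x|M. a y *\<^sub>R \<phi> x)"
    by (rule integral_density) (auto simp: less_imp_le a_pos)
  finally show ?thesis by (simp add: scaleR_conv_of_real)
qed

lemma scaled_translate:
  assumes "L2 M u" "y \<in> space N"
  shows "L2 M (\<lambda>x. u (T y x) / of_real (sqrt (a y)))"
    "l2norm M (\<lambda>x. u (T y x) / of_real (sqrt (a y))) \<le> l2norm M u"
proof -
  note [measurable] = L2_measurable[OF assms(1)]
  have [measurable]: "T y \<in> M \<rightarrow>\<^sub>M M" by (rule T_measurable2[OF assms(2)])
  have "(\<integral>\<^sup>+x. ennreal ((norm (u (T y x) / of_real (sqrt (a y))))\<^sup>2) \<partial>M)
      = (\<integral>\<^sup>+x. (\<lambda>z. ennreal (1 / a y) * ennreal ((norm (u z))\<^sup>2)) (T y x) \<partial>M)"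
    by (intro nn_integral_cong) (simp add: norm_divide power_divide ennreal_mult[symmetric] a_pos less_imp_le)
  also have "\<dots> = ennreal (a y) * (\<integral>\<^sup>+x. ennreal (1 / a y) * ennreal ((norm (u x))\<^sup>2) \<partial>M)"
    by (rule scale[OF assms(2)]) measurable
  also have "\<dots> = (ennreal (a y) * ennreal (1 / a y)) * (\<integral>\<^sup>+x. ennreal ((norm (u x))\<^sup>2) \<partial>M)"
    by (simp add: nn_integral_cmult mult.assoc)
  also have "ennreal (a y) * ennreal (1 / a y) = 1"
    using a_pos[of y] by (simp add: ennreal_mult[symmetric] less_imp_le)
  finally have *: "(\<integral>\<^sup>+x. ennreal ((norm (u (T y x) / of_real (sqrt (a y))))\<^sup>2) \<partial>M) \<le> ennreal ((l2norm M u)\<^sup>2)"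
    using L2_nn[OF assms(1)] by simp
  show "L2 M (\<lambda>x. u (T y x) / of_real (sqrt (a y)))"
    "l2norm M (\<lambda>x. u (T y x) / of_real (sqrt (a y))) \<le> l2norm M u"
    by (rule L2I[OF _ *]; simp)+
qed

lemma act_measurable [measurable]:
  assumes [measurable]: "f \<in> borel_measurable N" "u \<in> borel_measurable M"
  shows "act f u \<in> borel_measurable M"
  unfolding act_def by measurable

text \<open>Young's inequality for an integrable and a square integrable function: Cauchy-Schwarz
  for each \<open>x\<close> with respect to the measure with density \<open>norm (f y)\<close>, and
  then Tonelli.\<close>

lemma L2_act:
  assumes f: "integrable N f" and u: "L2 M u"
  shows "L2 M (act f u)"
proof -
  have [measurable]: "f \<in> borel_measurable N" "u \<in> borel_measurable M"
    using f u by (auto simp: L2_measurable)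
  define F where "F = (\<integral>\<^sup>+y. ennreal (norm (f y)) \<partial>N)"
  have F: "F < \<infinity>" using f by (simp add: F_def integrable_iff_bounded)
  define v where "v y x = u (T y x) / of_real (sqrt (a y))" for y x
  have [measurable]: "(\<lambda>(y, x). v y x) \<in> borel_measurable (N \<Otimes>\<^sub>M M)"
    unfolding v_def by measurable
  have pt: "ennreal ((norm (act f u x))\<^sup>2) \<le> F * (\<integral>\<^sup>+y. ennreal (norm (f y)) * ennreal ((norm (v y x))\<^sup>2) \<partial>N)"
    if [measurable]: "x \<in> space M" for x
  proof -
    have "ennreal (norm (act f u x)) \<le> (\<integral>\<^sup>+y. ennreal (norm (f y * v y x)) \<partial>N)"
      unfolding act_def v_def by (rule norm_integral_le_nn)
    \<comment> \<open>\<open>norm (f y)\<close> is split into two square roots, one of which stays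
      with \<open>v\<close>.\<close>
    also have "\<dots> = (\<integral>\<^sup>+y. ennreal (sqrt (norm (f y))) * ennreal (sqrt (norm (f y)) * norm (v y x)) \<partial>N)"
      by (intro nn_integral_cong) (simp add: ennreal_mult[symmetric] norm_mult mult.assoc[symmetric])
    finally have "(ennreal (norm (act f u x)))\<^sup>2 \<le> (\<integral>\<^sup>+y. ennreal (sqrt (norm (f y))) * ennreal (sqrt (norm (f y)) * norm (v y x)) \<partial>N)\<^sup>2"
      by (rule power_mono) simp
    also have "\<dots> \<le> (\<integral>\<^sup>+y. (ennreal (sqrt (norm (f y))))\<^sup>2 \<partial>N) * (\<integral>\<^sup>+y. (ennreal (sqrt (norm (f y)) * norm (v y x)))\<^sup>2 \<partial>N)"
      by (rule Cauchy_Schwarz_nn_integral) measurable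
    also have "\<dots> = F * (\<integral>\<^sup>+y. ennreal (norm (f y)) * ennreal ((norm (v y x))\<^sup>2) \<partial>N)"
      by (simp add: F_def ennreal_power power_mult_distrib ennreal_mult)
    finally show ?thesis by (simp add: ennreal_power)
  qed
  have "(\<integral>\<^sup>+x. ennreal ((norm (act f u x))\<^sup>2) \<partial>M)
      \<le> (\<integral>\<^sup>+x. F * (\<integral>\<^sup>+y. ennreal (norm (f y)) * ennreal ((norm (v y x))\<^sup>2) \<partial>N) \<partial>M)"
    by (intro nn_integral_mono pt)
  also have "\<dots> = F * (\<integral>\<^sup>+x. (\<integral>\<^sup>+y. ennreal (norm (f y)) * ennreal ((norm (v y x))\<^sup>2) \<partial>N) \<partial>M)"
    by (rule nn_integral_cmult) measurable
  also have "(\<integral>\<^sup>+x. (\<integral>\<^sup>+y. ennreal (norm (f y)) * ennreal ((norm (v y x))\<^sup>2) \<partial>N) \<partial>M)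
      = (\<integral>\<^sup>+y. (\<integral>\<^sup>+x. ennreal (norm (f y)) * ennreal ((norm (v y x))\<^sup>2) \<partial>M) \<partial>N)"
    by (rule Fubini') measurable
  also have "\<dots> \<le> (\<integral>\<^sup>+y. ennreal (norm (f y)) * ennreal ((l2norm M u)\<^sup>2) \<partial>N)"
  proof (intro nn_integral_mono)
    fix y assume y: "y \<in> space N"
    have L: "L2 M (v y)" and n: "l2norm M (v y) \<le> l2norm M u"
      unfolding v_def using scaled_translate[OF u y] by auto
    note [measurable] = L2_measurable[OF L]
    have "(\<integral>\<^sup>+x. ennreal (norm (f y)) * ennreal ((norm (v y x))\<^sup>2) \<partial>M) = ennreal (norm (f y)) * ennreal ((l2norm M (v y))\<^sup>2)"
      by (simp add: nn_integral_cmult L2_nn[OF L])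
    also have "\<dots> \<le> ennreal (norm (f y)) * ennreal ((l2norm M u)\<^sup>2)"
      using n by (intro mult_left_mono ennreal_leI power_mono) auto
    finally show "(\<integral>\<^sup>+x. ennreal (norm (f y)) * ennreal ((norm (v y x))\<^sup>2) \<partial>M) \<le> ennreal (norm (f y)) * ennreal ((l2norm M u)\<^sup>2)" .
  qed
  also have "\<dots> = F * ennreal ((l2norm M u)\<^sup>2)" by (simp add: F_def nn_integral_multc)
  finally have "(\<integral>\<^sup>+x. ennreal ((norm (act f u x))\<^sup>2) \<partial>M) \<le> F * (F * ennreal ((l2norm M u)\<^sup>2))"
    by (simp add: mult_left_mono)
  also have "\<dots> < \<infinity>" using F by (simp add: ennreal_mult_less_top)
  finally show ?thesis by (simp add: L2_iff)
qed

text \<open>Fubini applies because for each \<open>y\<close> the inner integral is at most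
  \<open>norm (f y)\<close> times a product of L2 norms that does not depend on \<open>y\<close>.
  Both transforms commute with the average over \<open>y\<close> through this identity.\<close>

lemma act_pairing:
  assumes f: "integrable N f" and u: "L2 M u" and v: "L2 M v"
  shows "(LINT x|M. act f u x * v x) = (LINT y|N. f y * (LINT x|M. (u (T y x) / of_real (sqrt (a y))) * v x))"
proof -
  have [measurable]: "f \<in> borel_measurable N" "u \<in> borel_measurable M" "v \<in> borel_measurable M"
    using f u v by (auto simp: L2_measurable)
  define w where "w y x = f y * (u (T y x) / of_real (sqrt (a y))) * v x" for y x
  have wm [measurable]: "case_prod w \<in> borel_measurable (N \<Otimes>\<^sub>M M)" unfolding w_def by measurable
  have "(\<integral>\<^sup>+z. ennreal (norm (case_prod w z)) \<partial>(N \<Otimes>\<^sub>M M)) = (\<integral>\<^sup>+y. (\<integral>\<^sup>+x. ennreal (norm (w y x)) \<partial>M) \<partial>N)"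
    by (subst M.nn_integral_fst[symmetric]) auto
  also have "\<dots> \<le> (\<integral>\<^sup>+y. ennreal (norm (f y)) * ennreal (l2norm M u * l2norm M v) \<partial>N)"
  proof (intro nn_integral_mono)
    fix y assume y: "y \<in> space N"
    note L = scaled_translate[OF u y]
    note [measurable] = L2_measurable[OF L(1)]
    have "(\<integral>\<^sup>+x. ennreal (norm (w y x)) \<partial>M)
        = ennreal (norm (f y)) * (\<integral>\<^sup>+x. ennreal (norm (u (T y x) / of_real (sqrt (a y)))) * ennreal (norm (v x)) \<partial>M)"
      unfolding w_def by (subst nn_integral_cmult[symmetric])
        (measurable, auto intro!: nn_integral_cong simp: norm_mult norm_divide ennreal_mult[symmetric])
    also have "\<dots> \<le> ennreal (norm (f y)) * ennreal (l2norm M u * l2norm M v)"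
      by (intro mult_left_mono order_trans[OF L2_nn_mult[OF L(1) v]] ennreal_leI mult_right_mono L(2)) auto
    finally show "(\<integral>\<^sup>+x. ennreal (norm (w y x)) \<partial>M) \<le> ennreal (norm (f y)) * ennreal (l2norm M u * l2norm M v)" .
  qed
  also have "\<dots> = (\<integral>\<^sup>+y. ennreal (norm (f y)) \<partial>N) * ennreal (l2norm M u * l2norm M v)"
    by (rule nn_integral_multc) measurable
  also have "\<dots> < \<infinity>" using f by (simp add: integrable_iff_bounded ennreal_mult_less_top)
  finally have int: "integrable (N \<Otimes>\<^sub>M M) (case_prod w)" by (intro integrableI_bounded) auto
  have "(LINT x|M. act f u x * v x) = (LINT x|M. LINT y|N. w y x)"
    by (simp only: act_def w_def Bochner_Integration.integral_mult_left_zero)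
  also have "\<dots> = (LINT y|N. LINT x|M. w y x)" by (rule Fubini_integral[OF int])
  also have "\<dots> = (LINT y|N. f y * (LINT x|M. (u (T y x) / of_real (sqrt (a y))) * v x))"
    unfolding w_def by (simp add: mult.assoc)
  finally show ?thesis .
qed

end

section \<open>The Plancherel inequality\<close>

lemma cnj_measurable [measurable (raw)]:
  "f \<in> borel_measurable M \<Longrightarrow> (\<lambda>x. cnj (f x)) \<in> borel_measurable M"
  by (rule measurable_compose[OF _ borel_measurable_continuous_onI]) (auto intro: continuous_intros)

definition fourier :: "('a::euclidean_space \<Rightarrow> complex) \<Rightarrow> 'a \<Rightarrow> complex" where
  "fourier h y = (LINT X|lborel. h X * exp (- (2 * of_real pi * \<i> * of_real (y \<bullet> X))))"

lemma norm_exp_i [simp]: "norm (exp (- (2 * of_real pi * \<i> * of_real t))) = 1"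
proof -
  have "- (2 * of_real pi * \<i> * of_real t) = \<i> * of_real (- (2 * pi * t))" by simp
  then show ?thesis by (metis norm_exp_i_times)
qed

text \<open>A cutoff that makes the integral over frequencies converge absolutely; it tends to 1 as
  \<open>s\<close> tends to 0.\<close>

definition gauss :: "real \<Rightarrow> 'a::euclidean_space \<Rightarrow> real" where
  "gauss s y = exp (- (s * norm y)\<^sup>2 / 2)"

lemma gauss_nonneg [simp]: "0 \<le> gauss s y"
  by (simp add: gauss_def)

lemma gauss_prod: "gauss s y = (\<Prod>b\<in>Basis. exp (- (s * (y \<bullet> b))\<^sup>2 / 2))"
proof -
  have "(norm y)\<^sup>2 = (\<Sum>b\<in>Basis. (y \<bullet> b)\<^sup>2)"
    by (simp only: power2_norm_eq_inner) (subst euclidean_inner, simp add: power2_eq_square)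
  then show ?thesis
    by (simp add: gauss_def exp_sum[symmetric] power_mult_distrib sum_distrib_left sum_negf sum_divide_distrib)
qed

lemma
  assumes [simp]: "s > 0"
  shows gauss1_integrable: "integrable lborel (\<lambda>y::real. exp (- (s * y)\<^sup>2 / 2))"
    and gauss1_integral: "(LBINT y. exp (- (s * y)\<^sup>2 / 2)) = sqrt (2 * pi) / s"
proof -
  have "std_normal_density (s * y) = exp (- (s * y)\<^sup>2 / 2) / sqrt (2 * pi)" for y
    by (simp add: std_normal_density_def)
  then have e: "exp (- (s * y)\<^sup>2 / 2) = sqrt (2 * pi) * std_normal_density (s * y)" for y
    by simp
  have I: "has_bochner_integral lborel std_normal_density 1"
    by (simp add: has_bochner_integral_iff)
  have "has_bochner_integral lborel (\<lambda>y. std_normal_density (0 + s * y)) (1 /\<^sub>R \<bar>s\<bar>)"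
    using assms by (intro lborel_has_bochner_integral_real_affine_iff[THEN iffD1, OF _ I]) linarith
  then have I': "has_bochner_integral lborel (\<lambda>y. sqrt (2 * pi) * std_normal_density (s * y)) (sqrt (2 * pi) * (1 /\<^sub>R \<bar>s\<bar>))"
    by (intro has_bochner_integral_mult_right) simp_all
  have *: "has_bochner_integral lborel (\<lambda>y::real. exp (- (s * y)\<^sup>2 / 2)) (sqrt (2 * pi) / s)"
  proof -
    have "sqrt (2 * pi) * (1 /\<^sub>R \<bar>s\<bar>) = sqrt (2 * pi) / s" using assms by (simp add: divide_inverse abs_of_pos)
    with I' show ?thesis by (simp only: e)
  qed
  show "integrable lborel (\<lambda>y::real. exp (- (s * y)\<^sup>2 / 2))" "(LBINT y. exp (- (s * y)\<^sup>2 / 2)) = sqrt (2 * pi) / s"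
    using * by (auto simp: has_bochner_integral_iff)
qed

text \<open>A rescaling of the characteristic function of the standard normal distribution.\<close>

lemma gauss1_fourier:
  assumes s: "s > 0"
  shows "(LBINT y. of_real (exp (- (s * y)\<^sup>2 / 2)) * exp (\<i> * of_real (t * y)))
    = of_real (sqrt (2 * pi) / s * exp (- (t / s)\<^sup>2 / 2))"
proof -
  have c: "(CLBINT x. std_normal_density x *\<^sub>R iexp (u * x)) = of_real (exp (- u\<^sup>2 / 2))" for u
    using fun_cong[OF char_std_normal_distribution, of u]
    unfolding char_def by (subst (asm) integral_density) (auto simp: normal_density_nonneg)
  have "(LBINT y. of_real (exp (- (s * y)\<^sup>2 / 2)) * exp (\<i> * of_real (t * y)))
     = (CLBINT y. (\<lambda>x. of_real (sqrt (2 * pi)) * (std_normal_density x *\<^sub>R iexp (t / s * x))) (0 + s * y))"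
    using s by (intro Bochner_Integration.integral_cong)
      (auto simp: std_normal_density_def scaleR_conv_of_real)
  also have "\<dots> = (CLBINT x. of_real (sqrt (2 * pi)) * (std_normal_density x *\<^sub>R iexp (t / s * x))) /\<^sub>R \<bar>s\<bar>"
    using s by (subst lborel_integral_real_affine[where c = s and t = 0]) auto
  also have "(CLBINT x. of_real (sqrt (2 * pi)) * (std_normal_density x *\<^sub>R iexp (t / s * x)))
      = of_real (sqrt (2 * pi)) * of_real (exp (- (t / s)\<^sup>2 / 2))"
    by (simp only: integral_mult_right_zero c)
  also have "(complex_of_real (sqrt (2 * pi)) * of_real (exp (- (t / s)\<^sup>2 / 2))) /\<^sub>R \<bar>s\<bar>
      = of_real (sqrt (2 * pi) / s * exp (- (t / s)\<^sup>2 / 2))"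
  proof -
    have "(complex_of_real p * of_real q) /\<^sub>R \<bar>s\<bar> = of_real (p / s * q)" for p q
      using s by (simp add: scaleR_conv_of_real divide_inverse mult_ac)
    then show ?thesis .
  qed
  finally show ?thesis .
qed

lemma lborel_integral_prod:
  fixes f :: "'a::euclidean_space \<Rightarrow> real \<Rightarrow> complex"
  assumes "\<And>b. b \<in> Basis \<Longrightarrow> integrable lborel (f b)"
  shows "integrable lborel (\<lambda>x. \<Prod>b\<in>Basis. f b (x \<bullet> b))"
    "(LINT x|lborel. (\<Prod>b\<in>Basis. f b (x \<bullet> b))) = (\<Prod>b\<in>Basis. (LBINT x. f b x))"
proof -
  interpret product_sigma_finite "\<lambda>_::'a. lborel :: real measure" ..
  have fm [measurable]: "b \<in> Basis \<Longrightarrow> f b \<in> borel_measurable borel" for b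
    using assms[of b] by (simp add: integrable_iff_bounded)
  have [measurable]: "(\<lambda>x. \<Prod>b\<in>Basis. f b (x \<bullet> b)) \<in> borel_measurable borel"
    by measurable
  have [measurable]: "(\<lambda>g. \<Sum>b\<in>Basis. g b *\<^sub>R b) \<in> measurable (Pi\<^sub>M Basis (\<lambda>_. lborel)) (borel :: 'a measure)"
    by measurable
  have eq: "(\<Prod>b\<in>Basis. f b ((\<Sum>c\<in>Basis. g c *\<^sub>R c) \<bullet> b)) = (\<Prod>b\<in>Basis. f b (g b))" for g :: "'a \<Rightarrow> real"
    by (rule prod.cong) auto
  show "integrable lborel (\<lambda>x. \<Prod>b\<in>Basis. f b (x \<bullet> b))"
    by (subst lborel_eq, subst integrable_distr_eq)
      (auto simp: eq intro!: product_integrable_prod assms)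
  show "(LINT x|lborel. (\<Prod>b\<in>Basis. f b (x \<bullet> b))) = (\<Prod>b\<in>Basis. (LBINT x. f b x))"
    by (subst lborel_eq, subst integral_distr)
      (auto simp: eq product_integral_prod assms)
qed

text \<open>The Fourier transform of \<open>gauss s\<close>, which is a probability density. The
  product form allows integration coordinate by coordinate.\<close>

definition gauss_dual :: "real \<Rightarrow> 'a::euclidean_space \<Rightarrow> real" where
  "gauss_dual s Z = (\<Prod>b\<in>Basis. sqrt (2 * pi) / s * exp (- (2 * pi / s * (Z \<bullet> b))\<^sup>2 / 2))"

lemma gauss_dual_nonneg: "s > 0 \<Longrightarrow> 0 \<le> gauss_dual s Z"
  by (simp add: gauss_dual_def prod_nonneg)

lemma gauss_measurable [measurable]: "gauss s \<in> borel_measurable borel"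
  unfolding gauss_def by measurable

lemma gauss_dual_measurable [measurable]: "gauss_dual s \<in> borel_measurable borel"
  unfolding gauss_dual_def by measurable

lemma gauss_integrable:
  assumes "s > 0" shows "integrable lborel (gauss s :: 'a::euclidean_space \<Rightarrow> real)"
proof -
  have "integrable lborel (\<lambda>x::'a. \<Prod>b\<in>Basis. complex_of_real (exp (- (s * (x \<bullet> b))\<^sup>2 / 2)))"
    by (rule lborel_integral_prod) (intro integrable_of_real gauss1_integrable assms)
  then have "integrable lborel (\<lambda>x::'a. complex_of_real (gauss s x))"
    by (simp add: gauss_prod)
  then show ?thesis by (simp add: complex_of_real_integrable_eq)
qed

lemma gauss_fourier:
  assumes s: "s > 0"
  shows "(LINT y|lborel. of_real (gauss s y) * exp (- (2 * of_real pi * \<i> * of_real (y \<bullet> (Z::'a::euclidean_space))))) = of_real (gauss_dual s Z)"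
proof -
  define f where "f b t = complex_of_real (exp (- (s * t)\<^sup>2 / 2)) * exp (\<i> * of_real (- (2 * pi * (Z \<bullet> b)) * t))" for b :: 'a and t
  have fi: "integrable lborel (f b)" for b
    unfolding f_def
    by (rule Bochner_Integration.integrable_bound[OF gauss1_integrable[OF s]]) (auto simp: norm_mult)
  have "- (2 * of_real pi * \<i> * complex_of_real (y \<bullet> Z)) = (\<Sum>b\<in>Basis. \<i> * of_real (- (2 * pi * (Z \<bullet> b)) * (y \<bullet> b)))" for y
    by (subst euclidean_inner) (simp add: sum_distrib_left sum_negf mult_ac)
  then have "of_real (gauss s y) * exp (- (2 * of_real pi * \<i> * of_real (y \<bullet> Z))) = (\<Prod>b\<in>Basis. f b (y \<bullet> b))" for y
    by (simp only: exp_sum finite_Basis gauss_prod of_real_prod f_def prod.distrib)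
  then have "(LINT y|lborel. of_real (gauss s y) * exp (- (2 * of_real pi * \<i> * of_real (y \<bullet> Z)))) = (\<Prod>b\<in>Basis. (LBINT t. f b t))"
    using lborel_integral_prod(2)[of f, OF fi] by simp
  also have "\<dots> = of_real (gauss_dual s Z)"
    unfolding f_def gauss1_fourier[OF s] gauss_dual_def of_real_prod
    by (intro prod.cong refl) (simp add: power_mult_distrib power_divide)
  finally show ?thesis .
qed

lemma gauss_dual_nn_integral:
  assumes s: "s > 0"
  shows "(\<integral>\<^sup>+Z. ennreal (gauss_dual s (Z::'a::euclidean_space)) \<partial>lborel) = 1"
proof -
  have "(\<integral>\<^sup>+z. ennreal (sqrt (2 * pi) / s * exp (- (2 * pi / s * z)\<^sup>2 / 2)) \<partial>lborel)
      = ennreal (LBINT z. sqrt (2 * pi) / s * exp (- (2 * pi / s * z)\<^sup>2 / 2))"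
    using gauss1_integrable[of "2 * pi / s"] s by (intro nn_integral_eq_integral) auto
  also have "\<dots> = ennreal (sqrt (2 * pi) / s * (sqrt (2 * pi) / (2 * pi / s)))"
    by (subst integral_mult_right_zero, subst gauss1_integral) (use s in auto)
  also have "\<dots> = 1" using s by (simp add: field_simps)
  finally have 1: "(\<integral>\<^sup>+z. ennreal (sqrt (2 * pi) / s * exp (- (2 * pi / s * z)\<^sup>2 / 2)) \<partial>lborel) = 1" .
  have "ennreal (gauss_dual s Z) = (\<Prod>b\<in>Basis. ennreal (sqrt (2 * pi) / s * exp (- (2 * pi / s * (Z \<bullet> b))\<^sup>2 / 2)))" for Z :: 'a
    unfolding gauss_dual_def using s by (subst prod_ennreal) auto
  then have "(\<integral>\<^sup>+Z. ennreal (gauss_dual s (Z::'a)) \<partial>lborel)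
     = (\<Prod>b\<in>(Basis::'a set). (\<integral>\<^sup>+z. ennreal (sqrt (2 * pi) / s * exp (- (2 * pi / s * z)\<^sup>2 / 2)) \<partial>lborel))"
    by (simp only: nn_integral_lborel_prod[symmetric] zero_le) (subst nn_integral_lborel_prod, auto)
  then show ?thesis by (simp only: 1 prod.neutral_const)
qed

lemma gauss_dual_translate:
  assumes s: "s > 0"
  shows "(\<integral>\<^sup>+Z. ennreal (gauss_dual s (c - (Z::'a::euclidean_space))) \<partial>lborel) = 1"
    "(\<integral>\<^sup>+Z. ennreal (gauss_dual s ((Z::'a::euclidean_space) - c)) \<partial>lborel) = 1"
proof -
  have sym: "gauss_dual s (c - Z) = gauss_dual s (Z - c)" for Z :: 'a
    unfolding gauss_dual_def by (intro prod.cong refl) (simp add: inner_diff_left power2_commute power_mult_distrib power_divide)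
  have "(\<integral>\<^sup>+Z. ennreal (gauss_dual s (Z - c)) \<partial>lborel) = (\<integral>\<^sup>+Z. ennreal (gauss_dual s (Z - c)) \<partial>(distr lborel borel ((+) c)))"
    by (simp add: lborel_distr_plus)
  also have "\<dots> = 1" by (subst nn_integral_distr) (auto simp: gauss_dual_nn_integral[OF s])
  finally show "(\<integral>\<^sup>+Z. ennreal (gauss_dual s (Z - c)) \<partial>lborel) = 1" .
  then show "(\<integral>\<^sup>+Z. ennreal (gauss_dual s (c - Z)) \<partial>lborel) = 1" by (simp only: sym)
qed

lemma fourier_measurable [measurable]:
  assumes [measurable]: "h \<in> borel_measurable lborel"
  shows "fourier h \<in> borel_measurable borel"
proof -
  have "(\<lambda>y. LINT X|lborel. h X * exp (- (2 * of_real pi * \<i> * of_real (y \<bullet> X)))) \<in> borel_measurable borel"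
    by measurable
  then show ?thesis by (simp add: fourier_def[abs_def])
qed

text \<open>Expanding \<open>(norm (fourier h y))\<^sup>2\<close> as a double integral and
  integrating the Gaussian over \<open>y\<close> first leaves the kernel
  \<open>gauss_dual s (X - X')\<close>. Its integral in each variable is 1, so Schur's test bounds
  the quadratic form by the right side, which may be infinite.\<close>

lemma fourier_gauss_le:
  fixes h :: "'a::euclidean_space \<Rightarrow> complex"
  assumes s: "s > 0" and i: "integrable lborel h"
  shows "(\<integral>\<^sup>+y. ennreal (gauss s y * (norm (fourier h y))\<^sup>2) \<partial>lborel) \<le> (\<integral>\<^sup>+X. ennreal ((norm (h X))\<^sup>2) \<partial>lborel)"
proof -
  have [measurable]: "h \<in> borel_measurable borel" using i by (simp add: integrable_iff_bounded)
  define E where "E t = exp (- (2 * of_real pi * \<i> * complex_of_real t))" for t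
  have E: "norm (E t) = 1" "E (a + b) = E a * E b" "cnj (E t) = E (- t)" for t a b
    by (simp_all add: E_def algebra_simps mult_exp_exp exp_cnj)
  have Ed: "E (a - b) = E a * E (- b)" for a b using E(2)[of a "- b"] by simp
  have [measurable]: "E \<in> borel_measurable borel" unfolding E_def by measurable
  have bnd: "norm (fourier h y) \<le> (LINT X|lborel. norm (h X))" for y
    unfolding fourier_def by (rule order_trans[OF integral_norm_bound]) (simp add: norm_mult)
  have "integrable lborel (\<lambda>y::'a. gauss s y * (LINT X|lborel. norm (h X))\<^sup>2)"
    by (intro integrable_mult_left gauss_integrable s)
  then have fi: "integrable lborel (\<lambda>y. gauss s y * (norm (fourier h y))\<^sup>2)"
    by (rule Bochner_Integration.integrable_bound)
      (auto intro!: mult_left_mono power_mono bnd simp: gauss_def)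
  have prodi: "integrable (lborel \<Otimes>\<^sub>M lborel) (\<lambda>(X, X'). h X * cnj (h X'))"
    by (rule lborel_pair.Fubini_integrable) (measurable, use i in \<open>auto simp: norm_mult\<close>)
  have sq: "of_real ((norm (fourier h y))\<^sup>2) = (LINT p|(lborel \<Otimes>\<^sub>M lborel). h (fst p) * cnj (h (snd p)) * E (y \<bullet> (fst p - snd p)))" for y
  proof -
    have "complex_of_real ((norm (fourier h y))\<^sup>2) = fourier h y * cnj (fourier h y)" by (rule complex_norm_square)
    also have "\<dots> = (LINT X|lborel. LINT X'|lborel. (h X * E (y \<bullet> X)) * (cnj (h X') * cnj (E (y \<bullet> X'))))"
      unfolding fourier_def E_def[symmetric]
      by (simp only: integral_mult_right_zero integral_mult_left_zero complex_cnj_mult[symmetric] Bochner_Integration.integral_cnj)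
    also have "\<dots> = (LINT X|lborel. LINT X'|lborel. h X * cnj (h X') * E (y \<bullet> (X - X')))"
      by (simp add: inner_diff_right Ed E(3) mult_ac)
    also have "\<dots> = (LINT p|(lborel \<Otimes>\<^sub>M lborel). h (fst p) * cnj (h (snd p)) * E (y \<bullet> (fst p - snd p)))"
    proof (subst lborel_pair.integral_fst'[symmetric])
      show "integrable (lborel \<Otimes>\<^sub>M lborel) (\<lambda>p. h (fst p) * cnj (h (snd p)) * E (y \<bullet> (fst p - snd p)))"
        by (rule Bochner_Integration.integrable_bound[OF prodi]) (auto simp: norm_mult E)
    qed simp
    finally show ?thesis .
  qed
  \<comment> \<open>The Gaussian is what makes this triple integral absolutely convergent.\<close>
  have tri: "integrable (lborel \<Otimes>\<^sub>M (lborel \<Otimes>\<^sub>M lborel))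
      (\<lambda>(y, p). of_real (gauss s y) * (h (fst p) * cnj (h (snd p)) * E (y \<bullet> (fst p - snd p))))"
  proof -
    interpret pp: pair_sigma_finite lborel "lborel \<Otimes>\<^sub>M lborel" ..
    have 1: "integrable (lborel \<Otimes>\<^sub>M lborel) (\<lambda>p. norm (h (fst p)) * norm (h (snd p)))"
      using integrable_norm[OF prodi] by (simp add: case_prod_beta norm_mult)
    show ?thesis
    proof (rule pp.Fubini_integrable)
      show "AE x in lborel. integrable (lborel \<Otimes>\<^sub>M lborel)
         (\<lambda>y. case (x, y) of (y, p) \<Rightarrow> complex_of_real (gauss s y) * (h (fst p) * cnj (h (snd p)) * E (y \<bullet> (fst p - snd p))))"
      proof (intro AE_I2)
        fix y :: 'a
        have "integrable (lborel \<Otimes>\<^sub>M lborel) (\<lambda>p. h (fst p) * cnj (h (snd p)) * E (y \<bullet> (fst p - snd p)))"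
          by (rule Bochner_Integration.integrable_bound[OF prodi]) (auto simp: norm_mult E)
        then show "integrable (lborel \<Otimes>\<^sub>M lborel)
         (\<lambda>z. case (y, z) of (y, p) \<Rightarrow> complex_of_real (gauss s y) * (h (fst p) * cnj (h (snd p)) * E (y \<bullet> (fst p - snd p))))"
          by (simp only: prod.case) (rule integrable_mult_right)
      qed
      show "integrable lborel (\<lambda>x. LINT y|(lborel \<Otimes>\<^sub>M lborel). norm (case (x, y) of (y, p) \<Rightarrow>
         complex_of_real (gauss s y) * (h (fst p) * cnj (h (snd p)) * E (y \<bullet> (fst p - snd p)))))"
        using gauss_integrable[OF s, where 'a = 'a] by (simp add: norm_mult E)
    qed measurable
  qed
  have "of_real (LINT y|lborel. gauss s y * (norm (fourier h y))\<^sup>2)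
     = (LINT y|lborel. LINT p|(lborel \<Otimes>\<^sub>M lborel). of_real (gauss s y) * (h (fst p) * cnj (h (snd p)) * E (y \<bullet> (fst p - snd p))))"
    by (simp only: integral_complex_of_real[symmetric] of_real_mult sq integral_mult_right_zero)
  also have "\<dots> = (LINT p|(lborel \<Otimes>\<^sub>M lborel). LINT y|lborel. of_real (gauss s y) * (h (fst p) * cnj (h (snd p)) * E (y \<bullet> (fst p - snd p))))"
  proof -
    interpret pp: pair_sigma_finite lborel "lborel \<Otimes>\<^sub>M lborel" ..
    show ?thesis using pp.Fubini_integral[OF tri] by simp
  qed
  also have "\<dots> = (LINT p|(lborel \<Otimes>\<^sub>M lborel). h (fst p) * cnj (h (snd p)) * of_real (gauss_dual s (fst p - snd p)))"
  proof (rule Bochner_Integration.integral_cong[OF refl])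
    fix p :: "'a \<times> 'a"
    have "(LINT y|lborel. of_real (gauss s y) * (h (fst p) * cnj (h (snd p)) * E (y \<bullet> (fst p - snd p))))
       = (LINT y|lborel. h (fst p) * cnj (h (snd p)) * (of_real (gauss s y) * E (y \<bullet> (fst p - snd p))))"
      by (simp add: mult_ac)
    then show "(LINT y|lborel. of_real (gauss s y) * (h (fst p) * cnj (h (snd p)) * E (y \<bullet> (fst p - snd p))))
       = h (fst p) * cnj (h (snd p)) * of_real (gauss_dual s (fst p - snd p))"
      by (simp only: integral_mult_right_zero E_def gauss_fourier[OF s])
  qed
  finally have eq: "complex_of_real (LINT y|lborel. gauss s y * (norm (fourier h y))\<^sup>2) = \<dots>" .
  have "(\<integral>\<^sup>+y. ennreal (gauss s y * (norm (fourier h y))\<^sup>2) \<partial>lborel) = ennreal (LINT y|lborel. gauss s y * (norm (fourier h y))\<^sup>2)"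
    by (intro nn_integral_eq_integral fi) (auto simp: gauss_def)
  also have "\<dots> = ennreal (norm (complex_of_real (LINT y|lborel. gauss s y * (norm (fourier h y))\<^sup>2)))"
    by (simp add: gauss_def)
  also have "\<dots> \<le> (\<integral>\<^sup>+p. ennreal (norm (h (fst p) * cnj (h (snd p)) * of_real (gauss_dual s (fst p - snd p)))) \<partial>(lborel \<Otimes>\<^sub>M lborel))"
    unfolding eq by (rule norm_integral_le_nn)
  \<comment> \<open>Schur's test: after \<open>a * b \<le> a\<^sup>2 / 2 + b\<^sup>2 / 2\<close>
    each half meets the kernel integrated over the other variable.\<close>
  also have "\<dots> \<le> (\<integral>\<^sup>+p. ennreal (1/2) * (ennreal ((norm (h (fst p)))\<^sup>2) * ennreal (gauss_dual s (fst p - snd p)))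
      + ennreal (1/2) * (ennreal ((norm (h (snd p)))\<^sup>2) * ennreal (gauss_dual s (fst p - snd p))) \<partial>(lborel \<Otimes>\<^sub>M lborel))"
  proof (intro nn_integral_mono)
    fix p :: "'a \<times> 'a"
    define g where "g = gauss_dual s (fst p - snd p)"
    have g: "0 \<le> g" using gauss_dual_nonneg[OF s] by (simp add: g_def)
    define a where "a = norm (h (fst p))"
    define b where "b = norm (h (snd p))"
    have "a * b * g \<le> (1/2 * (a\<^sup>2 * g) + 1/2 * (b\<^sup>2 * g))"
      using mult_right_mono[OF sum_squares_bound[of a b] g] by (simp add: algebra_simps)
    then have "ennreal (a * b * g) \<le> ennreal (1/2 * (a\<^sup>2 * g) + 1/2 * (b\<^sup>2 * g))" by (rule ennreal_leI)
    also have "\<dots> = ennreal (1/2) * (ennreal (a\<^sup>2) * ennreal g) + ennreal (1/2) * (ennreal (b\<^sup>2) * ennreal g)"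
      using g by (simp only: ennreal_mult[symmetric] ennreal_plus[symmetric] zero_le_power2 mult_nonneg_nonneg zero_le_divide_1_iff zero_le_numeral)
    finally show "ennreal (norm (h (fst p) * cnj (h (snd p)) * of_real (gauss_dual s (fst p - snd p))))
      \<le> ennreal (1/2) * (ennreal ((norm (h (fst p)))\<^sup>2) * ennreal (gauss_dual s (fst p - snd p)))
      + ennreal (1/2) * (ennreal ((norm (h (snd p)))\<^sup>2) * ennreal (gauss_dual s (fst p - snd p)))"
      using g by (simp add: norm_mult a_def b_def g_def)
  qed
  also have "\<dots> = ennreal (1/2) * (\<integral>\<^sup>+p. ennreal ((norm (h (fst p)))\<^sup>2) * ennreal (gauss_dual s (fst p - snd p)) \<partial>(lborel \<Otimes>\<^sub>M lborel))
      + ennreal (1/2) * (\<integral>\<^sup>+p. ennreal ((norm (h (snd p)))\<^sup>2) * ennreal (gauss_dual s (fst p - snd p)) \<partial>(lborel \<Otimes>\<^sub>M lborel))"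
    by (subst nn_integral_add) (auto simp: nn_integral_cmult)
  also have "(\<integral>\<^sup>+p. ennreal ((norm (h (fst p)))\<^sup>2) * ennreal (gauss_dual s (fst p - snd p)) \<partial>(lborel \<Otimes>\<^sub>M lborel))
     = (\<integral>\<^sup>+X. \<integral>\<^sup>+X'. ennreal ((norm (h X))\<^sup>2) * ennreal (gauss_dual s (X - X')) \<partial>lborel \<partial>lborel)"
    by (subst lborel.nn_integral_fst[symmetric]) auto
  also have "\<dots> = (\<integral>\<^sup>+X. ennreal ((norm (h X))\<^sup>2) \<partial>lborel)"
    by (subst nn_integral_cmult) (auto simp: gauss_dual_translate[OF s])
  also have "(\<integral>\<^sup>+p. ennreal ((norm (h (snd p)))\<^sup>2) * ennreal (gauss_dual s (fst p - snd p)) \<partial>(lborel \<Otimes>\<^sub>M lborel))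
     = (\<integral>\<^sup>+X'. \<integral>\<^sup>+X. ennreal ((norm (h X'))\<^sup>2) * ennreal (gauss_dual s (X - X')) \<partial>lborel \<partial>lborel)"
    by (subst lborel_pair.nn_integral_snd[symmetric]) auto
  also have "\<dots> = (\<integral>\<^sup>+X. ennreal ((norm (h X))\<^sup>2) \<partial>lborel)"
    by (subst nn_integral_cmult) (auto simp: gauss_dual_translate[OF s])
  also have "ennreal (1/2) * (\<integral>\<^sup>+X. ennreal ((norm (h X))\<^sup>2) \<partial>lborel) + ennreal (1/2) * (\<integral>\<^sup>+X. ennreal ((norm (h X))\<^sup>2) \<partial>lborel)
     = (\<integral>\<^sup>+X. ennreal ((norm (h X))\<^sup>2) \<partial>lborel)"
  proof -
    have "ennreal (1/2) + ennreal (1/2) = 1" by (subst ennreal_plus[symmetric]) auto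
    then show ?thesis by (simp only: distrib_right[symmetric] mult_1_left)
  qed
  finally show ?thesis .
qed

text \<open>The bound with cutoff is uniform in \<open>s\<close>, so Fatou's lemma along
  \<open>s = 1 / Suc n\<close> removes the cutoff.\<close>

lemma plancherel_le:
  fixes h :: "'a::euclidean_space \<Rightarrow> complex"
  assumes i: "integrable lborel h"
  shows "(\<integral>\<^sup>+y. ennreal ((norm (fourier h y))\<^sup>2) \<partial>lborel) \<le> (\<integral>\<^sup>+X. ennreal ((norm (h X))\<^sup>2) \<partial>lborel)"
proof -
  have [measurable]: "h \<in> borel_measurable borel" using i by (simp add: integrable_iff_bounded)
  have lim: "(\<lambda>n. ennreal (gauss (1 / Suc n) y * (norm (fourier h y))\<^sup>2)) \<longlonglongrightarrow> ennreal ((norm (fourier h y))\<^sup>2)" for y :: 'a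
  proof -
    have "(\<lambda>n. gauss (1 / Suc n) y) \<longlonglongrightarrow> exp (- (0 * norm y)\<^sup>2 / 2)"
      unfolding gauss_def by (intro tendsto_intros LIMSEQ_inverse_real_of_nat[unfolded inverse_eq_divide]) simp
    then have "(\<lambda>n. gauss (1 / Suc n) y * (norm (fourier h y))\<^sup>2) \<longlonglongrightarrow> 1 * (norm (fourier h y))\<^sup>2"
      by (intro tendsto_mult tendsto_const) simp
    then show ?thesis by (intro tendsto_ennrealI) simp
  qed
  have "(\<integral>\<^sup>+y. ennreal ((norm (fourier h y))\<^sup>2) \<partial>lborel) = (\<integral>\<^sup>+y. liminf (\<lambda>n. ennreal (gauss (1 / Suc n) y * (norm (fourier h y))\<^sup>2)) \<partial>lborel)"
    by (intro nn_integral_cong lim_imp_Liminf[symmetric] lim) auto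
  also have "\<dots> \<le> liminf (\<lambda>n. \<integral>\<^sup>+y. ennreal (gauss (1 / Suc n) y * (norm (fourier h y))\<^sup>2) \<partial>lborel)"
    by (rule nn_integral_liminf) measurable
  also have "\<dots> \<le> limsup (\<lambda>n. \<integral>\<^sup>+y. ennreal (gauss (1 / Suc n) y * (norm (fourier h y))\<^sup>2) \<partial>lborel)"
    by (rule Liminf_le_Limsup) auto
  also have "\<dots> \<le> (\<integral>\<^sup>+X. ennreal ((norm (h X))\<^sup>2) \<partial>lborel)"
    by (intro Limsup_bounded always_eventually allI fourier_gauss_le i) auto
  finally show ?thesis .
qed

section \<open>Exponential Lie groups\<close>

lemma mult_inverse_right [simp]: "a * inverse a = (1::'g::group_mult)"
proof -
  have "a * inverse a = (inverse (inverse a) * inverse a) * (a * inverse a)"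
    by (simp add: left_inverse_mult)
  also have "\<dots> = inverse (inverse a) * ((inverse a * a) * inverse a)"
    by (simp only: mult.assoc)
  also have "\<dots> = 1" by (simp add: left_inverse_mult)
  finally show ?thesis .
qed

lemma mult_inverse_left [simp]: "inverse a * a = (1::'g::group_mult)"
  by (rule left_inverse_mult)

lemma mult_inverse_cancel [simp]:
  "inverse a * (a * b) = (b::'g::group_mult)" "a * (inverse a * b) = b"
  by (simp_all flip: mult.assoc)

lemma inverse_unique_mult: "a * b = 1 \<Longrightarrow> inverse a = (b::'g::group_mult)"
  by (metis mult_inverse_cancel(1) mult_1_right)

lemma inverse_inverse_mult [simp]: "inverse (inverse a) = (a::'g::group_mult)"
  by (rule inverse_unique_mult) simp

lemma inverse_one_mult [simp]: "inverse 1 = (1::'g::group_mult)"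
  by (rule inverse_unique_mult) simp

lemma inverse_mult: "inverse (a * b) = inverse b * inverse (a::'g::group_mult)"
  by (rule inverse_unique_mult) (simp add: mult.assoc)

lemma conjugate_power: "(y * x * inverse y) ^ m = y * x ^ m * inverse (y::'g::group_mult)"
  by (induction m) (simp_all add: mult.assoc)

locale exp_lie =
  fixes e :: "real^'d \<Rightarrow> 'g::{group_mult, t2_space, second_countable_topology}"
  assumes exp_lie: "exponential_lie_group e"
begin

abbreviation lg where "lg \<equiv> inv e"

lemma exp_log [simp]: "e (lg x) = x" and log_exp [simp]: "lg (e X) = X"
  and cont_exp: "continuous_on UNIV e" and cont_log: "continuous_on UNIV lg"
  using exp_lie by (auto simp: exponential_lie_group_def homeomorphism_def)

lemma exp_inj: "e X = e Y \<longleftrightarrow> X = Y"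
  by (metis log_exp)

lemma exp_add: "e ((s + t) *\<^sub>R X) = e (s *\<^sub>R X) * e (t *\<^sub>R X)"
  using exp_lie by (auto simp: exponential_lie_group_def)

lemma exp_zero [simp]: "e 0 = 1"
  using exp_add[of 0 0 0] by (metis mult_inverse_cancel(1) mult_inverse_left scaleR_zero_left add_0)

lemma exp_minus: "e (- X) = inverse (e X)"
  using exp_add[of 1 "-1" X] by (intro inverse_unique_mult[symmetric]) simp

lemma exp_nat: "e (real m *\<^sub>R X) = e X ^ m"
proof (induction m)
  case (Suc m)
  then show ?case using exp_add[of 1 "real m" X] by simp
qed simp

text \<open>The Baker-Campbell-Hausdorff product: the group multiplication in exponential
  coordinates.\<close>

definition m :: "(real^'d) \<times> (real^'d) \<Rightarrow> real^'d" where
  "m p = lg (e (fst p) * e (snd p))"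

lemma m_differentiable: "m differentiable (at p)" and m_continuous: "continuous_on UNIV m"
proof -
  have "(\<lambda>(X, Y). lg (e X * e Y)) = m" by (auto simp: m_def)
  then have "C_k (Suc 0) m" "C_k 0 m"
    using exp_lie by (auto simp: exponential_lie_group_def smooth_def simp del: C_k.simps)
  then show "m differentiable (at p)" "continuous_on UNIV m" by (cases p, auto)+
qed

lemma mult_eq: "x * y = e (m (lg x, lg y))"
  by (simp add: m_def)

lemma continuous_on_group_mult [continuous_intros]:
  assumes "continuous_on A f" "continuous_on A g"
  shows "continuous_on A (\<lambda>x. f x * (g x :: 'g))"
  unfolding mult_eq
  by (intro continuous_on_compose2[OF cont_exp] continuous_on_compose2[OF m_continuous] continuous_on_Pair
      continuous_on_compose2[OF cont_log] assms) auto

lemma inverse_eq: "inverse x = e (- lg x)"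
  by (simp add: exp_minus)

lemma continuous_on_group_inverse [continuous_intros]:
  assumes "continuous_on A f"
  shows "continuous_on A (\<lambda>x. inverse (f x :: 'g))"
  unfolding inverse_eq
  by (intro continuous_on_compose2[OF cont_exp] continuous_intros continuous_on_compose2[OF cont_log] assms) auto

lemma exp_measurable [measurable]: "e \<in> borel \<rightarrow>\<^sub>M borel" and log_measurable [measurable]: "lg \<in> borel \<rightarrow>\<^sub>M borel"
  by (intro borel_measurable_continuous_onI cont_exp cont_log)+

lemma group_mult_measurable [measurable (raw)]:
  assumes "f \<in> M \<rightarrow>\<^sub>M borel" "g \<in> M \<rightarrow>\<^sub>M borel"
  shows "(\<lambda>x. f x * (g x :: 'g)) \<in> M \<rightarrow>\<^sub>M borel"
  by (rule borel_measurable_continuous_Pair[OF assms]) (intro continuous_intros)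

lemma group_inverse_measurable [measurable (raw)]:
  assumes "f \<in> M \<rightarrow>\<^sub>M borel"
  shows "(\<lambda>x. inverse (f x :: 'g)) \<in> M \<rightarrow>\<^sub>M borel"
  by (rule measurable_compose[OF assms borel_measurable_continuous_onI]) (intro continuous_intros)

subsection \<open>The adjoint representation\<close>

definition conj_log :: "'g \<Rightarrow> real^'d \<Rightarrow> real^'d" where
  "conj_log y X = lg (y * e X * inverse y)"

lemma exp_conj_log: "e (conj_log y X) = y * e X * inverse y"
  by (simp add: conj_log_def)

lemma conj_log_m: "conj_log (e Z) X = m (m (Z, X), - Z)"
  by (simp add: conj_log_def m_def exp_minus)

lemma conj_log_nat: "conj_log y (real k *\<^sub>R X) = real k *\<^sub>R conj_log y X"
proof -
  have "e (conj_log y (real k *\<^sub>R X)) = e (real k *\<^sub>R conj_log y X)"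
    by (simp add: exp_nat exp_conj_log conjugate_power)
  then show ?thesis by (simp add: exp_inj)
qed

lemma conj_log_differentiable: "conj_log y differentiable (at X)"
proof -
  have "conj_log y = (\<lambda>X. m (m (lg y, X), - lg y))"
    using conj_log_m[of "lg y"] by auto
  moreover have "(\<lambda>X. m (m (lg y, X), - lg y)) differentiable (at X)"
    by (intro differentiable_compose[OF m_differentiable] differentiable_Pair differentiable_const differentiable_ident)
  ultimately show ?thesis by simp
qed

text \<open>Conjugation by \<open>y\<close> is homogeneous in exponential coordinates, hence equal to its derivative at 0.\<close>

lemma Ad_eq: "Ad e y = conj_log y" and linear_conj_log: "linear (conj_log y)"
proof -
  have c0: "conj_log y 0 = 0"
    using conj_log_nat[of y 0 0] by simp
  define D where "D = frechet_derivative (conj_log y) (at 0)"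
  have D: "(conj_log y has_derivative D) (at 0)"
    unfolding D_def using conj_log_differentiable frechet_derivative_works by blast
  have "conj_log y X = D X" for X
  proof -
    show ?thesis
    proof (cases "X = 0")
      case False
      have lin: "linear D" by (rule has_derivative_linear[OF D])
      have "((\<lambda>h. norm (conj_log y h - D h) / norm h) \<longlongrightarrow> 0) (at 0)"
        using D by (simp add: has_derivative_at c0)
      moreover have "(\<lambda>k. inverse (real (Suc k)) *\<^sub>R X) \<longlonglongrightarrow> 0"
        using tendsto_scaleR[OF LIMSEQ_inverse_real_of_nat tendsto_const[of X]] by simp
      ultimately have "(\<lambda>k. norm (conj_log y (inverse (real (Suc k)) *\<^sub>R X) - D (inverse (real (Suc k)) *\<^sub>R X))
          / norm (inverse (real (Suc k)) *\<^sub>R X)) \<longlonglongrightarrow> 0"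
        by (rule tendsto_compose_eventually) (use False in auto)
      \<comment> \<open>By homogeneity the difference quotient at \<open>X / Suc k\<close> does not
        depend on \<open>k\<close>, while differentiability at 0 sends it to 0.\<close>
      moreover have "norm (conj_log y (inverse (real (Suc k)) *\<^sub>R X) - D (inverse (real (Suc k)) *\<^sub>R X))
          / norm (inverse (real (Suc k)) *\<^sub>R X) = norm (conj_log y X - D X) / norm X" for k
      proof -
        have "conj_log y X = real (Suc k) *\<^sub>R conj_log y (inverse (real (Suc k)) *\<^sub>R X)"
          using conj_log_nat[of y "Suc k" "inverse (real (Suc k)) *\<^sub>R X"] by simp
        then have "conj_log y (inverse (real (Suc k)) *\<^sub>R X) = inverse (real (Suc k)) *\<^sub>R conj_log y X"
          by simp
        then show ?thesis
          by (simp add: linear_scale[OF lin] scaleR_diff_right[symmetric] del: of_nat_Suc)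
      qed
      ultimately have "norm (conj_log y X - D X) / norm X = 0" by (simp add: LIMSEQ_const_iff)
      then show ?thesis using False by simp
    qed (simp add: c0 linear_0[OF has_derivative_linear[OF D]])
  qed
  then have "conj_log y = D" by auto
  then show "linear (conj_log y)" using has_derivative_linear[OF D] by simp
  have "Ad e y = D" unfolding Ad_def D_def conj_log_def[abs_def] ..
  then show "Ad e y = conj_log y" using \<open>conj_log y = D\<close> by simp
qed

lemma linear_Ad: "linear (Ad e y)"
  by (simp add: Ad_eq linear_conj_log)

lemma exp_Ad: "e (Ad e y X) = y * e X * inverse y"
  by (simp add: Ad_eq exp_conj_log)

lemma Ad_mult: "Ad e (x * y) X = Ad e x (Ad e y X)"
  by (simp add: exp_inj[symmetric] exp_Ad inverse_mult mult.assoc)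

lemma Ad_one [simp]: "Ad e 1 X = X"
  by (simp add: exp_inj[symmetric] exp_Ad)

lemma Ad_inverse [simp]: "Ad e (inverse y) (Ad e y X) = X" "Ad e y (Ad e (inverse y) X) = X"
  by (simp_all flip: Ad_mult)

lemma Ad_continuous: "continuous_on UNIV (\<lambda>p. Ad e (fst p) (snd p))"
  unfolding Ad_eq conj_log_def
  by (intro continuous_intros continuous_on_compose2[OF cont_log] continuous_on_compose2[OF cont_exp]) auto

lemma Ad_measurable [measurable (raw)]:
  assumes "f \<in> M \<rightarrow>\<^sub>M borel" "g \<in> M \<rightarrow>\<^sub>M borel"
  shows "(\<lambda>x. Ad e (f x) (g x)) \<in> M \<rightarrow>\<^sub>M borel"
proof -
  note [measurable] = assms
  show ?thesis unfolding Ad_eq conj_log_def by measurable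
qed

text \<open>Differentiability in the vector \<open>Z = t *\<^sub>R X\<close>, and not only along
  each line, makes the derivative linear in \<open>X\<close>; left linearity of the bracket comes
  from here.\<close>

lemma Ad_exp_derivative:
  "\<exists>D. linear D \<and> (\<forall>X. ((\<lambda>t. Ad e (e (t *\<^sub>R X)) Y) has_vector_derivative D X) (at 0))"
proof -
  have "(\<lambda>Z. m (m (Z, Y), - Z)) differentiable (at 0)"
    by (intro differentiable_compose[OF m_differentiable] differentiable_Pair differentiable_const
        differentiable_ident differentiable_minus)
  then obtain D where D: "((\<lambda>Z. m (m (Z, Y), - Z)) has_derivative D) (at 0)"
    by (auto simp: differentiable_def)
  have "((\<lambda>t. m (m (t *\<^sub>R X, Y), - (t *\<^sub>R X))) has_derivative (\<lambda>t. D (t *\<^sub>R X))) (at 0)" for X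
    by (rule has_derivative_compose[where g = "\<lambda>Z. m (m (Z, Y), - Z)" and g' = D])
      (auto intro!: derivative_eq_intros D)
  then have "((\<lambda>t. Ad e (e (t *\<^sub>R X)) Y) has_vector_derivative D X) (at 0)" for X
    unfolding has_vector_derivative_def Ad_eq conj_log_m using linear_scale[OF has_derivative_linear[OF D]] by simp
  then show ?thesis using has_derivative_linear[OF D] by blast
qed

section \<open>The Lie bracket and the invariance of \<open>Theta\<close>\<close>

lemma lie_bracket_derivative:
  "((\<lambda>t. Ad e (e (t *\<^sub>R X)) Y) has_vector_derivative lie_bracket e X Y) (at 0)"
  using Ad_exp_derivative[of Y] unfolding lie_bracket_def by (metis vector_derivative_at)

lemma lie_bracket_eqI:
  "((\<lambda>t. Ad e (e (t *\<^sub>R X)) Y) has_vector_derivative D) (at 0) \<Longrightarrow> lie_bracket e X Y = D"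
  unfolding lie_bracket_def by (rule vector_derivative_at)

lemma linear_lie_bracket_right: "linear (lie_bracket e X)"
proof (rule linearI)
  show "lie_bracket e X (Y + Z) = lie_bracket e X Y + lie_bracket e X Z" for Y Z
    by (rule lie_bracket_eqI) (simp add: linear_add[OF linear_Ad] has_vector_derivative_add lie_bracket_derivative)
  show "lie_bracket e X (r *\<^sub>R Y) = r *\<^sub>R lie_bracket e X Y" for r Y
    using has_vector_derivative_scaleR[OF DERIV_const lie_bracket_derivative]
    by (intro lie_bracket_eqI) (simp add: linear_scale[OF linear_Ad])
qed

lemma linear_lie_bracket_left: "linear (\<lambda>X. lie_bracket e X Y)"
proof -
  obtain D where "linear D" "\<And>X. ((\<lambda>t. Ad e (e (t *\<^sub>R X)) Y) has_vector_derivative D X) (at 0)"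
    using Ad_exp_derivative by blast
  then show ?thesis using lie_bracket_eqI by (metis (no_types, lifting) ext)
qed

lemma bounded_bilinear_lie_bracket: "bounded_bilinear (lie_bracket e)"
  unfolding bilinear_conv_bounded_bilinear[symmetric] bilinear_def
  using linear_lie_bracket_left linear_lie_bracket_right by auto

text \<open>Conjugating the one-parameter group of \<open>X\<close> by \<open>y\<close> gives that
  of \<open>Ad e y X\<close>, and the bounded linear map \<open>Ad e y\<close> commutes with
  differentiation in \<open>t\<close>.\<close>

lemma Ad_lie_bracket: "lie_bracket e (Ad e y X) (Ad e y Y) = Ad e y (lie_bracket e X Y)"
proof (rule lie_bracket_eqI)
  have "Ad e (e (t *\<^sub>R Ad e y X)) (Ad e y Y) = Ad e y (Ad e (e (t *\<^sub>R X)) Y)" for t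
  proof -
    have "e (t *\<^sub>R Ad e y X) = y * e (t *\<^sub>R X) * inverse y"
      by (simp add: linear_scale[OF linear_Ad, symmetric] exp_Ad)
    then show ?thesis by (simp add: Ad_mult)
  qed
  moreover have "bounded_linear (Ad e y)" using linear_Ad linear_conv_bounded_linear by blast
  ultimately show "((\<lambda>t. Ad e (e (t *\<^sub>R Ad e y X)) (Ad e y Y)) has_vector_derivative Ad e y (lie_bracket e X Y)) (at 0)"
    using bounded_linear.has_vector_derivative[OF _ lie_bracket_derivative] by simp
qed

lemma Ad_lie_bracket_power:
  "(lie_bracket e (Ad e y X) ^^ k) (Ad e y Y) = Ad e y ((lie_bracket e X ^^ k) Y)"
  by (induction k) (simp_all add: Ad_lie_bracket)

lemma linear_lie_bracket_power: "linear (lie_bracket e X ^^ k)"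
proof (induction k)
  case (Suc k)
  then show ?case using linear_compose[OF Suc linear_lie_bracket_right[of X]] by (simp add: o_def)
qed (simp add: linear_ident)

lemma norm_matrix_le:
  fixes f :: "real^'d \<Rightarrow> real^'d"
  assumes "\<And>v. norm (f v) \<le> K * norm v"
  shows "norm (matrix f) \<le> of_nat CARD('d) * (of_nat CARD('d) * K)"
proof -
  have "norm (matrix f) \<le> (\<Sum>i\<in>UNIV. norm (matrix f $ i))"
    unfolding norm_vec_def by (rule L2_set_le_sum) auto
  also have "\<dots> \<le> (\<Sum>i\<in>(UNIV :: 'd set). of_nat CARD('d) * K)"
  proof (rule sum_mono)
    fix i
    have "norm (matrix f $ i) \<le> (\<Sum>j\<in>UNIV. \<bar>matrix f $ i $ j\<bar>)" by (rule norm_le_l1_cart)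
    also have "\<dots> \<le> (\<Sum>j\<in>(UNIV :: 'd set). K)"
    proof (rule sum_mono)
      fix j
      have "\<bar>matrix f $ i $ j\<bar> \<le> norm (f (axis j 1))"
        unfolding matrix_def by (simp add: component_le_norm_cart)
      also have "\<dots> \<le> K" using assms[of "axis j 1"] by simp
      finally show "\<bar>matrix f $ i $ j\<bar> \<le> K" .
    qed
    finally show "norm (matrix f $ i) \<le> of_nat CARD('d) * K" by simp
  qed
  finally show ?thesis by simp
qed

text \<open>Makes the series in \<open>Theta\<close> a genuine limit, which \<open>Theta_Ad\<close>
  then conjugates term by term.\<close>

lemma Theta_summable: "summable (\<lambda>k. (1 / fact (k + 1)) *\<^sub>R matrix (lie_bracket e X ^^ k))"
proof -
  obtain K where K: "0 < K" "\<And>Y. norm (lie_bracket e X Y) \<le> norm Y * K"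
    using bounded_linear.pos_bounded[of "lie_bracket e X"] linear_lie_bracket_right linear_conv_bounded_linear by blast
  have pow: "norm ((lie_bracket e X ^^ k) Y) \<le> K ^ k * norm Y" for k Y
  proof (induction k)
    case (Suc k)
    have "norm ((lie_bracket e X ^^ Suc k) Y) \<le> norm ((lie_bracket e X ^^ k) Y) * K" using K by simp
    also have "\<dots> \<le> (K ^ k * norm Y) * K" using Suc K by (intro mult_right_mono) auto
    finally show ?case by (simp add: mult_ac)
  qed simp
  \<comment> \<open>The number of matrix entries: the norm of a matrix is at most the sum over its
    entries, each bounded by \<open>K ^ k\<close>.\<close>
  define c where "c = real CARD('d) * real CARD('d)"
  have "summable (\<lambda>k. c * (inverse (fact k) * K ^ k))"
    by (intro summable_mult summable_exp)
  then show ?thesis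
  proof (rule summable_comparison_test'[where N = 0])
    fix k :: nat
    have "norm ((1 / fact (k + 1)) *\<^sub>R matrix (lie_bracket e X ^^ k)) \<le> (1 / fact (k + 1)) * (c * K ^ k)"
      using norm_matrix_le[OF pow, of k] by (simp add: c_def divide_right_mono mult.assoc)
    also have "\<dots> \<le> inverse (fact k) * (c * K ^ k)"
      using K by (intro mult_right_mono) (auto simp: c_def inverse_eq_divide intro!: divide_left_mono fact_mono mult_pos_pos)
    finally show "norm ((1 / fact (k + 1)) *\<^sub>R matrix (lie_bracket e X ^^ k)) \<le> c * (inverse (fact k) * K ^ k)"
      by (simp add: mult_ac)
  qed
qed

text \<open>\<open>Ad e y\<close> intertwines \<open>lie_bracket e X\<close> with
  \<open>lie_bracket e (Ad e y X)\<close>, so the two series are conjugate matrices. Both weights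
  \<open>w\<close> of the theorem inherit their invariance from this.\<close>

lemma Theta_Ad: "Theta e (Ad e y X) = Theta e X"
proof -
  define P where "P = matrix (Ad e y)"
  define Q where "Q = matrix (Ad e (inverse y))"
  have PQ: "P ** Q = mat 1"
    unfolding P_def Q_def by (subst matrix_compose[symmetric]) (auto simp: linear_Ad o_def matrix_id_mat_1[unfolded id_def])
  define A where "A k = (1 / fact (k + 1)) *\<^sub>R matrix (lie_bracket e X ^^ k)" for k
  have "(1 / fact (k + 1)) *\<^sub>R matrix (lie_bracket e (Ad e y X) ^^ k) = P ** A k ** Q" for k
  proof -
    have "lie_bracket e (Ad e y X) ^^ k = Ad e y \<circ> (lie_bracket e X ^^ k) \<circ> Ad e (inverse y)"
    proof
      fix Z show "(lie_bracket e (Ad e y X) ^^ k) Z = (Ad e y \<circ> (lie_bracket e X ^^ k) \<circ> Ad e (inverse y)) Z"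
        using Ad_lie_bracket_power[of k y X "Ad e (inverse y) Z"] by simp
    qed
    then have "matrix (lie_bracket e (Ad e y X) ^^ k) = P ** matrix (lie_bracket e X ^^ k) ** Q"
      unfolding P_def Q_def by (simp add: matrix_compose linear_Ad linear_lie_bracket_power linear_compose)
    then show ?thesis
      by (simp add: A_def matrix_scalar_ac scalar_matrix_assoc flip: scalar_mult_eq_scaleR)
  qed
  moreover have "(\<Sum>k. P ** A k ** Q) = P ** (\<Sum>k. A k) ** Q"
  proof -
    have "linear (\<lambda>A. P ** A ** Q)"
      by (rule linearI) (simp_all add: vec_eq_iff matrix_matrix_mult_def distrib_left distrib_right sum.distrib sum_distrib_left mult_ac)
    then have "bounded_linear (\<lambda>A. P ** A ** Q)" by (simp add: linear_conv_bounded_linear)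
    then show ?thesis
      using bounded_linear.suminf[of "\<lambda>A. P ** A ** Q" A] Theta_summable[of X] by (simp add: A_def)
  qed
  ultimately have "Theta e (Ad e y X) = \<bar>det (P ** (\<Sum>k. A k) ** Q)\<bar>"
    unfolding Theta_def by simp
  also have "\<dots> = \<bar>det (\<Sum>k. A k) * det (P ** Q)\<bar>" by (simp add: det_mul mult_ac)
  also have "\<dots> = Theta e X" by (simp add: PQ Theta_def A_def)
  finally show ?thesis .
qed

lemma Theta_nonneg [simp]: "0 \<le> Theta e X"
  by (simp add: Theta_def)

lemma Theta_measurable [measurable]: "Theta e \<in> borel_measurable borel"
proof -
  have c: "continuous_on UNIV (\<lambda>X. (lie_bracket e X ^^ k) Y)" for k Y
  proof (induction k)
    case (Suc k)
    then show ?case by (auto intro!: bounded_bilinear.continuous_on[OF bounded_bilinear_lie_bracket] continuous_intros)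
  qed simp
  have "continuous_on UNIV (\<lambda>X. matrix (lie_bracket e X ^^ k))" for k
    unfolding matrix_def by (intro continuous_on_vec_lambda continuous_intros c)
  then have [measurable]: "(\<lambda>X. matrix (lie_bracket e X ^^ k)) \<in> borel_measurable borel" for k
    by (intro borel_measurable_continuous_onI)
  have "(\<lambda>X. \<Sum>k. (1 / fact (k + 1)) *\<^sub>R matrix (lie_bracket e X ^^ k)) \<in> borel_measurable borel"
    by measurable
  moreover have "(\<lambda>A. \<bar>det A\<bar>) \<in> borel_measurable (borel :: (real^'d^'d) measure)"
    unfolding det_def
    by (intro borel_measurable_continuous_onI continuous_intros)
  ultimately show ?thesis
    unfolding Theta_def[abs_def] by (rule measurable_compose)
qed

end

subsection \<open>Linear change of variables\<close>

text \<open>The theory of linear images of Lebesgue measure in the library assumes a well-ordered index type.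
  Here the image measure is instead compared with Lebesgue measure by the uniqueness of
  translation-invariant measures (the fact \<open>swap\<close>).\<close>

lemma nn_integral_lborel_linear:
  fixes L :: "real^'d \<Rightarrow> real^'d"
  assumes L: "linear L" and M: "linear M" and inv: "\<And>X. L (M X) = X" "\<And>X. M (L X) = X"
  shows "\<exists>a>0. \<forall>\<phi>\<in>borel_measurable borel. (\<integral>\<^sup>+X. \<phi> (L X) \<partial>lborel) = ennreal a * (\<integral>\<^sup>+X. \<phi> X \<partial>lborel)"
proof -
  have cL: "continuous_on A L" for A using L linear_continuous_on linear_conv_bounded_linear by blast
  have [measurable]: "L \<in> borel_measurable borel" by (intro borel_measurable_continuous_onI cL)
  define \<nu> where "\<nu> = distr lborel borel L"
  have [simp, measurable_cong]: "sets \<nu> = sets borel" by (simp add: \<nu>_def)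
  have [simp]: "space \<nu> = UNIV" by (simp add: \<nu>_def)
  have int: "(\<integral>\<^sup>+x. \<phi> x \<partial>\<nu>) = (\<integral>\<^sup>+x. \<phi> (L x) \<partial>lborel)" if "\<phi> \<in> borel_measurable borel" for \<phi>
    unfolding \<nu>_def using that by (subst nn_integral_distr) auto
  have translate: "(\<integral>\<^sup>+x. \<phi> (x + y) \<partial>\<nu>) = (\<integral>\<^sup>+x. \<phi> x \<partial>\<nu>)" if [measurable]: "\<phi> \<in> borel_measurable borel" for \<phi> y
  proof -
    have "(\<integral>\<^sup>+x. \<phi> (x + y) \<partial>\<nu>) = (\<integral>\<^sup>+x. \<phi> (L (M y + x)) \<partial>lborel)"
      by (subst int) (auto simp: linear_add[OF L] inv add.commute)
    also have "\<dots> = (\<integral>\<^sup>+x. \<phi> (L x) \<partial>(distr lborel borel ((+) (M y))))"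
      by (subst nn_integral_distr) auto
    finally show ?thesis by (simp add: lborel_distr_plus int)
  qed
  have bounded: "emeasure \<nu> B < \<infinity>" if "bounded B" "B \<in> sets borel" for B
  proof -
    have "L -` B = M ` B"
    proof safe
      show "X \<in> M ` B" if "L X \<in> B" for X using imageI[OF that, of M] by (simp add: inv)
    qed (simp add: inv)
    then have "bounded (L -` B)"
      using that(1) M by (simp add: bounded_linear_image linear_conv_bounded_linear)
    then show ?thesis
      using that(2) emeasure_bounded_finite[of "L -` B"] by (simp add: \<nu>_def emeasure_distr)
  qed
  have "sigma_finite_measure \<nu>"
  proof
    show "\<exists>A. countable A \<and> A \<subseteq> sets \<nu> \<and> \<Union> A = space \<nu> \<and> (\<forall>a\<in>A. emeasure \<nu> a \<noteq> \<infinity>)"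
    proof (intro exI[of _ "range (\<lambda>n::nat. ball 0 (real n))"] conjI ballI)
      show "\<Union> (range (\<lambda>n::nat. ball (0::real^'d) (real n))) = space \<nu>"
        by (auto simp: reals_Archimedean2)
    qed (use bounded in \<open>auto simp: less_top[symmetric]\<close>)
  qed
  then interpret pair_sigma_finite \<nu> "lborel :: (real^'d) measure"
    by (simp add: pair_sigma_finite_def sigma_finite_lborel)
  \<comment> \<open>As \<open>\<nu>\<close> and Lebesgue measure are both invariant, integrating
    \<open>indicator A x * indicator B (x + y)\<close> in the two orders exchanges the roles of
    \<open>A\<close> and \<open>B\<close>.\<close>
  have swap: "emeasure \<nu> A * emeasure lborel B = emeasure \<nu> B * emeasure lborel A"
    if AB [measurable, simp]: "A \<in> sets borel" "B \<in> sets borel" for A B :: "(real^'d) set"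
  proof -
    have meas [measurable]: "(\<lambda>p. indicator A (fst p) * indicator B (fst p + snd p) :: ennreal) \<in> borel_measurable (\<nu> \<Otimes>\<^sub>M lborel)"
      "(\<lambda>p. indicator A (fst p - snd p) * indicator B (fst p) :: ennreal) \<in> borel_measurable (\<nu> \<Otimes>\<^sub>M lborel)"
      by measurable
    have plus: "(\<integral>\<^sup>+y. \<phi> (x + y) \<partial>lborel) = (\<integral>\<^sup>+y. \<phi> y \<partial>lborel)"
      if [measurable]: "\<phi> \<in> borel_measurable borel" for \<phi> and x :: "real^'d"
      by (subst (2) lborel_distr_plus[symmetric, of x]) (simp add: nn_integral_distr)
    have minus: "(\<integral>\<^sup>+y. \<phi> (x - y) \<partial>lborel) = (\<integral>\<^sup>+y. \<phi> y \<partial>lborel)"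
      if [measurable]: "\<phi> \<in> borel_measurable borel" for \<phi> and x :: "real^'d"
      by (subst (2) lborel_affine[of "-1" x]) (simp_all add: nn_integral_density nn_integral_distr)
    have "emeasure \<nu> A * emeasure lborel B = (\<integral>\<^sup>+x. indicator A x * emeasure lborel B \<partial>\<nu>)"
      by (subst nn_integral_multc) auto
    also have "\<dots> = (\<integral>\<^sup>+x. (\<integral>\<^sup>+y. indicator A x * indicator B (x + y) \<partial>lborel) \<partial>\<nu>)"
      using plus[of "indicator B"] by (simp add: nn_integral_cmult)
    also have "\<dots> = (\<integral>\<^sup>+y. (\<integral>\<^sup>+x. indicator A x * indicator B (x + y) \<partial>\<nu>) \<partial>lborel)"
      using Fubini[OF meas(1)] by simp
    also have "\<dots> = (\<integral>\<^sup>+y. (\<integral>\<^sup>+x. indicator A (x - y) * indicator B x \<partial>\<nu>) \<partial>lborel)"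
    proof (rule nn_integral_cong)
      fix y
      show "(\<integral>\<^sup>+x. indicator A x * indicator B (x + y) \<partial>\<nu>) = (\<integral>\<^sup>+x. indicator A (x - y) * indicator B x \<partial>\<nu>)"
        using translate[of "\<lambda>x. indicator A (x - y) * indicator B x" y] by simp
    qed
    also have "\<dots> = (\<integral>\<^sup>+x. (\<integral>\<^sup>+y. indicator A (x - y) * indicator B x \<partial>lborel) \<partial>\<nu>)"
      using Fubini[OF meas(2)] by simp
    also have "\<dots> = (\<integral>\<^sup>+x. emeasure lborel A * indicator B x \<partial>\<nu>)"
      using minus[of "indicator A"] by (simp add: nn_integral_multc)
    also have "\<dots> = emeasure \<nu> B * emeasure lborel A"
      by (subst nn_integral_cmult) (auto simp: mult.commute)
    finally show ?thesis .
  qed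
  \<comment> \<open>The unit cube has Lebesgue measure 1, so its \<open>\<nu>\<close>-measure is the
    constant of proportionality.\<close>
  define Q :: "(real^'d) set" where "Q = box 0 One"
  have Q: "emeasure lborel Q = 1" by (simp add: Q_def emeasure_lborel_box_eq inner_sum_left inner_Basis)
  obtain a where a: "0 \<le> a" "emeasure \<nu> Q = ennreal a"
    using bounded[of Q] by (cases "emeasure \<nu> Q") (auto simp: Q_def)
  have eq: "\<nu> = scale_measure (ennreal a) lborel"
  proof (rule measure_eqI)
    fix A assume "A \<in> sets \<nu>"
    then show "emeasure \<nu> A = emeasure (scale_measure (ennreal a) lborel) A"
      using swap[of A Q] Q a by (simp add: Q_def)
  qed simp
  have "a > 0"
  proof (rule ccontr)
    assume "\<not> a > 0"
    then have "emeasure \<nu> UNIV = 0" using a eq by simp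
    then show False by (simp add: \<nu>_def emeasure_distr)
  qed
  moreover have "(\<integral>\<^sup>+X. \<phi> (L X) \<partial>lborel) = ennreal a * (\<integral>\<^sup>+X. \<phi> X \<partial>lborel)" if "\<phi> \<in> borel_measurable borel" for \<phi>
    using int[OF that] that by (simp add: eq nn_integral_scale_measure)
  ultimately show ?thesis by blast
qed

subsection \<open>Haar measure\<close>

lemma ennreal_mult_right_cancel:
  assumes "ennreal a * t = ennreal b * t" "t \<noteq> 0" "t < \<infinity>" "0 \<le> a" "0 \<le> b"
  shows "a = b"
proof (cases t)
  case (real r)
  then have "r \<noteq> 0" "ennreal (a * r) = ennreal (b * r)" using assms by (auto simp: ennreal_mult)
  then show ?thesis using assms real by simp
qed (use assms in simp)

locale haar_group = exp_lie e
  for e :: "real^'d \<Rightarrow> 'g::{group_mult, t2_space, second_countable_topology}" +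
  fixes \<mu>l \<mu>r :: "'g measure" and \<Delta> :: "'g \<Rightarrow> real"
  assumes left_haar: "left_haar UNIV \<mu>l" and right_haar: "right_haar UNIV \<mu>r"
    and modular: "modular_function UNIV \<Delta>"
    and left_density: "\<mu>l = density \<mu>r (\<lambda>x. ennreal (\<Delta> x))"
    and right_chart: "\<mu>r = distr (density lborel (\<lambda>X. ennreal (Theta e X))) borel e"
begin

lemma compact_exp_cball: "compact (e ` cball 0 r)"
  by (intro compact_continuous_image continuous_on_subset[OF cont_exp]) auto

lemma UN_exp_cball: "(\<Union>n::nat. e ` cball 0 (real n)) = UNIV"
proof safe
  fix x
  obtain n :: nat where "norm (lg x) \<le> real n" using real_arch_simple by blast
  then have "x \<in> e ` cball 0 (real n)" by (intro image_eqI[of _ _ "lg x"]) auto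
  then show "x \<in> (\<Union>n::nat. e ` cball 0 (real n))" by blast
qed auto

text \<open>The images of closed balls under \<open>e\<close> are compact and exhaust the group.
  This gives sigma-finiteness and, since the measure is not zero, a compact set of positive finite
  measure, on which scaling factors are compared later.\<close>

lemma haar_likeD:
  fixes M :: "'g measure"
  assumes "haar_like UNIV M"
  shows "sets M = sets borel" "space M = UNIV" "sigma_finite_measure M"
    "\<exists>K. compact K \<and> emeasure M K \<noteq> 0 \<and> emeasure M K < \<infinity>"
proof -
  show s: "sets M = sets borel" using assms by (simp add: haar_like_def)
  show sp: "space M = UNIV" using sets_eq_imp_space_eq[OF s] by simp
  have fin: "emeasure M (e ` cball 0 r) < \<infinity>" for r
    using assms compact_exp_cball unfolding haar_like_def by blast
  have cl: "e ` cball 0 r \<in> sets M" for r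
    unfolding s by (intro borel_closed compact_imp_closed compact_exp_cball)
  show "sigma_finite_measure M"
  proof
    show "\<exists>A. countable A \<and> A \<subseteq> sets M \<and> \<Union> A = space M \<and> (\<forall>a\<in>A. emeasure M a \<noteq> \<infinity>)"
      using fin cl UN_exp_cball by (intro exI[of _ "range (\<lambda>n::nat. e ` cball 0 (real n))"]) (auto simp: sp less_top)
  qed
  have "\<exists>n::nat. emeasure M (e ` cball 0 (real n)) \<noteq> 0"
  proof (rule ccontr)
    assume "\<not> ?thesis"
    then have "emeasure M (\<Union>n::nat. e ` cball 0 (real n)) = 0"
      using cl by (intro emeasure_UN_eq_0) auto
    then show False using assms by (simp add: UN_exp_cball haar_like_def)
  qed
  then show "\<exists>K. compact K \<and> emeasure M K \<noteq> 0 \<and> emeasure M K < \<infinity>"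
    using fin compact_exp_cball by blast
qed

lemma haar_like: "haar_like UNIV \<mu>l" "haar_like UNIV \<mu>r"
  using left_haar right_haar by (simp_all add: left_haar_def right_haar_def)

lemma sets_mu [simp, measurable_cong]: "sets \<mu>r = sets borel" "sets \<mu>l = sets borel"
  and space_mu [simp]: "space \<mu>r = UNIV" "space \<mu>l = UNIV"
  using haar_likeD[OF haar_like(1)] haar_likeD[OF haar_like(2)] by blast+

sublocale R: sigma_finite_measure \<mu>r
  using haar_likeD(3)[OF haar_like(2)] .

lemma right_translate:
  assumes [measurable]: "\<phi> \<in> borel_measurable borel"
  shows "(\<integral>\<^sup>+x. \<phi> (x * s) \<partial>\<mu>r) = (\<integral>\<^sup>+x. \<phi> x \<partial>\<mu>r)"
proof -
  have "distr \<mu>r borel (\<lambda>x. x * s) = \<mu>r"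
  proof (rule measure_eqI)
    fix A assume "A \<in> sets (distr \<mu>r borel (\<lambda>x. x * s))"
    then have [measurable]: "A \<in> sets borel" by simp
    have "(\<lambda>x. x * s) -` A = (\<lambda>x. x * inverse s) ` A"
    proof safe
      fix x assume "x * s \<in> A"
      then have "(x * s) * inverse s \<in> (\<lambda>x. x * inverse s) ` A" by blast
      then show "x \<in> (\<lambda>x. x * inverse s) ` A" by (simp add: mult.assoc)
    qed (simp add: mult.assoc)
    then show "emeasure (distr \<mu>r borel (\<lambda>x. x * s)) A = emeasure \<mu>r A"
      using right_haar \<open>A \<in> sets borel\<close> by (simp add: emeasure_distr right_haar_def)
  qed simp
  then have "(\<integral>\<^sup>+x. \<phi> x \<partial>\<mu>r) = (\<integral>\<^sup>+x. \<phi> x \<partial>distr \<mu>r borel (\<lambda>x. x * s))" by simp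
  also have "\<dots> = (\<integral>\<^sup>+x. \<phi> (x * s) \<partial>\<mu>r)" by (rule nn_integral_distr) measurable
  finally show ?thesis by simp
qed

lemma left_translate_l:
  assumes [measurable]: "\<phi> \<in> borel_measurable borel"
  shows "(\<integral>\<^sup>+x. \<phi> (s * x) \<partial>\<mu>l) = (\<integral>\<^sup>+x. \<phi> x \<partial>\<mu>l)"
proof -
  have "distr \<mu>l borel (\<lambda>x. s * x) = \<mu>l"
  proof (rule measure_eqI)
    fix A assume "A \<in> sets (distr \<mu>l borel (\<lambda>x. s * x))"
    then have [measurable]: "A \<in> sets borel" by simp
    have "(\<lambda>x. s * x) -` A = (\<lambda>x. inverse s * x) ` A"
    proof safe
      fix x assume "s * x \<in> A"
      then have "inverse s * (s * x) \<in> (\<lambda>x. inverse s * x) ` A" by blast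
      then show "x \<in> (\<lambda>x. inverse s * x) ` A" by simp
    qed simp
    then show "emeasure (distr \<mu>l borel (\<lambda>x. s * x)) A = emeasure \<mu>l A"
      using left_haar \<open>A \<in> sets borel\<close> by (simp add: emeasure_distr left_haar_def)
  qed simp
  then have "(\<integral>\<^sup>+x. \<phi> x \<partial>\<mu>l) = (\<integral>\<^sup>+x. \<phi> x \<partial>distr \<mu>l borel (\<lambda>x. s * x))" by simp
  also have "\<dots> = (\<integral>\<^sup>+x. \<phi> (s * x) \<partial>\<mu>l)" by (rule nn_integral_distr) measurable
  finally show ?thesis by simp
qed

lemma Delta_pos [simp]: "0 < \<Delta> y"
  using modular by (simp add: modular_function_def)

lemma Delta_nonneg [simp]: "0 \<le> \<Delta> y"
  using Delta_pos less_imp_le by blast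

lemma Delta_nonzero [simp]: "\<Delta> y \<noteq> 0"
  using Delta_pos[of y] by linarith

lemma measurable_mu: "\<mu>r \<rightarrow>\<^sub>M N = borel \<rightarrow>\<^sub>M N"
  by (rule measurable_cong_sets) simp_all

text \<open>The measure \<open>M\<close> behind \<open>modular_function\<close> is some left Haar
  measure, not assumed to be \<open>\<mu>l\<close>; multiplicativity is read off a compact
  \<open>K\<close> of positive finite measure. Measurability comes from writing
  \<open>\<Delta> s\<close> as a parameter integral divided by a constant.\<close>

lemma Delta_mult: "\<Delta> (x * y) = \<Delta> x * \<Delta> y"
  and Delta_measurable [measurable]: "\<Delta> \<in> borel_measurable borel"
proof -
  obtain M where M: "left_haar UNIV M"
    and scale: "\<And>s A. A \<in> sets M \<Longrightarrow> emeasure M ((\<lambda>x. x * s) ` A) = ennreal (\<Delta> s) * emeasure M A"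
    using modular by (auto simp: modular_function_def)
  have "haar_like UNIV M" using M by (simp add: left_haar_def)
  note H = haar_likeD[OF this]
  note [simp, measurable_cong] = H(1)
  interpret M: sigma_finite_measure M by (rule H)
  obtain K where K: "compact K" "emeasure M K \<noteq> 0" "emeasure M K < \<infinity>" using H(4) by blast
  then have Kb [measurable]: "K \<in> sets borel" by (intro borel_closed compact_imp_closed)
  have im: "(\<lambda>x. x * s) ` A = (\<lambda>x. x * inverse s) -` A" for s and A :: "'g set"
  proof safe
    fix x assume "x * inverse s \<in> A"
    then have "(x * inverse s) * s \<in> (\<lambda>x. x * s) ` A" by blast
    then show "x \<in> (\<lambda>x. x * s) ` A" by (simp add: mult.assoc)
  qed (simp add: mult.assoc)
  have [measurable]: "(\<lambda>x. x * s) ` A \<in> sets borel" if [measurable]: "A \<in> sets borel" for s and A :: "'g set"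
  proof -
    have "(\<lambda>x. x * inverse s) -` A \<inter> space borel \<in> sets borel" by measurable
    then show ?thesis by (simp add: im)
  qed
  have "(\<lambda>z. z * (x * y)) ` K = (\<lambda>z. z * y) ` ((\<lambda>z. z * x) ` K)"
    by (simp add: image_image mult.assoc)
  then have "ennreal (\<Delta> (x * y)) * emeasure M K = ennreal (\<Delta> y) * (ennreal (\<Delta> x) * emeasure M K)"
    using scale[of K "x * y"] scale[of K x] scale[of "(\<lambda>z. z * x) ` K" y] by simp
  also have "\<dots> = ennreal (\<Delta> x * \<Delta> y) * emeasure M K"
    by (simp add: ennreal_mult mult_ac)
  finally show "\<Delta> (x * y) = \<Delta> x * \<Delta> y"
    using K modular by (rule_tac ennreal_mult_right_cancel[of _ "emeasure M K"]) (auto simp: less_imp_le)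
  have "ennreal (\<Delta> s) * emeasure M K = (\<integral>\<^sup>+x. indicator K (x * inverse s) \<partial>M)" for s
  proof -
    have "(\<integral>\<^sup>+x. indicator K (x * inverse s) \<partial>M) = (\<integral>\<^sup>+x. indicator ((\<lambda>x. x * s) ` K) x \<partial>M)"
      by (intro nn_integral_cong) (simp add: im indicator_def)
    then show ?thesis using scale[of K s] by simp
  qed
  then have eq: "\<Delta> s = enn2real (\<integral>\<^sup>+x. indicator K (x * inverse s) \<partial>M) / enn2real (emeasure M K)" for s
  proof -
    have "enn2real (emeasure M K) \<noteq> 0" using K by (simp add: enn2real_eq_0_iff less_top)
    moreover have "enn2real (\<integral>\<^sup>+x. indicator K (x * inverse s) \<partial>M) = \<Delta> s * enn2real (emeasure M K)"
      by (simp flip: \<open>\<And>s. ennreal (\<Delta> s) * emeasure M K = (\<integral>\<^sup>+x. indicator K (x * inverse s) \<partial>M)\<close> add: enn2real_mult)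
    ultimately show ?thesis by simp
  qed
  have "(\<lambda>s. enn2real (\<integral>\<^sup>+x. indicator K (x * inverse s) \<partial>M) / enn2real (emeasure M K)) \<in> borel_measurable borel"
    by measurable
  then show "\<Delta> \<in> borel_measurable borel" by (simp add: eq[abs_def])
qed

lemma Delta_one [simp]: "\<Delta> 1 = 1"
  using Delta_mult[of 1 1] Delta_pos[of 1] by simp

lemma Delta_inverse: "\<Delta> (inverse y) = 1 / \<Delta> y"
proof -
  have "\<Delta> y * \<Delta> (inverse y) = 1" using Delta_mult[of y "inverse y"] by simp
  moreover have "\<Delta> y \<noteq> 0" using Delta_pos[of y] by linarith
  ultimately show ?thesis by (simp add: field_simps)
qed

text \<open>\<open>1 / \<Delta>\<close> is the density of \<open>\<mu>r\<close> with respect to the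
  left invariant \<open>\<mu>l\<close>, and \<open>1 / \<Delta> x\<close> equals
  \<open>\<Delta> y / \<Delta> (y * x)\<close>.\<close>

lemma left_translate:
  assumes [measurable]: "\<phi> \<in> borel_measurable borel"
  shows "(\<integral>\<^sup>+x. \<phi> (y * x) \<partial>\<mu>r) = ennreal (\<Delta> y) * (\<integral>\<^sup>+x. \<phi> x \<partial>\<mu>r)"
proof -
  have cancel: "ennreal (\<Delta> x) * (ennreal (1 / \<Delta> x) * t) = t" for x t
    using Delta_pos[of x] by (simp add: mult.assoc[symmetric] ennreal_mult[symmetric] less_imp_le del: Delta_pos)
  have l: "(\<integral>\<^sup>+x. \<psi> x \<partial>\<mu>l) = (\<integral>\<^sup>+x. ennreal (\<Delta> x) * \<psi> x \<partial>\<mu>r)" if [measurable]: "\<psi> \<in> borel_measurable borel" for \<psi>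
    unfolding left_density by (rule nn_integral_density) measurable
  have "(\<integral>\<^sup>+x. \<phi> (y * x) \<partial>\<mu>r) = (\<integral>\<^sup>+x. ennreal (1 / \<Delta> x) * \<phi> (y * x) \<partial>\<mu>l)"
    by (subst l) (auto simp: cancel)
  also have "\<dots> = (\<integral>\<^sup>+x. (\<lambda>z. ennreal (\<Delta> y) * (ennreal (1 / \<Delta> z) * \<phi> z)) (y * x) \<partial>\<mu>l)"
  proof (rule nn_integral_cong)
    fix x
    have "ennreal (1 / \<Delta> x) = ennreal (\<Delta> y) * ennreal (1 / \<Delta> (y * x))"
      by (subst ennreal_mult[symmetric]) (use less_imp_neq[OF Delta_pos, of y] in \<open>auto simp: Delta_mult\<close>)
    then show "ennreal (1 / \<Delta> x) * \<phi> (y * x) = (\<lambda>z. ennreal (\<Delta> y) * (ennreal (1 / \<Delta> z) * \<phi> z)) (y * x)"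
      by (simp add: mult.assoc)
  qed
  also have "\<dots> = (\<integral>\<^sup>+x. ennreal (\<Delta> y) * (ennreal (1 / \<Delta> x) * \<phi> x) \<partial>\<mu>l)"
    by (rule left_translate_l) measurable
  also have "\<dots> = ennreal (\<Delta> y) * (\<integral>\<^sup>+x. \<phi> x \<partial>\<mu>r)"
    by (subst nn_integral_cmult) (auto simp: l cancel)
  finally show ?thesis .
qed

lemma conj_translate:
  assumes [measurable]: "\<phi> \<in> borel_measurable borel"
  shows "(\<integral>\<^sup>+x. \<phi> (y * x * inverse y) \<partial>\<mu>r) = ennreal (\<Delta> y) * (\<integral>\<^sup>+x. \<phi> x \<partial>\<mu>r)"
  using left_translate[of "\<lambda>x. \<phi> (x * inverse y)" y] right_translate[OF assms, of "inverse y"] by simp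

lemma nn_integral_chart:
  assumes [measurable]: "\<phi> \<in> borel_measurable borel"
  shows "(\<integral>\<^sup>+x. \<phi> x \<partial>\<mu>r) = (\<integral>\<^sup>+X. ennreal (Theta e X) * \<phi> (e X) \<partial>lborel)"
  by (subst right_chart, subst nn_integral_distr) (auto simp: nn_integral_density)

text \<open>Linearity of \<open>Ad e y\<close> gives some factor \<open>a\<close>. It is identified
  on a compact set through the chart: conjugation scales \<open>\<mu>r\<close> by
  \<open>\<Delta> y\<close> while \<open>Theta\<close> is unchanged, so \<open>a\<close> is
  \<open>\<Delta> y\<close>.\<close>

lemma Ad_translate:
  assumes [measurable]: "\<phi> \<in> borel_measurable borel"
  shows "(\<integral>\<^sup>+X. \<phi> (Ad e y X) \<partial>lborel) = ennreal (\<Delta> y) * (\<integral>\<^sup>+X. \<phi> X \<partial>lborel)"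
proof -
  obtain a where a: "a > 0" "\<And>\<phi>. \<phi> \<in> borel_measurable borel \<Longrightarrow>
      (\<integral>\<^sup>+X. \<phi> (Ad e y X) \<partial>lborel) = ennreal a * (\<integral>\<^sup>+X. \<phi> X \<partial>lborel)"
    using nn_integral_lborel_linear[OF linear_Ad[of y] linear_Ad[of "inverse y"]] by auto
  obtain K where K: "compact K" "emeasure \<mu>r K \<noteq> 0" "emeasure \<mu>r K < \<infinity>"
    using haar_likeD(4)[OF haar_like(2)] by blast
  then have Kb [measurable]: "K \<in> sets borel" by (intro borel_closed compact_imp_closed)
  have "ennreal (\<Delta> y) * emeasure \<mu>r K = (\<integral>\<^sup>+x. indicator K (y * x * inverse y) \<partial>\<mu>r)"
    using conj_translate[of "indicator K" y] by simp
  also have "\<dots> = (\<integral>\<^sup>+X. (\<lambda>Z. ennreal (Theta e Z) * indicator K (e Z)) (Ad e y X) \<partial>lborel)"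
    by (subst nn_integral_chart) (auto simp: Theta_Ad exp_Ad)
  also have "\<dots> = ennreal a * (\<integral>\<^sup>+X. ennreal (Theta e X) * indicator K (e X) \<partial>lborel)"
    by (rule a(2)) measurable
  also have "\<dots> = ennreal a * emeasure \<mu>r K"
    by (subst nn_integral_chart[symmetric]) auto
  finally have "\<Delta> y = a"
    using K a by (rule_tac ennreal_mult_right_cancel[of _ "emeasure \<mu>r K"]) auto
  then show ?thesis using a(2)[OF assms] by simp
qed

sublocale conv: measure_action \<mu>r \<mu>r "\<lambda>y x. x * inverse y" "\<lambda>_. 1"
  by standard (auto simp: right_translate case_prod_beta)

sublocale cj: measure_action \<mu>r \<mu>r "\<lambda>y x. y * x * inverse y" \<Delta>
  by standard (auto simp: conj_translate case_prod_beta)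

sublocale leb: measure_action \<mu>r lborel "\<lambda>y X. Ad e y X" \<Delta>
  by standard (auto simp: Ad_translate case_prod_beta)

lemma group_convolution_act: "group_convolution \<mu>r f g = conv.act f g"
  by (simp add: group_convolution_def conv.act_def fun_eq_iff)

text \<open>In the chart \<open>\<mu>r\<close> has a density with respect to Lebesgue measure, so
  Lebesgue null sets have \<open>\<mu>r\<close>-null images.\<close>

lemma AE_chart:
  assumes "AE X in lborel. P (e X)"
  shows "AE x in \<mu>r. P x"
proof -
  obtain N where N: "{X. \<not> P (e X)} \<subseteq> N" "N \<in> null_sets lborel"
    using assms by (auto simp: eventually_ae_filter)
  have [measurable]: "N \<in> sets borel" using N(2) by auto
  have "AE X in lborel. X \<notin> N" using N(2) by (rule AE_not_in)
  have "(\<integral>\<^sup>+x. indicator N (lg x) \<partial>\<mu>r) = (\<integral>\<^sup>+X. ennreal (Theta e X) * indicator N X \<partial>lborel)"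
    by (subst nn_integral_chart) auto
  also have "\<dots> = integral\<^sup>N lborel (\<lambda>X :: real^'d. 0)"
    by (rule nn_integral_cong_AE, rule eventually_mono[OF \<open>AE X in lborel. X \<notin> N\<close>]) (simp add: indicator_def)
  finally have "AE x in \<mu>r. indicator N (lg x) = (0::ennreal)"
    by (intro nn_integral_0_iff_AE[THEN iffD1]) auto
  then show ?thesis
  proof eventually_elim
    fix x assume "indicator N (lg x) = (0::ennreal)"
    then show "P x" using N(1) by (auto simp: indicator_eq_0_iff) (metis exp_log mem_Collect_eq subsetD)
  qed
qed

lemma AE_mu_ex: "AE x in \<mu>r. P x \<Longrightarrow> \<exists>x. P x"
proof (rule ccontr)
  assume "AE x in \<mu>r. P x" "\<nexists>x. P x"
  then have "AE x in \<mu>r. x \<notin> space \<mu>r" by (auto elim: eventually_mono)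
  then have "emeasure \<mu>r (space \<mu>r) = 0" by (subst (asm) AE_iff_measurable[OF _ refl]) auto
  then show False using haar_like(2) by (simp add: haar_like_def)
qed

end

section \<open>The Duflo-Moore operator\<close>

lemma positive_selfadjointD:
  assumes "positive_selfadjoint V C"
  shows "csubspace V" "closure V = UNIV" "clinear_on V C"
    "\<And>\<phi>. \<phi> \<in> V \<Longrightarrow> 0 \<le> Re (cinner (C \<phi>) \<phi>)"
    "\<And>\<phi> \<psi>. \<phi> \<in> V \<Longrightarrow> \<psi> \<in> V \<Longrightarrow> cinner (C \<phi>) \<psi> = cinner \<phi> (C \<psi>)"
    "\<And>\<psi> \<eta>. (\<And>\<phi>. \<phi> \<in> V \<Longrightarrow> cinner (C \<phi>) \<psi> = cinner \<phi> \<eta>) \<Longrightarrow> \<psi> \<in> V \<and> C \<psi> = \<eta>"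
proof -
  show "csubspace V" "closure V = UNIV" "clinear_on V C"
    "\<And>\<phi>. \<phi> \<in> V \<Longrightarrow> 0 \<le> Re (cinner (C \<phi>) \<phi>)"
    "\<And>\<psi> \<eta>. (\<And>\<phi>. \<phi> \<in> V \<Longrightarrow> cinner (C \<phi>) \<psi> = cinner \<phi> \<eta>) \<Longrightarrow> \<psi> \<in> V \<and> C \<psi> = \<eta>"
    using assms unfolding positive_selfadjoint_def by blast+
  show "\<And>\<phi> \<psi>. \<phi> \<in> V \<Longrightarrow> \<psi> \<in> V \<Longrightarrow> cinner (C \<phi>) \<psi> = cinner \<phi> (C \<psi>)"
    using assms unfolding positive_selfadjoint_def by blast
qed

lemma csubspace_image:
  assumes "csubspace V" "clinear_on V C"
  shows "csubspace (C ` V)"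
  unfolding csubspace_def
proof (intro conjI ballI allI)
  show "0 \<in> C ` V" using csubspaceD(1)[OF assms(1)] clinear_on_zero_diff(1)[OF assms] by (metis imageI)
  show "v + w \<in> C ` V" if "v \<in> C ` V" "w \<in> C ` V" for v w
    using that clinear_onD(1)[OF assms(2)] csubspaceD(2)[OF assms(1)] by (smt (verit) image_iff)
  show "c *\<^sub>C v \<in> C ` V" if "v \<in> C ` V" for c v
    using that clinear_onD(2)[OF assms(2)] csubspaceD(3)[OF assms(1)] by (smt (verit) image_iff)
qed

lemma clinear_on_inv_into:
  assumes V: "csubspace V" and C: "clinear_on V C" and inj: "\<And>v. v \<in> V \<Longrightarrow> C v = 0 \<Longrightarrow> v = 0"
    and L: "clinear_on V L"
  shows "inj_on C V" "clinear_on (C ` V) (\<lambda>w. L (inv_into V C w))"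
    "\<And>v. v \<in> V \<Longrightarrow> inv_into V C (C v) = v"
proof -
  show ij: "inj_on C V"
  proof (rule inj_onI)
    fix v w assume "v \<in> V" "w \<in> V" "C v = C w"
    then have "v - w \<in> V" "C (v - w) = 0"
      using clinear_on_zero_diff(2)[OF V C] csubspaceD(4)[OF V] by auto
    then have "v - w = 0" by (rule inj)
    then show "v = w" by simp
  qed
  then show i: "inv_into V C (C v) = v" if "v \<in> V" for v using that by simp
  show "clinear_on (C ` V) (\<lambda>w. L (inv_into V C w))"
    unfolding clinear_on_def
  proof (intro conjI ballI allI; elim imageE; hypsubst)
    fix v w assume "v \<in> V" "w \<in> V"
    then show "L (inv_into V C (C v + C w)) = L (inv_into V C (C v)) + L (inv_into V C (C w))"
      using i[of "v + w"] i by (simp add: clinear_onD(1)[OF C] clinear_onD(1)[OF L] csubspaceD(2)[OF V] flip: clinear_onD(1)[OF C])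
  next
    fix c v assume "v \<in> V"
    then show "L (inv_into V C (c *\<^sub>C C v)) = c *\<^sub>C L (inv_into V C (C v))"
      using i[of "c *\<^sub>C v"] i by (simp add: clinear_onD(2)[OF L] csubspaceD(3)[OF V] flip: clinear_onD(2)[OF C])
  qed
qed

text \<open>A vector orthogonal to the range satisfies the adjoint relation with
  \<open>\<eta> = 0\<close>, so by self-adjointness it lies in \<open>V\<close> and in the kernel of
  \<open>C\<close>.\<close>

lemma positive_selfadjoint_range_dense:
  fixes V :: "'h::{chilbert_space, second_countable_topology} set"
  assumes psa: "positive_selfadjoint V C" and inj: "\<And>v. v \<in> V \<Longrightarrow> C v = 0 \<Longrightarrow> v = 0"
  shows "closure (C ` V) = UNIV" "(\<And>w. w \<in> C ` V \<Longrightarrow> cinner v w = 0) \<Longrightarrow> v = 0"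
proof -
  note D = positive_selfadjointD[OF psa]
  show tot: "v = 0" if "\<And>w. w \<in> C ` V \<Longrightarrow> cinner v w = 0" for v
  proof -
    have "cinner (C \<phi>) v = cinner \<phi> 0" if "\<phi> \<in> V" for \<phi>
      using \<open>\<And>w. w \<in> C ` V \<Longrightarrow> cinner v w = 0\<close>[of "C \<phi>"] that
      by (metis cinner_commute cinner_zero_right complex_cnj_zero imageI)
    then have "v \<in> V \<and> C v = 0" by (rule D(6))
    then show ?thesis using inj by blast
  qed
  show "closure (C ` V) = UNIV"
    using csubspace_image[OF D(1,3)] tot by (rule closure_total)
qed

text \<open>The quadratic form of \<open>C\<close> is nonnegative on the line
  \<open>v + s *\<^sub>R x\<close>, so its vanishing at \<open>v\<close> forces the linear
  coefficient in \<open>s\<close> to vanish. Density of \<open>V\<close> then allows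
  \<open>C v\<close> itself as test vector.\<close>

lemma positive_selfadjoint_kernel:
  assumes psa: "positive_selfadjoint V C" and v: "v \<in> V" and z: "Re (cinner (C v) v) = 0"
  shows "C v = 0"
proof -
  note D = positive_selfadjointD[OF psa]
  have r: "Re (cinner (C v) x) = 0" if x: "x \<in> V" for x
  proof -
    define b where "b = Re (cinner (C v) x)"
    define q where "q = Re (cinner (C x) x)"
    have le: "0 \<le> 2 * s * b + s\<^sup>2 * q" for s :: real
    proof -
      have sx: "s *\<^sub>R x \<in> V" using csubspaceD(5)[OF D(1) x] .
      have "C (s *\<^sub>R x) = s *\<^sub>R C x"
        using clinear_onD(2)[OF D(3) x] by (simp add: scaleR_scaleC)
      then have "C (v + s *\<^sub>R x) = C v + s *\<^sub>R C x"
        using clinear_onD(1)[OF D(3) v sx] by simp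
      then have "cinner (C (v + s *\<^sub>R x)) (v + s *\<^sub>R x)
          = cinner (C v) v + of_real s * cinner (C v) x + of_real s * cinner (C x) v + of_real (s\<^sup>2) * cinner (C x) x"
        by (simp add: cinner_add_left cinner_add_right cinner_scaleR_left cinner_scaleR_right
            power2_eq_square algebra_simps)
      moreover have "cinner (C x) v = cnj (cinner (C v) x)"
        using D(5)[OF x v] cinner_commute by metis
      ultimately have "Re (cinner (C (v + s *\<^sub>R x)) (v + s *\<^sub>R x)) = 2 * s * b + s\<^sup>2 * q"
        using z by (simp add: b_def q_def)
      then show ?thesis using D(4)[OF csubspaceD(2)[OF D(1) v sx]] by simp
    qed
    have q: "0 \<le> q" unfolding q_def using D(4)[OF x] .
    have "b = 0"
    proof (rule ccontr)
      assume b: "b \<noteq> 0"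
      \<comment> \<open>The minimizer would be \<open>- b / q\<close>; adding 1 avoids division by
        zero and still makes the value negative.\<close>
      define s where "s = - b / (q + 1)"
      have "2 * s * b + s\<^sup>2 * q = b\<^sup>2 / (q + 1) * (q / (q + 1) - 2)"
        using q by (simp add: s_def power2_eq_square divide_simps) (simp add: algebra_simps)
      moreover have "q / (q + 1) - 2 < 0" using q by (simp add: divide_simps)
      moreover have "0 < b\<^sup>2 / (q + 1)" using b q by simp
      ultimately have "2 * s * b + s\<^sup>2 * q < 0" by (metis mult_pos_neg)
      then show False using le[of s] by simp
    qed
    then show ?thesis by (simp add: b_def)
  qed
  have "Re (cinner (C v) x) = 0" for x
    by (rule dense_extend[OF D(2) _ r]) (intro closed_Collect_eq continuous_intros)
  from this[of "C v"] show ?thesis by (simp add: cinner_self)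
qed

text \<open>The partial isometry \<open>U\<close> with \<open>C' = U C\<close> is unitary and satisfies \<open>C U = U\<^sup>* C\<close>.  Therefore
  \<open>J = i (U - U\<^sup>*) / 2\<close> anticommutes with \<open>C\<close>, and \<open>\<langle>C \<phi>, (1 - J\<^sup>2)\<^sup>m \<phi>\<rangle> \<ge> m \<langle>C J \<phi>, J \<phi>\<rangle>\<close> stays bounded as
  \<open>m\<close> grows.  This forces \<open>J = 0\<close>, and then positivity of \<open>C'\<close> forces \<open>U = 1\<close>.\<close>

lemma positive_selfadjoint_unique:
  fixes V :: "'h::{chilbert_space, second_countable_topology} set"
  assumes C: "positive_selfadjoint V C" and C': "positive_selfadjoint V C'"
    and iso: "\<And>u v. u \<in> V \<Longrightarrow> v \<in> V \<Longrightarrow> cinner (C' u) (C' v) = cinner (C u) (C v)"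
    and inj: "\<And>v. v \<in> V \<Longrightarrow> C v = 0 \<Longrightarrow> v = 0"
    and v: "v \<in> V"
  shows "C' v = C v"
proof -
  note D = positive_selfadjointD[OF C] and D' = positive_selfadjointD[OF C']
  have nrm: "norm (C' u) = norm (C u)" if "u \<in> V" for u
  proof -
    have "complex_of_real ((norm (C' u))\<^sup>2) = of_real ((norm (C u))\<^sup>2)"
      using iso[OF that that] by (simp only: cinner_self)
    then have "(norm (C' u))\<^sup>2 = (norm (C u))\<^sup>2" using of_real_eq_iff by blast
    then show ?thesis by (simp add: power2_eq_iff_nonneg)
  qed
  have inj': "u = 0" if "u \<in> V" "C' u = 0" for u
    using nrm[OF that(1)] that(2) inj[OF that(1)] by simp
  have I: "clinear_on (C ` V) (\<lambda>w. C' (inv_into V C w))" "\<And>v. v \<in> V \<Longrightarrow> inv_into V C (C v) = v"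
    using clinear_on_inv_into[OF D(1,3) _ D'(3)] inj by blast+
  have I': "clinear_on (C' ` V) (\<lambda>w. C (inv_into V C' w))" "\<And>v. v \<in> V \<Longrightarrow> inv_into V C' (C' v) = v"
    using clinear_on_inv_into[OF D'(1,3) _ D(3)] inj' by blast+
  have R: "closure (C ` V) = UNIV" by (rule positive_selfadjoint_range_dense(1)[OF C]) (rule inj)
  have R': "closure (C' ` V) = UNIV" by (rule positive_selfadjoint_range_dense(1)[OF C']) (rule inj')
  have b: "norm (C' (inv_into V C w)) \<le> 1 * norm w" if "w \<in> C ` V" for w
    using that I(2) nrm by auto
  have b': "norm (C (inv_into V C' w)) \<le> 1 * norm w" if "w \<in> C' ` V" for w
    using that I'(2) nrm by auto
  \<comment> \<open>\<open>U\<close> and \<open>U'\<close> are given on the dense ranges by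
    \<open>C u \<mapsto> C' u\<close> and back; \<open>iso\<close> makes both isometric.\<close>
  obtain U :: "'h \<Rightarrow>\<^sub>L 'h" where Ul: "clinear_on UNIV U" and U0: "\<And>w. w \<in> C ` V \<Longrightarrow> U w = C' (inv_into V C w)"
    using bounded_clinear_extension[OF csubspace_image[OF D(1,3)] R I(1) b, where thesis = thesis] by blast
  obtain U' :: "'h \<Rightarrow>\<^sub>L 'h" where U'l: "clinear_on UNIV U'" and U'0: "\<And>w. w \<in> C' ` V \<Longrightarrow> U' w = C (inv_into V C' w)"
    using bounded_clinear_extension[OF csubspace_image[OF D'(1,3)] R' I'(1) b', where thesis = thesis] by blast
  have U: "U (C u) = C' u" if "u \<in> V" for u using U0[of "C u"] that I(2) by simp
  have U': "U' (C' u) = C u" if "u \<in> V" for u using U'0[of "C' u"] that I'(2) by simp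
  have UU': "U (U' x) = x" for x
    by (rule dense_extend[OF R']) (auto intro!: closed_Collect_eq continuous_intros simp: U U')
  have adj: "cinner (U x) y = cinner x (U' y)" for x y
  proof (rule dense_extend[OF R, where x = x])
    fix w assume "w \<in> C ` V"
    then obtain u where u: "u \<in> V" "w = C u" by blast
    show "cinner (U w) y = cinner w (U' y)"
    proof (rule dense_extend[OF R', where x = y])
      fix z assume "z \<in> C' ` V"
      then show "cinner (U w) z = cinner w (U' z)" using u iso by (auto simp: U U')
    qed (intro closed_Collect_eq continuous_intros)
  qed (intro closed_Collect_eq continuous_intros)
  have adj': "cinner (U' x) y = cinner x (U y)" for x y
    using adj[of y x] by (metis cinner_commute)
  \<comment> \<open>Self-adjointness in its strong form: satisfying the adjoint relation is enough
    for membership in \<open>V\<close>. Hence \<open>U\<close> and \<open>U'\<close> preserve the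
    domain.\<close>
  have VU': "U' p \<in> V \<and> C (U' p) = C' p" if p: "p \<in> V" for p
  proof (rule D(6))
    fix q assume "q \<in> V"
    then show "cinner (C q) (U' p) = cinner q (C' p)" using D'(5)[of q p] p by (simp add: U flip: adj)
  qed
  have VU: "U p \<in> V \<and> C' (U p) = C p" if p: "p \<in> V" for p
  proof (rule D'(6))
    fix q assume "q \<in> V"
    then show "cinner (C' q) (U p) = cinner q (C p)" using D(5)[of q p] p by (simp add: U' flip: adj')
  qed
  have CU: "C (U p) = U' (C p)" if "p \<in> V" for p
    using U'[of "U p"] VU[OF that] by simp
  have CU': "C (U' p) = U (C p)" if "p \<in> V" for p
    using VU'[OF that] U[OF that] by simp
  have nU: "norm (U x) \<le> norm x" for x
  proof (rule dense_extend[OF R, where x = x])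
    show "norm (U w) \<le> norm w" if "w \<in> C ` V" for w using that nrm by (auto simp: U)
  qed (intro closed_Collect_le continuous_intros)
  have nU': "norm (U' x) \<le> norm x" for x
  proof (rule dense_extend[OF R', where x = x])
    show "norm (U' w) \<le> norm w" if "w \<in> C' ` V" for w using that nrm by (auto simp: U')
  qed (intro closed_Collect_le continuous_intros)
  define J where "J x = (\<i> / 2) *\<^sub>C (U x - U' x)" for x
  have JV: "J p \<in> V" if "p \<in> V" for p
    unfolding J_def using VU[OF that] VU'[OF that] by (intro csubspaceD(3,4)[OF D(1)]) auto
  have CJ: "C (J p) = - J (C p)" if p: "p \<in> V" for p
  proof -
    have "C (J p) = (\<i> / 2) *\<^sub>C (U' (C p) - U (C p))"
      unfolding J_def using VU[OF p] VU'[OF p] CU[OF p] CU'[OF p]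
      by (subst clinear_onD(2)[OF D(3)]) (auto simp: clinear_on_zero_diff(2)[OF D(1,3)] csubspaceD(4)[OF D(1)])
    then show ?thesis by (simp add: J_def scaleC_diff_right)
  qed
  have Jadj: "cinner (J x) y = cinner x (J y)" for x y
    by (simp add: J_def cinner_scaleC_left cinner_scaleC_right cinner_diff_left cinner_diff_right adj adj' algebra_simps)
  have nJ: "norm (J x) \<le> norm x" for x
  proof -
    have "norm (J x) = norm (U x - U' x) / 2" by (simp add: J_def norm_scaleC norm_divide)
    also have "\<dots> \<le> (norm (U x) + norm (U' x)) / 2" by (intro divide_right_mono norm_triangle_ineq4) auto
    also have "\<dots> \<le> norm x" using nU[of x] nU'[of x] by simp
    finally show ?thesis .
  qed
  \<comment> \<open>\<open>J\<close> is symmetric of norm at most 1, so \<open>K\<close> is a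
    contraction; its powers keep \<open>t m p\<close> below a bound that does not depend on
    \<open>m\<close>.\<close>
  define K where "K x = x - J (J x)" for x
  have J_add: "J (x - y) = J x - J y" for x y
    by (simp add: J_def blinfun.diff_right scaleC_diff_right)
  have KJ: "(K ^^ m) (J x) = J ((K ^^ m) x)" for m x
    by (induction m) (simp_all add: K_def J_add)
  have nK: "norm (K x) \<le> norm x" for x
  proof -
    have "inner x (J (J x)) = (norm (J x))\<^sup>2"
      by (simp add: inner_cinner Jadj[symmetric] cinner_self)
    then have "(norm (K x))\<^sup>2 = (norm x)\<^sup>2 - 2 * (norm (J x))\<^sup>2 + (norm (J (J x)))\<^sup>2"
      by (simp add: K_def power2_norm_eq_inner inner_diff_left inner_diff_right inner_commute)
    moreover have "(norm (J (J x)))\<^sup>2 \<le> (norm (J x))\<^sup>2" by (intro power_mono nJ) auto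
    ultimately have "(norm (K x))\<^sup>2 \<le> (norm x)\<^sup>2" using zero_le_power2[of "norm (J x)"] by linarith
    then show ?thesis by (rule power2_le_imp_le) simp
  qed
  have nKm: "norm ((K ^^ m) x) \<le> norm x" for m x
    by (induction m) (auto intro: order_trans[OF nK])
  define t where "t m p = Re (cinner (C p) ((K ^^ m) p))" for m p
  \<comment> \<open>Moving one \<open>J\<close> past \<open>C\<close> changes the sign, so the
    subtracted \<open>J\<^sup>2\<close> becomes an added term at \<open>J p\<close>, and
    \<open>t\<close> grows by at least \<open>t 0 (J p)\<close> in each step.\<close>
  have step: "t (Suc m) p = t m p + t m (J p)" if p: "p \<in> V" for m p
  proof -
    have "cinner (C p) ((K ^^ Suc m) p) = cinner (C p) ((K ^^ m) p) - cinner (C p) (J (J ((K ^^ m) p)))"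
      by (simp add: K_def cinner_diff_right)
    also have "cinner (C p) (J (J ((K ^^ m) p))) = - cinner (C (J p)) ((K ^^ m) (J p))"
      by (simp add: CJ[OF p] KJ Jadj cinner_minus_left)
    finally show ?thesis by (simp add: t_def)
  qed
  have t0: "0 \<le> t 0 p" if "p \<in> V" for p
    using D(4)[OF that] by (simp add: t_def)
  have mono: "t 0 p \<le> t m p" if "p \<in> V" for m p
    using that
  proof (induction m arbitrary: p)
    case (Suc m)
    then show ?case
      using step[OF Suc(2), of m] Suc(1)[OF Suc(2)] Suc(1)[OF JV[OF Suc(2)]] t0[OF JV[OF Suc(2)]] by linarith
  qed simp
  have lower: "t 0 p + real m * t 0 (J p) \<le> t m p" if p: "p \<in> V" for m p
  proof (induction m)
    case (Suc m)
    then show ?case using step[OF p, of m] mono[OF JV[OF p], of m] by (simp add: algebra_simps)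
  qed simp
  have J0: "J p = 0" if p: "p \<in> V" for p
  proof -
    have upper: "t m p \<le> norm (C p) * norm p" for m
    proof -
      have "t m p \<le> cmod (cinner (C p) ((K ^^ m) p))" unfolding t_def by (rule complex_Re_le_cmod)
      also have "\<dots> \<le> norm (C p) * norm ((K ^^ m) p)" by (rule cmod_cinner_le)
      also have "\<dots> \<le> norm (C p) * norm p" by (intro mult_left_mono nKm) auto
      finally show ?thesis .
    qed
    have "t 0 (J p) \<le> 0"
    proof (rule ccontr)
      assume "\<not> t 0 (J p) \<le> 0"
      then obtain m where "norm (C p) * norm p < real m * t 0 (J p)"
        using reals_Archimedean3[of "t 0 (J p)"] by auto
      then show False using lower[OF p, of m] upper[of m] t0[OF p] by linarith
    qed
    then have "Re (cinner (C (J p)) (J p)) = 0"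
      using t0[OF JV[OF p]] by (simp add: t_def)
    then have "C (J p) = 0" by (rule positive_selfadjoint_kernel[OF C JV[OF p]])
    then show ?thesis by (rule inj[OF JV[OF p]])
  qed
  have UeqU': "U p = U' p" if "p \<in> V" for p
  proof -
    have "(\<i> / 2) *\<^sub>C (U p - U' p) = 0" using J0[OF that] by (simp add: J_def)
    then have "norm ((\<i> / 2) *\<^sub>C (U p - U' p)) = 0" by simp
    then show ?thesis by (simp add: norm_scaleC norm_divide)
  qed
  \<comment> \<open>Now \<open>U\<close> is an involution on \<open>V\<close>, so
    \<open>U x = - x\<close>. Then \<open>cinner (C' x) x = - cinner (C x) x\<close>, although both
    have nonnegative real part.\<close>
  define x where "x = v - U v"
  have xV: "x \<in> V" unfolding x_def using VU[OF v] v by (intro csubspaceD(4)[OF D(1)]) auto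
  have Ux: "U x = - x"
    using UU'[of v] UeqU'[OF v] by (simp add: x_def blinfun.diff_right)
  have "cinner (C' x) x = cinner (C x) (U' x)" using U[OF xV] by (simp flip: adj)
  also have "\<dots> = - cinner (C x) x" by (simp only: UeqU'[OF xV, symmetric] Ux cinner_minus_right)
  finally have "Re (cinner (C x) x) \<le> 0" using D'(4)[OF xV] by simp
  then have "Re (cinner (C x) x) = 0" using D(4)[OF xV] by simp
  then have "C x = 0" by (rule positive_selfadjoint_kernel[OF C xV])
  then have "x = 0" by (rule inj[OF xV])
  then have "U v = v" by (simp add: x_def)
  then show ?thesis using VU[OF v] by simp
qed

locale duflo_moore = haar_group e \<mu>l \<mu>r \<Delta>
  for e :: "real^'d \<Rightarrow> 'g::{group_mult, t2_space, second_countable_topology}"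
    and \<mu>l \<mu>r :: "'g measure" and \<Delta> :: "'g \<Rightarrow> real" +
  fixes \<pi> :: "'g \<Rightarrow> ('h::{chilbert_space, second_countable_topology} \<Rightarrow>\<^sub>L 'h)"
    and V :: "'h set" and C :: "'h \<Rightarrow> 'h"
  assumes unitary: "unitary_representation \<pi>"
    and duflo: "duflo_moore_inverse \<mu>r \<pi> V C"
begin

sublocale left: measure_action \<mu>r \<mu>r "\<lambda>y x. y * x" \<Delta>
  by standard (auto simp: left_translate case_prod_beta)

lemma pi_one [simp]: "\<pi> 1 v = v" and pi_mult: "\<pi> (x * y) v = \<pi> x (\<pi> y v)"
  and pi_clinear: "clinear_on UNIV (\<pi> x)" and pi_isometric: "cinner (\<pi> x v) (\<pi> x w) = cinner v w"
  and pi_continuous: "continuous_on UNIV (\<lambda>x. \<pi> x v)"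
  using unitary by (auto simp: unitary_representation_def)

lemma pi_inverse [simp]: "\<pi> (inverse x) (\<pi> x v) = v" "\<pi> x (\<pi> (inverse x) v) = v"
  by (simp_all flip: pi_mult)

lemma pi_adjoint: "cinner (\<pi> x v) w = cinner v (\<pi> (inverse x) w)"
  using pi_isometric[of x v "\<pi> (inverse x) w"] by simp

lemma pi_norm [simp]: "norm (\<pi> x v) = norm v"
proof -
  have "complex_of_real ((norm (\<pi> x v))\<^sup>2) = of_real ((norm v)\<^sup>2)"
    using pi_isometric[of x v v] by (simp only: cinner_self)
  then have "(norm (\<pi> x v))\<^sup>2 = (norm v)\<^sup>2" using of_real_eq_iff by blast
  then show ?thesis by (simp add: power2_eq_iff_nonneg)
qed

lemma pi_scaleC: "\<pi> x (c *\<^sub>C v) = c *\<^sub>C \<pi> x v"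
  using pi_clinear by (auto simp: clinear_on_def)

lemma cadjoint_pi: "cadjoint (\<pi> x) = \<pi> (inverse x)"
  by (rule cadjoint_eqI) (rule pi_adjoint)

lemma pi_continuous_compose [continuous_intros]:
  assumes "continuous_on A f"
  shows "continuous_on A (\<lambda>x. \<pi> (f x) v)"
  by (rule continuous_on_compose2[OF pi_continuous assms]) auto

lemma wavelet_eq: "wavelet \<pi> \<phi> \<psi> x = cinner (\<pi> x \<psi>) \<phi>"
  by (simp add: wavelet_def cadjoint_pi pi_adjoint)

lemma wavelet_measurable [measurable]: "wavelet \<pi> \<phi> \<psi> \<in> borel_measurable borel"
  unfolding wavelet_eq by (intro borel_measurable_continuous_onI continuous_intros)

lemma psa: "positive_selfadjoint V C"
  and wavelet_L2: "\<phi> \<in> V \<Longrightarrow> L2 \<mu>r (wavelet \<pi> \<phi> \<psi>)"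
  and wavelet_orthogonality: "\<phi>1 \<in> V \<Longrightarrow> \<phi>2 \<in> V \<Longrightarrow>
    (LINT x|\<mu>r. wavelet \<pi> \<phi>1 \<psi>1 x * cnj (wavelet \<pi> \<phi>2 \<psi>2 x)) = cinner \<psi>1 \<psi>2 * cnj (cinner (C \<phi>1) (C \<phi>2))"
  and admissible: "(\<And>\<psi>. L2 \<mu>r (wavelet \<pi> \<phi> \<psi>)) \<Longrightarrow> \<phi> \<in> V"
  using duflo unfolding duflo_moore_inverse_def by blast+

lemmas V_subspace = positive_selfadjointD(1)[OF psa]
  and C_clinear = positive_selfadjointD(3)[OF psa]

text \<open>By orthogonality all wavelet coefficients of \<open>\<phi>\<close> vanish almost
  everywhere. For a countable basis of vectors \<open>\<psi>\<close> they vanish at one common point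
  \<open>x\<close>, where \<open>\<pi> (inverse x) \<phi>\<close> is then orthogonal to the
  basis.\<close>

lemma C_injective:
  assumes \<phi>: "\<phi> \<in> V" "C \<phi> = 0"
  shows "\<phi> = 0"
proof -
  have "AE x in \<mu>r. wavelet \<pi> \<phi> \<psi> x = 0" for \<psi>
  proof -
    have "complex_of_real (LINT x|\<mu>r. (norm (wavelet \<pi> \<phi> \<psi> x))\<^sup>2) = (LINT x|\<mu>r. wavelet \<pi> \<phi> \<psi> x * cnj (wavelet \<pi> \<phi> \<psi> x))"
      by (subst integral_complex_of_real[symmetric]) (simp only: complex_norm_square)
    then have "(LINT x|\<mu>r. (norm (wavelet \<pi> \<phi> \<psi> x))\<^sup>2) = 0"
      using wavelet_orthogonality[OF \<phi>(1) \<phi>(1), of \<psi> \<psi>] \<phi>(2) by simp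
    moreover have "integrable \<mu>r (\<lambda>x. (norm (wavelet \<pi> \<phi> \<psi> x))\<^sup>2)"
      using wavelet_L2[OF \<phi>(1)] by (simp add: L2_def)
    ultimately have "AE x in \<mu>r. (norm (wavelet \<pi> \<phi> \<psi> x))\<^sup>2 = 0"
      by (subst (asm) integral_nonneg_eq_0_iff_AE) auto
    then show ?thesis by simp
  qed
  then have "AE x in \<mu>r. \<forall>\<psi>\<in>hs_basis. wavelet \<pi> \<phi> \<psi> x = 0"
    by (subst AE_ball_countable) (use hs_basis in \<open>auto simp: orthonormal_basis_iff intro: orthonormal_countable\<close>)
  then obtain x where x: "\<forall>\<psi>\<in>hs_basis. wavelet \<pi> \<phi> \<psi> x = 0" using AE_mu_ex by blast
  have "cinner (\<pi> (inverse x) \<phi>) \<psi> = 0" if "\<psi> \<in> hs_basis" for \<psi>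
    using x that by (metis cinner_commute complex_cnj_zero pi_adjoint wavelet_eq)
  then have "\<pi> (inverse x) \<phi> = 0"
    using hs_basis by (auto simp: orthonormal_basis_iff)
  then show ?thesis by (metis norm_eq_zero pi_norm)
qed

lemma CV_dense: "closure (C ` V) = UNIV"
  by (rule positive_selfadjoint_range_dense(1)[OF psa]) (rule C_injective)

lemma CV_total: "(\<And>w. w \<in> C ` V \<Longrightarrow> cinner v w = 0) \<Longrightarrow> v = 0"
  by (rule positive_selfadjoint_range_dense(2)[OF psa]) (rule C_injective, auto)

lemma CV_subspace: "csubspace (C ` V)"
  by (rule csubspace_image[OF V_subspace C_clinear])

lemma inv_C: "\<phi> \<in> V \<Longrightarrow> inv_into V C (C \<phi>) = \<phi>"
  by (rule clinear_on_inv_into(3)[OF V_subspace C_clinear _ C_clinear]) (auto intro: C_injective)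

lemma blinfun_eq_on_CV:
  fixes S T :: "'h \<Rightarrow>\<^sub>L 'h"
  assumes "\<And>\<phi>. \<phi> \<in> V \<Longrightarrow> S (C \<phi>) = T (C \<phi>)"
  shows "S = T"
proof (rule blinfun_eqI)
  show "S v = T v" for v
    by (rule dense_extend[OF CV_dense]) (use assms in \<open>auto intro!: closed_Collect_eq continuous_intros\<close>)
qed

subsection \<open>Semi-invariance\<close>

lemma wavelet_pi: "wavelet \<pi> (\<pi> y \<phi>) \<psi> x = wavelet \<pi> \<phi> \<psi> (inverse y * x)"
  by (simp add: wavelet_eq pi_mult) (metis inverse_inverse_mult pi_adjoint)

text \<open>Left translation only rescales \<open>\<mu>r\<close>, so the translated wavelets stay
  square integrable; and \<open>V\<close> contains every admissible vector.\<close>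

lemma V_invariant: "\<phi> \<in> V \<Longrightarrow> \<pi> y \<phi> \<in> V"
proof (rule admissible)
  fix \<psi> assume "\<phi> \<in> V"
  have "L2 \<mu>r (\<lambda>x. of_real (sqrt (\<Delta> (inverse y))) * (wavelet \<pi> \<phi> \<psi> (inverse y * x) / of_real (sqrt (\<Delta> (inverse y)))))"
    by (rule L2_mult_left) (rule left.scaled_translate, auto intro: wavelet_L2 \<open>\<phi> \<in> V\<close>)
  moreover have "of_real (sqrt (\<Delta> (inverse y))) * (wavelet \<pi> \<phi> \<psi> (inverse y * x) / of_real (sqrt (\<Delta> (inverse y))))
     = wavelet \<pi> (\<pi> y \<phi>) \<psi> x" for x
    using Delta_pos[of "inverse y"] by (simp add: wavelet_pi)
  ultimately show "L2 \<mu>r (wavelet \<pi> (\<pi> y \<phi>) \<psi>)" by simp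
qed

text \<open>The orthogonality relations express the product through an integral of wavelets, and the
  left translate of the integrand contributes \<open>\<Delta> (inverse y)\<close>. A nonzero
  \<open>\<psi>\<close> to divide by exists unless the space is zero.\<close>

lemma C_pi_cinner:
  assumes \<phi>: "\<phi>1 \<in> V" "\<phi>2 \<in> V"
  shows "cinner (C (\<pi> y \<phi>1)) (C (\<pi> y \<phi>2)) = of_real (1 / \<Delta> y) * cinner (C \<phi>1) (C \<phi>2)"
proof (cases "\<exists>\<psi>::'h. \<psi> \<noteq> 0")
  case True
  then obtain \<psi> :: 'h where \<psi>: "\<psi> \<noteq> 0" by blast
  define w where "w x = wavelet \<pi> \<phi>1 \<psi> x * cnj (wavelet \<pi> \<phi>2 \<psi> x)" for x
  have [measurable]: "w \<in> borel_measurable \<mu>r" unfolding w_def by measurable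
  have "cinner \<psi> \<psi> * cnj (cinner (C (\<pi> y \<phi>1)) (C (\<pi> y \<phi>2))) = (LINT x|\<mu>r. w (inverse y * x))"
    unfolding w_def using wavelet_orthogonality[OF V_invariant[OF \<phi>(1)] V_invariant[OF \<phi>(2)], of y \<psi> y \<psi>]
    by (simp add: wavelet_pi)
  also have "\<dots> = of_real (1 / \<Delta> y) * (LINT x|\<mu>r. w x)"
    by (subst left.integral_scale) (auto simp: Delta_inverse)
  also have "(LINT x|\<mu>r. w x) = cinner \<psi> \<psi> * cnj (cinner (C \<phi>1) (C \<phi>2))"
    unfolding w_def by (rule wavelet_orthogonality[OF \<phi>])
  finally have "cinner \<psi> \<psi> * cnj (cinner (C (\<pi> y \<phi>1)) (C (\<pi> y \<phi>2)))
      = cinner \<psi> \<psi> * cnj (of_real (1 / \<Delta> y) * cinner (C \<phi>1) (C \<phi>2))"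
    by (simp add: mult_ac)
  moreover have "cinner \<psi> \<psi> \<noteq> 0" using \<psi> by (simp add: cinner_self)
  ultimately show ?thesis by (metis complex_cnj_cancel_iff mult_cancel_left)
next
  case False
  then have "C (\<pi> y \<phi>1) = 0" "C \<phi>1 = 0" by auto
  then show ?thesis by simp
qed

text \<open>The operator \<open>C'\<close>, obtained from \<open>C\<close> by conjugation with
  \<open>\<pi> y\<close> and scaling by \<open>sqrt (\<Delta> y)\<close>, is again positive and
  self-adjoint on \<open>V\<close> and has the same products as \<open>C\<close>, so
  \<open>positive_selfadjoint_unique\<close> applies.\<close>

lemma C_pi:
  assumes "\<phi> \<in> V"
  shows "C (\<pi> y \<phi>) = (1 / sqrt (\<Delta> y)) *\<^sub>R \<pi> y (C \<phi>)"
proof -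
  define s where "s = sqrt (\<Delta> y)"
  have s: "s > 0" "s * s = \<Delta> y" by (simp_all add: s_def)
  define C' where "C' \<phi> = s *\<^sub>R \<pi> (inverse y) (C (\<pi> y \<phi>))" for \<phi>
  have C'c: "cinner (C' \<phi>) \<psi> = of_real s * cinner (C (\<pi> y \<phi>)) (\<pi> y \<psi>)" for \<phi> \<psi>
    by (simp add: C'_def cinner_scaleR_left pi_adjoint)
  note D = positive_selfadjointD[OF psa]
  have "positive_selfadjoint V C'"
    unfolding positive_selfadjoint_def
  proof (intro conjI allI ballI)
    show "csubspace V" "closure V = UNIV" by (fact D)+
    show "clinear_on V C'"
      unfolding clinear_on_def C'_def
      by (simp add: blinfun.add_right pi_scaleC clinear_onD[OF D(3)] V_invariant scaleR_add_right scaleC_scaleR_commute)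
    show "0 \<le> Re (cinner (C' \<phi>) \<phi>)" if "\<phi> \<in> V" for \<phi>
      using D(4)[OF V_invariant[OF that, of y]] s by (simp add: C'c)
    show "(\<forall>\<phi>\<in>V. cinner (C' \<phi>) \<psi> = cinner \<phi> \<eta>) \<longleftrightarrow> \<psi> \<in> V \<and> C' \<psi> = \<eta>" for \<psi> \<eta>
    proof
      assume *: "\<forall>\<phi>\<in>V. cinner (C' \<phi>) \<psi> = cinner \<phi> \<eta>"
      have "s *\<^sub>R \<pi> y \<psi> \<in> V \<and> C (s *\<^sub>R \<pi> y \<psi>) = \<pi> y \<eta>"
      proof (rule D(6))
        fix \<phi> assume "\<phi> \<in> V"
        then have "\<pi> (inverse y) \<phi> \<in> V" by (rule V_invariant)
        then have "cinner (C' (\<pi> (inverse y) \<phi>)) \<psi> = cinner (\<pi> (inverse y) \<phi>) \<eta>" using * by blast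
        then show "cinner (C \<phi>) (s *\<^sub>R \<pi> y \<psi>) = cinner \<phi> (\<pi> y \<eta>)"
          by (simp add: C'c cinner_scaleR_right pi_adjoint)
      qed
      then have 1: "s *\<^sub>R \<pi> y \<psi> \<in> V" "C (s *\<^sub>R \<pi> y \<psi>) = \<pi> y \<eta>" by auto
      have "\<pi> (inverse y) ((1 / s) *\<^sub>R (s *\<^sub>R \<pi> y \<psi>)) \<in> V"
        by (intro V_invariant csubspaceD(5)[OF D(1)] 1)
      then have 2: "\<psi> \<in> V" using s by simp
      have "C' \<psi> = \<pi> (inverse y) (C (s *\<^sub>R \<pi> y \<psi>))"
        using V_invariant[OF 2, of y] by (simp add: C'_def scaleR_scaleC clinear_onD[OF D(3)] pi_scaleC)
      then show "\<psi> \<in> V \<and> C' \<psi> = \<eta>" using 1 2 by simp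
    next
      assume *: "\<psi> \<in> V \<and> C' \<psi> = \<eta>"
      show "\<forall>\<phi>\<in>V. cinner (C' \<phi>) \<psi> = cinner \<phi> \<eta>"
      proof
        fix \<phi> assume "\<phi> \<in> V"
        then have "cinner (C' \<phi>) \<psi> = of_real s * cinner (\<pi> y \<phi>) (C (\<pi> y \<psi>))"
          using * by (simp add: C'c D(5) V_invariant)
        also have "\<dots> = cinner \<phi> (C' \<psi>)" by (simp add: C'_def cinner_scaleR_right pi_adjoint)
        finally show "cinner (C' \<phi>) \<psi> = cinner \<phi> \<eta>" using * by simp
      qed
    qed
  qed
  moreover have "cinner (C' u) (C' v) = cinner (C u) (C v)" if "u \<in> V" "v \<in> V" for u v
  proof -
    have "cinner (C' u) (C' v) = of_real (s * s) * cinner (C (\<pi> y u)) (C (\<pi> y v))"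
      by (simp add: C'_def cinner_scaleR_left cinner_scaleR_right pi_isometric)
    then show ?thesis
      using C_pi_cinner[OF that, of y] s less_imp_neq[OF Delta_pos[of y]] by simp
  qed
  ultimately have "C' \<phi> = C \<phi>"
    by (intro positive_selfadjoint_unique[OF psa]) (auto intro: C_injective assms)
  then have "\<pi> y (C \<phi>) = s *\<^sub>R C (\<pi> y \<phi>)"
    by (metis C'_def blinfun.scaleR_right pi_inverse(2))
  then show ?thesis using s by (simp add: s_def)
qed

section \<open>The inverse Fourier-Wigner transform\<close>

text \<open>The operator integral tested on \<open>\<eta> = C \<phi>\<close>: there the Duflo-Moore
  operator gives back \<open>\<phi>\<close>, and
  \<open>cinner (\<pi> (inverse x) \<phi>) \<psi>\<close> is the conjugate of the wavelet
  coefficient. In this form the transform makes sense for every square integrable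
  \<open>h\<close>.\<close>

definition fw_weak :: "('g \<Rightarrow> complex) \<Rightarrow> ('h \<Rightarrow>\<^sub>L 'h) \<Rightarrow> bool" where
  "fw_weak h S \<longleftrightarrow> (\<forall>\<phi>\<in>V. \<forall>\<psi>. cinner (S (C \<phi>)) \<psi> = (LINT x|\<mu>r. h x * cnj (wavelet \<pi> \<phi> \<psi> x)))"

lemma fw_weak_unique: "fw_weak h S \<Longrightarrow> fw_weak h T \<Longrightarrow> S = T"
  by (rule blinfun_eq_on_CV) (auto simp: fw_weak_def intro: cinner_eqI)

lemma fw_weak_cong_AE:
  assumes "AE x in \<mu>r. h x = h' x" "h \<in> borel_measurable borel" "h' \<in> borel_measurable borel"
  shows "fw_weak h S \<longleftrightarrow> fw_weak h' S"
proof -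
  note [measurable] = assms(2,3)
  have "(LINT x|\<mu>r. h x * cnj (wavelet \<pi> \<phi> \<psi> x)) = (LINT x|\<mu>r. h' x * cnj (wavelet \<pi> \<phi> \<psi> x))" for \<phi> \<psi>
    by (rule integral_cong_AE) (use assms(1) in auto)
  then show ?thesis by (simp add: fw_weak_def)
qed

lemma l2norm_wavelet:
  assumes "\<phi> \<in> V"
  shows "l2norm \<mu>r (wavelet \<pi> \<phi> \<psi>) = norm \<psi> * norm (C \<phi>)"
proof -
  have "complex_of_real (LINT x|\<mu>r. (norm (wavelet \<pi> \<phi> \<psi> x))\<^sup>2) = (LINT x|\<mu>r. wavelet \<pi> \<phi> \<psi> x * cnj (wavelet \<pi> \<phi> \<psi> x))"
    by (subst integral_complex_of_real[symmetric]) (simp only: complex_norm_square)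
  also have "\<dots> = of_real ((norm \<psi> * norm (C \<phi>))\<^sup>2)"
    unfolding wavelet_orthogonality[OF assms assms] by (simp add: cinner_self power_mult_distrib)
  finally have "(LINT x|\<mu>r. (norm (wavelet \<pi> \<phi> \<psi> x))\<^sup>2) = (norm \<psi> * norm (C \<phi>))\<^sup>2"
    using of_real_eq_iff by blast
  then show ?thesis by (simp add: l2norm_def)
qed

lemma L2_sum: "(\<And>i. i \<in> I \<Longrightarrow> L2 M (u i)) \<Longrightarrow> L2 M (\<lambda>x. \<Sum>i\<in>I. u i x)"
proof (induction I rule: infinite_finite_induct)
  case (insert i I)
  then show ?case by (simp add: L2_add)
qed (simp_all add: L2_def)

text \<open>Testing \<open>h\<close> against \<open>\<Sum> W\<^sub>\<phi>(S \<eta>)\<close>, whose norm is known by the orthogonality relations.\<close>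

lemma fw_weak_hs_bound:
  assumes h: "L2 \<mu>r h" and S: "clinear_on UNIV (blinfun_apply S)" "fw_weak h S"
  shows "hilbert_schmidt S" "hs_norm S \<le> l2norm \<mu>r h"
proof -
  obtain B where B: "B \<subseteq> C ` V" "orthonormal_basis B"
    using orthonormal_basis_in_total[OF CV_subspace CV_total] by blast
  have "(\<Sum>b\<in>F. (norm (S b))\<^sup>2) \<le> (l2norm \<mu>r h)\<^sup>2" if F: "finite F" "F \<subseteq> B" for F
  proof -
    \<comment> \<open>Basis vectors in the range of \<open>C\<close> have preimages in the domain,
      so their wavelets are square integrable.\<close>
    define p where "p b = inv_into V C b" for b
    have p: "p b \<in> V" "C (p b) = b" if "b \<in> F" for b
      using that F B by (auto simp: p_def inv_into_into f_inv_into_f subset_iff)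
    define W where "W b = wavelet \<pi> (p b) (S b)" for b
    define u where "u x = (\<Sum>b\<in>F. W b x)" for x
    have L: "L2 \<mu>r (W b)" if "b \<in> F" for b
      unfolding W_def using p[OF that] by (intro wavelet_L2)
    have Lu: "L2 \<mu>r u" unfolding u_def by (intro L2_sum L)
    define s where "s = (\<Sum>b\<in>F. (norm (S b))\<^sup>2)"
    have s0: "0 \<le> s" by (simp add: s_def sum_nonneg)
    have oF: "orthonormal F" using F B by (auto simp: orthonormal_basis_iff intro: orthonormal_subset)
    have "complex_of_real (LINT x|\<mu>r. (norm (u x))\<^sup>2) = (LINT x|\<mu>r. u x * cnj (u x))"
      by (subst integral_complex_of_real[symmetric]) (simp only: complex_norm_square)
    also have "\<dots> = (LINT x|\<mu>r. (\<Sum>b\<in>F. \<Sum>b'\<in>F. W b x * cnj (W b' x)))"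
      by (simp add: u_def sum_product)
    also have "\<dots> = (\<Sum>b\<in>F. \<Sum>b'\<in>F. LINT x|\<mu>r. W b x * cnj (W b' x))"
      using L by (simp add: Bochner_Integration.integral_sum L2_integrable_mult L2_cnj)
    \<comment> \<open>The orthogonality relations contribute
      \<open>cinner (C (p b)) (C (p b'))\<close>, up to conjugation; this is
      \<open>cinner b b'\<close>, so only the diagonal survives.\<close>
    also have "\<dots> = (\<Sum>b\<in>F. \<Sum>b'\<in>F. cinner (S b) (S b') * (if b = b' then 1 else 0))"
    proof (intro sum.cong refl)
      fix b b' assume b: "b \<in> F" "b' \<in> F"
      then have "cinner b b' = (if b = b' then 1 else 0)" using oF by (simp add: orthonormal_def)
      then show "(LINT x|\<mu>r. W b x * cnj (W b' x)) = cinner (S b) (S b') * (if b = b' then 1 else 0)"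
        unfolding W_def by (simp add: wavelet_orthogonality p b)
    qed
    also have "\<dots> = (\<Sum>b\<in>F. cinner (S b) (S b))"
      using F by (simp add: if_distrib[of "\<lambda>z. _ * z"] cong: if_cong)
    also have "\<dots> = of_real s" by (simp add: s_def cinner_self)
    finally have "(LINT x|\<mu>r. (norm (u x))\<^sup>2) = s" using of_real_eq_iff by blast
    then have nu: "l2norm \<mu>r u = sqrt s" by (simp add: l2norm_def)
    have "complex_of_real s = (\<Sum>b\<in>F. cinner (S (C (p b))) (S b))"
      by (simp add: s_def cinner_self p)
    also have "\<dots> = (\<Sum>b\<in>F. LINT x|\<mu>r. h x * cnj (W b x))"
      using S(2) p(1) by (intro sum.cong refl) (simp add: fw_weak_def W_def)
    also have "\<dots> = (LINT x|\<mu>r. h x * cnj (u x))"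
      using h L by (simp add: u_def sum_distrib_left Bochner_Integration.integral_sum L2_integrable_mult L2_cnj)
    finally have "s = norm (LINT x|\<mu>r. h x * cnj (u x))" using s0 by (metis abs_of_nonneg norm_of_real)
    also have "\<dots> \<le> l2norm \<mu>r h * sqrt s"
      using L2_integral_mult_le[OF h L2_cnj[OF Lu]] by (simp add: l2norm_cnj nu)
    finally have "sqrt s * sqrt s \<le> l2norm \<mu>r h * sqrt s" using s0 by simp
    then have "sqrt s \<le> l2norm \<mu>r h"
    proof (cases "s = 0")
      case False
      with s0 have "0 < sqrt s" by simp
      with \<open>sqrt s * sqrt s \<le> l2norm \<mu>r h * sqrt s\<close> show ?thesis by (rule mult_right_le_imp_le)
    qed simp
    then have "(sqrt s)\<^sup>2 \<le> (l2norm \<mu>r h)\<^sup>2" using s0 by (intro power_mono) auto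
    then show ?thesis using s0 by (simp add: s_def)
  qed
  then show "hilbert_schmidt S" "hs_norm S \<le> l2norm \<mu>r h"
    using hs_norm_le[OF S(1) B(2), of "l2norm \<mu>r h"] by auto
qed

text \<open>For fixed \<open>\<phi>\<close> the pairing is antilinear in \<open>\<psi>\<close>, so
  Riesz representation is applied to its conjugate \<open>l\<close>. Since wavelets have norm
  \<open>norm \<psi> * norm (C \<phi>)\<close>, the representing vector is a bounded function of
  \<open>C \<phi>\<close> and extends from the dense range.\<close>

lemma fw_weak_exists:
  assumes h: "L2 \<mu>r h"
  shows "\<exists>S. clinear_on UNIV (blinfun_apply S) \<and> fw_weak h S"
proof -
  have "\<exists>r. (\<forall>\<psi>. (LINT x|\<mu>r. h x * cnj (wavelet \<pi> \<phi> \<psi> x)) = cinner r \<psi>) \<and> norm r \<le> l2norm \<mu>r h * norm (C \<phi>)"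
    if \<phi>: "\<phi> \<in> V" for \<phi>
  proof -
    define l where "l \<psi> = (LINT x|\<mu>r. wavelet \<pi> \<phi> \<psi> x * cnj (h x))" for \<psi>
    have i: "integrable \<mu>r (\<lambda>x. wavelet \<pi> \<phi> \<psi> x * cnj (h x))" for \<psi>
      by (intro L2_integrable_mult wavelet_L2 \<phi> L2_cnj h)
    have "l (x + y) = l x + l y" for x y
      using i[of x] i[of y]
      by (simp add: l_def wavelet_eq blinfun.add_right cinner_add_left distrib_right)
    moreover have "l (c *\<^sub>C x) = c * l x" for c x
      by (simp add: l_def wavelet_eq pi_scaleC cinner_scaleC_left mult.assoc)
    moreover have "cmod (l x) \<le> (l2norm \<mu>r h * norm (C \<phi>)) * norm x" for x
      using L2_integral_mult_le[OF wavelet_L2[OF \<phi>] L2_cnj[OF h], of x]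
      by (simp add: l_def l2norm_cnj l2norm_wavelet[OF \<phi>] mult_ac)
    ultimately obtain r where r: "\<And>x. l x = cinner x r" "norm r \<le> \<bar>l2norm \<mu>r h * norm (C \<phi>)\<bar>"
      by (rule riesz_representation) blast
    have "(LINT x|\<mu>r. h x * cnj (wavelet \<pi> \<phi> \<psi> x)) = cnj (l \<psi>)" for \<psi>
      by (simp add: l_def mult.commute flip: Bochner_Integration.integral_cnj)
    then have "(LINT x|\<mu>r. h x * cnj (wavelet \<pi> \<phi> \<psi> x)) = cinner r \<psi>" for \<psi>
      using r(1) by (metis cinner_commute)
    then show ?thesis using r(2) by auto
  qed
  then obtain r where r: "\<And>\<phi> \<psi>. \<phi> \<in> V \<Longrightarrow> (LINT x|\<mu>r. h x * cnj (wavelet \<pi> \<phi> \<psi> x)) = cinner (r \<phi>) \<psi>"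
    and nr: "\<And>\<phi>. \<phi> \<in> V \<Longrightarrow> norm (r \<phi>) \<le> l2norm \<mu>r h * norm (C \<phi>)" by metis
  have i: "integrable \<mu>r (\<lambda>x. h x * cnj (wavelet \<pi> \<phi> \<psi> x))" if "\<phi> \<in> V" for \<phi> \<psi>
    by (intro L2_integrable_mult wavelet_L2 that L2_cnj h)
  have rl: "clinear_on V r"
    unfolding clinear_on_def
  proof (intro conjI ballI allI)
    fix v w assume v: "v \<in> V" "w \<in> V"
    show "r (v + w) = r v + r w"
      by (rule cinner_eqI) (use v csubspaceD(2)[OF V_subspace v] i in
        \<open>simp add: cinner_add_left wavelet_eq cinner_add_right distrib_left flip: r\<close>)
  next
    fix c v assume v: "v \<in> V"
    have "cinner (r (c *\<^sub>C v)) z = c * (LINT x|\<mu>r. h x * cnj (wavelet \<pi> v z x))" for z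
      unfolding r[OF csubspaceD(3)[OF V_subspace v], symmetric] integral_mult_right_zero[symmetric]
      by (simp add: wavelet_eq cinner_scaleC_right mult_ac)
    then show "r (c *\<^sub>C v) = c *\<^sub>C r v"
      by (intro cinner_eqI) (simp add: r[OF v] cinner_scaleC_left)
  qed
  have "clinear_on (C ` V) (\<lambda>w. r (inv_into V C w))"
    by (rule clinear_on_inv_into(2)[OF V_subspace C_clinear _ rl]) (rule C_injective)
  moreover have "norm (r (inv_into V C w)) \<le> l2norm \<mu>r h * norm w" if "w \<in> C ` V" for w
    using that by (auto simp: inv_C nr)
  ultimately obtain S :: "'h \<Rightarrow>\<^sub>L 'h" where S: "clinear_on UNIV S" "\<And>w. w \<in> C ` V \<Longrightarrow> S w = r (inv_into V C w)"
    using bounded_clinear_extension[OF CV_subspace CV_dense, where thesis = thesis] by blast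
  have "S (C \<phi>) = r \<phi>" if "\<phi> \<in> V" for \<phi> using S(2)[of "C \<phi>"] that by (simp add: inv_C)
  then show ?thesis using S(1) r by (auto simp: fw_weak_def)
qed

lemma fw_inverse_integrable_iff:
  assumes h: "integrable \<mu>r h"
  shows "fw_inverse_integrable \<mu>r \<pi> V C h S \<longleftrightarrow> hilbert_schmidt S \<and> fw_weak h S"
proof -
  have [measurable]: "h \<in> borel_measurable borel" using h by (simp add: integrable_iff_bounded measurable_mu)
  have int: "integrable \<mu>r (\<lambda>x. h x *\<^sub>C \<pi> (inverse x) \<phi>)" for \<phi>
  proof (rule Bochner_Integration.integrable_bound)
    show "integrable \<mu>r (\<lambda>x. norm (h x) * norm \<phi>)" using h by (intro integrable_mult_left integrable_norm)
    have [measurable]: "(\<lambda>x. \<pi> (inverse x) \<phi>) \<in> borel_measurable borel"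
      by (intro borel_measurable_continuous_onI continuous_intros)
    have "(\<lambda>x. h x *\<^sub>C \<pi> (inverse x) \<phi>) \<in> borel_measurable borel"
      by (rule borel_measurable_continuous_Pair[where H = "\<lambda>c v. c *\<^sub>C v"]) (measurable, intro continuous_intros)
    then show "(\<lambda>x. h x *\<^sub>C \<pi> (inverse x) \<phi>) \<in> borel_measurable \<mu>r" by simp
  qed (simp add: norm_scaleC)
  have "cinner (LINT x|\<mu>r. h x *\<^sub>C \<pi> (inverse x) \<phi>) \<psi> = (LINT x|\<mu>r. h x * cnj (wavelet \<pi> \<phi> \<psi> x))" for \<phi> \<psi>
  proof -
    have bl: "bounded_linear (\<lambda>v. cinner v \<psi>)"
      by (rule bounded_bilinear.bounded_linear_left[OF bounded_bilinear_cinner])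
    have "cinner (LINT x|\<mu>r. h x *\<^sub>C \<pi> (inverse x) \<phi>) \<psi> = (LINT x|\<mu>r. cinner (h x *\<^sub>C \<pi> (inverse x) \<phi>) \<psi>)"
      by (rule integral_bounded_linear[OF bl int, symmetric])
    also have "\<dots> = (LINT x|\<mu>r. h x * cnj (wavelet \<pi> \<phi> \<psi> x))"
      by (simp add: cinner_scaleC_left wavelet_eq pi_adjoint[of "inverse _"] flip: cinner_commute)
    finally show ?thesis .
  qed
  then have "S (C \<phi>) = (LINT x|\<mu>r. h x *\<^sub>C \<pi> (inverse x) \<phi>) \<longleftrightarrow>
      (\<forall>\<psi>. cinner (S (C \<phi>)) \<psi> = (LINT x|\<mu>r. h x * cnj (wavelet \<pi> \<phi> \<psi> x)))" for \<phi>
    by (auto intro: cinner_eqI)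
  then show ?thesis
    unfolding fw_inverse_integrable_def fw_weak_def by (auto simp: inv_C)
qed

text \<open>The description \<open>THE\<close> has a solution, found by cutting \<open>h\<close> off
  outside compact sets, and only one, because \<open>fw_weak\<close> survives Hilbert-Schmidt limits
  of the operators together with L2 limits of the functions.\<close>

lemma fw_inverse_eqI:
  assumes h: "L2 \<mu>r h" and S: "hilbert_schmidt S" "fw_weak h S"
  shows "fw_inverse \<mu>r \<pi> V C h = S"
  unfolding fw_inverse_def
proof (rule the_equality, intro conjI S(1))
  note [measurable] = L2_measurable[OF h]
  define A where "A k = e ` cball 0 (real k)" for k :: nat
  have A [measurable]: "A k \<in> sets \<mu>r" for k
    unfolding A_def sets_mu by (intro borel_closed compact_imp_closed compact_exp_cball)
  have ev: "\<forall>\<^sub>F k in sequentially. x \<in> A k" for x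
  proof -
    obtain n where n: "norm (lg x) \<le> real n" using real_arch_simple by blast
    have "x \<in> A k" if "k \<ge> n" for k
      unfolding A_def using n that by (intro image_eqI[of _ _ "lg x"]) auto
    then show ?thesis by (auto simp: eventually_sequentially)
  qed
  define hs where "hs k x = h x * indicator (A k) x" for k x
  have L: "L2 \<mu>r (hs k)" and T: "L2_tendsto \<mu>r hs h" for k
    unfolding hs_def using L2_truncate[OF h A ev] by simp_all
  have i: "integrable \<mu>r (hs k)" for k
  proof -
    have "emeasure \<mu>r (A k) < \<infinity>"
      using haar_like(2) compact_exp_cball unfolding A_def haar_like_def by blast
    moreover have "ennreal ((cmod (indicator (A k) x))\<^sup>2) = indicator (A k) x" for x
      by (simp split: split_indicator)
    ultimately have "L2 \<mu>r (\<lambda>x. indicator (A k) x)" by (simp add: L2_iff nn_integral_indicator[OF A])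
    then show ?thesis unfolding hs_def by (rule L2_integrable_mult[OF h])
  qed
  have "\<exists>S. hilbert_schmidt S \<and> fw_weak (hs k) S" for k
    using fw_weak_exists[OF L[of k]] fw_weak_hs_bound[OF L[of k]] by blast
  then obtain Ss where Ss: "\<And>k. hilbert_schmidt (Ss k)" "\<And>k. fw_weak (hs k) (Ss k)" by metis
  have weak_diff: "fw_weak (\<lambda>x. a x - b x) (P - Q)" if "fw_weak a P" "fw_weak b Q" "L2 \<mu>r a" "L2 \<mu>r b" for a b P Q
    unfolding fw_weak_def
  proof (intro ballI allI)
    fix \<phi> \<psi> assume \<phi>: "\<phi> \<in> V"
    have "integrable \<mu>r (\<lambda>x. a x * cnj (wavelet \<pi> \<phi> \<psi> x))" "integrable \<mu>r (\<lambda>x. b x * cnj (wavelet \<pi> \<phi> \<psi> x))"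
      by (intro L2_integrable_mult that L2_cnj wavelet_L2 \<phi>)+
    then show "cinner ((P - Q) (C \<phi>)) \<psi> = (LINT x|\<mu>r. (a x - b x) * cnj (wavelet \<pi> \<phi> \<psi> x))"
      using that(1,2) \<phi> by (simp add: fw_weak_def blinfun.diff_left cinner_diff_left left_diff_distrib)
  qed
  have conv: "(\<lambda>k. hs_norm (Ss k - S)) \<longlonglongrightarrow> 0"
  proof (rule tendsto_sandwich[OF _ _ tendsto_const])
    show "(\<lambda>k. l2norm \<mu>r (\<lambda>x. hs k x - h x)) \<longlonglongrightarrow> 0" using T L2_tendsto_iff[of \<mu>r hs h] L h by blast
    show "\<forall>\<^sub>F k in sequentially. hs_norm (Ss k - S) \<le> l2norm \<mu>r (\<lambda>x. hs k x - h x)"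
      using Ss S L h by (intro always_eventually allI fw_weak_hs_bound(2) L2_diff weak_diff)
        (auto intro!: clinear_on_blinfun_add simp: hilbert_schmidt_iff)
  qed simp
  show "\<exists>fs Ss. (\<forall>k. integrable \<mu>r (fs k) \<and> L2 \<mu>r (fs k) \<and> fw_inverse_integrable \<mu>r \<pi> V C (fs k) (Ss k)) \<and>
      L2_tendsto \<mu>r fs h \<and> (\<lambda>k. hs_norm (Ss k - S)) \<longlonglongrightarrow> 0"
    using i L T conv Ss by (intro exI[of _ hs] exI[of _ Ss]) (simp add: fw_inverse_integrable_iff)
next
  fix S' assume S': "hilbert_schmidt S' \<and> (\<exists>fs Ss. (\<forall>k. integrable \<mu>r (fs k) \<and> L2 \<mu>r (fs k) \<and>
    fw_inverse_integrable \<mu>r \<pi> V C (fs k) (Ss k)) \<and> L2_tendsto \<mu>r fs h \<and> (\<lambda>k. hs_norm (Ss k - S')) \<longlonglongrightarrow> 0)"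
  then obtain fs Ss where *: "\<And>k. integrable \<mu>r (fs k) \<and> L2 \<mu>r (fs k) \<and> fw_inverse_integrable \<mu>r \<pi> V C (fs k) (Ss k)"
    and T: "L2_tendsto \<mu>r fs h" and conv: "(\<lambda>k. hs_norm (Ss k - S')) \<longlonglongrightarrow> 0" by blast
  have fs: "L2 \<mu>r (fs k)" "hilbert_schmidt (Ss k)" "fw_weak (fs k) (Ss k)" for k
    using *[of k] fw_inverse_integrable_iff[of "fs k" "Ss k"] by auto
  have "fw_weak h S'"
    unfolding fw_weak_def
  proof (intro ballI allI)
    fix \<phi> \<psi> assume \<phi>: "\<phi> \<in> V"
    have "(\<lambda>k. Ss k (C \<phi>) - S' (C \<phi>)) \<longlonglongrightarrow> 0"
    proof (rule Lim_null_comparison)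
      show "(\<lambda>k. hs_norm (Ss k - S') * norm (C \<phi>)) \<longlonglongrightarrow> 0" using conv by (rule tendsto_mult_left_zero)
      show "\<forall>\<^sub>F k in sequentially. norm (Ss k (C \<phi>) - S' (C \<phi>)) \<le> hs_norm (Ss k - S') * norm (C \<phi>)"
        using norm_le_hs_norm[OF hilbert_schmidt_diff[OF fs(2)], of S'] S' by (simp add: blinfun.diff_left)
    qed
    then have "(\<lambda>k. Ss k (C \<phi>)) \<longlonglongrightarrow> S' (C \<phi>)" by (rule LIM_zero_cancel)
    then have l1: "(\<lambda>k. cinner (Ss k (C \<phi>)) \<psi>) \<longlonglongrightarrow> cinner (S' (C \<phi>)) \<psi>"
      by (intro tendsto_cinner tendsto_const)
    have l2: "(\<lambda>k. LINT x|\<mu>r. fs k x * cnj (wavelet \<pi> \<phi> \<psi> x)) \<longlonglongrightarrow> (LINT x|\<mu>r. h x * cnj (wavelet \<pi> \<phi> \<psi> x))"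
      by (intro L2_tendsto_integral fs(1) h T L2_cnj wavelet_L2 \<phi>)
    have "cinner (Ss k (C \<phi>)) \<psi> = (LINT x|\<mu>r. fs k x * cnj (wavelet \<pi> \<phi> \<psi> x))" for k
      using fs(3)[of k] \<phi> by (simp add: fw_weak_def)
    from LIMSEQ_unique_eq[OF l1 this l2]
    show "cinner (S' (C \<phi>)) \<psi> = (LINT x|\<mu>r. h x * cnj (wavelet \<pi> \<phi> \<psi> x))" .
  qed
  then show "S' = S" using S(2) fw_weak_unique by blast
qed

lemma fw_inverse:
  assumes h: "L2 \<mu>r h"
  shows "hilbert_schmidt (fw_inverse \<mu>r \<pi> V C h)" "fw_weak h (fw_inverse \<mu>r \<pi> V C h)"
proof -
  obtain S where "clinear_on UNIV (blinfun_apply S)" "fw_weak h S" using fw_weak_exists[OF h] by blast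
  then have S: "hilbert_schmidt S" "fw_weak h S" using fw_weak_hs_bound[OF h] by auto
  then show "hilbert_schmidt (fw_inverse \<mu>r \<pi> V C h)" "fw_weak h (fw_inverse \<mu>r \<pi> V C h)"
    using fw_inverse_eqI[OF h S] by auto
qed

text \<open>Conjugating \<open>h\<close> conjugates the operator; the two modular factors, from the change of variables
  and from the semi-invariance of \<open>C\<close>, combine to the normalization in the action.\<close>

lemma fw_weak_conj:
  assumes h: "L2 \<mu>r h" and S: "fw_weak h S" and \<phi>: "\<phi> \<in> V"
  shows "(LINT x|\<mu>r. (h (y * x * inverse y) / of_real (sqrt (\<Delta> y))) * cnj (wavelet \<pi> \<phi> \<psi> x))
    = cinner (S (\<pi> y (C \<phi>))) (\<pi> y \<psi>)"
proof -
  have [measurable]: "h \<in> borel_measurable borel" using L2_measurable[OF h] by (simp add: measurable_mu)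
  define w where "w x = (h x / of_real (sqrt (\<Delta> y))) * cnj (wavelet \<pi> (\<pi> y \<phi>) (\<pi> y \<psi>) x)" for x
  have [measurable]: "w \<in> borel_measurable \<mu>r" unfolding w_def by measurable
  have s: "sqrt (\<Delta> y) > 0" "sqrt (\<Delta> y) * sqrt (\<Delta> y) = \<Delta> y" by simp_all
  have "(LINT x|\<mu>r. (h (y * x * inverse y) / of_real (sqrt (\<Delta> y))) * cnj (wavelet \<pi> \<phi> \<psi> x)) = (LINT x|\<mu>r. w (y * x * inverse y))"
    by (simp add: w_def wavelet_eq pi_mult pi_isometric)
  also have "\<dots> = of_real (\<Delta> y) * (LINT x|\<mu>r. w x)"
    by (rule cj.integral_scale) auto
  also have "(LINT x|\<mu>r. w x) = (LINT x|\<mu>r. (1 / of_real (sqrt (\<Delta> y))) * (h x * cnj (wavelet \<pi> (\<pi> y \<phi>) (\<pi> y \<psi>) x)))"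
    by (simp add: w_def)
  also have "\<dots> = (1 / of_real (sqrt (\<Delta> y))) * cinner (S (C (\<pi> y \<phi>))) (\<pi> y \<psi>)"
    using S V_invariant[OF \<phi>, of y] by (simp only: integral_mult_right_zero fw_weak_def)
  also have "cinner (S (C (\<pi> y \<phi>))) (\<pi> y \<psi>) = (1 / of_real (sqrt (\<Delta> y))) * cinner (S (\<pi> y (C \<phi>))) (\<pi> y \<psi>)"
    by (simp add: C_pi[OF \<phi>] blinfun.scaleR_right cinner_scaleR_left)
  also have "of_real (\<Delta> y) * ((1 / of_real (sqrt (\<Delta> y))) * ((1 / of_real (sqrt (\<Delta> y))) * z)) = z" for z :: complex
  proof -
    have "of_real (\<Delta> y) * ((1 / of_real (sqrt (\<Delta> y))) * ((1 / of_real (sqrt (\<Delta> y))) * z))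
        = complex_of_real (\<Delta> y / (sqrt (\<Delta> y) * sqrt (\<Delta> y))) * z"
      by (simp only: of_real_divide of_real_mult times_divide_eq_left times_divide_eq_right mult_1_left divide_divide_eq_left mult.assoc)
    also have "\<Delta> y / (sqrt (\<Delta> y) * sqrt (\<Delta> y)) = 1" unfolding s(2) using Delta_pos[of y] by (metis less_numeral_extra(3) divide_self)
    finally show ?thesis by simp
  qed
  finally show ?thesis .
qed

lemma fw_act_weak:
  assumes f: "integrable \<mu>r f" and h: "L2 \<mu>r h" and S: "fw_weak h S" and T: "fw_weak (cj.act f h) T" and \<phi>: "\<phi> \<in> V"
  shows "cinner (T (C \<phi>)) \<psi> = (LINT y|\<mu>r. f y * cinner (S (\<pi> y (C \<phi>))) (\<pi> y \<psi>))"
proof -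
  have "cinner (T (C \<phi>)) \<psi> = (LINT x|\<mu>r. cj.act f h x * cnj (wavelet \<pi> \<phi> \<psi> x))"
    using T \<phi> by (simp add: fw_weak_def)
  also have "\<dots> = (LINT y|\<mu>r. f y * (LINT x|\<mu>r. (h (y * x * inverse y) / of_real (sqrt (\<Delta> y))) * cnj (wavelet \<pi> \<phi> \<psi> x)))"
    by (rule cj.act_pairing[OF f h L2_cnj[OF wavelet_L2[OF \<phi>]]])
  finally show ?thesis by (simp only: fw_weak_conj[OF h S \<phi>])
qed

end

section \<open>Integrals of Hilbert-Schmidt operators\<close>

definition blinfun_scaleC :: "complex \<Rightarrow> ('h::chilbert_space \<Rightarrow>\<^sub>L 'h) \<Rightarrow> ('h \<Rightarrow>\<^sub>L 'h)" where
  "blinfun_scaleC a R = Blinfun (\<lambda>v. a *\<^sub>C R v)"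

lemma blinfun_scaleC_apply [simp]: "blinfun_scaleC a R v = a *\<^sub>C R v"
proof -
  have "bounded_linear (\<lambda>v. a *\<^sub>C R v)"
    by (rule bounded_linear_compose[OF bounded_bilinear.bounded_linear_right[OF bounded_bilinear_scaleC] blinfun.bounded_linear_right])
  then show ?thesis by (simp add: blinfun_scaleC_def bounded_linear_Blinfun_apply)
qed

lemma blinfun_scaleC_zero [simp]: "blinfun_scaleC 0 R = 0"
  by (rule blinfun_eqI) simp

lemma
  fixes R :: "'h::{chilbert_space, second_countable_topology} \<Rightarrow>\<^sub>L 'h"
  assumes R: "hilbert_schmidt R"
  shows hilbert_schmidt_scaleC: "hilbert_schmidt (blinfun_scaleC a R)"
    and hs_norm_scaleC_le: "hs_norm (blinfun_scaleC a R) \<le> cmod a * hs_norm R"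
proof -
  have l: "clinear_on UNIV (blinfun_scaleC a R)"
    using R by (auto simp: hilbert_schmidt_iff clinear_on_def scaleC_add_right scaleC_scaleC mult.commute)
  have n: "norm (blinfun_scaleC a R v) \<le> cmod a * norm (R v)" for v by (simp add: norm_scaleC)
  show "hilbert_schmidt (blinfun_scaleC a R)" "hs_norm (blinfun_scaleC a R) \<le> cmod a * hs_norm R"
    by (rule hilbert_schmidt_dominated[OF R l n] hs_norm_dominated[OF R l n], simp)+
qed

lemma hilbert_schmidt_scaleR:
  fixes R :: "'h::{chilbert_space, second_countable_topology} \<Rightarrow>\<^sub>L 'h"
  assumes R: "hilbert_schmidt R"
  shows "hilbert_schmidt (r *\<^sub>R R)"
proof -
  have "r *\<^sub>R R = blinfun_scaleC (of_real r) R"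
    by (rule blinfun_eqI) (simp add: blinfun.scaleR_left scaleR_scaleC)
  then show ?thesis using hilbert_schmidt_scaleC[OF R] by simp
qed

lemma hs_norm_le_iff:
  fixes T :: "'h::{chilbert_space, second_countable_topology} \<Rightarrow>\<^sub>L 'h"
  assumes T: "hilbert_schmidt T"
  shows "hs_norm T \<le> a \<longleftrightarrow> 0 \<le> a \<and> (\<forall>F\<in>{F. finite F \<and> F \<subseteq> hs_basis}. (\<Sum>b\<in>F. (norm (T b))\<^sup>2) \<le> a\<^sup>2)"
proof (intro iffI conjI ballI)
  assume *: "hs_norm T \<le> a"
  then show "0 \<le> a" using hs_norm_nonneg[of T] by linarith
  fix F :: "'h set" assume "F \<in> {F. finite F \<and> F \<subseteq> hs_basis}"
  then have "(\<Sum>b\<in>F. (norm (T b))\<^sup>2) \<le> (hs_norm T)\<^sup>2"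
    using hs_bound_norm[OF T] by (auto simp: hs_bound_def hs_basis_subset)
  also have "\<dots> \<le> a\<^sup>2" using * by (intro power_mono) auto
  finally show "(\<Sum>b\<in>F. (norm (T b))\<^sup>2) \<le> a\<^sup>2" .
next
  assume *: "0 \<le> a \<and> (\<forall>F\<in>{F. finite F \<and> F \<subseteq> hs_basis}. (\<Sum>b\<in>F. (norm (T b))\<^sup>2) \<le> a\<^sup>2)"
  then show "hs_norm T \<le> a"
    using T by (intro hs_norm_le(2)[OF _ hs_basis]) (auto simp: hilbert_schmidt_iff)
qed

text \<open>A sublevel set of the norm is cut out by the square sums over finite subsets of a basis,
  and separability makes these countably many.\<close>

lemma hs_norm_measurable:
  fixes k :: "'x \<Rightarrow> 'h::{chilbert_space, second_countable_topology} \<Rightarrow>\<^sub>L 'h"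
  assumes k: "\<And>x. x \<in> space M \<Longrightarrow> hilbert_schmidt (k x)" and m [measurable]: "\<And>b. (\<lambda>x. k x b) \<in> borel_measurable M"
  shows "(\<lambda>x. hs_norm (k x)) \<in> borel_measurable M"
proof (rule borel_measurableI_le)
  fix a
  have c: "countable {F. finite F \<and> F \<subseteq> (hs_basis :: 'h set)}"
    by (intro countable_Collect_finite_subset orthonormal_countable hs_basis_subset order_refl)
  have "{x \<in> space M. hs_norm (k x) \<le> a} = (if 0 \<le> a then
      {x \<in> space M. \<forall>F\<in>{F. finite F \<and> F \<subseteq> hs_basis}. (\<Sum>b\<in>F. (norm (k x b))\<^sup>2) \<le> a\<^sup>2} else {})"
    using hs_norm_le_iff[OF k] by auto
  also have "\<dots> \<in> sets M"
  proof (cases "0 \<le> a")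
    case True
    have "{x \<in> space M. \<forall>F\<in>{F. finite F \<and> F \<subseteq> (hs_basis :: 'h set)}. (\<Sum>b\<in>F. (norm (k x b))\<^sup>2) \<le> a\<^sup>2} \<in> sets M"
      by (rule sets.sets_Collect_countable_All'[OF _ c]) measurable
    then show ?thesis using True by simp
  qed simp
  finally show "{x \<in> space M. hs_norm (k x) \<le> a} \<in> sets M" .
qed

text \<open>Evaluation \<open>R \<mapsto> cinner (R v) \<psi>\<close> is linear over the reals, and
  simple integrals commute with linear maps by finite additivity.\<close>

lemma simple_bochner_integral_cinner:
  fixes s :: "'x \<Rightarrow> 'h::chilbert_space \<Rightarrow>\<^sub>L 'h"
  assumes s: "Bochner_Integration.simple_bochner_integrable M s"
  shows "integrable M (\<lambda>x. cinner (s x v) \<psi>)"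
    "cinner (Bochner_Integration.simple_bochner_integral M s v) \<psi> = (LINT x|M. cinner (s x v) \<psi>)"
proof -
  define L where "L R = cinner (blinfun_apply R v) \<psi>" for R
  have L: "linear L"
    by (rule linearI) (simp_all add: L_def blinfun.add_left blinfun.scaleR_left cinner_add_left cinner_scaleR_left scaleR_conv_of_real)
  have i: "Bochner_Integration.simple_bochner_integrable M (\<lambda>x. L (s x))"
  proof (rule simple_bochner_integrable.intros)
    have sf: "simple_function M s" "emeasure M {x \<in> space M. s x \<noteq> 0} \<noteq> \<infinity>"
      using s by (auto elim: simple_bochner_integrable.cases)
    then show "simple_function M (\<lambda>x. L (s x))" by (intro simple_function_compose1[OF sf(1)])
    have "{x \<in> space M. s x \<noteq> 0} = s -` (- {0}) \<inter> space M" by auto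
    then have "{x \<in> space M. s x \<noteq> 0} \<in> sets M"
      using sf(1) by (metis simple_functionD(2))
    then have "emeasure M {x \<in> space M. L (s x) \<noteq> 0} \<le> emeasure M {x \<in> space M. s x \<noteq> 0}"
      by (intro emeasure_mono) (auto simp: L_def)
    then show "emeasure M {x \<in> space M. L (s x) \<noteq> 0} \<noteq> \<infinity>"
      using sf(2) by (auto simp: top_unique)
  qed
  have "has_bochner_integral M (\<lambda>x. L (s x)) (L (Bochner_Integration.simple_bochner_integral M s))"
    using has_bochner_integral_simple_bochner_integrable[OF i] simple_bochner_integral_linear[OF L s] by simp
  then show "integrable M (\<lambda>x. cinner (s x v) \<psi>)"
    "cinner (Bochner_Integration.simple_bochner_integral M s v) \<psi> = (LINT x|M. cinner (s x v) \<psi>)"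
    by (auto simp: L_def has_bochner_integral_iff)
qed

lemma hilbert_schmidt_simple_integral:
  fixes s :: "'x \<Rightarrow> 'h::{chilbert_space, second_countable_topology} \<Rightarrow>\<^sub>L 'h"
  assumes "\<And>x. x \<in> space M \<Longrightarrow> hilbert_schmidt (s x)"
  shows "hilbert_schmidt (Bochner_Integration.simple_bochner_integral M s)"
  unfolding simple_bochner_integral_def
  by (intro hilbert_schmidt_sum hilbert_schmidt_scaleR) (use assms in auto)

text \<open>Minkowski's integral inequality for the Hilbert-Schmidt norm, when \<open>R\<close> is
  known only through matrix coefficients on one basis. Testing with \<open>\<psi> = R b\<close>
  reproduces the square sum \<open>r\<^sup>2\<close>, and Cauchy-Schwarz over \<open>F\<close>
  bounds the integrand by \<open>hs_norm (k x) * r\<close>.\<close>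

lemma hs_norm_weak_integral_le:
  fixes k :: "'x \<Rightarrow> 'h::{chilbert_space, second_countable_topology} \<Rightarrow>\<^sub>L 'h"
  assumes B: "orthonormal_basis B" and R: "clinear_on UNIV (blinfun_apply R)"
    and k: "\<And>x. x \<in> space M \<Longrightarrow> hilbert_schmidt (k x)"
    and i: "\<And>b \<psi>. b \<in> B \<Longrightarrow> integrable M (\<lambda>x. cinner (k x b) \<psi>)"
    and w: "\<And>b \<psi>. b \<in> B \<Longrightarrow> cinner (R b) \<psi> = (LINT x|M. cinner (k x b) \<psi>)"
    and m: "(\<lambda>x. hs_norm (k x)) \<in> borel_measurable M"
    and K: "(\<integral>\<^sup>+x. ennreal (hs_norm (k x)) \<partial>M) \<le> ennreal K" "0 \<le> K"
  shows "hilbert_schmidt R" "hs_norm R \<le> K"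
proof -
  have "(\<Sum>b\<in>F. (norm (R b))\<^sup>2) \<le> K\<^sup>2" if F: "finite F" "F \<subseteq> B" for F
  proof -
    define r where "r = L2_set (\<lambda>b. norm (R b)) F"
    have r: "(\<Sum>b\<in>F. (norm (R b))\<^sup>2) = r\<^sup>2" "0 \<le> r" by (simp_all add: r_def L2_set_def sum_nonneg)
    have oF: "orthonormal F" using F B by (auto simp: orthonormal_basis_iff intro: orthonormal_subset)
    have "complex_of_real (r\<^sup>2) = (\<Sum>b\<in>F. cinner (R b) (R b))"
      by (simp add: r(1)[symmetric] cinner_self)
    also have "\<dots> = (\<Sum>b\<in>F. LINT x|M. cinner (k x b) (R b))"
      using F(2) w by (intro sum.cong) auto
    also have "\<dots> = (LINT x|M. (\<Sum>b\<in>F. cinner (k x b) (R b)))"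
      using F(2) i by (intro Bochner_Integration.integral_sum[symmetric]) auto
    finally have "r\<^sup>2 = norm (LINT x|M. (\<Sum>b\<in>F. cinner (k x b) (R b)))"
      by (metis abs_of_nonneg norm_of_real zero_le_power2)
    then have "ennreal (r\<^sup>2) \<le> (\<integral>\<^sup>+x. ennreal (norm (\<Sum>b\<in>F. cinner (k x b) (R b))) \<partial>M)"
      using norm_integral_le_nn[of M "\<lambda>x. \<Sum>b\<in>F. cinner (k x b) (R b)"] by simp
    also have "\<dots> \<le> (\<integral>\<^sup>+x. ennreal (hs_norm (k x)) * ennreal r \<partial>M)"
    proof (intro nn_integral_mono)
      fix x assume x: "x \<in> space M"
      have "norm (\<Sum>b\<in>F. cinner (k x b) (R b)) \<le> (\<Sum>b\<in>F. \<bar>norm (k x b)\<bar> * \<bar>norm (R b)\<bar>)"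
        by (rule order_trans[OF norm_sum]) (auto intro!: sum_mono cmod_cinner_le)
      also have "\<dots> \<le> L2_set (\<lambda>b. norm (k x b)) F * r"
        unfolding r_def by (rule L2_set_mult_ineq)
      also have "\<dots> \<le> hs_norm (k x) * r"
        using hs_norm_L2_set[OF k[OF x] F(1) oF] r(2) by (rule mult_right_mono)
      finally show "ennreal (norm (\<Sum>b\<in>F. cinner (k x b) (R b))) \<le> ennreal (hs_norm (k x)) * ennreal r"
        using r(2) by (simp add: ennreal_mult[symmetric] ennreal_leI)
    qed
    also have "\<dots> = (\<integral>\<^sup>+x. ennreal (hs_norm (k x)) \<partial>M) * ennreal r"
      by (rule nn_integral_multc) (use m in measurable)
    also have "\<dots> \<le> ennreal K * ennreal r" by (rule mult_right_mono[OF K(1)]) simp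
    finally have "r\<^sup>2 \<le> K * r" using K(2) r(2) by (simp add: ennreal_mult[symmetric] ennreal_le_iff)
    then have "r \<le> K" using r(2) K(2) by (cases "r = 0") (auto simp: power2_eq_square)
    then show ?thesis unfolding r(1) using r(2) by (intro power_mono)
  qed
  then show "hilbert_schmidt R" "hs_norm R \<le> K" using hs_norm_le[OF R B _ K(2)] by auto
qed

text \<open>Matrix coefficients pin the integral down, which makes the description in
  \<open>hs_integral\<close> unambiguous.\<close>

lemma has_hs_integral_weak:
  fixes h :: "'x \<Rightarrow> 'h::{chilbert_space, second_countable_topology} \<Rightarrow>\<^sub>L 'h"
  assumes T: "has_hs_integral M h T" and i: "integrable M (\<lambda>x. cinner (h x v) \<psi>)"
  shows "cinner (T v) \<psi> = (LINT x|M. cinner (h x v) \<psi>)"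
proof -
  obtain s where s: "\<And>i. Bochner_Integration.simple_bochner_integrable M (s i)"
      "\<And>i x. x \<in> space M \<Longrightarrow> hilbert_schmidt (s i x)"
      "\<And>i. (\<lambda>x. hs_norm (h x - s i x)) \<in> borel_measurable M"
      "(\<lambda>i. \<integral>\<^sup>+x. ennreal (hs_norm (h x - s i x)) \<partial>M) \<longlonglongrightarrow> 0"
      "(\<lambda>i. hs_norm (Bochner_Integration.simple_bochner_integral M (s i) - T)) \<longlonglongrightarrow> 0"
    and h: "\<And>x. x \<in> space M \<Longrightarrow> hilbert_schmidt (h x)" and T': "hilbert_schmidt T"
    using T unfolding has_hs_integral_def by blast
  define I where "I i = Bochner_Integration.simple_bochner_integral M (s i)" for i
  have Ihs: "hilbert_schmidt (I i)" for i unfolding I_def by (rule hilbert_schmidt_simple_integral[OF s(2)])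
  have "(\<lambda>i. I i v - T v) \<longlonglongrightarrow> 0"
  proof (rule Lim_null_comparison)
    show "(\<lambda>i. hs_norm (I i - T) * norm v) \<longlonglongrightarrow> 0" using s(5) unfolding I_def by (rule tendsto_mult_left_zero)
    show "\<forall>\<^sub>F i in sequentially. norm (I i v - T v) \<le> hs_norm (I i - T) * norm v"
      using norm_le_hs_norm[OF hilbert_schmidt_diff[OF Ihs T'], of _ v] by (simp add: blinfun.diff_left)
  qed
  then have "(\<lambda>i. I i v) \<longlonglongrightarrow> T v" by (rule LIM_zero_cancel)
  then have l1: "(\<lambda>i. cinner (I i v) \<psi>) \<longlonglongrightarrow> cinner (T v) \<psi>"
    by (intro tendsto_cinner tendsto_const)
  have "(\<lambda>i. cinner (I i v) \<psi> - (LINT x|M. cinner (h x v) \<psi>)) \<longlonglongrightarrow> 0"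
  proof (rule tendsto_norm_zero_cancel, rule tendsto_ennreal_iff[THEN iffD1])
    show "(\<lambda>j. ennreal (norm (cinner (I j v) \<psi> - (LINT x|M. cinner (h x v) \<psi>)))) \<longlonglongrightarrow> ennreal 0"
    proof (rule tendsto_sandwich[OF _ _ tendsto_const])
      show "(\<lambda>j. (\<integral>\<^sup>+x. ennreal (hs_norm (h x - s j x)) \<partial>M) * ennreal (norm v * norm \<psi>)) \<longlonglongrightarrow> ennreal 0"
        using ennreal_tendsto_cmult[OF _ s(4), of "ennreal (norm v * norm \<psi>)"] by (simp add: mult.commute)
      show "\<forall>\<^sub>F j in sequentially. ennreal (norm (cinner (I j v) \<psi> - (LINT x|M. cinner (h x v) \<psi>)))
          \<le> (\<integral>\<^sup>+x. ennreal (hs_norm (h x - s j x)) \<partial>M) * ennreal (norm v * norm \<psi>)"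
      proof (intro always_eventually allI)
        fix j
        note c = simple_bochner_integral_cinner[OF s(1)[of j], of v \<psi>]
        have "cinner (I j v) \<psi> - (LINT x|M. cinner (h x v) \<psi>) = (LINT x|M. cinner ((s j x - h x) v) \<psi>)"
          using c i by (simp add: I_def blinfun.diff_left cinner_diff_left)
        then have "ennreal (norm (cinner (I j v) \<psi> - (LINT x|M. cinner (h x v) \<psi>)))
            \<le> (\<integral>\<^sup>+x. ennreal (norm (cinner ((s j x - h x) v) \<psi>)) \<partial>M)"
          by (simp only: norm_integral_le_nn)
        also have "\<dots> \<le> (\<integral>\<^sup>+x. ennreal (hs_norm (h x - s j x)) * ennreal (norm v * norm \<psi>) \<partial>M)"
        proof (intro nn_integral_mono)
          fix x assume x: "x \<in> space M"
          have "norm (cinner ((s j x - h x) v) \<psi>) \<le> norm ((s j x - h x) v) * norm \<psi>" by (rule cmod_cinner_le)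
          also have "\<dots> \<le> (hs_norm (s j x - h x) * norm v) * norm \<psi>"
            by (intro mult_right_mono norm_le_hs_norm hilbert_schmidt_diff s(2) h x) auto
          finally show "ennreal (norm (cinner ((s j x - h x) v) \<psi>)) \<le> ennreal (hs_norm (h x - s j x)) * ennreal (norm v * norm \<psi>)"
            by (simp add: ennreal_mult[symmetric] ennreal_leI hs_norm_minus_commute[of "h x"] mult.assoc)
        qed
        also have "\<dots> = (\<integral>\<^sup>+x. ennreal (hs_norm (h x - s j x)) \<partial>M) * ennreal (norm v * norm \<psi>)"
          by (rule nn_integral_multc) (use s(3)[of j] in measurable)
        finally show "ennreal (norm (cinner (I j v) \<psi> - (LINT x|M. cinner (h x v) \<psi>)))
          \<le> (\<integral>\<^sup>+x. ennreal (hs_norm (h x - s j x)) \<partial>M) * ennreal (norm v * norm \<psi>)" .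
      qed
    qed simp
  qed auto
  then have "(\<lambda>i. cinner (I i v) \<psi>) \<longlonglongrightarrow> (LINT x|M. cinner (h x v) \<psi>)" by (rule LIM_zero_cancel)
  with l1 show ?thesis by (rule LIMSEQ_unique)
qed

subsection \<open>Conjugation by the representation\<close>

context duflo_moore
begin

text \<open>Dominated convergence along a basis, in the form of a finite sum plus a uniformly small tail.\<close>

lemma hs_pi_continuous:
  assumes R: "hilbert_schmidt R" and "0 < \<epsilon>"
  shows "\<forall>\<^sub>F x in nhds x0. hs_norm ((\<pi> x - \<pi> x0) o\<^sub>L R) < \<epsilon>"
proof -
  \<comment> \<open>The finite part contributes \<open>\<delta>\<close> and the tail
    \<open>4 * \<delta>\<close>, since \<open>norm (\<pi> x v - \<pi> x0 v)\<close> is at most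
    \<open>2 * norm v\<close>; dividing by 6 leaves the total strictly below
    \<open>\<epsilon>\<^sup>2\<close>.\<close>
  define \<delta> where "\<delta> = \<epsilon>\<^sup>2 / 6"
  have \<delta>: "0 < \<delta>" "5 * \<delta> < \<epsilon>\<^sup>2" using \<open>0 < \<epsilon>\<close> by (simp_all add: \<delta>_def)
  have hsum: "((\<lambda>b. (norm (R b))\<^sup>2) has_sum (hs_norm R)\<^sup>2) hs_basis"
    unfolding hs_norm_sq by (rule has_sum_infsum[OF hs_summable[OF R]])
  then have "\<forall>\<^sub>F F in finite_subsets_at_top hs_basis. dist (\<Sum>b\<in>F. (norm (R b))\<^sup>2) ((hs_norm R)\<^sup>2) < \<delta>"
    unfolding has_sum_def using \<delta>(1) tendstoD by blast
  then obtain F where F: "finite F" "F \<subseteq> hs_basis" "dist (\<Sum>b\<in>F. (norm (R b))\<^sup>2) ((hs_norm R)\<^sup>2) < \<delta>"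
    unfolding eventually_finite_subsets_at_top by blast
  have tail: "(\<Sum>b\<in>D. (norm (R b))\<^sup>2) \<le> \<delta>" if "finite D" "D \<subseteq> hs_basis" "D \<inter> F = {}" for D
  proof -
    have "(\<Sum>b\<in>D. (norm (R b))\<^sup>2) + (\<Sum>b\<in>F. (norm (R b))\<^sup>2) = (\<Sum>b\<in>D \<union> F. (norm (R b))\<^sup>2)"
      by (rule sum.union_disjoint[symmetric]) (use that F in auto)
    also have "\<dots> \<le> (hs_norm R)\<^sup>2"
      using hs_bound_norm[OF R] that F by (simp add: hs_bound_def hs_basis_subset)
    finally show ?thesis using F(3) by (simp add: dist_real_def)
  qed
  have Rl: "clinear_on UNIV R" using R by (simp add: hilbert_schmidt_iff)
  have l: "clinear_on UNIV ((\<pi> x - \<pi> x0) o\<^sub>L R)" for x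
    by (intro clinear_on_blinfun_add pi_clinear Rl)
  have n2: "(norm (((\<pi> x - \<pi> x0) o\<^sub>L R) b))\<^sup>2 \<le> 4 * (norm (R b))\<^sup>2" for x b
  proof -
    have "norm (((\<pi> x - \<pi> x0) o\<^sub>L R) b) \<le> norm (\<pi> x (R b)) + norm (\<pi> x0 (R b))"
      by (simp add: blinfun.diff_left del: pi_norm) (rule norm_triangle_ineq4)
    then have "(norm (((\<pi> x - \<pi> x0) o\<^sub>L R) b))\<^sup>2 \<le> (2 * norm (R b))\<^sup>2" by (intro power_mono) auto
    then show ?thesis by (simp add: power_mult_distrib)
  qed
  define q where "q x = (\<Sum>b\<in>F. (norm (((\<pi> x - \<pi> x0) o\<^sub>L R) b))\<^sup>2)" for x
  have "continuous_on UNIV q"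
    unfolding q_def by (simp add: blinfun.diff_left) (intro continuous_intros)
  then have "isCont q x0" by (simp add: continuous_on_eq_continuous_at)
  then have "q \<midarrow>x0\<rightarrow> q x0" by (simp add: isCont_def)
  moreover have "q x0 = 0" by (simp add: q_def blinfun.diff_left)
  ultimately have "\<forall>\<^sub>F x in nhds x0. dist (q x) 0 < \<delta>"
    using \<delta>(1) by (metis tendstoD tendsto_nhds_iff)
  then show ?thesis
  proof eventually_elim
    fix x assume x: "dist (q x) 0 < \<delta>"
    have "hs_norm ((\<pi> x - \<pi> x0) o\<^sub>L R) \<le> sqrt (5 * \<delta>)"
    proof (rule hs_norm_le(2)[OF l hs_basis])
      fix D :: "'h set" assume D: "finite D" "D \<subseteq> hs_basis"
      have "(\<Sum>b\<in>D. (norm (((\<pi> x - \<pi> x0) o\<^sub>L R) b))\<^sup>2)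
          = (\<Sum>b\<in>D \<inter> F. (norm (((\<pi> x - \<pi> x0) o\<^sub>L R) b))\<^sup>2) + (\<Sum>b\<in>D - F. (norm (((\<pi> x - \<pi> x0) o\<^sub>L R) b))\<^sup>2)"
        by (rule sum.Int_Diff[OF D(1)])
      also have "(\<Sum>b\<in>D \<inter> F. (norm (((\<pi> x - \<pi> x0) o\<^sub>L R) b))\<^sup>2) \<le> q x"
        unfolding q_def using F by (intro sum_mono2) auto
      also have "(\<Sum>b\<in>D - F. (norm (((\<pi> x - \<pi> x0) o\<^sub>L R) b))\<^sup>2) \<le> (\<Sum>b\<in>D - F. 4 * (norm (R b))\<^sup>2)"
        by (intro sum_mono n2)
      also have "\<dots> = 4 * (\<Sum>b\<in>D - F. (norm (R b))\<^sup>2)" by (simp add: sum_distrib_left)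
      also have "\<dots> \<le> 4 * \<delta>" using tail[of "D - F"] D by auto
      finally show "(\<Sum>b\<in>D. (norm (((\<pi> x - \<pi> x0) o\<^sub>L R) b))\<^sup>2) \<le> (sqrt (5 * \<delta>))\<^sup>2"
        using x \<delta> by (simp add: dist_real_def)
    qed (use \<delta> in simp)
    also have "\<dots> < \<epsilon>" using \<delta>(2) \<open>0 < \<epsilon>\<close> by (intro real_less_lsqrt) auto
    finally show "hs_norm ((\<pi> x - \<pi> x0) o\<^sub>L R) < \<epsilon>" .
  qed
qed

definition conj_op :: "('h \<Rightarrow>\<^sub>L 'h) \<Rightarrow> 'g \<Rightarrow> ('h \<Rightarrow>\<^sub>L 'h)" where
  "conj_op S x = \<pi> (inverse x) o\<^sub>L S o\<^sub>L \<pi> x"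

lemma star_integrand_eq: "star_integrand \<pi> f S x = blinfun_scaleC (f x) (conj_op S x)"
  by (simp add: star_integrand_def blinfun_scaleC_def conj_op_def cadjoint_pi)

lemma
  assumes S: "hilbert_schmidt S"
  shows hilbert_schmidt_compose_pi: "hilbert_schmidt (S o\<^sub>L \<pi> x)"
    and hs_norm_compose_pi: "hs_norm (S o\<^sub>L \<pi> x) \<le> hs_norm S"
proof -
  have l: "clinear_on UNIV (S o\<^sub>L \<pi> x)"
    using S by (intro clinear_on_blinfun_add pi_clinear) (simp add: hilbert_schmidt_iff)
  have b: "hs_bound (S o\<^sub>L \<pi> x) ((hs_norm S)\<^sup>2)" unfolding hs_bound_def
  proof (intro allI impI, elim conjE)
    fix F :: "'h set" assume F: "finite F" "orthonormal F"
    have inj: "inj_on (\<pi> x) F" by (metis inj_onI pi_inverse(1))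
    have "orthonormal (\<pi> x ` F)"
      using F(2) unfolding orthonormal_def by (auto simp: pi_isometric) (metis pi_inverse(1))
    then have "(\<Sum>b\<in>\<pi> x ` F. (norm (S b))\<^sup>2) \<le> (hs_norm S)\<^sup>2"
      using hs_bound_norm[OF S] F(1) by (simp add: hs_bound_def)
    then show "(\<Sum>b\<in>F. (norm ((S o\<^sub>L \<pi> x) b))\<^sup>2) \<le> (hs_norm S)\<^sup>2"
      by (simp add: sum.reindex[OF inj])
  qed
  show "hilbert_schmidt (S o\<^sub>L \<pi> x)" "hs_norm (S o\<^sub>L \<pi> x) \<le> hs_norm S"
    using hs_norm_le_bound[OF l b] by auto
qed

lemma
  assumes S: "hilbert_schmidt S"
  shows hilbert_schmidt_pi_compose: "hilbert_schmidt (\<pi> x o\<^sub>L S)"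
    and hs_norm_pi_compose: "hs_norm (\<pi> x o\<^sub>L S) \<le> hs_norm S"
proof -
  have l: "clinear_on UNIV (\<pi> x o\<^sub>L S)"
    using S by (intro clinear_on_blinfun_add pi_clinear) (simp add: hilbert_schmidt_iff)
  have n: "norm ((\<pi> x o\<^sub>L S) v) \<le> 1 * norm (S v)" for v by simp
  show "hilbert_schmidt (\<pi> x o\<^sub>L S)" "hs_norm (\<pi> x o\<^sub>L S) \<le> hs_norm S"
    using hilbert_schmidt_dominated[OF S l n] hs_norm_dominated[OF S l n] by auto
qed

lemma
  assumes S: "hilbert_schmidt S"
  shows hilbert_schmidt_conj_op: "hilbert_schmidt (conj_op S x)"
    and hs_norm_conj_op: "hs_norm (conj_op S x) \<le> hs_norm S"
proof -
  have eq: "conj_op S x = \<pi> (inverse x) o\<^sub>L (S o\<^sub>L \<pi> x)"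
    by (rule blinfun_eqI) (simp add: conj_op_def)
  show "hilbert_schmidt (conj_op S x)"
    unfolding eq by (intro hilbert_schmidt_pi_compose hilbert_schmidt_compose_pi S)
  show "hs_norm (conj_op S x) \<le> hs_norm S"
    unfolding eq by (rule order_trans[OF hs_norm_pi_compose[OF hilbert_schmidt_compose_pi[OF S]] hs_norm_compose_pi[OF S]])
qed

text \<open>\<open>hs_pi_continuous\<close> treats a moving factor on the left. The moving factor on
  the right is brought there by taking adjoints, with \<open>S'\<close> in place of
  \<open>S\<close>; the difference splits as
  \<open>(\<pi> (inverse x) o\<^sub>L P) + Q\<close>.\<close>

lemma conj_op_continuous:
  assumes S: "hilbert_schmidt S" and \<epsilon>: "0 < \<epsilon>"
  shows "\<forall>\<^sub>F x in nhds x0. hs_norm (conj_op S x - conj_op S x0) < \<epsilon>"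
proof -
  have Sl: "clinear_on UNIV S" using S by (simp add: hilbert_schmidt_iff)
  obtain S' :: "'h \<Rightarrow>\<^sub>L 'h" where S': "\<And>v w. cinner (S v) w = cinner v (S' w)"
    using clinear_adjoint_exists[OF Sl] by blast
  have S'hs: "hilbert_schmidt S'" by (rule hilbert_schmidt_adjoint[OF S S'])
  have inv: "filterlim inverse (nhds (inverse x0)) (nhds x0)"
  proof -
    have "continuous_on UNIV (inverse :: 'g \<Rightarrow> 'g)" by (intro continuous_intros)
    then have "isCont (inverse :: 'g \<Rightarrow> 'g) x0" by (simp add: continuous_on_eq_continuous_at)
    then show ?thesis by (simp add: isCont_def tendsto_nhds_iff)
  qed
  have 1: "\<forall>\<^sub>F x in nhds x0. hs_norm ((\<pi> (inverse x) - \<pi> (inverse x0)) o\<^sub>L S') < \<epsilon> / 2"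
    by (rule eventually_compose_filterlim[OF hs_pi_continuous[OF S'hs] inv]) (use \<epsilon> in simp)
  have 2: "\<forall>\<^sub>F x in nhds x0. hs_norm ((\<pi> (inverse x) - \<pi> (inverse x0)) o\<^sub>L (S o\<^sub>L \<pi> x0)) < \<epsilon> / 2"
    by (rule eventually_compose_filterlim[OF hs_pi_continuous[OF hilbert_schmidt_compose_pi[OF S]] inv]) (use \<epsilon> in simp)
  show ?thesis
    using 1 2
  proof eventually_elim
    fix x
    assume a: "hs_norm ((\<pi> (inverse x) - \<pi> (inverse x0)) o\<^sub>L S') < \<epsilon> / 2"
      and b: "hs_norm ((\<pi> (inverse x) - \<pi> (inverse x0)) o\<^sub>L (S o\<^sub>L \<pi> x0)) < \<epsilon> / 2"
    define P where "P = (S o\<^sub>L \<pi> x) - (S o\<^sub>L \<pi> x0)"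
    define Q where "Q = (\<pi> (inverse x) - \<pi> (inverse x0)) o\<^sub>L (S o\<^sub>L \<pi> x0)"
    define P' where "P' = (\<pi> (inverse x) - \<pi> (inverse x0)) o\<^sub>L S'"
    have Phs: "hilbert_schmidt P" unfolding P_def by (intro hilbert_schmidt_diff hilbert_schmidt_compose_pi S)
    have P': "cinner (P' v) w = cinner v (P w)" for v w
      unfolding P_def P'_def using S'[of _ v] pi_adjoint[of "inverse _" "S' v" w]
      by (simp add: blinfun.diff_left cinner_diff_left cinner_diff_right) (metis cinner_commute)
    have P'hs: "hilbert_schmidt P'"
    proof -
      have "P' = (\<pi> (inverse x) o\<^sub>L S') - (\<pi> (inverse x0) o\<^sub>L S')"
        unfolding P'_def by (rule blinfun_eqI) (simp add: blinfun.diff_left)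
      then show ?thesis by (simp add: hilbert_schmidt_diff hilbert_schmidt_pi_compose S'hs)
    qed
    have "hs_norm P < \<epsilon> / 2"
      using hs_norm_adjoint[OF P'hs P'] a by (simp add: P'_def)
    moreover have eq: "conj_op S x - conj_op S x0 = (\<pi> (inverse x) o\<^sub>L P) + Q"
      by (rule blinfun_eqI) (simp add: conj_op_def P_def Q_def blinfun.diff_left blinfun.add_left blinfun.diff_right)
    have "hilbert_schmidt Q"
    proof -
      have "Q = (\<pi> (inverse x) o\<^sub>L (S o\<^sub>L \<pi> x0)) - (\<pi> (inverse x0) o\<^sub>L (S o\<^sub>L \<pi> x0))"
        unfolding Q_def by (rule blinfun_eqI) (simp add: blinfun.diff_left)
      then show ?thesis by (simp add: hilbert_schmidt_diff hilbert_schmidt_pi_compose hilbert_schmidt_compose_pi S)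
    qed
    note hs_norm_triangle[OF hilbert_schmidt_pi_compose[OF Phs] this, of "inverse x"]
    moreover have "hs_norm Q < \<epsilon> / 2" using b by (simp only: Q_def)
    ultimately show "hs_norm (conj_op S x - conj_op S x0) < \<epsilon>"
      using hs_norm_pi_compose[OF Phs, of "inverse x"] unfolding eq by linarith
  qed
qed

text \<open>By the Lindelof property, countably many open sets cover the group on each of which
  \<open>conj_op S\<close> stays within \<open>\<epsilon>\<close> of one value; taking the least
  index makes them a measurable partition. This is the separability that a Bochner integral asks of
  its integrand.\<close>

lemma conj_op_pieces:
  assumes S: "hilbert_schmidt S" and \<epsilon>: "0 < \<epsilon>"
  obtains j :: "'g \<Rightarrow> nat" and y :: "nat \<Rightarrow> 'g" where "j \<in> borel \<rightarrow>\<^sub>M count_space UNIV"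
    "\<And>x. hs_norm (conj_op S x - conj_op S (y (j x))) < \<epsilon>"
proof -
  define \<F> where "\<F> = {U. open U \<and> (\<exists>z. \<forall>x\<in>U. hs_norm (conj_op S x - conj_op S z) < \<epsilon>)}"
  have "x \<in> \<Union>\<F>" for x
    using conj_op_continuous[OF S \<epsilon>, of x] unfolding eventually_nhds \<F>_def by blast
  then have cov: "\<Union>\<F> = UNIV" by blast
  obtain \<F>' where F': "\<F>' \<subseteq> \<F>" "countable \<F>'" "\<Union>\<F>' = \<Union>\<F>"
    by (rule Lindelof[of \<F>]) (auto simp: \<F>_def)
  have "\<F>' \<noteq> {}" using F' cov by auto
  define U where "U = from_nat_into \<F>'"
  have U: "range U = \<F>'" using F'(2) \<open>\<F>' \<noteq> {}\<close> by (simp add: U_def range_from_nat_into)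
  then have "\<exists>z. \<forall>x\<in>U n. hs_norm (conj_op S x - conj_op S z) < \<epsilon>" for n
    using F'(1) by (auto simp: \<F>_def)
  then obtain y where y: "\<And>n x. x \<in> U n \<Longrightarrow> hs_norm (conj_op S x - conj_op S (y n)) < \<epsilon>" by metis
  have [measurable]: "U n \<in> sets borel" for n
    using U F'(1) by (auto simp: \<F>_def intro!: borel_open)
  define j where "j x = (LEAST n. x \<in> U n)" for x
  have j: "x \<in> U (j x)" for x
    unfolding j_def by (rule LeastI_ex) (use U F'(3) cov in \<open>metis UNIV_I UN_iff\<close>)
  have "j \<in> borel \<rightarrow>\<^sub>M count_space UNIV" unfolding j_def by measurable
  then show thesis using y[OF j] by (rule that)
qed

lemma conj_op_measurable [measurable]: "(\<lambda>x. conj_op S x v) \<in> borel_measurable borel"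
proof -
  have "continuous_on UNIV (\<lambda>x. \<pi> (inverse x) (S (\<pi> x v)))"
    unfolding continuous_on_def
  proof
    fix x0 :: 'g
    have i: "((\<lambda>x. \<pi> (inverse x) u) \<longlongrightarrow> \<pi> (inverse x0) u) (at x0)" for u
      using continuous_on_def[of UNIV "\<lambda>x. \<pi> (inverse x) u"] pi_continuous_compose[of UNIV inverse u]
        continuous_on_group_inverse[of UNIV "\<lambda>x. x"] by simp
    have s: "((\<lambda>x. S (\<pi> x v)) \<longlongrightarrow> S (\<pi> x0 v)) (at x0)"
      using pi_continuous[of v] by (intro blinfun.tendsto[OF tendsto_const]) (simp add: continuous_on_def)
    have "((\<lambda>x. \<pi> (inverse x) (S (\<pi> x v)) - \<pi> (inverse x) (S (\<pi> x0 v))) \<longlongrightarrow> 0) (at x0)"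
    proof (rule Lim_null_comparison)
      show "((\<lambda>x. norm (S (\<pi> x v) - S (\<pi> x0 v))) \<longlongrightarrow> 0) (at x0)"
        using tendsto_norm[OF tendsto_diff[OF s tendsto_const[of "S (\<pi> x0 v)"]]] by simp
      show "\<forall>\<^sub>F x in at x0. norm (\<pi> (inverse x) (S (\<pi> x v)) - \<pi> (inverse x) (S (\<pi> x0 v))) \<le> norm (S (\<pi> x v) - S (\<pi> x0 v))"
        by (simp flip: blinfun.diff_right)
    qed
    from tendsto_add[OF this i[of "S (\<pi> x0 v)"]]
    show "((\<lambda>x. \<pi> (inverse x) (S (\<pi> x v))) \<longlongrightarrow> \<pi> (inverse x0) (S (\<pi> x0 v))) (at x0 within UNIV)" by simp
  qed
  then show ?thesis unfolding conj_op_def by (simp add: borel_measurable_continuous_onI)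
qed

lemma star_integrand_measurable [measurable]:
  assumes [measurable]: "f \<in> borel_measurable borel"
  shows "(\<lambda>x. star_integrand \<pi> f S x v) \<in> borel_measurable borel"
proof -
  have "(\<lambda>x. f x *\<^sub>C conj_op S x v) \<in> borel_measurable borel"
    by (rule borel_measurable_continuous_Pair[where H = "\<lambda>c v. c *\<^sub>C v"]) (measurable, intro continuous_intros)
  then show ?thesis by (simp add: star_integrand_eq)
qed

lemma star_integrand_cinner: "cinner (star_integrand \<pi> f S x v) \<psi> = f x * cinner (S (\<pi> x v)) (\<pi> x \<psi>)"
  by (simp add: star_integrand_eq conj_op_def cinner_scaleC_left pi_adjoint[of "inverse _"])

lemma star_integrand_integrable:
  assumes f: "integrable \<mu>r f" and S: "hilbert_schmidt S"
  shows "integrable \<mu>r (\<lambda>x. cinner (star_integrand \<pi> f S x v) \<psi>)"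
proof (rule Bochner_Integration.integrable_bound)
  have [measurable]: "f \<in> borel_measurable borel" using f by (simp add: integrable_iff_bounded measurable_mu)
  show "integrable \<mu>r (\<lambda>x. norm (f x) * (hs_norm S * norm v * norm \<psi>))"
    using f by (intro integrable_mult_left integrable_norm)
  show "(\<lambda>x. cinner (star_integrand \<pi> f S x v) \<psi>) \<in> borel_measurable \<mu>r"
    unfolding measurable_mu
    by (rule borel_measurable_continuous_Pair[where H = cinner]) (measurable, intro continuous_intros)
  have "norm (cinner (S (\<pi> x v)) (\<pi> x \<psi>)) \<le> hs_norm S * norm v * norm \<psi>" for x
  proof -
    have "norm (cinner (S (\<pi> x v)) (\<pi> x \<psi>)) \<le> norm (S (\<pi> x v)) * norm \<psi>"
      using cmod_cinner_le[of "S (\<pi> x v)" "\<pi> x \<psi>"] by simp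
    also have "\<dots> \<le> (hs_norm S * norm v) * norm \<psi>"
      using norm_le_hs_norm[OF S, of "\<pi> x v"] by (intro mult_right_mono) auto
    finally show ?thesis .
  qed
  then show "AE x in \<mu>r. norm (cinner (star_integrand \<pi> f S x v) \<psi>) \<le> norm (norm (f x) * (hs_norm S * norm v * norm \<psi>))"
    by (auto simp: star_integrand_cinner norm_mult intro!: mult_left_mono)
qed

text \<open>Step functions \<open>f\<^sub>i(x) \<pi>(y)\<^sup>* S \<pi>(y)\<close>, with \<open>y\<close> constant on small pieces of \<open>G\<close>, approximate the
  integrand.\<close>

lemma star_integrand_approx:
  assumes f: "integrable \<mu>r f" and S: "hilbert_schmidt S" and \<epsilon>: "0 < \<epsilon>"
  shows "\<exists>s. Bochner_Integration.simple_bochner_integrable \<mu>r s \<and> (\<forall>x. hilbert_schmidt (s x)) \<and>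
    (\<integral>\<^sup>+x. ennreal (hs_norm (star_integrand \<pi> f S x - s x)) \<partial>\<mu>r) \<le> ennreal \<epsilon>"
proof -
  have [measurable]: "f \<in> borel_measurable borel" using f by (simp add: integrable_iff_bounded measurable_mu)
  define n where "n = hs_norm S"
  have n: "0 \<le> n" by (simp add: n_def)
  define A where "A = (LINT x|\<mu>r. norm (f x))"
  have A: "0 \<le> A" "(\<integral>\<^sup>+x. ennreal (norm (f x)) \<partial>\<mu>r) = ennreal A"
    unfolding A_def using f by (auto intro: nn_integral_eq_integral)
  \<comment> \<open>Three errors of at most \<open>\<epsilon> / 3\<close> are planned: freezing the
    operator on each piece, replacing \<open>f\<close> by a simple \<open>g\<close>, and dropping
    the pieces from index \<open>N\<close> on. The added 1 guards against \<open>A = 0\<close> or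
    \<open>n = 0\<close>.\<close>
  define \<delta> where "\<delta> = \<epsilon> / (3 * (A + 1))"
  have \<delta>: "0 < \<delta>" "\<delta> * A \<le> \<epsilon> / 3"
    using \<epsilon> A by (auto simp: \<delta>_def field_simps)
  define \<eta> where "\<eta> = \<epsilon> / (3 * (n + 1))"
  have \<eta>: "0 < \<eta>" "n * \<eta> \<le> \<epsilon> / 3"
    using \<epsilon> n by (auto simp: \<eta>_def field_simps)
  obtain j y where j [measurable]: "j \<in> borel \<rightarrow>\<^sub>M count_space UNIV"
    and y: "\<And>x. hs_norm (conj_op S x - conj_op S (y (j x :: nat))) < \<delta>"
    using conj_op_pieces[OF S \<delta>(1)] by blast
  obtain g where g: "Bochner_Integration.simple_bochner_integrable \<mu>r g"
    "(\<integral>\<^sup>+x. ennreal (norm (f x - g x)) \<partial>\<mu>r) \<le> ennreal \<eta>"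
  proof -
    have "has_bochner_integral \<mu>r f (integral\<^sup>L \<mu>r f)" using f by (rule has_bochner_integral_integrable)
    then obtain gs where gs: "\<And>i. Bochner_Integration.simple_bochner_integrable \<mu>r (gs i)"
      "(\<lambda>i. \<integral>\<^sup>+x. ennreal (norm (f x - gs i x)) \<partial>\<mu>r) \<longlonglongrightarrow> 0"
      unfolding has_bochner_integral.simps by blast
    have "\<forall>\<^sub>F i in sequentially. (\<integral>\<^sup>+x. ennreal (norm (f x - gs i x)) \<partial>\<mu>r) < ennreal \<eta>"
      using gs(2) by (rule order_tendstoD) (simp add: \<eta>)
    then obtain i where "(\<integral>\<^sup>+x. ennreal (norm (f x - gs i x)) \<partial>\<mu>r) < ennreal \<eta>"
      using eventually_happens'[OF sequentially_bot] by blast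
    then show thesis using that gs(1) by (blast intro: less_imp_le)
  qed
  have gsf: "simple_function \<mu>r g" "emeasure \<mu>r {x \<in> space \<mu>r. g x \<noteq> 0} \<noteq> \<infinity>"
    using g(1) by (auto elim: simple_bochner_integrable.cases)
  have [measurable]: "g \<in> borel_measurable borel"
    using borel_measurable_simple_function[OF gsf(1)] by (simp add: measurable_mu)
  obtain N :: nat where N: "(\<integral>\<^sup>+x. ennreal (norm (f x)) * indicator {x. N \<le> j x} x \<partial>\<mu>r) \<le> ennreal \<eta>"
  proof -
    have "(\<lambda>N. \<integral>\<^sup>+x. ennreal (norm (f x)) * indicator {x. N \<le> j x} x \<partial>\<mu>r) \<longlonglongrightarrow> (\<integral>\<^sup>+x. 0 \<partial>\<mu>r)"
    proof (rule nn_integral_dominated_convergence[where w = "\<lambda>x. ennreal (norm (f x))"])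
      show "AE x in \<mu>r. (\<lambda>N. ennreal (norm (f x)) * indicator {x. N \<le> j x} x) \<longlonglongrightarrow> 0"
      proof (rule AE_I2)
        fix x
        show "(\<lambda>N. ennreal (norm (f x)) * indicator {x. N \<le> j x} x) \<longlonglongrightarrow> 0"
          by (intro tendsto_eventually eventually_sequentiallyI[of "Suc (j x)"]) auto
      qed
    qed (use A in \<open>auto simp: indicator_def\<close>)
    then have "\<forall>\<^sub>F N in sequentially. (\<integral>\<^sup>+x. ennreal (norm (f x)) * indicator {x. N \<le> j x} x \<partial>\<mu>r) < ennreal \<eta>"
      by (rule order_tendstoD) (simp add: \<eta>)
    then show thesis using that eventually_happens'[OF sequentially_bot] by (blast intro: less_imp_le)
  qed
  \<comment> \<open>\<open>j\<close> may take infinitely many values; the cap makes it simple, and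
    where it equals \<open>N\<close> the step function is 0.\<close>
  define k where "k x = min (j x) N" for x
  have k: "simple_function \<mu>r k"
    unfolding simple_function_def
  proof (intro conjI ballI)
    have "k ` space \<mu>r \<subseteq> {..N}" by (auto simp: k_def)
    then show "finite (k ` space \<mu>r)" by (rule finite_subset) simp
    have [measurable]: "k \<in> borel \<rightarrow>\<^sub>M count_space UNIV" unfolding k_def by measurable
    show "k -` {z} \<inter> space \<mu>r \<in> sets \<mu>r" for z
      using measurable_sets[of k borel "count_space UNIV" "{z}"] by simp
  qed
  define s where "s x = (if k x < N then blinfun_scaleC (g x) (conj_op S (y (k x))) else 0)" for x
  have shs: "hilbert_schmidt (s x)" for x
    by (simp add: s_def hilbert_schmidt_scaleC hilbert_schmidt_conj_op S)
  have sint: "Bochner_Integration.simple_bochner_integrable \<mu>r s"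
  proof (rule simple_bochner_integrable.intros)
    show "simple_function \<mu>r s"
      unfolding s_def
      by (rule simple_function_compose2[OF gsf(1) k, where h = "\<lambda>a i. if i < N then blinfun_scaleC a (conj_op S (y i)) else 0"])
    have "{x \<in> space \<mu>r. g x \<noteq> 0} = g -` (- {0}) \<inter> space \<mu>r" by auto
    then have "{x \<in> space \<mu>r. g x \<noteq> 0} \<in> sets \<mu>r" using gsf(1) by (metis simple_functionD(2))
    then have "emeasure \<mu>r {x \<in> space \<mu>r. s x \<noteq> 0} \<le> emeasure \<mu>r {x \<in> space \<mu>r. g x \<noteq> 0}"
      by (intro emeasure_mono) (auto simp: s_def split: if_splits)
    then show "emeasure \<mu>r {x \<in> space \<mu>r. s x \<noteq> 0} \<noteq> \<infinity>" using gsf(2) by (auto simp: top_unique)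
  qed
  have pt: "ennreal (hs_norm (star_integrand \<pi> f S x - s x))
      \<le> ennreal n * ennreal (norm (f x - g x)) + (ennreal \<delta> * ennreal (norm (f x)) + ennreal n * (ennreal (norm (f x)) * indicator {x. N \<le> j x} x))" for x
  proof (cases "j x < N")
    case True
    define P where "P = blinfun_scaleC (f x - g x) (conj_op S (y (j x)))"
    define Q where "Q = blinfun_scaleC (f x) (conj_op S x - conj_op S (y (j x)))"
    have "star_integrand \<pi> f S x - s x = P + Q"
      using True by (intro blinfun_eqI) (simp add: star_integrand_eq s_def k_def P_def Q_def blinfun.diff_left
          blinfun.add_left scaleC_diff_left scaleC_diff_right)
    moreover have D: "hilbert_schmidt (conj_op S x - conj_op S (y (j x)))"
      by (intro hilbert_schmidt_diff hilbert_schmidt_conj_op S)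
    moreover have "hs_norm P \<le> norm (f x - g x) * n"
      unfolding P_def n_def
      by (rule order_trans[OF hs_norm_scaleC_le[OF hilbert_schmidt_conj_op[OF S]]]) (intro mult_left_mono hs_norm_conj_op S, simp)
    moreover have "hs_norm Q \<le> norm (f x) * \<delta>"
      unfolding Q_def
      by (rule order_trans[OF hs_norm_scaleC_le[OF D]]) (intro mult_left_mono order.strict_implies_order[OF y], simp)
    ultimately have "hs_norm (star_integrand \<pi> f S x - s x) \<le> n * norm (f x - g x) + \<delta> * norm (f x)"
      using hs_norm_triangle[of P Q] hilbert_schmidt_scaleC[OF D, of "f x"]
        hilbert_schmidt_scaleC[OF hilbert_schmidt_conj_op[OF S], of "f x - g x" "y (j x)"]
      unfolding P_def Q_def by (simp add: mult.commute)
    then have "ennreal (hs_norm (star_integrand \<pi> f S x - s x)) \<le> ennreal (n * norm (f x - g x) + \<delta> * norm (f x))"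
      by (rule ennreal_leI)
    then show ?thesis using True n \<delta> by (simp add: ennreal_mult)
  next
    case False
    then have "hs_norm (star_integrand \<pi> f S x - s x) = hs_norm (blinfun_scaleC (f x) (conj_op S x))"
      by (simp add: s_def k_def star_integrand_eq)
    also have "\<dots> \<le> norm (f x) * n"
      unfolding n_def
      by (rule order_trans[OF hs_norm_scaleC_le[OF hilbert_schmidt_conj_op[OF S]]]) (intro mult_left_mono hs_norm_conj_op S, simp)
    finally have "ennreal (hs_norm (star_integrand \<pi> f S x - s x)) \<le> ennreal (n * norm (f x))"
      by (simp add: ennreal_leI mult.commute)
    also have "\<dots> = ennreal n * (ennreal (norm (f x)) * indicator {x. N \<le> j x} x)"
      using False n by (simp add: ennreal_mult)
    finally show ?thesis by (intro add_increasing zero_le)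
  qed
  have "(\<integral>\<^sup>+x. ennreal (hs_norm (star_integrand \<pi> f S x - s x)) \<partial>\<mu>r)
      \<le> (\<integral>\<^sup>+x. ennreal n * ennreal (norm (f x - g x)) + (ennreal \<delta> * ennreal (norm (f x)) + ennreal n * (ennreal (norm (f x)) * indicator {x. N \<le> j x} x)) \<partial>\<mu>r)"
    by (intro nn_integral_mono pt)
  also have "\<dots> = ennreal n * (\<integral>\<^sup>+x. ennreal (norm (f x - g x)) \<partial>\<mu>r)
      + (ennreal \<delta> * (\<integral>\<^sup>+x. ennreal (norm (f x)) \<partial>\<mu>r) + ennreal n * (\<integral>\<^sup>+x. ennreal (norm (f x)) * indicator {x. N \<le> j x} x \<partial>\<mu>r))"
    by (simp add: nn_integral_add nn_integral_cmult)
  also have "\<dots> \<le> ennreal n * ennreal \<eta> + (ennreal \<delta> * ennreal A + ennreal n * ennreal \<eta>)"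
    using A(2) by (intro add_mono mult_left_mono g(2) N) auto
  also have "\<dots> = ennreal (n * \<eta> + (\<delta> * A + n * \<eta>))"
    using n A \<delta> \<eta> by (simp add: ennreal_mult[symmetric] ennreal_plus[symmetric] del: ennreal_plus)
  also have "\<dots> \<le> ennreal \<epsilon>" using \<delta>(2) \<eta>(2) by (intro ennreal_leI) linarith
  finally show ?thesis using sint shs by blast
qed

text \<open>\<open>T\<close> is already identified by its weak form, so the integrals of the step
  functions are compared with it directly: \<open>hs_norm_weak_integral_le\<close> bounds their
  distance to \<open>T\<close> by the mean error \<open>1 / Suc i\<close>. The basis is taken in the
  range of \<open>C\<close>, where the weak form is given.\<close>

lemma star_integral:
  assumes f: "integrable \<mu>r f" and S: "hilbert_schmidt S" and T: "clinear_on UNIV (blinfun_apply T)"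
    and weak: "\<And>\<phi> \<psi>. \<phi> \<in> V \<Longrightarrow> cinner (T (C \<phi>)) \<psi> = (LINT x|\<mu>r. f x * cinner (S (\<pi> x (C \<phi>))) (\<pi> x \<psi>))"
  shows "hs_integrable \<mu>r (star_integrand \<pi> f S)" "operator_convolution \<mu>r \<pi> f S = T"
proof -
  have fm [measurable]: "f \<in> borel_measurable borel" using f by (simp add: integrable_iff_bounded measurable_mu)
  define h where "h = star_integrand \<pi> f S"
  have hhs: "hilbert_schmidt (h x)" for x
    by (simp add: h_def star_integrand_eq hilbert_schmidt_scaleC hilbert_schmidt_conj_op S)
  have hi: "integrable \<mu>r (\<lambda>x. cinner (h x v) \<psi>)" for v \<psi>
    unfolding h_def by (rule star_integrand_integrable[OF f S])
  have weak': "cinner (T b) \<psi> = (LINT x|\<mu>r. cinner (h x b) \<psi>)" if "b \<in> C ` V" for b \<psi>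
    using that weak by (auto simp: h_def star_integrand_cinner)
  obtain B where B: "B \<subseteq> C ` V" "orthonormal_basis B"
    using orthonormal_basis_in_total[OF CV_subspace CV_total] by blast
  have "\<exists>s. Bochner_Integration.simple_bochner_integrable \<mu>r s \<and> (\<forall>x. hilbert_schmidt (s x)) \<and>
    (\<integral>\<^sup>+x. ennreal (hs_norm (h x - s x)) \<partial>\<mu>r) \<le> ennreal (1 / Suc i)" for i :: nat
    unfolding h_def by (rule star_integrand_approx[OF f S]) simp
  then obtain s where s: "\<And>i. Bochner_Integration.simple_bochner_integrable \<mu>r (s i)" "\<And>i x. hilbert_schmidt (s i x)"
    "\<And>i. (\<integral>\<^sup>+x. ennreal (hs_norm (h x - s i x)) \<partial>\<mu>r) \<le> ennreal (1 / Suc i)" by metis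
  have sm: "(\<lambda>x. s i x v) \<in> borel_measurable \<mu>r" for i v
    using s(1)[of i] by (auto elim!: simple_bochner_integrable.cases
        intro!: borel_measurable_simple_function simple_function_compose1[where g = "\<lambda>R. blinfun_apply R v"])
  have hm: "(\<lambda>x. h x v) \<in> borel_measurable \<mu>r" for v
    unfolding h_def measurable_mu by measurable
  have m: "(\<lambda>x. hs_norm (h x - s i x)) \<in> borel_measurable \<mu>r" for i
    by (rule hs_norm_measurable) (auto simp: hilbert_schmidt_diff hhs s(2) blinfun.diff_left intro!: borel_measurable_diff hm sm)
  have m': "(\<lambda>x. hs_norm (s i x - h x)) \<in> borel_measurable \<mu>r" for i
    using m[of i] by (subst hs_norm_minus_commute)
  have lim0: "(\<lambda>i. 1 / real (Suc i)) \<longlonglongrightarrow> 0"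
    using LIMSEQ_inverse_real_of_nat by (simp add: inverse_eq_divide)
  have diff: "hilbert_schmidt (Bochner_Integration.simple_bochner_integral \<mu>r (s i) - T)"
    "hs_norm (Bochner_Integration.simple_bochner_integral \<mu>r (s i) - T) \<le> 1 / Suc i" for i
  proof -
    define R where "R = Bochner_Integration.simple_bochner_integral \<mu>r (s i) - T"
    have I: "hilbert_schmidt (Bochner_Integration.simple_bochner_integral \<mu>r (s i))"
      by (intro hilbert_schmidt_simple_integral s(2))
    have Rl: "clinear_on UNIV R"
      unfolding R_def using I T by (intro clinear_on_blinfun_add) (auto simp: hilbert_schmidt_iff)
    have Ri: "integrable \<mu>r (\<lambda>x. cinner ((s i x - h x) b) \<psi>)" for b \<psi>
      using simple_bochner_integral_cinner(1)[OF s(1)[of i]] hi by (simp add: blinfun.diff_left cinner_diff_left)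
    have Rw: "cinner (R b) \<psi> = (LINT x|\<mu>r. cinner ((s i x - h x) b) \<psi>)" if "b \<in> B" for b \<psi>
      using weak'[of b \<psi>] that B(1) hi simple_bochner_integral_cinner[OF s(1)[of i], of b \<psi>]
      by (auto simp: R_def blinfun.diff_left cinner_diff_left)
    have le: "(\<integral>\<^sup>+x. ennreal (hs_norm (s i x - h x)) \<partial>\<mu>r) \<le> ennreal (1 / Suc i)"
      using s(3)[of i] by (subst hs_norm_minus_commute)
    have hd: "hilbert_schmidt (s i x - h x)" for x by (intro hilbert_schmidt_diff s(2) hhs)
    show "hilbert_schmidt (Bochner_Integration.simple_bochner_integral \<mu>r (s i) - T)"
      "hs_norm (Bochner_Integration.simple_bochner_integral \<mu>r (s i) - T) \<le> 1 / Suc i"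
      using hs_norm_weak_integral_le[OF B(2) Rl hd Ri Rw m' le] by (auto simp: R_def)
  qed
  have Ths: "hilbert_schmidt T"
  proof -
    have "T = Bochner_Integration.simple_bochner_integral \<mu>r (s 0) - (Bochner_Integration.simple_bochner_integral \<mu>r (s 0) - T)" by simp
    then show ?thesis using hilbert_schmidt_diff[OF hilbert_schmidt_simple_integral[of \<mu>r "s 0", OF s(2)] diff(1)[of 0]] by simp
  qed
  have has: "has_hs_integral \<mu>r h T"
    unfolding has_hs_integral_def
  proof (intro conjI exI[of _ s] allI ballI hhs Ths s(1,2) m)
    show "(\<lambda>i. \<integral>\<^sup>+x. ennreal (hs_norm (h x - s i x)) \<partial>\<mu>r) \<longlonglongrightarrow> 0"
    proof (rule tendsto_sandwich[OF _ _ tendsto_const])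
      show "(\<lambda>i. ennreal (1 / real (Suc i))) \<longlonglongrightarrow> 0" using tendsto_ennrealI[OF lim0] by simp
    qed (use s(3) in auto)
    show "(\<lambda>i. hs_norm (Bochner_Integration.simple_bochner_integral \<mu>r (s i) - T)) \<longlonglongrightarrow> 0"
      by (rule tendsto_sandwich[OF _ _ tendsto_const lim0]) (use diff(2) in auto)
  qed
  then show "hs_integrable \<mu>r (star_integrand \<pi> f S)" by (auto simp: hs_integrable_def h_def)
  have "T' = T" if "has_hs_integral \<mu>r h T'" for T'
    using has_hs_integral_weak[OF that hi] has_hs_integral_weak[OF has hi]
    by (intro blinfun_eqI cinner_eqI) simp
  then have "hs_integral \<mu>r h = T" unfolding hs_integral_def using has by (intro the_equality)
  then show "operator_convolution \<mu>r \<pi> f S = T" by (simp add: operator_convolution_def h_def)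
qed

end

section \<open>The inverse Fourier-Kirillov transform\<close>

text \<open>The Riesz vector of a functional, inverse to \<open>blinfun_inner_right\<close>; it
  turns points of the orbit into arguments of \<open>fourier\<close>.\<close>

definition dual_vec :: "(('a::euclidean_space) \<Rightarrow>\<^sub>L real) \<Rightarrow> 'a" where
  "dual_vec Y = (\<Sum>b\<in>Basis. Y b *\<^sub>R b)"

lemma dual_vec_inner: "dual_vec Y \<bullet> X = Y X"
proof -
  have "Y X = Y (\<Sum>b\<in>Basis. (X \<bullet> b) *\<^sub>R b)" by (simp add: euclidean_representation)
  also have "\<dots> = dual_vec Y \<bullet> X"
    by (simp only: blinfun.sum_right blinfun.scaleR_right dual_vec_def inner_sum_left inner_scaleR_left)
      (simp add: inner_commute mult.commute)
  finally show ?thesis by simp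
qed

lemma dual_vec_inner_right [simp]: "dual_vec (blinfun_inner_right y) = y"
  by (rule vector_eq_rdot[THEN iffD1]) (simp add: dual_vec_inner)

lemma dual_vec_measurable [measurable]: "dual_vec \<in> borel_measurable borel"
  unfolding dual_vec_def by (intro borel_measurable_continuous_onI continuous_intros)

locale ko_setting = haar_group e \<mu>l \<mu>r \<Delta>
  for e :: "real^'d \<Rightarrow> 'g::{group_mult, t2_space, second_countable_topology}"
    and \<mu>l \<mu>r :: "'g measure" and \<Delta> :: "'g \<Rightarrow> real" +
  fixes F :: "(real^'d) \<Rightarrow>\<^sub>L real" and c :: real
  assumes stabilizer: "{x. coadjoint e x F = F} = {1}"
    and kappa_distr: "distr \<mu>r borel (kappa e F) = density dual_lborel
      (\<lambda>Y. ennreal (c * \<Delta> (inv (kappa e F) Y)) * indicator (range (\<lambda>x. coadjoint e x F)) Y)"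
    and c_nonneg: "0 \<le> c"
begin

lemma coadjoint_apply: "coadjoint e x F X = F (Ad e (inverse x) X)"
proof -
  have "bounded_linear (\<lambda>X. F (Ad e (inverse x) X))"
    by (rule bounded_linear_compose[OF blinfun.bounded_linear_right])
      (use linear_Ad linear_conv_bounded_linear in blast)
  then show ?thesis by (simp add: coadjoint_def bounded_linear_Blinfun_apply)
qed

lemma kappa_apply: "kappa e F x X = F (Ad e x X)"
  by (simp add: kappa_def coadjoint_apply)

text \<open>Two group elements with the same image differ by an element of the stabilizer.\<close>

lemma kappa_inj: "inj (kappa e F)"
proof (rule injI)
  fix x y assume "kappa e F x = kappa e F y"
  then have eq: "F (Ad e x X) = F (Ad e y X)" for X by (metis kappa_apply)
  have "coadjoint e (y * inverse x) F = F"
  proof (rule blinfun_eqI)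
    show "coadjoint e (y * inverse x) F X = F X" for X
      using eq[of "Ad e (inverse y) X"] by (simp add: coadjoint_apply inverse_mult Ad_mult)
  qed
  then have "y * inverse x = 1" using stabilizer by blast
  then have "(y * inverse x) * x = x" by simp
  then show "x = y" by (simp add: mult.assoc)
qed

lemma range_coadjoint: "range (\<lambda>x. coadjoint e x F) = range (kappa e F)"
proof -
  have "coadjoint e x F = kappa e F (inverse x)" for x by (simp add: kappa_def)
  then have "coadjoint e x F \<in> range (kappa e F)" for x by simp
  moreover have "kappa e F x \<in> range (\<lambda>x. coadjoint e x F)" for x by (simp add: kappa_def)
  ultimately show ?thesis by blast
qed

lemma kappa_continuous: "continuous_on UNIV (kappa e F)"
proof (rule continuous_on_blinfun_componentwise)
  show "continuous_on UNIV (\<lambda>x. kappa e F x i)" for i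
    unfolding kappa_apply
    by (intro continuous_intros continuous_on_compose2[OF Ad_continuous, of _ "\<lambda>x. (x, i)", simplified])
qed

text \<open>\<open>\<kappa>\<close> maps closed sets to countable unions of compact sets, since \<open>G\<close> is \<open>\<sigma>\<close>-compact.\<close>

lemma kappa_image_borel: "A \<in> sets borel \<Longrightarrow> kappa e F ` A \<in> sets borel"
proof -
  have closed: "kappa e F ` S \<in> sets borel" if "closed S" for S
  proof -
    have "S = (\<Union>n::nat. S \<inter> e ` cball 0 (real n))" using UN_exp_cball by blast
    then have "kappa e F ` S = (\<Union>n::nat. kappa e F ` (S \<inter> e ` cball 0 (real n)))" by (metis image_UN)
    also have "\<dots> \<in> sets borel"
    proof (rule sets.countable_nat_UN, safe)
      fix n :: nat
      have "compact (S \<inter> e ` cball 0 (real n))" using that compact_exp_cball by (intro closed_Int_compact)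
      then show "kappa e F ` (S \<inter> e ` cball 0 (real n)) \<in> sets borel"
        by (intro borel_compact compact_continuous_image continuous_on_subset[OF kappa_continuous]) auto
    qed
    finally show ?thesis .
  qed
  assume "A \<in> sets borel"
  then have "A \<in> sigma_sets UNIV (Collect closed)" unfolding borel_eq_closed by simp
  then show ?thesis
  proof induction
    case (Compl A)
    have "kappa e F ` (UNIV - A) = kappa e F ` UNIV - kappa e F ` A"
      using kappa_inj by (rule image_set_diff)
    then show ?case using Compl closed[of UNIV] by (simp only: closed_UNIV sets.Diff)
  next
    case (Union A)
    then show ?case by (simp only: image_UN) (rule sets.countable_UN, auto)
  qed (auto intro: closed)
qed

lemma kappa_measurable [measurable]: "kappa e F \<in> borel \<rightarrow>\<^sub>M borel"
  by (intro borel_measurable_continuous_onI kappa_continuous)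

text \<open>Off the orbit \<open>inv (kappa e F)\<close> is unspecified; the fixed value 1 there
  makes the inverse a Borel map on the whole dual space.\<close>

definition kappa_inv :: "((real^'d) \<Rightarrow>\<^sub>L real) \<Rightarrow> 'g" where
  "kappa_inv Y = (if Y \<in> range (kappa e F) then inv (kappa e F) Y else 1)"

lemma kappa_inv_measurable [measurable]: "kappa_inv \<in> borel \<rightarrow>\<^sub>M borel"
proof (rule measurableI)
  fix A :: "'g set" assume A: "A \<in> sets borel"
  have "kappa_inv -` A = kappa e F ` A \<union> (if 1 \<in> A then - range (kappa e F) else {})"
    using kappa_inj by (auto simp: kappa_inv_def split: if_splits)
  also have "\<dots> \<in> sets borel"
    using kappa_image_borel[OF A] kappa_image_borel[of UNIV] by (auto intro: borel_comp)
  finally show "kappa_inv -` A \<inter> space borel \<in> sets borel" by simp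
qed simp

lemma kappa_inv [simp]: "kappa_inv (kappa e F x) = x"
  using kappa_inj by (simp add: kappa_inv_def)

lemma range_kappa_borel [measurable]: "range (kappa e F) \<in> sets borel"
  by (rule kappa_image_borel) simp

lemma kappa_distr': "distr \<mu>r borel (kappa e F) =
  density dual_lborel (\<lambda>Y. ennreal (c * \<Delta> (kappa_inv Y)) * indicator (range (kappa e F)) Y)"
proof -
  have "(\<lambda>Y. ennreal (c * \<Delta> (inv (kappa e F) Y)) * indicator (range (\<lambda>x. coadjoint e x F)) Y)
      = (\<lambda>Y. ennreal (c * \<Delta> (kappa_inv Y)) * indicator (range (kappa e F)) Y)"
    by (auto simp: fun_eq_iff kappa_inv_def range_coadjoint indicator_def)
  then show ?thesis using kappa_distr by simp
qed

lemma sets_dual [simp, measurable_cong]: "sets dual_lborel = sets borel"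
  by (simp add: dual_lborel_def)

lemma inner_right_measurable [measurable]: "blinfun_inner_right \<in> borel \<rightarrow>\<^sub>M borel"
  by (intro borel_measurable_continuous_onI linear_continuous_on bounded_linear_blinfun_inner_right)

text \<open>For \<open>c = 0\<close> the image of \<open>\<mu>r\<close> under \<open>kappa\<close>,
  and with it \<open>\<mu>r\<close>, would be the zero measure.\<close>

lemma c_pos: "0 < c"
proof (rule ccontr)
  assume "\<not> 0 < c"
  then have "c = 0" using c_nonneg by simp
  then have "emeasure (distr \<mu>r borel (kappa e F)) UNIV = 0"
    unfolding kappa_distr' by (simp add: emeasure_density dual_lborel_def)
  then have "emeasure \<mu>r UNIV = 0" by (simp add: emeasure_distr)
  then show False using haar_like(2) by (simp add: haar_like_def)
qed

section \<open>The Fourier transform on the orbit and its pairings\<close>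

definition kv :: "'g \<Rightarrow> real^'d" where "kv x = dual_vec (kappa e F x)"

lemma kv_inner: "kv x \<bullet> X = F (Ad e x X)"
  by (simp add: kv_def dual_vec_inner kappa_apply)

lemma kv_mult: "kv (x * y) \<bullet> X = kv x \<bullet> Ad e y X"
  by (simp add: kv_inner Ad_mult)

lemma kv_measurable [measurable]: "kv \<in> borel \<rightarrow>\<^sub>M borel"
  unfolding kv_def by measurable

text \<open>On the orbit the density in \<open>kappa_distr'\<close> cancels the factor
  \<open>1 / (c * \<Delta> x)\<close> exactly. The orbit need not fill the dual space, so the
  Lebesgue integral on the right is only an upper bound.\<close>

lemma kv_nn_integral_le:
  assumes [measurable]: "\<Phi> \<in> borel_measurable borel"
  shows "(\<integral>\<^sup>+x. ennreal (1 / (c * \<Delta> x)) * \<Phi> (kv x) \<partial>\<mu>r) \<le> (\<integral>\<^sup>+y. \<Phi> y \<partial>lborel)"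
proof -
  have "(\<integral>\<^sup>+x. ennreal (1 / (c * \<Delta> x)) * \<Phi> (kv x) \<partial>\<mu>r)
      = (\<integral>\<^sup>+Y. ennreal (1 / (c * \<Delta> (kappa_inv Y))) * \<Phi> (dual_vec Y) \<partial>distr \<mu>r borel (kappa e F))"
    by (subst nn_integral_distr) (auto simp: kv_def)
  also have "\<dots> = (\<integral>\<^sup>+Y. (ennreal (c * \<Delta> (kappa_inv Y)) * indicator (range (kappa e F)) Y) *
      (ennreal (1 / (c * \<Delta> (kappa_inv Y))) * \<Phi> (dual_vec Y)) \<partial>dual_lborel)"
    unfolding kappa_distr' by (rule nn_integral_density) measurable
  also have "\<dots> \<le> (\<integral>\<^sup>+Y. \<Phi> (dual_vec Y) \<partial>dual_lborel)"
  proof (rule nn_integral_mono)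
    fix Y
    have "ennreal (c * \<Delta> (kappa_inv Y)) * (ennreal (1 / (c * \<Delta> (kappa_inv Y))) * t) = t" for t
      using c_pos by (simp add: mult.assoc[symmetric] ennreal_mult[symmetric] less_imp_le)
    then show "(ennreal (c * \<Delta> (kappa_inv Y)) * indicator (range (kappa e F)) Y) *
      (ennreal (1 / (c * \<Delta> (kappa_inv Y))) * \<Phi> (dual_vec Y)) \<le> \<Phi> (dual_vec Y)"
      by (auto simp: indicator_def)
  qed
  also have "\<dots> = (\<integral>\<^sup>+y. \<Phi> y \<partial>lborel)"
    unfolding dual_lborel_def by (subst nn_integral_distr) auto
  finally show ?thesis .
qed

text \<open>The transpose of the Fourier-Kirillov integral: by Fubini, pairing a transform with
  \<open>h\<close> is pairing the original function with \<open>ko_test h\<close>.\<close>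

definition ko_test :: "(real^'d \<Rightarrow> complex) \<Rightarrow> 'g \<Rightarrow> complex" where
  "ko_test h x = fourier h (kv x) / of_real (sqrt (c * \<Delta> x))"

lemma
  assumes i: "integrable lborel h" and h: "L2 lborel h"
  shows ko_test_L2: "L2 \<mu>r (ko_test h)" and ko_test_l2norm: "l2norm \<mu>r (ko_test h) \<le> l2norm lborel h"
proof -
  have [measurable]: "h \<in> borel_measurable borel" using i by (simp add: integrable_iff_bounded)
  have [measurable]: "ko_test h \<in> borel_measurable \<mu>r" unfolding ko_test_def by measurable
  have "ennreal ((norm (ko_test h x))\<^sup>2) = ennreal (1 / (c * \<Delta> x)) * ennreal ((norm (fourier h (kv x)))\<^sup>2)" for x
  proof -
    have "0 < c * \<Delta> x" using c_pos Delta_pos by (intro mult_pos_pos)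
    then show ?thesis
      by (simp add: ko_test_def norm_divide power_divide ennreal_mult[symmetric] del: Delta_pos)
  qed
  then have "(\<integral>\<^sup>+x. ennreal ((norm (ko_test h x))\<^sup>2) \<partial>\<mu>r)
      = (\<integral>\<^sup>+x. ennreal (1 / (c * \<Delta> x)) * (\<lambda>y. ennreal ((norm (fourier h y))\<^sup>2)) (kv x) \<partial>\<mu>r)" by simp
  also have "\<dots> \<le> (\<integral>\<^sup>+y. ennreal ((norm (fourier h y))\<^sup>2) \<partial>lborel)"
    by (rule kv_nn_integral_le) measurable
  also have "\<dots> \<le> ennreal ((l2norm lborel h)\<^sup>2)" using plancherel_le[OF i] L2_nn[OF h] by simp
  finally have *: "(\<integral>\<^sup>+x. ennreal ((norm (ko_test h x))\<^sup>2) \<partial>\<mu>r) \<le> ennreal ((l2norm lborel h)\<^sup>2)" .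
  show "L2 \<mu>r (ko_test h)" "l2norm \<mu>r (ko_test h) \<le> l2norm lborel h"
    by (rule L2I[OF _ *]; simp)+
qed

definition ko_weak :: "('g \<Rightarrow> complex) \<Rightarrow> (real^'d \<Rightarrow> complex) \<Rightarrow> bool" where
  "ko_weak g u \<longleftrightarrow> (\<forall>h. integrable lborel h \<longrightarrow> L2 lborel h \<longrightarrow>
     (LINT X|lborel. u X * h X) = (LINT x|\<mu>r. g x * ko_test h x))"

lemma ball_L2:
  assumes [measurable]: "u \<in> borel_measurable lborel" and b: "\<And>X. norm (u X) \<le> b" and "b \<ge> 0"
  shows "integrable lborel (\<lambda>X. u X * indicator (ball 0 r) X)" "L2 lborel (\<lambda>X::real^'d. u X * indicator (ball 0 r) X)"
proof -
  have i: "integrable lborel (\<lambda>X::real^'d. k * indicator (ball 0 r) X)" for k :: real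
    using emeasure_bounded_finite[OF bounded_ball, of "0::real^'d" r]
    by (intro integrable_mult_right integrable_real_indicator) simp_all
  have [measurable]: "ball 0 r \<in> sets (borel :: (real^'d) measure)" by (intro borel_open open_ball)
  have m: "(\<lambda>X. u X * indicator (ball 0 r) X) \<in> borel_measurable lborel" by measurable
  show "integrable lborel (\<lambda>X. u X * indicator (ball 0 r) X)"
    by (rule Bochner_Integration.integrable_bound[OF i[of b]]) (use assms in \<open>auto simp: indicator_def\<close>)
  have "integrable lborel (\<lambda>X. (norm (u X * indicator (ball 0 r) X))\<^sup>2)"
    by (rule Bochner_Integration.integrable_bound[OF i[of "b\<^sup>2"]])
      (use assms in \<open>auto simp: indicator_def intro!: power_mono\<close>)
  with m show "L2 lborel (\<lambda>X::real^'d. u X * indicator (ball 0 r) X)" unfolding L2_def by blast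
qed

text \<open>The test function is the conjugate of the difference, cut off to a ball to make it
  integrable as well as square integrable; so the squared modulus of the difference has integral 0
  over every ball.\<close>

lemma ko_weak_unique:
  assumes u: "L2 lborel u" "ko_weak g u" and u': "L2 lborel u'" "ko_weak g u'"
  shows "AE X in lborel. u X = u' X"
proof -
  define d where "d X = u X - u' X" for X
  have d: "L2 lborel d" unfolding d_def by (intro L2_diff u u')
  note [measurable] = L2_measurable[OF d]
  have "AE X in lborel. X \<in> ball 0 (real n) \<longrightarrow> d X = 0" for n :: nat
  proof -
    define h where "h X = cnj (d X) * indicator (ball 0 (real n)) X" for X
    have [measurable]: "ball 0 (real n) \<in> sets (borel :: (real^'d) measure)" by (intro borel_open open_ball)
    have one: "L2 lborel (\<lambda>X::real^'d. 1 * indicator (ball 0 (real n)) X)"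
      by (rule ball_L2[where b = 1]) auto
    have hi: "integrable lborel h"
      unfolding h_def using L2_integrable_mult[OF L2_cnj[OF d] one] by simp
    have hL: "L2 lborel h"
    proof -
      have "L2 lborel (\<lambda>X. cnj (d X))" by (rule L2_cnj[OF d])
      moreover have "(\<integral>\<^sup>+X. ennreal ((norm (h X))\<^sup>2) \<partial>lborel) \<le> (\<integral>\<^sup>+X. ennreal ((norm (cnj (d X)))\<^sup>2) \<partial>lborel)"
        by (intro nn_integral_mono) (auto simp: h_def indicator_def)
      moreover have "h \<in> borel_measurable lborel" unfolding h_def by measurable
      ultimately show ?thesis by (auto simp: L2_iff intro: le_less_trans)
    qed
    have "(LINT X|lborel. d X * h X) = (LINT X|lborel. u X * h X) - (LINT X|lborel. u' X * h X)"
      unfolding d_def left_diff_distrib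
      by (intro Bochner_Integration.integral_diff L2_integrable_mult u u' hL)
    also have "\<dots> = 0" using u(2) u'(2) hi hL by (simp add: ko_weak_def)
    finally have "(LINT X|lborel. d X * h X) = 0" .
    moreover have "d X * h X = of_real ((norm (d X))\<^sup>2 * indicator (ball 0 (real n)) X)" for X
      by (simp add: h_def mult_cnj_cmod indicator_def)
    ultimately have "complex_of_real (LINT X|lborel. (norm (d X))\<^sup>2 * indicator (ball 0 (real n)) X) = 0"
      by (simp only: integral_complex_of_real)
    then have "(LINT X|lborel. (norm (d X))\<^sup>2 * indicator (ball 0 (real n)) X) = 0"
      by (simp only: of_real_eq_0_iff)
    moreover have "integrable lborel (\<lambda>X. (norm (d X))\<^sup>2 * indicator (ball 0 (real n)) X)"
      by (rule Bochner_Integration.integrable_bound[where f = "\<lambda>X. (norm (d X))\<^sup>2"])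
        (use d in \<open>auto simp: L2_def indicator_def\<close>)
    ultimately have "AE X in lborel. (norm (d X))\<^sup>2 * indicator (ball 0 (real n)) X = 0"
      by (subst (asm) integral_nonneg_eq_0_iff_AE) auto
    then show ?thesis by eventually_elim (auto simp: indicator_def)
  qed
  then have "AE X in lborel. \<forall>n::nat. X \<in> ball 0 (real n) \<longrightarrow> d X = 0"
    unfolding AE_all_countable by blast
  then show ?thesis
  proof eventually_elim
    fix X assume *: "\<forall>n::nat. X \<in> ball 0 (real n) \<longrightarrow> d X = 0"
    obtain n :: nat where "norm X < real n" using reals_Archimedean2 by blast
    then show "u X = u' X" using * by (auto simp: d_def)
  qed
qed

section \<open>The absolutely convergent transform and its extension to square integrable
  functions\<close>

definition ko_hat :: "('g \<Rightarrow> complex) \<Rightarrow> real^'d \<Rightarrow> complex" where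
  "ko_hat f X = (LINT y|\<mu>r. ko_integrand e F c \<Delta> f X y)"

lemma ko_integrand_kv: "ko_integrand e F c \<Delta> f X y =
  f y / of_real (sqrt (c * \<Delta> y)) * exp (- (2 * of_real pi * \<i> * of_real (kv y \<bullet> X)))"
  by (simp add: ko_integrand_def kv_inner kappa_apply)

text \<open>An absolutely convergent transform is bounded, so its conjugate cut off to a ball is an
  admissible test function. Pairing the two and using the bound for \<open>ko_test\<close> gives the
  norm estimate on the ball; Fatou's lemma removes the ball.\<close>

lemma
  assumes f: "L2 \<mu>r f" and i: "integrable \<mu>r (\<lambda>y. f y / of_real (sqrt (c * \<Delta> y)))"
  shows ko_hat_weak: "ko_weak f (ko_hat f)" and ko_hat_L2: "L2 lborel (ko_hat f)"
    and ko_hat_l2norm: "l2norm lborel (ko_hat f) \<le> l2norm \<mu>r f"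
proof -
  have [measurable]: "f \<in> borel_measurable borel" using L2_measurable[OF f] by (simp add: measurable_mu)
  define p where "p y = f y / of_real (sqrt (c * \<Delta> y))" for y
  have pm [measurable]: "p \<in> borel_measurable borel" unfolding p_def by measurable
  define E where "E y X = exp (- (2 * of_real pi * \<i> * complex_of_real (kv y \<bullet> X)))" for y X
  have [measurable]: "case_prod E \<in> borel_measurable (borel \<Otimes>\<^sub>M borel)" unfolding E_def by measurable
  have [simp]: "norm (E y X) = 1" for y X by (simp add: E_def)
  have hat: "ko_hat f X = (LINT y|\<mu>r. p y * E y X)" for X
    by (simp add: ko_hat_def ko_integrand_kv p_def E_def)
  have hm [measurable]: "ko_hat f \<in> borel_measurable lborel"
    unfolding hat[abs_def] by measurable
  show weak: "ko_weak f (ko_hat f)"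
    unfolding ko_weak_def
  proof (intro allI impI)
    fix h :: "real^'d \<Rightarrow> complex" assume h: "integrable lborel h" "L2 lborel h"
    have [measurable]: "h \<in> borel_measurable borel" using h by (simp add: integrable_iff_bounded)
    have "integrable (\<mu>r \<Otimes>\<^sub>M lborel) (\<lambda>(y, X). p y * E y X * h X)"
    proof (rule leb.Fubini_integrable)
      show "(\<lambda>(y, X). p y * E y X * h X) \<in> borel_measurable (\<mu>r \<Otimes>\<^sub>M lborel)" by measurable
      show "integrable \<mu>r (\<lambda>y. LINT X|lborel. norm (case (y, X) of (y, X) \<Rightarrow> p y * E y X * h X))"
        using i by (simp add: norm_mult p_def[symmetric])
      show "AE y in \<mu>r. integrable lborel (\<lambda>X. case (y, X) of (y, X) \<Rightarrow> p y * E y X * h X)"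
      proof (rule AE_I2)
        fix y
        have "integrable lborel (\<lambda>X. p y * h X)" using h by (intro integrable_mult_right)
        then show "integrable lborel (\<lambda>X. case (y, X) of (y, X) \<Rightarrow> p y * E y X * h X)"
          by (rule Bochner_Integration.integrable_bound) (auto simp: norm_mult)
      qed
    qed
    from leb.Fubini_integral[OF this]
    have "(LINT X|lborel. LINT y|\<mu>r. p y * E y X * h X) = (LINT y|\<mu>r. LINT X|lborel. p y * E y X * h X)" by simp
    also have "\<dots> = (LINT y|\<mu>r. f y * ko_test h y)"
    proof (rule Bochner_Integration.integral_cong[OF refl])
      fix y
      have "(LINT X|lborel. p y * E y X * h X) = (LINT X|lborel. p y * (h X * E y X))" by (simp add: mult_ac)
      also have "\<dots> = p y * fourier h (kv y)" by (simp only: integral_mult_right_zero fourier_def E_def)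
      finally show "(LINT X|lborel. p y * E y X * h X) = f y * ko_test h y" by (simp add: p_def ko_test_def)
    qed
    finally show "(LINT X|lborel. ko_hat f X * h X) = (LINT y|\<mu>r. f y * ko_test h y)"
      by (simp only: hat integral_mult_left_zero[symmetric])
  qed
  have [measurable]: "ball 0 r \<in> sets (borel :: (real^'d) measure)" for r by (intro borel_open open_ball)
  define b where "b = (LINT y|\<mu>r. norm (p y))"
  have b: "norm (ko_hat f X) \<le> b" for X
    unfolding hat b_def by (rule order_trans[OF integral_norm_bound]) (simp add: norm_mult)
  have b0: "0 \<le> b" unfolding b_def by simp
  have trunc: "(\<integral>\<^sup>+X. ennreal ((norm (ko_hat f X))\<^sup>2 * indicator (ball 0 (real n)) X) \<partial>lborel) \<le> ennreal ((l2norm \<mu>r f)\<^sup>2)" for n :: nat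
  proof -
    define h where "h X = cnj (ko_hat f X) * indicator (ball 0 (real n)) X" for X
    have h: "integrable lborel h" "L2 lborel h"
      unfolding h_def by (rule ball_L2[where b = b]; use b b0 in simp)+
    have nh: "(norm (h X))\<^sup>2 = (norm (ko_hat f X))\<^sup>2 * indicator (ball 0 (real n)) X" for X
      by (simp add: h_def indicator_def)
    have "(l2norm lborel h)\<^sup>2 = (LINT X|lborel. (norm (h X))\<^sup>2)" by (simp add: l2norm_def)
    then have "complex_of_real ((l2norm lborel h)\<^sup>2) = (LINT X|lborel. of_real ((norm (h X))\<^sup>2))"
      by (simp only: integral_complex_of_real)
    also have "\<dots> = (LINT X|lborel. ko_hat f X * h X)"
      unfolding nh by (intro Bochner_Integration.integral_cong refl) (simp add: h_def mult_cnj_cmod indicator_def)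
    also have "\<dots> = (LINT y|\<mu>r. f y * ko_test h y)" using weak h by (simp add: ko_weak_def)
    finally have "(l2norm lborel h)\<^sup>2 = norm (LINT y|\<mu>r. f y * ko_test h y)"
      by (metis abs_of_nonneg norm_of_real zero_le_power2)
    also have "\<dots> \<le> l2norm \<mu>r f * l2norm \<mu>r (ko_test h)"
      by (rule L2_integral_mult_le[OF f ko_test_L2[OF h]])
    also have "\<dots> \<le> l2norm \<mu>r f * l2norm lborel h"
      by (intro mult_left_mono ko_test_l2norm h) simp
    finally have "l2norm lborel h \<le> l2norm \<mu>r f"
      by (cases "l2norm lborel h = 0") (auto simp: power2_eq_square less_le)
    then have "(l2norm lborel h)\<^sup>2 \<le> (l2norm \<mu>r f)\<^sup>2" by (intro power_mono) auto
    then show ?thesis using L2_nn[OF h(2)] by (simp add: nh ennreal_leI)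
  qed
  have "(\<integral>\<^sup>+X. ennreal ((norm (ko_hat f X))\<^sup>2) \<partial>lborel)
      = (\<integral>\<^sup>+X. liminf (\<lambda>n. ennreal ((norm (ko_hat f X))\<^sup>2 * indicator (ball 0 (real n)) X)) \<partial>lborel)"
  proof (rule nn_integral_cong)
    fix X :: "real^'d"
    obtain N :: nat where N: "norm X < real N" using reals_Archimedean2 by blast
    have "(\<lambda>n. ennreal ((norm (ko_hat f X))\<^sup>2 * indicator (ball 0 (real n)) X)) \<longlonglongrightarrow> ennreal ((norm (ko_hat f X))\<^sup>2)"
      using N by (intro tendsto_eventually eventually_sequentiallyI[of N]) (auto simp: indicator_def)
    then show "ennreal ((norm (ko_hat f X))\<^sup>2) = liminf (\<lambda>n. ennreal ((norm (ko_hat f X))\<^sup>2 * indicator (ball 0 (real n)) X))"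
      by (intro lim_imp_Liminf[symmetric]) auto
  qed
  also have "\<dots> \<le> liminf (\<lambda>n. \<integral>\<^sup>+X. ennreal ((norm (ko_hat f X))\<^sup>2 * indicator (ball 0 (real n)) X) \<partial>lborel)"
    by (rule nn_integral_liminf) measurable
  also have "\<dots> \<le> limsup (\<lambda>n. \<integral>\<^sup>+X. ennreal ((norm (ko_hat f X))\<^sup>2 * indicator (ball 0 (real n)) X) \<partial>lborel)"
    by (rule Liminf_le_Limsup) simp
  also have "\<dots> \<le> ennreal ((l2norm \<mu>r f)\<^sup>2)"
    by (intro Limsup_bounded always_eventually allI trunc)
  finally have *: "(\<integral>\<^sup>+X. ennreal ((norm (ko_hat f X))\<^sup>2) \<partial>lborel) \<le> ennreal ((l2norm \<mu>r f)\<^sup>2)" .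
  show "L2 lborel (ko_hat f)" "l2norm lborel (ko_hat f) \<le> l2norm \<mu>r f"
    by (rule L2I[OF hm *]; simp)+
qed

lemma ko_approx:
  assumes g: "L2 \<mu>r g"
  obtains fs where "\<And>k::nat. L2 \<mu>r (fs k)" "\<And>k. integrable \<mu>r (\<lambda>y. fs k y / of_real (sqrt (c * \<Delta> y)))"
    "L2_tendsto \<mu>r fs g"
proof -
  have [measurable]: "g \<in> borel_measurable borel" using L2_measurable[OF g] by (simp add: measurable_mu)
  define K where "K k = e ` cball 0 (real k)" for k :: nat
  have K [measurable]: "K k \<in> sets borel" for k unfolding K_def by (intro borel_compact compact_exp_cball)
  \<comment> \<open>Compactness of \<open>K k\<close> controls the measure, but
    \<open>\<Delta>\<close> is known here only to be measurable; the lower bound that makes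
    \<open>1 / sqrt (c * \<Delta> x)\<close> square integrable on \<open>A k\<close> is imposed
    separately.\<close>
  define A where "A k = K k \<inter> {x. 1 / real (Suc k) \<le> \<Delta> x}" for k
  have A [measurable]: "A k \<in> sets \<mu>r" for k
    unfolding A_def sets_mu by measurable
  have ev: "\<forall>\<^sub>F k in sequentially. x \<in> A k" for x
  proof -
    obtain n :: nat where n: "norm (lg x) \<le> real n" using real_arch_simple by blast
    obtain m where m: "inverse (real (Suc m)) < \<Delta> x" using reals_Archimedean[OF Delta_pos] by blast
    have "x \<in> A k" if "k \<ge> max n m" for k
    proof -
      have "x \<in> K k" unfolding K_def using n that by (intro image_eqI[of _ _ "lg x"]) auto
      moreover have "1 / real (Suc k) \<le> 1 / real (Suc m)" using that by (intro divide_left_mono) auto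
      ultimately show ?thesis using m by (simp add: A_def inverse_eq_divide)
    qed
    then show ?thesis by (intro eventually_sequentiallyI[of "max n m"])
  qed
  define fs where "fs k x = g x * indicator (A k) x" for k x
  have L: "L2 \<mu>r (fs k)" and T: "L2_tendsto \<mu>r fs g" for k
    unfolding fs_def using L2_truncate[OF g A ev] by simp_all
  have i: "integrable \<mu>r (\<lambda>y. fs k y / of_real (sqrt (c * \<Delta> y)))" for k
  proof -
    define q where "q x = indicator (A k) x / complex_of_real (sqrt (c * \<Delta> x))" for x
    have fin: "emeasure \<mu>r (K k) < \<infinity>"
      using haar_like(2) compact_exp_cball unfolding K_def haar_like_def by blast
    have "L2 \<mu>r q"
      unfolding L2_def
    proof
      show "q \<in> borel_measurable \<mu>r" unfolding q_def by measurable
      have "integrable \<mu>r (\<lambda>x. (real (Suc k) / c) * indicator (K k) x)"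
        using fin by (intro integrable_mult_right integrable_real_indicator) auto
      then show "integrable \<mu>r (\<lambda>x. (norm (q x))\<^sup>2)"
      proof (rule Bochner_Integration.integrable_bound)
        show "(\<lambda>x. (norm (q x))\<^sup>2) \<in> borel_measurable \<mu>r" unfolding q_def by measurable
        show "AE x in \<mu>r. norm ((norm (q x))\<^sup>2) \<le> norm (real (Suc k) / c * indicator (K k) x)"
        proof (rule AE_I2)
          fix x
          show "norm ((norm (q x))\<^sup>2) \<le> norm (real (Suc k) / c * indicator (K k) x)"
          proof (cases "x \<in> A k")
            case True
            then have d: "1 / real (Suc k) \<le> \<Delta> x" "x \<in> K k" by (auto simp: A_def)
            have pos: "0 < c * \<Delta> x" using c_pos Delta_pos by (intro mult_pos_pos)
            have "1 \<le> real (Suc k) * \<Delta> x" using d(1) by (simp add: field_simps)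
            then have "1 / (c * \<Delta> x) \<le> real (Suc k) / c"
              using c_pos pos by (simp add: divide_simps mult_ac)
            moreover have "(norm (q x))\<^sup>2 = 1 / (c * \<Delta> x)"
              using True pos by (simp add: q_def norm_divide power_divide del: Delta_pos)
            ultimately show ?thesis using d c_pos pos by (simp del: of_nat_Suc)
          next
            case False
            then show ?thesis by (simp add: q_def)
          qed
        qed
      qed
    qed
    then have "integrable \<mu>r (\<lambda>x. g x * q x)" by (rule L2_integrable_mult[OF g])
    then show ?thesis by (simp add: q_def fs_def)
  qed
  show thesis by (rule that[OF L i T])
qed

text \<open>The \<open>SOME\<close> can be satisfied because the norm bound for
  \<open>ko_hat\<close> makes the transforms of an approximating sequence Cauchy. The weak form then
  holds for whichever function was chosen, by passing to the limit along its own sequence.\<close>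

lemma ko_integral:
  assumes g: "L2 \<mu>r g"
  shows "L2 lborel (ko_integral e F c \<mu>r \<Delta> g)" "ko_weak g (ko_integral e F c \<mu>r \<Delta> g)"
proof -
  define P where "P u \<longleftrightarrow> L2 lborel u \<and>
        (\<exists>fs. (\<forall>k. L2 \<mu>r (fs k) \<and> integrable \<mu>r (\<lambda>y. fs k y / of_real (sqrt (c * \<Delta> y)))) \<and>
              L2_tendsto \<mu>r fs g \<and>
              L2_tendsto lborel (\<lambda>k X. LINT y|\<mu>r. ko_integrand e F c \<Delta> (fs k) X y) u)" for u
  have "\<exists>u. P u"
  proof -
    obtain fs where fs: "\<And>k::nat. L2 \<mu>r (fs k)" "\<And>k. integrable \<mu>r (\<lambda>y. fs k y / of_real (sqrt (c * \<Delta> y)))"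
      "L2_tendsto \<mu>r fs g" using ko_approx[OF g, where thesis = thesis] that by blast
    define us where "us k = ko_hat (fs k)" for k
    have us: "L2 lborel (us k)" for k unfolding us_def by (rule ko_hat_L2[OF fs(1,2)])
    have lim: "(\<lambda>k. l2norm \<mu>r (\<lambda>x. fs k x - g x)) \<longlonglongrightarrow> 0"
      using L2_tendsto_iff[of \<mu>r fs g] fs g by blast
    obtain u where u: "L2 lborel u" "L2_tendsto lborel us u"
    proof (rule L2_complete[OF us])
      fix \<epsilon> :: real assume \<epsilon>: "0 < \<epsilon>"
      define \<delta> where "\<delta> = sqrt (\<epsilon> / 4)"
      have \<delta>: "0 < \<delta>" "\<delta>\<^sup>2 = \<epsilon> / 4" using \<epsilon> by (simp_all add: \<delta>_def)
      obtain N where N: "\<And>k. k \<ge> N \<Longrightarrow> l2norm \<mu>r (\<lambda>x. fs k x - g x) < \<delta>"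
        using order_tendstoD(2)[OF lim \<delta>(1)] by (auto simp: eventually_sequentially)
      have "(\<integral>\<^sup>+X. ennreal ((norm (us m X - us n X))\<^sup>2) \<partial>lborel) \<le> ennreal \<epsilon>" if mn: "m \<ge> N" "n \<ge> N" for m n
      proof -
        define d where "d x = fs m x - fs n x" for x
        have dL: "L2 \<mu>r d" unfolding d_def by (intro L2_diff fs)
        have di: "integrable \<mu>r (\<lambda>y. d y / of_real (sqrt (c * \<Delta> y)))"
          unfolding d_def diff_divide_distrib by (intro Bochner_Integration.integrable_diff fs)
        have int: "integrable \<mu>r (ko_integrand e F c \<Delta> (fs k) X)" for k X
        proof (rule Bochner_Integration.integrable_bound[OF fs(2)[of k]])
          have [measurable]: "fs k \<in> borel_measurable borel"
            using L2_measurable[OF fs(1)] by (simp add: measurable_mu)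
          show "ko_integrand e F c \<Delta> (fs k) X \<in> borel_measurable \<mu>r"
            unfolding ko_integrand_kv[abs_def] by measurable
        qed (simp add: ko_integrand_kv norm_mult norm_divide)
        have "us m X - us n X = ko_hat d X" for X
          unfolding us_def ko_hat_def
          by (subst Bochner_Integration.integral_diff[OF int int, symmetric])
            (simp add: ko_integrand_kv[abs_def] d_def left_diff_distrib diff_divide_distrib)
        then have "(\<integral>\<^sup>+X. ennreal ((norm (us m X - us n X))\<^sup>2) \<partial>lborel) = ennreal ((l2norm lborel (ko_hat d))\<^sup>2)"
          using L2_nn[OF ko_hat_L2[OF dL di]] by simp
        also have "\<dots> \<le> ennreal ((l2norm \<mu>r d)\<^sup>2)"
          by (intro ennreal_leI power_mono ko_hat_l2norm dL di) simp
        also have "\<dots> = (\<integral>\<^sup>+x. ennreal ((norm (d x))\<^sup>2) \<partial>\<mu>r)" by (rule L2_nn[OF dL, symmetric])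
        also have "\<dots> \<le> (\<integral>\<^sup>+x. 2 * ennreal ((norm (fs m x - g x))\<^sup>2) + 2 * ennreal ((norm (fs n x - g x))\<^sup>2) \<partial>\<mu>r)"
        proof (intro nn_integral_mono)
          fix x
          have "(norm (d x))\<^sup>2 \<le> 2 * (norm (fs m x - g x))\<^sup>2 + 2 * (norm (fs n x - g x))\<^sup>2"
            using norm_sum_sq_le[of "fs m x - g x" "- (fs n x - g x)"] by (simp add: d_def norm_minus_commute)
          then have "ennreal ((norm (d x))\<^sup>2) \<le> ennreal (2 * (norm (fs m x - g x))\<^sup>2 + 2 * (norm (fs n x - g x))\<^sup>2)"
            by (rule ennreal_leI)
          then show "ennreal ((norm (d x))\<^sup>2) \<le> 2 * ennreal ((norm (fs m x - g x))\<^sup>2) + 2 * ennreal ((norm (fs n x - g x))\<^sup>2)"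
            by (simp add: ennreal_mult)
        qed
        also have "\<dots> = 2 * ennreal ((l2norm \<mu>r (\<lambda>x. fs m x - g x))\<^sup>2) + 2 * ennreal ((l2norm \<mu>r (\<lambda>x. fs n x - g x))\<^sup>2)"
          using L2_measurable[OF fs(1)] L2_measurable[OF g]
          by (simp add: nn_integral_add nn_integral_cmult L2_nn L2_diff fs(1) g)
        also have "\<dots> \<le> 2 * ennreal (\<delta>\<^sup>2) + 2 * ennreal (\<delta>\<^sup>2)"
          using N[OF mn(1)] N[OF mn(2)] by (intro add_mono mult_left_mono ennreal_leI power_mono) auto
        also have "\<dots> = (2 + 2) * ennreal (\<delta>\<^sup>2)" by (simp only: distrib_right)
        also have "\<dots> = ennreal (4 * \<delta>\<^sup>2)" by (simp add: ennreal_mult)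
        also have "4 * \<delta>\<^sup>2 = \<epsilon>" using \<delta>(2) by simp
        finally show ?thesis .
      qed
      then show "\<exists>N. \<forall>m\<ge>N. \<forall>n\<ge>N. (\<integral>\<^sup>+X. ennreal ((norm (us m X - us n X))\<^sup>2) \<partial>lborel) \<le> ennreal \<epsilon>" by blast
    qed
    have "us = (\<lambda>k X. LINT y|\<mu>r. ko_integrand e F c \<Delta> (fs k) X y)"
      by (simp add: us_def ko_hat_def fun_eq_iff)
    then have "P u" unfolding P_def using u fs by (intro conjI exI[of _ fs]) auto
    then show ?thesis by blast
  qed
  then have "P (SOME u. P u)" by (rule someI_ex)
  then have "P (ko_integral e F c \<mu>r \<Delta> g)" by (simp add: ko_integral_def P_def)
  then obtain fs where u: "L2 lborel (ko_integral e F c \<mu>r \<Delta> g)"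
    and fs: "\<And>k::nat. L2 \<mu>r (fs k)" "\<And>k. integrable \<mu>r (\<lambda>y. fs k y / of_real (sqrt (c * \<Delta> y)))"
    and T: "L2_tendsto \<mu>r fs g"
    and U: "L2_tendsto lborel (\<lambda>k X. LINT y|\<mu>r. ko_integrand e F c \<Delta> (fs k) X y) (ko_integral e F c \<mu>r \<Delta> g)"
    unfolding P_def by blast
  have U': "L2_tendsto lborel (\<lambda>k. ko_hat (fs k)) (ko_integral e F c \<mu>r \<Delta> g)"
    using U by (simp add: ko_hat_def[abs_def])
  show "L2 lborel (ko_integral e F c \<mu>r \<Delta> g)" by (rule u)
  show "ko_weak g (ko_integral e F c \<mu>r \<Delta> g)"
    unfolding ko_weak_def
  proof (intro allI impI)
    fix h :: "real^'d \<Rightarrow> complex" assume h: "integrable lborel h" "L2 lborel h"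
    have l1: "(\<lambda>k. LINT X|lborel. ko_hat (fs k) X * h X) \<longlonglongrightarrow> (LINT X|lborel. ko_integral e F c \<mu>r \<Delta> g X * h X)"
      by (rule L2_tendsto_integral[OF ko_hat_L2[OF fs] u U' h(2)])
    have l2: "(\<lambda>k. LINT x|\<mu>r. fs k x * ko_test h x) \<longlonglongrightarrow> (LINT x|\<mu>r. g x * ko_test h x)"
      by (rule L2_tendsto_integral[OF fs(1) g T ko_test_L2[OF h]])
    have "(LINT X|lborel. ko_hat (fs k) X * h X) = (LINT x|\<mu>r. fs k x * ko_test h x)" for k
      using ko_hat_weak[OF fs(1,2)[of k]] h by (simp add: ko_weak_def)
    then show "(LINT X|lborel. ko_integral e F c \<mu>r \<Delta> g X * h X) = (LINT x|\<mu>r. g x * ko_test h x)"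
      by (rule LIMSEQ_unique_eq[OF l1 _ l2])
  qed
qed

text \<open>Changing variables by \<open>Ad\<close> produces \<open>1 / \<Delta> y\<close>;
  rewriting \<open>sqrt (c * \<Delta> x)\<close> in terms of \<open>x * y\<close> gives back
  \<open>sqrt (\<Delta> y)\<close>, so a single root remains.\<close>

lemma ko_test_Ad:
  assumes h: "integrable lborel h"
  shows "ko_test (\<lambda>Z. h (Ad e (inverse y) Z)) x = ko_test h (x * y) / of_real (sqrt (\<Delta> y))"
proof -
  have [measurable]: "h \<in> borel_measurable borel" using h by (simp add: integrable_iff_bounded)
  define w where "w X = h X * exp (- (2 * of_real pi * \<i> * of_real (kv (x * y) \<bullet> X)))" for X
  have [measurable]: "w \<in> borel_measurable lborel" unfolding w_def by measurable
  have "fourier (\<lambda>Z. h (Ad e (inverse y) Z)) (kv x) = (LINT Z|lborel. w (Ad e (inverse y) Z))"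
    unfolding fourier_def w_def by (simp add: kv_mult)
  also have "\<dots> = of_real (\<Delta> (inverse y)) * (LINT X|lborel. w X)"
    by (rule leb.integral_scale) auto
  also have "(LINT X|lborel. w X) = fourier h (kv (x * y))" by (simp add: fourier_def w_def)
  finally have 1: "fourier (\<lambda>Z. h (Ad e (inverse y) Z)) (kv x) = of_real (1 / \<Delta> y) * fourier h (kv (x * y))"
    by (simp add: Delta_inverse)
  have "(1 / \<Delta> y) / sqrt (c * \<Delta> x) = 1 / (sqrt (c * \<Delta> (x * y)) * sqrt (\<Delta> y))"
  proof -
    have "sqrt (c * \<Delta> (x * y)) * sqrt (\<Delta> y) = sqrt (c * \<Delta> x) * (sqrt (\<Delta> y) * sqrt (\<Delta> y))"
      by (simp only: Delta_mult real_sqrt_mult mult_ac)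
    then show ?thesis by simp
  qed
  then have "complex_of_real ((1 / \<Delta> y) / sqrt (c * \<Delta> x)) = of_real (1 / (sqrt (c * \<Delta> (x * y)) * sqrt (\<Delta> y)))"
    by (rule arg_cong)
  then have "complex_of_real (1 / \<Delta> y) / of_real (sqrt (c * \<Delta> x)) = 1 / (of_real (sqrt (c * \<Delta> (x * y))) * of_real (sqrt (\<Delta> y)))"
    by (simp only: of_real_divide of_real_mult of_real_1)
  then show ?thesis
    unfolding ko_test_def 1 by (metis (no_types, lifting) divide_divide_eq_left mult.commute times_divide_eq_left mult_1_left)
qed

text \<open>For fixed \<open>y\<close> the \<open>Ad\<close>-translation is moved from
  \<open>u\<close> to the test function, turned into right translation by \<open>ko_test_Ad\<close>,
  and moved on to \<open>g\<close> by right invariance of \<open>\<mu>r\<close>. The factors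
  \<open>\<Delta> y\<close> leave exactly the normalizations of the two averages.\<close>

lemma ko_weak_act:
  assumes f: "integrable \<mu>r f" and g: "L2 \<mu>r g" and u: "L2 lborel u" "ko_weak g u"
  shows "ko_weak (conv.act f g) (leb.act f u)"
  unfolding ko_weak_def
proof (intro allI impI)
  fix h :: "real^'d \<Rightarrow> complex" assume h: "integrable lborel h" "L2 lborel h"
  have gm [measurable]: "g \<in> borel_measurable borel" using L2_measurable[OF g] by (simp add: measurable_mu)
  have [measurable]: "u \<in> borel_measurable borel" using L2_measurable[OF u(1)] by simp
  have [measurable]: "h \<in> borel_measurable borel" using h by (simp add: integrable_iff_bounded)
  have tm [measurable]: "ko_test h \<in> borel_measurable borel" unfolding ko_test_def by measurable
  \<comment> \<open>\<open>sqrt 1\<close> is the normalizing factor of \<open>conv.act\<close>, kept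
    to match \<open>act_pairing\<close> literally.\<close>
  have key: "(LINT X|lborel. (u (Ad e y X) / of_real (sqrt (\<Delta> y))) * h X)
      = (LINT x|\<mu>r. (g (x * inverse y) / of_real (sqrt 1)) * ko_test h x)" for y
  proof -
    define h' where "h' Z = h (Ad e (inverse y) Z)" for Z
    have [measurable]: "h' \<in> borel_measurable borel" unfolding h'_def by measurable
    have "(\<integral>\<^sup>+X. ennreal (norm (h' X)) \<partial>lborel) = ennreal (\<Delta> (inverse y)) * (\<integral>\<^sup>+X. ennreal (norm (h X)) \<partial>lborel)"
      unfolding h'_def by (rule Ad_translate) measurable
    then have h'i: "integrable lborel h'"
      using h(1) by (simp add: integrable_iff_bounded ennreal_mult_less_top)
    have "(\<integral>\<^sup>+X. ennreal ((norm (h' X))\<^sup>2) \<partial>lborel) = ennreal (\<Delta> (inverse y)) * (\<integral>\<^sup>+X. ennreal ((norm (h X))\<^sup>2) \<partial>lborel)"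
      unfolding h'_def by (rule Ad_translate) measurable
    then have h'L: "L2 lborel h'"
      using h(2) by (simp add: L2_iff ennreal_mult_less_top)
    have s: "complex_of_real (\<Delta> y) = of_real (sqrt (\<Delta> y)) * of_real (sqrt (\<Delta> y))"
      by (simp flip: of_real_mult)
    have nz: "complex_of_real (sqrt (\<Delta> y)) \<noteq> 0" using Delta_pos[of y] by (simp del: Delta_pos)
    have "(LINT X|lborel. (u (Ad e y X) / of_real (sqrt (\<Delta> y))) * h X)
        = (LINT X|lborel. (\<lambda>Z. (1 / of_real (sqrt (\<Delta> y))) * (u Z * h' Z)) (Ad e y X))"
      by (simp add: h'_def)
    also have "\<dots> = of_real (\<Delta> y) * (LINT Z|lborel. (1 / of_real (sqrt (\<Delta> y))) * (u Z * h' Z))"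
      by (rule leb.integral_scale) auto
    also have "\<dots> = of_real (sqrt (\<Delta> y)) * (LINT Z|lborel. u Z * h' Z)"
      using nz by (simp only: integral_mult_right_zero s) (simp add: field_simps)
    also have "(LINT Z|lborel. u Z * h' Z) = (LINT x|\<mu>r. g x * ko_test h' x)"
      using u(2) h'i h'L by (simp add: ko_weak_def)
    also have "\<dots> = (LINT x|\<mu>r. (1 / of_real (sqrt (\<Delta> y))) * (g x * ko_test h (x * y)))"
      unfolding h'_def ko_test_Ad[OF h(1)] by simp
    also have "\<dots> = (1 / of_real (sqrt (\<Delta> y))) * (LINT x|\<mu>r. g x * ko_test h (x * y))"
      by (simp only: integral_mult_right_zero)
    also have "(LINT x|\<mu>r. g x * ko_test h (x * y)) = (LINT x|\<mu>r. (\<lambda>z. g (z * inverse y) * ko_test h z) (x * inverse (inverse y)))"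
      by (simp add: mult.assoc)
    also have "\<dots> = of_real 1 * (LINT z|\<mu>r. g (z * inverse y) * ko_test h z)"
      by (rule conv.integral_scale) auto
    finally show ?thesis using nz by simp
  qed
  have "(LINT X|lborel. leb.act f u X * h X) = (LINT y|\<mu>r. f y * (LINT X|lborel. (u (Ad e y X) / of_real (sqrt (\<Delta> y))) * h X))"
    by (rule leb.act_pairing[OF f u(1) h(2)])
  also have "\<dots> = (LINT y|\<mu>r. f y * (LINT x|\<mu>r. (g (x * inverse y) / of_real (sqrt 1)) * ko_test h x))"
    by (simp only: key)
  also have "\<dots> = (LINT x|\<mu>r. conv.act f g x * ko_test h x)"
    by (rule conv.act_pairing[OF f g ko_test_L2[OF h], symmetric])
  finally show "(LINT X|lborel. leb.act f u X * h X) = (LINT x|\<mu>r. conv.act f g x * ko_test h x)" .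
qed

lemma ko_integral_convolution:
  assumes f: "integrable \<mu>r f" and g: "L2 \<mu>r g"
  shows "AE X in lborel. ko_integral e F c \<mu>r \<Delta> (conv.act f g) X = leb.act f (ko_integral e F c \<mu>r \<Delta> g) X"
  by (rule ko_weak_unique[OF ko_integral[OF conv.L2_act[OF f g]]])
    (intro leb.L2_act ko_weak_act f g ko_integral[OF g])+

text \<open>The weight is constant along \<open>Ad\<close>-orbits, so it passes inside the average
  over \<open>y\<close>. The equality is one almost everywhere because \<open>ko_integral\<close> is
  determined up to null sets.\<close>

lemma ko_inverse_convolution:
  assumes f: "integrable \<mu>r f" and g: "L2 \<mu>r g" and w: "\<And>y X. w (Ad e y X) = w X"
  shows "AE x in \<mu>r. ko_inverse w e F c \<mu>r \<Delta> (conv.act f g) x = cj.act f (ko_inverse w e F c \<mu>r \<Delta> g) x"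
proof (rule AE_chart, rule eventually_mono[OF ko_integral_convolution[OF f g]])
  fix X
  define u where "u = ko_integral e F c \<mu>r \<Delta> g"
  assume "ko_integral e F c \<mu>r \<Delta> (conv.act f g) X = leb.act f (ko_integral e F c \<mu>r \<Delta> g) X"
  then have "ko_inverse w e F c \<mu>r \<Delta> (conv.act f g) (e X) = of_real (w X) * leb.act f u X"
    by (simp add: ko_inverse_def u_def)
  also have "\<dots> = (LINT y|\<mu>r. f y * (of_real (w X) * u (Ad e y X) / of_real (sqrt (\<Delta> y))))"
    unfolding leb.act_def integral_mult_right_zero[symmetric] by (simp add: mult_ac)
  also have "\<dots> = cj.act f (ko_inverse w e F c \<mu>r \<Delta> g) (e X)"
    unfolding cj.act_def ko_inverse_def u_def[symmetric] by (simp add: w flip: exp_Ad)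
  finally show "ko_inverse w e F c \<mu>r \<Delta> (conv.act f g) (e X) = cj.act f (ko_inverse w e F c \<mu>r \<Delta> g) (e X)" .
qed

lemma ko_inverse_measurable:
  assumes g: "L2 \<mu>r g" and [measurable]: "w \<in> borel_measurable borel"
  shows "ko_inverse w e F c \<mu>r \<Delta> g \<in> borel_measurable \<mu>r"
proof -
  have [measurable]: "ko_integral e F c \<mu>r \<Delta> g \<in> borel_measurable borel"
    using L2_measurable[OF ko_integral(1)[OF g]] by simp
  show ?thesis unfolding ko_inverse_def[abs_def] by measurable
qed

lemma ko_inverse_L2:
  assumes g: "L2 \<mu>r g"
  shows "L2 \<mu>r (ko_inverse (\<lambda>X. 1 / sqrt (Theta e X)) e F c \<mu>r \<Delta> g)"
proof -
  define k where "k = ko_inverse (\<lambda>X. 1 / sqrt (Theta e X)) e F c \<mu>r \<Delta> g"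
  define u where "u = ko_integral e F c \<mu>r \<Delta> g"
  have km: "k \<in> borel_measurable \<mu>r" unfolding k_def by (rule ko_inverse_measurable[OF g]) measurable
  then have [measurable]: "k \<in> borel_measurable borel" by (simp add: measurable_mu)
  have "(\<integral>\<^sup>+x. ennreal ((norm (k x))\<^sup>2) \<partial>\<mu>r) = (\<integral>\<^sup>+X. ennreal (Theta e X) * ennreal ((norm (k (e X)))\<^sup>2) \<partial>lborel)"
    by (rule nn_integral_chart) measurable
  also have "\<dots> \<le> (\<integral>\<^sup>+X. ennreal ((norm (u X))\<^sup>2) \<partial>lborel)"
  proof (rule nn_integral_mono)
    fix X
    \<comment> \<open>Where \<open>Theta\<close> vanishes, the default value of division by zero
      makes the left side 0; elsewhere both sides agree.\<close>
    have "Theta e X * (norm (k (e X)))\<^sup>2 \<le> (norm (u X))\<^sup>2"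
      by (cases "Theta e X = 0")
        (simp_all add: k_def ko_inverse_def u_def norm_mult norm_divide power_mult_distrib power_divide)
    then show "ennreal (Theta e X) * ennreal ((norm (k (e X)))\<^sup>2) \<le> ennreal ((norm (u X))\<^sup>2)"
      by (simp add: ennreal_mult[symmetric] ennreal_leI)
  qed
  also have "\<dots> < \<infinity>" using ko_integral(1)[OF g] by (simp add: L2_iff u_def)
  finally show ?thesis using km by (simp add: L2_iff k_def)
qed

end

section \<open>The two intertwining relations combined\<close>

theorem proposition4p20:
  fixes e :: "real^'d \<Rightarrow> 'g::{group_mult, t2_space, second_countable_topology}"
    and F :: "(real^'d) \<Rightarrow>\<^sub>L real"
    and \<iota> :: "nat \<Rightarrow> 'd" and n :: nat
    and \<mu>l \<mu>r :: "'g measure" and \<Delta> :: "'g \<Rightarrow> real"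
    and \<hh> :: "(real^'d) set"
    and \<pi> :: "'g \<Rightarrow> ('h::{chilbert_space, second_countable_topology} \<Rightarrow>\<^sub>L 'h)"
    and V :: "'h set" and C :: "'h \<Rightarrow> 'h"
    and f g :: "'g \<Rightarrow> complex"
  defines "c \<equiv> \<bar>Pf e n \<iota> F\<bar>"
    and "FKO \<equiv> (\<lambda>w k. ko_inverse w e F \<bar>Pf e n \<iota> F\<bar> \<mu>r \<Delta> k)"
    and "A \<equiv> (\<lambda>w k. fw_inverse \<mu>r \<pi> V C (ko_inverse w e F \<bar>Pf e n \<iota> F\<bar> \<mu>r \<Delta> k))"
  assumes "exponential_lie_group e"
    and "bij_betw \<iota> {..<2*n} UNIV"
    and "{x. coadjoint e x F = F} = {1}"
    and "left_haar UNIV \<mu>l" and "right_haar UNIV \<mu>r"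
    and "modular_function UNIV \<Delta>"
    and "\<mu>l = density \<mu>r (\<lambda>x. ennreal (\<Delta> x))"
    and "\<mu>r = distr (density lborel (\<lambda>X. ennreal (Theta e X))) borel e"
    and "distr \<mu>r borel (kappa e F) =
           density dual_lborel
             (\<lambda>Y. ennreal (c * \<Delta> (inv (kappa e F) Y)) * indicator (range (\<lambda>x. coadjoint e x F)) Y)"
    and "pukanszky_polarization e F \<hh>"
    and "unitary_representation \<pi>" and "irreducible_representation \<pi>"
    and "is_induced_representation \<mu>r \<Delta> (e ` \<hh>) (orbit_character e F) \<pi>"
    and "duflo_moore_inverse \<mu>r \<pi> V C"
    and "integrable \<mu>r f" and "L2 \<mu>r g"
  shows "L2 \<mu>r (group_convolution \<mu>r f g) \<and>
    L2 \<mu>r (FKO (\<lambda>X. 1 / sqrt (Theta e X)) g) \<and>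
    (\<forall>w\<in>{\<lambda>X. sqrt (Theta e X), \<lambda>X. 1 / sqrt (Theta e X)}. L2 \<mu>r (FKO w g) \<longrightarrow>
       L2 \<mu>r (FKO w (group_convolution \<mu>r f g)) \<and>
       hs_integrable \<mu>r (star_integrand \<pi> f (A w g)) \<and>
       A w (group_convolution \<mu>r f g) = operator_convolution \<mu>r \<pi> f (A w g))"
proof -
  have haar_loc: "haar_group e \<mu>l \<mu>r \<Delta>"
    using assms(4,7-11) by (simp add: haar_group_def haar_group_axioms_def exp_lie_def)
  have duflo_loc: "duflo_moore e \<mu>l \<mu>r \<Delta> \<pi> V C"
    using haar_loc assms(14,17) by (simp add: duflo_moore_def duflo_moore_axioms_def)
  have ko_loc: "ko_setting e \<mu>l \<mu>r \<Delta> F c"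
    using haar_loc assms(6,12) by (simp add: ko_setting_def ko_setting_axioms_def c_def)
  interpret duflo_moore e \<mu>l \<mu>r \<Delta> \<pi> V C by (rule duflo_loc)
  interpret ko_setting e \<mu>l \<mu>r \<Delta> F c by (rule ko_loc)
  have f: "integrable \<mu>r f" and g: "L2 \<mu>r g" by (fact assms)+
  have fg: "L2 \<mu>r (group_convolution \<mu>r f g)"
    unfolding group_convolution_act by (rule conv.L2_act[OF f g])
  have FKO: "FKO w k = ko_inverse w e F c \<mu>r \<Delta> k" and A: "A w k = fw_inverse \<mu>r \<pi> V C (FKO w k)" for w k
    by (simp_all add: FKO_def A_def c_def)
  have main: "L2 \<mu>r (FKO w (group_convolution \<mu>r f g)) \<and>
       hs_integrable \<mu>r (star_integrand \<pi> f (A w g)) \<and>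
       A w (group_convolution \<mu>r f g) = operator_convolution \<mu>r \<pi> f (A w g)"
    if w: "w \<in> {\<lambda>X. sqrt (Theta e X), \<lambda>X. 1 / sqrt (Theta e X)}" and L: "L2 \<mu>r (FKO w g)" for w
  proof -
    \<comment> \<open>Both weights depend on \<open>X\<close> only through
      \<open>Theta e X\<close>.\<close>
    have wm: "w \<in> borel_measurable borel" and wA: "w (Ad e y X) = w X" for y X
      using w by (auto simp: Theta_Ad)
    define h where "h = FKO w g"
    have h: "L2 \<mu>r h" using L by (simp add: h_def)
    have ae: "AE x in \<mu>r. FKO w (group_convolution \<mu>r f g) x = cj.act f h x"
      unfolding h_def FKO group_convolution_act by (rule ko_inverse_convolution[OF f g wA])
    have meas: "FKO w (group_convolution \<mu>r f g) \<in> borel_measurable \<mu>r"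
      unfolding FKO by (rule ko_inverse_measurable[OF fg wm])
    have act: "L2 \<mu>r (cj.act f h)" by (rule cj.L2_act[OF f h])
    have L2: "L2 \<mu>r (FKO w (group_convolution \<mu>r f g))"
      by (rule L2_cong_AE[OF act _ meas], rule eventually_mono[OF ae]) simp
    note S = fw_inverse[OF h] and T = fw_inverse[OF L2]
    \<comment> \<open>The transform of the convolution and \<open>cj.act f h\<close> agree almost
      everywhere, and the pairings do not distinguish them.\<close>
    have "fw_weak (cj.act f h) (fw_inverse \<mu>r \<pi> V C (FKO w (group_convolution \<mu>r f g)))"
      using T(2) fw_weak_cong_AE[OF ae] meas L2_measurable[OF act] by (simp add: measurable_mu)
    note weak = fw_act_weak[OF f h S(2) this]
    have Tl: "clinear_on UNIV (blinfun_apply (fw_inverse \<mu>r \<pi> V C (FKO w (group_convolution \<mu>r f g))))"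
      using T(1) by (simp add: hilbert_schmidt_iff)
    show ?thesis
      using L2 star_integral[OF f S(1) Tl weak] by (simp add: A h_def)
  qed
  show ?thesis
    using fg ko_inverse_L2[OF g] main unfolding FKO by blast
qed

end
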